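(* Let $\Omega\subseteq\mathbb{R}^n$ ($n\ge2$) be a $C^1$ domain, let $a\in C^{1,1}_{\mathrm{loc}}([0,\infty))$ satisfy $a(t)>0$ and $(ta(t))'>0$ for all $t\in[0,\infty)$, and let $f\in C^1(\mathbb{R})$. Assume that $u\in C^3(\Omega)\cap C^1(\overline\Omega)$ is a non-constant, stable solution to $$\mathrm{div}\big(a(|\nabla u|)\nabla u\big)+f(u)=0\qquad\text{in }\Omega.$$ Let $\Omega_0\subseteq\Omega$ be a connected (non-empty) open subset such that $\nabla u=0$ everywhere on $\partial\Omega_0$. If $u$ has moderate energy growth in $\Omega_0$, then $\Omega_0=\Omega$ and there exists $X\in\mathbb{S}^{n-1}$ such that $\langle\nabla u,X\rangle>0$ in $\Omega$. In particular, $\mathrm{crit}(u)=\emptyset$.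
   Context: A domain is a connected open set. $\mathrm{crit}(u)=\{x\in\Omega:\nabla u(x)=0\}$. For a vector $Y$, $A(Y)Z=\frac{a'(|Y|)}{|Y|}\langle Y,Z\rangle Y+a(|Y|)Z$ if $Y\neq0$, and $A(0)=a(0)\,\mathrm{Id}$. The solution $u$ is stable if $\int_\Omega f'(u)\varphi^2\le\int_\Omega\langle A(\nabla u)\nabla\varphi,\nabla\varphi\rangle$ for all Lipschitz $\varphi$ with compact support in $\Omega$. Moderate energy growth: $u$ has moderate energy growth in $\Omega_0$ if there exists a sequence $\{\varphi_j\}$ of Lipschitz functions with compact support in $\overline\Omega_0$ such that, as $j\to\infty$, $0\le\varphi_j\to1$ locally uniformly on $\overline\Omega_0$ and $\int_{\Omega_0}|\nabla u|^2\langle A(\nabla u)\nabla\varphi_j,\nabla\varphi_j\rangle\to0$. *)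

theory Defs
  imports "HOL-Analysis.Analysis"
begin

text \<open>The value \<^term>\<open>0\<close> at points of non-differentiability is a convention. It is only relevant for
  Lipschitz functions, where it concerns a Lebesgue null set (Rademacher).\<close>

definition grad :: "(real^'n \<Rightarrow> real) \<Rightarrow> real^'n \<Rightarrow> real^'n" where
  "grad u x = (if u differentiable (at x) then (THE D. GDERIV u x :> D) else 0)"

lemma grad_eqI:
  assumes "GDERIV u x :> D"
  shows "grad u x = D"
proof -
  have d: "(u has_derivative (\<lambda>h. inner h D)) (at x)"
    using assms by (simp add: gderiv_def)
  have "E = D" if "GDERIV u x :> E" for E
  proof -
    have "(u has_derivative (\<lambda>h. inner h E)) (at x)"
      using that by (simp add: gderiv_def)
    then have "(\<lambda>h. inner h E) = (\<lambda>h. inner h D)"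
      by (rule has_derivative_unique) (rule d)
    then have "inner (E - D) E = inner (E - D) D"
      by (rule fun_cong)
    then have "inner (E - D) (E - D) = 0"
      by (simp only: inner_diff_right)
    then show ?thesis
      by (simp only: inner_eq_zero_iff right_minus_eq)
  qed
  then have "(THE D. GDERIV u x :> D) = D"
    using assms by (intro the_equality)
  moreover have "u differentiable (at x)"
    using d by (rule differentiableI)
  ultimately show ?thesis
    by (simp only: grad_def if_True)
qed

text \<open>The continuous extension of the gradient from an open set to its closure.\<close>

definition grad_closure :: "(real^'n) set \<Rightarrow> (real^'n \<Rightarrow> real) \<Rightarrow> real^'n \<Rightarrow> real^'n" where
  "grad_closure \<Omega> u x = Lim (at x within \<Omega>) (grad u)"

definition divergence :: "(real^'n \<Rightarrow> real^'n) \<Rightarrow> real^'n \<Rightarrow> real" where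
  "divergence F x = trace (jacobian F (at x))"

definition crit :: "(real^'n) set \<Rightarrow> (real^'n \<Rightarrow> real) \<Rightarrow> (real^'n) set" where
  "crit \<Omega> u = {x \<in> \<Omega>. grad u x = 0}"

text \<open>The class $C^k(S)$, for open sets \<open>S\<close> only.\<close>

primrec Ck_on :: "nat \<Rightarrow> (real^'n) set \<Rightarrow> (real^'n \<Rightarrow> real) \<Rightarrow> bool" where
  "Ck_on 0 S g \<longleftrightarrow> continuous_on S g"
| "Ck_on (Suc k) S g \<longleftrightarrow>
     (\<forall>x\<in>S. g differentiable (at x)) \<and>
     (\<forall>i. Ck_on k S (\<lambda>x. frechet_derivative g (at x) (axis i 1)))"

text \<open>$C^1(\overline\Omega)$: the function and its gradient extend continuously to the closure.
  The values of \<open>u\<close> on the boundary are those of the extension.\<close>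

definition C1_closure :: "(real^'n) set \<Rightarrow> (real^'n \<Rightarrow> real) \<Rightarrow> bool" where
  "C1_closure \<Omega> u \<longleftrightarrow>
     Ck_on 1 \<Omega> u \<and> continuous_on (closure \<Omega>) u \<and>
     (\<exists>G. continuous_on (closure \<Omega>) G \<and> (\<forall>x\<in>\<Omega>. G x = grad u x))"

text \<open>Near each boundary point the domain is the part above the graph of a $C^1$ function \<open>\<gamma>\<close> over
  the hyperplane orthogonal to a unit vector \<open>\<nu>\<close>; \<open>\<gamma>\<close> is defined on the whole space but
  evaluated only on that hyperplane.\<close>

definition C1_domain :: "(real^'n) set \<Rightarrow> bool" where
  "C1_domain \<Omega> \<longleftrightarrow> open \<Omega> \<and> connected \<Omega> \<and>
     (\<forall>p\<in>frontier \<Omega>. \<exists>r>0. \<exists>\<nu>\<in>sphere 0 1. \<exists>\<gamma>. Ck_on 1 UNIV \<gamma> \<and>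
        \<Omega> \<inter> ball p r = {x \<in> ball p r. x \<bullet> \<nu> > \<gamma> (x - (x \<bullet> \<nu>) *\<^sub>R \<nu>)})"

text \<open>$C^{1,1}_{\mathrm{loc}}([0,\infty))$; the derivative at \<open>0\<close> is one-sided and only the values of
  \<open>a\<close> on the half-line matter.\<close>

definition C11_loc :: "(real \<Rightarrow> real) \<Rightarrow> bool" where
  "C11_loc a \<longleftrightarrow> (\<exists>a'.
     (\<forall>t\<ge>0. (a has_real_derivative a' t) (at t within {0..})) \<and>
     (\<forall>t\<ge>0. \<exists>e>0. \<exists>L. L-lipschitz_on (cball t e \<inter> {0..}) a'))"

definition A_op :: "(real \<Rightarrow> real) \<Rightarrow> real^'n \<Rightarrow> real^'n \<Rightarrow> real^'n" where
  "A_op a Y Z = (if Y = 0 then a 0 *\<^sub>R Z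
     else (deriv a (norm Y) / norm Y * (Y \<bullet> Z)) *\<^sub>R Y + a (norm Y) *\<^sub>R Z)"

definition solution :: "(real \<Rightarrow> real) \<Rightarrow> (real \<Rightarrow> real) \<Rightarrow> (real^'n) set \<Rightarrow> (real^'n \<Rightarrow> real) \<Rightarrow> bool" where
  "solution a f \<Omega> u \<longleftrightarrow>
     (\<forall>x\<in>\<Omega>. divergence (\<lambda>y. a (norm (grad u y)) *\<^sub>R grad u y) x + f (u x) = 0)"

text \<open>Lipschitz functions on \<open>S\<close> whose support is a compact subset of \<open>S\<close>; values outside \<open>S\<close> are
  irrelevant.\<close>

definition lipschitz_compact_support :: "(real^'n) set \<Rightarrow> (real^'n \<Rightarrow> real) \<Rightarrow> bool" where
  "lipschitz_compact_support S \<phi> \<longleftrightarrow>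
     (\<exists>L. L-lipschitz_on S \<phi>) \<and>
     compact (closure {x\<in>S. \<phi> x \<noteq> 0}) \<and> closure {x\<in>S. \<phi> x \<noteq> 0} \<subseteq> S"

definition stable_solution :: "(real \<Rightarrow> real) \<Rightarrow> (real \<Rightarrow> real) \<Rightarrow> (real^'n) set \<Rightarrow> (real^'n \<Rightarrow> real) \<Rightarrow> bool" where
  "stable_solution a f \<Omega> u \<longleftrightarrow> (\<forall>\<phi>. lipschitz_compact_support \<Omega> \<phi> \<longrightarrow>
     (LINT x:\<Omega>|lebesgue. deriv f (u x) * (\<phi> x)\<^sup>2)
       \<le> (LINT x:\<Omega>|lebesgue. A_op a (grad u x) (grad \<phi> x) \<bullet> grad \<phi> x))"

definition moderate_energy_growth :: "(real \<Rightarrow> real) \<Rightarrow> (real^'n) set \<Rightarrow> (real^'n \<Rightarrow> real) \<Rightarrow> bool" where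
  "moderate_energy_growth a \<Omega>\<^sub>0 u \<longleftrightarrow> (\<exists>\<phi> :: nat \<Rightarrow> real^'n \<Rightarrow> real.
     (\<forall>j. lipschitz_compact_support (closure \<Omega>\<^sub>0) (\<phi> j)) \<and>
     (\<forall>j. \<forall>x\<in>closure \<Omega>\<^sub>0. 0 \<le> \<phi> j x) \<and>
     (\<forall>x\<in>closure \<Omega>\<^sub>0. \<exists>e>0. uniform_limit (ball x e \<inter> closure \<Omega>\<^sub>0) \<phi> (\<lambda>_. 1) sequentially) \<and>
     (\<lambda>j. LINT x:\<Omega>\<^sub>0|lebesgue.
        (norm (grad u x))\<^sup>2 * (A_op a (grad u x) (grad (\<phi> j) x) \<bullet> grad (\<phi> j) x)) \<longlonglongrightarrow> 0)"

end

theory Submission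
  imports Defs
begin

text \<open>For a unit vector \<open>X\<close>, the derivative \<open>v = \<nabla>u \<bullet> X\<close> solves the linearised equation. It vanishes on
  \<open>\<partial>\<Omega>\<^sub>0\<close>, so the truncations \<open>(v - \<delta>)\<^sup>+ \<phi>\<^sub>j\<close>, cut off outside \<open>\<Omega>\<^sub>0\<close>, are admissible in the stability inequality
  on all of \<open>\<Omega>\<close>, even where \<open>\<Omega>\<^sub>0\<close> touches \<open>\<partial>\<Omega>\<close>. Testing the linearised equation with \<open>(v - \<delta>)\<^sup>+ \<phi>\<^sub>j\<^sup>2\<close> and using
  the moderate energy growth, the stability form of these functions tends to \<open>0\<close> for suitable \<open>\<delta>\<^sub>j\<close>.
  By the Cauchy-Schwarz inequality for the nonnegative stability form, their limit \<open>w = v\<^sup>+ 1\<^bsub>\<Omega>\<^sub>0\<^esub>\<close> is then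
  an approximate solution on \<open>\<Omega>\<close>, and a Hopf type barrier, tested against the approximants, gives the
  strong maximum principle: \<open>w\<close> is zero or positive on all of \<open>\<Omega>\<close>. If it is positive then \<open>\<Omega>\<^sub>0 = \<Omega>\<close>.
  Some \<open>X\<close> makes \<open>w\<close> nonzero unless \<open>\<nabla>u\<close> vanishes on \<open>\<Omega>\<^sub>0\<close>; then \<open>|\<Delta>u| \<le> C (|u - k| + |\<nabla>u|)\<close> locally, and
  unique continuation makes \<open>u\<close> constant. The test functions \<open>\<phi>\<^sub>j\<close> are merely Lipschitz and
  their energy involves the pointwise gradient, which is why Rademacher's theorem is needed.\<close>

section \<open>Differentiability of Lipschitz functions\<close>

text \<open>The limit w is known only as a continuous function and through its approximants W_j, so
  its equation has the form: the stability form of W_j against a test function is at most the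
  geometric mean of the two diagonal values. The barrier test functions depend on j and their
  energies are not bounded in advance; each energy is absorbed by the left side of the barrier
  inequality it comes from.

  The level \<delta> provides compactness: v vanishes on the boundary of \<open>\<Omega>0\<close>,
  so inside the support of phi_j the set where v >= \<delta> is a compact subset of
  \<open>\<Omega>0\<close>. In the form of W_j the Hessian terms cancel; what remains is ((v -
  \<delta>)^+)^2 times the form of grad phi_j, bounded by the energy density since |v| <= |grad u|,
  and an error \<delta> C with C depending on phi_j. Hence \<delta>_j is chosen after phi_j.

  The coefficients A(grad u) are merely locally Lipschitz. Second-order identities are therefore
  proved weakly, by moving difference quotients between Lipschitz functions of compact
  support.\<close>

lemma AE_deriv_of_integral_real:
  fixes k F :: "real \<Rightarrow> real"
  assumes int: "\<And>a b. k integrable_on {a..b}"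
    and eq: "\<And>a b. a \<le> b \<Longrightarrow> integral {a..b} k = F b - F a"
  obtains N where "negligible N" "\<And>x. x \<notin> N \<Longrightarrow> (F has_real_derivative k x) (at x)"
proof -
  obtain N where N: "negligible N"
    "\<And>x e. \<lbrakk>x \<notin> N; 0 < e\<rbrakk> \<Longrightarrow> \<exists>d>0. \<forall>h. 0 < h \<and> h < d \<longrightarrow>
        norm (integral (cbox x (x + h *\<^sub>R One)) k /\<^sub>R h ^ DIM(real) - k x) < e"
    using integrable_ccontinuous_explicit[of k] int unfolding cbox_interval by blast
  \<comment> \<open>\<open>integrable_ccontinuous_explicit\<close> controls averages over intervals
    to the right of a point only; the left ones come from the reflected function.\<close>
  have int': "(\<lambda>x. k (- x)) integrable_on {a..b}" for a b
    using Henstock_Kurzweil_Integration.integrable_reflect_real[of k "-a" "-b"] int[of "-b" "-a"]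
    by simp
  obtain N' where N': "negligible N'"
    "\<And>x e. \<lbrakk>x \<notin> N'; 0 < e\<rbrakk> \<Longrightarrow> \<exists>d>0. \<forall>h. 0 < h \<and> h < d \<longrightarrow>
        norm (integral (cbox x (x + h *\<^sub>R One)) (\<lambda>x. k (- x)) /\<^sub>R h ^ DIM(real) - k (- x)) < e"
    using integrable_ccontinuous_explicit[of "\<lambda>x. k (- x)"] int' unfolding cbox_interval by blast
  have "negligible (uminus ` N')"
    by (intro negligible_differentiable_image_negligible N') (auto intro!: derivative_intros)
  then have neg: "negligible (N \<union> uminus ` N')" using N by auto
  moreover have "(F has_real_derivative k x) (at x)" if x: "x \<notin> N \<union> uminus ` N'" for x
  proof -
    have x1: "x \<notin> N" and x2: "- x \<notin> N'" using x by (auto simp: image_iff)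
    have r: "\<forall>e>0. \<exists>d>0. \<forall>h. 0 < h \<and> h < d \<longrightarrow> \<bar>(F (x + h) - F x) / h - k x\<bar> < e"
    proof (intro allI impI)
      fix e :: real assume "0 < e"
      from N(2)[OF x1 this] obtain d where d: "d > 0" "\<And>h. 0 < h \<and> h < d \<longrightarrow>
        norm (integral (cbox x (x + h *\<^sub>R One)) k /\<^sub>R h ^ DIM(real) - k x) < e" by blast
      have "\<bar>(F (x + h) - F x) / h - k x\<bar> < e" if "0 < h" "h < d" for h
        using d(2)[of h] that eq[of x "x + h"] by (simp add: cbox_interval field_simps)
      with d(1) show "\<exists>d>0. \<forall>h. 0 < h \<and> h < d \<longrightarrow> \<bar>(F (x + h) - F x) / h - k x\<bar> < e" by blast
    qed
    have l: "\<forall>e>0. \<exists>d>0. \<forall>h. 0 < h \<and> h < d \<longrightarrow> \<bar>(F x - F (x - h)) / h - k x\<bar> < e"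
    proof (intro allI impI)
      fix e :: real assume "0 < e"
      from N'(2)[OF x2 this] obtain d where d: "d > 0" "\<And>h. 0 < h \<and> h < d \<longrightarrow>
        norm (integral (cbox (-x) (-x + h *\<^sub>R One)) (\<lambda>x. k (- x)) /\<^sub>R h ^ DIM(real) - k (- (- x))) < e"
        by blast
      have "\<bar>(F x - F (x - h)) / h - k x\<bar> < e" if "0 < h" "h < d" for h
      proof -
        have "integral {-x..-x+h} (\<lambda>x. k (- x)) = F x - F (x - h)"
          using Henstock_Kurzweil_Integration.integral_reflect_real[of "x" "x - h" k] that eq[of "x - h" x]
          by (simp add: algebra_simps)
        then show ?thesis using d(2)[of h] that by (simp add: cbox_interval field_simps)
      qed
      with d(1) show "\<exists>d>0. \<forall>h. 0 < h \<and> h < d \<longrightarrow> \<bar>(F x - F (x - h)) / h - k x\<bar> < e" by blast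
    qed
    have "(\<lambda>h. (F (x + h) - F x) / h) \<midarrow>0\<rightarrow> k x"
    proof (rule LIM_I)
      fix e :: real assume e: "0 < e"
      from r e obtain d1 where d1: "d1 > 0" "\<forall>h. 0 < h \<and> h < d1 \<longrightarrow> \<bar>(F (x + h) - F x) / h - k x\<bar> < e"
        by blast
      from l e obtain d2 where d2: "d2 > 0" "\<forall>h. 0 < h \<and> h < d2 \<longrightarrow> \<bar>(F x - F (x - h)) / h - k x\<bar> < e"
        by blast
      have "norm ((F (x + h) - F x) / h - k x) < e" if "h \<noteq> 0" "norm (h - 0) < min d1 d2" for h
      proof (cases "h > 0")
        case True then show ?thesis using d1(2) that by auto
      next
        case False
        have "(F x - F (x - (-h))) / (-h) = (F (x + h) - F x) / h"
          using that by (simp add: divide_simps)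
        then show ?thesis using d2(2)[rule_format, of "-h"] that False by auto
      qed
      then show "\<exists>s>0. \<forall>h. h \<noteq> 0 \<and> norm (h - 0) < s \<longrightarrow> norm ((F (x + h) - F x) / h - k x) < e"
        using d1(1) d2(1) by (intro exI[of _ "min d1 d2"]) auto
    qed
    then show ?thesis by (simp add: DERIV_def)
  qed
  ultimately show ?thesis using that by blast
qed

text \<open>Makes each of the two Stieltjes measures dominated by Lebesgue measure. Their sum is a
  measure that gives an open interval (l, u) the mass (F u - F l) + (G u - G l) = u - l, and this
  characterises \<open>lborel\<close>.\<close>

lemma interval_measure_add_eq_lborel:
  fixes F G :: "real \<Rightarrow> real"
  assumes F: "mono F" "continuous_on UNIV F" and G: "mono G" "continuous_on UNIV G"
    and sum: "\<And>t. F t + G t = t"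
    and A: "A \<in> sets borel"
  shows "emeasure (interval_measure F) A + emeasure (interval_measure G) A = emeasure lborel A"
proof -
  let ?m = "\<lambda>A. emeasure (interval_measure F) A + emeasure (interval_measure G) A"
  define M where "M = measure_of UNIV (sets borel) ?m"
  have em: "emeasure M A = ?m A" if "A \<in> sets borel" for A :: "real set"
    unfolding M_def
  proof (rule emeasure_measure_of_sigma)
    show "sigma_algebra UNIV (sets (borel :: real measure))"
      using sets.sigma_algebra_axioms[of "borel :: real measure"] by simp
    show "positive (sets borel) ?m" by (simp add: positive_def)
    show "countably_additive (sets borel) ?m"
    proof (rule countably_additiveI)
      fix B :: "nat \<Rightarrow> real set"
      assume B: "range B \<subseteq> sets borel" "disjoint_family B"
      show "(\<Sum>i. ?m (B i)) = ?m (\<Union>i. B i)"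
        using suminf_emeasure[of B "interval_measure F"] suminf_emeasure[of B "interval_measure G"] B
        by (subst suminf_add[symmetric]) auto
    qed
  qed fact
  have sM: "sets M = sets borel" unfolding M_def by (simp add: sets.sigma_sets_eq[of borel, simplified])
  have "lborel = M"
  proof (rule lborel_eqI[symmetric, symmetric])
    fix l u :: real assume "\<And>b. b \<in> Basis \<Longrightarrow> l \<bullet> b \<le> u \<bullet> b"
    then have lu: "l \<le> u" by simp
    have box: "emeasure (interval_measure H) {l<..<u} = ennreal (H u - H l)"
      if H: "mono H" "continuous_on UNIV H" for H :: "real \<Rightarrow> real"
    proof -
      have H1: "\<And>x y. x \<le> y \<Longrightarrow> H x \<le> H y" using H(1) by (simp add: monoD)
      have cc: "emeasure (interval_measure H) {l..u} = H u - H l"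
        by (rule emeasure_interval_measure_Icc[OF lu H1 H(2)])
      have pt: "emeasure (interval_measure H) {t} = 0" for t
        using emeasure_interval_measure_Icc[OF order_refl[of t] H1 H(2)] by simp
      have "emeasure (interval_measure H) {l..u} = emeasure (interval_measure H) ({l..u} - {l})"
        using pt by (intro emeasure_Diff_null_set[symmetric]) (auto simp: null_sets_def)
      also have "\<dots> = emeasure (interval_measure H) ({l..u} - {l} - {u})"
        using pt by (intro emeasure_Diff_null_set[symmetric]) (auto simp: null_sets_def)
      also have "{l..u} - {l} - {u} = {l<..<u}" by auto
      finally show ?thesis using cc by simp
    qed
    have "emeasure M (box l u) = ennreal (F u - F l) + ennreal (G u - G l)"
      using em[of "box l u"] box[OF F] box[OF G] by (simp add: box_real)
    also have "\<dots> = ennreal (u - l)"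
    proof -
      have "F l \<le> F u" "G l \<le> G u" using F(1) G(1) lu by (auto simp: monoD)
      moreover have "u - l = (F u - F l) + (G u - G l)" using sum[of u] sum[of l] by simp
      ultimately show ?thesis by (simp only: ennreal_plus diff_ge_0_iff_ge)
    qed
    finally show "emeasure M (box l u) = (\<Prod>b\<in>Basis. (u - l) \<bullet> b)" by simp
  qed (rule sM)
  then show ?thesis using em[OF A] by simp
qed

text \<open>After division by a Lipschitz constant, the identity is the sum of the increasing
  functions (t + f t) / 2 and (t - f t) / 2. The Stieltjes measure of the first lies below Lebesgue
  measure, so it has a density, and Lebesgue differentiation of the integral of that density gives
  the derivative.\<close>

lemma lipschitz_real_AE_differentiable:
  fixes f :: "real \<Rightarrow> real"
  assumes f: "L-lipschitz_on UNIV f"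
  shows "negligible {t. \<not> f differentiable (at t)}"
proof -
  \<comment> \<open>The extra 1 keeps the divisor positive when \<open>f\<close> is
    constant.\<close>
  define M where "M = L + 1"
  have L0: "L \<ge> 0" using f by (rule lipschitz_on_nonneg)
  have M: "M > 0" using L0 by (simp add: M_def)
  have lip: "\<bar>f x - f y\<bar> \<le> M * \<bar>x - y\<bar>" for x y
    using lipschitz_onD[OF f, of x y] mult_right_mono[of L M "\<bar>x - y\<bar>"] by (simp add: dist_real_def M_def)
  have cf: "continuous_on UNIV f" using f by (rule lipschitz_on_continuous_on)
  define F where "F t = (t + f t / M) / 2" for t
  define G where "G t = (t - f t / M) / 2" for t
  have lip': "\<bar>f x / M - f y / M\<bar> \<le> \<bar>x - y\<bar>" for x y
    using lip[of x y] M by (simp add: diff_divide_distrib[symmetric] pos_divide_le_eq mult.commute)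
  have half: "(x + p) / 2 \<le> (y + q) / 2" "(x - p) / 2 \<le> (y - q) / 2"
    if "\<bar>p - q\<bar> \<le> y - x" for x y p q :: real
    using abs_le_D1[OF that] abs_le_D2[OF that] by (simp_all add: divide_simps)
  have F: "mono F" "continuous_on UNIV F"
  proof -
    show "mono F"
    proof (rule monoI)
      fix x y :: real assume "x \<le> y"
      then have "\<bar>f x / M - f y / M\<bar> \<le> y - x" using lip'[of x y] by simp
      then show "F x \<le> F y" unfolding F_def using half by blast
    qed
    show "continuous_on UNIV F"
      unfolding F_def using cf M by (intro continuous_intros) auto
  qed
  have G: "mono G" "continuous_on UNIV G"
  proof -
    show "mono G"
    proof (rule monoI)
      fix x y :: real assume "x \<le> y"
      then have "\<bar>f x / M - f y / M\<bar> \<le> y - x" using lip'[of x y] by simp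
      then show "G x \<le> G y" unfolding G_def using half by blast
    qed
    show "continuous_on UNIV G"
      unfolding G_def using cf M by (intro continuous_intros) auto
  qed
  have sum: "F t + G t = t" for t by (simp add: F_def G_def field_simps)
  let ?\<mu> = "interval_measure F"
  have le: "emeasure ?\<mu> A \<le> emeasure lborel A" if "A \<in> sets borel" for A
    using interval_measure_add_eq_lborel[OF F G sum that]  by (metis le_iff_add)
  have "absolutely_continuous lborel ?\<mu>"
    unfolding absolutely_continuous_def
    using le by (auto simp: null_sets_def) (metis le_zero_eq)
  then obtain g where g: "g \<in> borel_measurable lborel" "density lborel g = ?\<mu>"
    using sigma_finite_measure.Radon_Nikodym[OF sigma_finite_lborel, of ?\<mu>] by auto
  have Icc: "(\<integral>\<^sup>+x. g x * indicator {a..b} x \<partial>lborel) = ennreal (F b - F a)" if "a \<le> b" for a b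
  proof -
    have "ennreal (F b - F a) = emeasure ?\<mu> {a..b}"
      using F that by (subst emeasure_interval_measure_Icc) (auto simp: monoD)
    also have "\<dots> = (\<integral>\<^sup>+x. g x * indicator {a..b} x \<partial>lborel)"
      using g(1) by (simp add: g(2)[symmetric] emeasure_density)
    finally show ?thesis by simp
  qed
  define k where "k x = enn2real (g x)" for x
  have kb: "k \<in> borel_measurable borel" using g(1) unfolding k_def by measurable
  have fin: "AE x in lborel. x \<in> {a..b} \<longrightarrow> g x \<noteq> \<infinity>" for a b
  proof (cases "a \<le> b")
    case True
    have "AE x in lborel. g x * indicator {a..b} x \<noteq> \<infinity>"
      using g(1) Icc[OF True] by (intro nn_integral_noteq_infinite) auto
    then show ?thesis by eventually_elim (auto simp: indicator_def)
  qed auto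
  have kI: "(\<integral>\<^sup>+x. ennreal (indicator {a..b} x * k x) \<partial>lborel) = ennreal (F b - F a)" if "a \<le> b" for a b
  proof -
    have "(\<integral>\<^sup>+x. ennreal (indicator {a..b} x * k x) \<partial>lborel) = (\<integral>\<^sup>+x. g x * indicator {a..b} x \<partial>lborel)"
      using fin[of a b] by (intro nn_integral_cong_AE, eventually_elim)
         (auto simp: k_def indicator_def ennreal_enn2real_if less_top)
    then show ?thesis using Icc[OF that] by simp
  qed
  have hi: "has_bochner_integral lborel (\<lambda>x. indicator {a..b} x * k x) (F b - F a)" if "a \<le> b" for a b
  proof (rule has_bochner_integral_nn_integral)
    show "AE x in lborel. 0 \<le> indicator {a..b} x * k x" by (simp add: k_def)
    show "0 \<le> F b - F a" using F(1) that by (simp add: monoD)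
  qed (use kI[OF that] kb in auto)
  have si: "set_integrable lborel {a..b} k" "a \<le> b \<Longrightarrow> (LINT x:{a..b}|lborel. k x) = F b - F a" for a b
  proof -
    show "set_integrable lborel {a..b} k"
      using hi[of a b] by (cases "a \<le> b") (auto simp: set_integrable_def has_bochner_integral_iff)
    show "(LINT x:{a..b}|lborel. k x) = F b - F a" if "a \<le> b"
      using hi[OF that] by (auto simp: set_lebesgue_integral_def has_bochner_integral_iff)
  qed
  have 1: "k integrable_on {a..b}" for a b
    using set_borel_integral_eq_integral(1)[OF si(1)] .
  have 2: "integral {a..b} k = F b - F a" if "a \<le> b" for a b
    using set_borel_integral_eq_integral(2)[OF si(1), of a b] si(2)[OF that] by simp
  obtain N where N: "negligible N" "\<And>x. x \<notin> N \<Longrightarrow> (F has_real_derivative k x) (at x)"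
    using AE_deriv_of_integral_real[OF 1 2] by metis
  have "f differentiable (at x)" if "x \<notin> N" for x
  proof -
    have "f = (\<lambda>t. (2 * F t - t) * M)" using M by (auto simp: F_def field_simps)
    moreover have "((\<lambda>t. (2 * F t - t) * M) has_real_derivative (2 * k x - 1) * M) (at x)"
      by (rule derivative_eq_intros N(2)[OF that] refl | simp)+
    ultimately show ?thesis by (metis real_differentiable_def)
  qed
  then have "{t. \<not> f differentiable (at t)} \<subseteq> N" by blast
  with N(1) show ?thesis by (rule negligible_subset)
qed

text \<open>The bad set is Borel and, by the one-dimensional result, meets every line in direction
  \<open>e\<close> in a null set; Fubini then makes it null.\<close>

lemma lipschitz_AE_directional_limit:
  fixes g :: "'a::euclidean_space \<Rightarrow> real"
  assumes g: "L-lipschitz_on UNIV g"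
  shows "AE x in lborel. \<exists>l. ((\<lambda>h. (g (x + h *\<^sub>R e) - g x) / h) \<longlongrightarrow> l) (at 0)"
proof -
  define q where "q x h = (g (x + h *\<^sub>R e) - g x) / h" for x h
  \<comment> \<open>Quantifying over uncountably many h and h' does not spoil measurability: an
    arbitrary intersection of closed sets is closed, and only \<open>k\<close> and \<open>m\<close>
    enter through countable operations.\<close>
  define S where "S k m = {x. \<forall>h h'. 0 < \<bar>h\<bar> \<and> \<bar>h\<bar> < 1 / Suc m \<and> 0 < \<bar>h'\<bar> \<and> \<bar>h'\<bar> < 1 / Suc m
      \<longrightarrow> \<bar>q x h - q x h'\<bar> \<le> 1 / Suc k}" for k m :: nat
  define G where "G = (\<Inter>k. \<Union>m. S k m)"
  have cg: "continuous_on UNIV g" using g by (rule lipschitz_on_continuous_on)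
  have cq: "continuous_on UNIV (\<lambda>x. q x h)" for h
  proof (cases "h = 0")
    case False
    have "continuous_on UNIV (\<lambda>x. g (x + h *\<^sub>R e))"
      by (rule continuous_on_compose2[OF cg]) (auto intro!: continuous_intros)
    then show ?thesis unfolding q_def using cg False by (intro continuous_intros) auto
  qed (simp add: q_def)
  have "closed (S k m)" for k m
  proof -
    let ?P = "{p. 0 < \<bar>fst p\<bar> \<and> \<bar>fst p\<bar> < 1 / Suc m \<and> 0 < \<bar>snd p\<bar> \<and> \<bar>snd p\<bar> < 1 / Suc m}"
    have "S k m = (\<Inter>p\<in>?P. {x. \<bar>q x (fst p) - q x (snd p)\<bar> \<le> 1 / Suc k})"
      unfolding S_def by auto
    moreover have "closed {x. \<bar>q x h - q x h'\<bar> \<le> 1 / Suc k}" for h h'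
      by (intro closed_Collect_le continuous_on_rabs continuous_on_diff cq continuous_on_const)
    ultimately show ?thesis by (simp add: closed_INT)
  qed
  then have Gb: "G \<in> sets borel" unfolding G_def by (auto intro!: sets.countable_INT sets.countable_UN)
  have lim: "\<exists>l. (q x \<longlongrightarrow> l) (at 0)" if x: "x \<in> G" for x
  proof -
    have cau: "\<exists>d>0. \<forall>h h'. 0 < \<bar>h\<bar> \<and> \<bar>h\<bar> < d \<and> 0 < \<bar>h'\<bar> \<and> \<bar>h'\<bar> < d \<longrightarrow> \<bar>q x h - q x h'\<bar> < r"
      if r: "r > 0" for r
    proof -
      obtain k where k: "1 / Suc k < r" using r nat_approx_posE by blast
      from x obtain m where "x \<in> S k m" unfolding G_def by blast
      then have m: "\<bar>q x h - q x h'\<bar> \<le> 1 / Suc k"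
        if "0 < \<bar>h\<bar> \<and> \<bar>h\<bar> < 1 / Suc m \<and> 0 < \<bar>h'\<bar> \<and> \<bar>h'\<bar> < 1 / Suc m" for h h'
        using that unfolding S_def by blast
      show ?thesis
        by (rule exI[of _ "1 / Suc m"]) (use m k in \<open>auto intro: le_less_trans\<close>)
    qed
    have "Cauchy (\<lambda>n. q x (1 / Suc n))"
    proof (rule metric_CauchyI)
      fix r :: real assume "r > 0"
      from cau[OF this] obtain d where d: "d > 0"
        "\<And>h h'. 0 < \<bar>h\<bar> \<and> \<bar>h\<bar> < d \<and> 0 < \<bar>h'\<bar> \<and> \<bar>h'\<bar> < d \<Longrightarrow> \<bar>q x h - q x h'\<bar> < r" by blast
      obtain M where M: "1 / Suc M < d" using d(1) nat_approx_posE by blast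
      have "1 / Suc n < d" if "n \<ge> M" for n
      proof -
        have "1 / real (Suc n) \<le> 1 / real (Suc M)" using that by (intro divide_left_mono) auto
        with M show ?thesis by linarith
      qed
      then show "\<exists>M. \<forall>m\<ge>M. \<forall>n\<ge>M. dist (q x (1 / Suc m)) (q x (1 / Suc n)) < r"
        using d(2) by (intro exI[of _ M]) (auto simp: dist_real_def)
    qed
    then obtain l where l: "(\<lambda>n. q x (1 / Suc n)) \<longlonglongrightarrow> l"
      using Cauchy_convergent_iff convergent_def by blast
    have "(q x \<longlongrightarrow> l) (at 0)"
    proof (rule LIM_I)
      fix r :: real assume r: "r > 0"
      then have "r / 2 > 0" by simp
      from cau[OF this] obtain d where d: "d > 0"
        "\<And>h h'. 0 < \<bar>h\<bar> \<and> \<bar>h\<bar> < d \<and> 0 < \<bar>h'\<bar> \<and> \<bar>h'\<bar> < d \<Longrightarrow> \<bar>q x h - q x h'\<bar> < r / 2" by blast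
      have "\<forall>\<^sub>F n in sequentially. 1 / real (Suc n) < d"
        using d(1) by (rule order_tendstoD(2)[OF LIMSEQ_Suc[OF lim_1_over_n]])
      moreover have "\<forall>\<^sub>F n in sequentially. \<bar>q x (1 / Suc n) - l\<bar> < r / 2"
        using tendstoD[OF l \<open>r / 2 > 0\<close>] by (simp add: dist_real_def)
      ultimately have "\<forall>\<^sub>F n in sequentially. 1 / real (Suc n) < d \<and> \<bar>q x (1 / Suc n) - l\<bar> < r / 2"
        by eventually_elim simp
      then obtain n where n: "1 / real (Suc n) < d" "\<bar>q x (1 / Suc n) - l\<bar> < r / 2"
        using eventually_happens'[OF sequentially_bot] by blast
      have "norm (q x h - l) < r" if "h \<noteq> 0" "norm (h - 0) < d" for h
      proof -
        have "\<bar>q x h - q x (1 / Suc n)\<bar> < r / 2" using n(1) that by (intro d(2)) auto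
        with n(2) show ?thesis unfolding real_norm_def by linarith
      qed
      with d(1) show "\<exists>s>0. \<forall>h. h \<noteq> 0 \<and> norm (h - 0) < s \<longrightarrow> norm (q x h - l) < r" by blast
    qed
    then show ?thesis by blast
  qed
  have dG: "x \<in> G" if l: "(q x \<longlongrightarrow> l) (at 0)" for x l
    unfolding G_def
  proof (intro INT_I)
    fix k :: nat
    have "1 / (2 * real (Suc k)) > 0" by simp
    from LIM_D[OF l this] obtain s where s: "s > 0"
      "\<And>h. h \<noteq> 0 \<and> norm (h - 0) < s \<Longrightarrow> norm (q x h - l) < 1 / (2 * real (Suc k))" by blast
    obtain m where m: "1 / Suc m < s" using s(1) nat_approx_posE by blast
    have "\<bar>q x h - q x h'\<bar> \<le> 1 / Suc k"
      if "0 < \<bar>h\<bar> \<and> \<bar>h\<bar> < 1 / Suc m \<and> 0 < \<bar>h'\<bar> \<and> \<bar>h'\<bar> < 1 / Suc m" for h h'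
    proof -
      define r where "r = 1 / (2 * real (Suc k))"
      have "\<bar>q x h - l\<bar> < r" "\<bar>q x h' - l\<bar> < r"
        using s(2)[of h] s(2)[of h'] that m by (auto simp: r_def)
      moreover have "1 / Suc k = r + r"
        by (simp add: field_simps r_def)
      ultimately show ?thesis by (simp only:)
    qed
    then show "x \<in> (\<Union>m. S k m)" unfolding S_def by blast
  qed
  have null: "{t. x + t *\<^sub>R e \<notin> G} \<in> null_sets lborel" for x
  proof -
    have "(norm e * L)-lipschitz_on UNIV (\<lambda>t. g (x + t *\<^sub>R e))"
    proof (rule lipschitz_onI)
      show "dist (g (x + s *\<^sub>R e)) (g (x + t *\<^sub>R e)) \<le> norm e * L * dist s t" for s t
        using lipschitz_onD[OF g, of "x + s *\<^sub>R e" "x + t *\<^sub>R e"]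
        by (simp add: dist_norm scaleR_left_diff_distrib[symmetric] mult_ac)
    qed (use lipschitz_on_nonneg[OF g] in auto)
    from lipschitz_real_AE_differentiable[OF this]
    have neg: "negligible {t. \<not> (\<lambda>t. g (x + t *\<^sub>R e)) differentiable (at t)}" .
    have "{t. x + t *\<^sub>R e \<notin> G} \<subseteq> {t. \<not> (\<lambda>t. g (x + t *\<^sub>R e)) differentiable (at t)}"
    proof safe
      fix t assume nG: "x + t *\<^sub>R e \<notin> G" and "(\<lambda>t. g (x + t *\<^sub>R e)) differentiable (at t)"
      then obtain l where "((\<lambda>t. g (x + t *\<^sub>R e)) has_real_derivative l) (at t)"
        using real_differentiable_def by blast
      then have "(q (x + t *\<^sub>R e) \<longlongrightarrow> l) (at 0)"
        by (simp add: DERIV_def q_def[abs_def] scaleR_left_distrib add.assoc)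
      with dG nG show False by blast
    qed
    with neg have "negligible {t. x + t *\<^sub>R e \<notin> G}" by (rule negligible_subset)
    moreover have "{t. x + t *\<^sub>R e \<notin> G} = (\<lambda>t. x + t *\<^sub>R e) -` (- G) \<inter> space borel" by auto
    moreover have "\<dots> \<in> sets borel" using Gb by (intro measurable_sets[of _ borel borel]) auto
    ultimately show ?thesis by (simp add: negligible_iff_null_sets null_sets_completion_iff)
  qed
  have Gi: "(indicator (- G) :: 'a \<Rightarrow> ennreal) \<in> borel_measurable borel"
    using Gb by (intro borel_measurable_indicator) auto
  \<comment> \<open>Instead of splitting the space into lines, the measure is averaged over the
    translates of the bad set by t e with t in [0, 1]. Each translate has the same measure, and
    exchanging the integrals leaves a slice of the bad set along a line inside.\<close>
  have "emeasure lborel (- G) = (\<integral>\<^sup>+t. emeasure lborel (- G) * indicator {0..1::real} t \<partial>lborel)"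
    by (simp add: nn_integral_cmult_indicator)
  also have "\<dots> = (\<integral>\<^sup>+t. (\<integral>\<^sup>+x. indicator (- G) (x + t *\<^sub>R e) * indicator {0..1::real} t \<partial>lborel) \<partial>lborel)"
  proof (rule nn_integral_cong)
    fix t :: real
    have "emeasure lborel (- G) = (\<integral>\<^sup>+x. indicator (- G) x \<partial>distr lborel borel ((+) (t *\<^sub>R e)))"
      using Gb by (simp add: lborel_distr_plus)
    also have "\<dots> = (\<integral>\<^sup>+x. indicator (- G) (t *\<^sub>R e + x) \<partial>lborel)"
      using Gb by (subst nn_integral_distr) auto
    finally have "emeasure lborel (- G) = (\<integral>\<^sup>+x. indicator (- G) (x + t *\<^sub>R e) \<partial>lborel)"
      unfolding add.commute[of "t *\<^sub>R e"] .
    moreover have m: "(\<lambda>x. indicator (- G) (x + t *\<^sub>R e) :: ennreal) \<in> borel_measurable lborel"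
      by (rule measurable_compose[OF _ Gi]) measurable
    ultimately show "emeasure lborel (- G) * indicator {0..1::real} t
        = (\<integral>\<^sup>+x. indicator (- G) (x + t *\<^sub>R e) * indicator {0..1::real} t \<partial>lborel)"
      by (simp only: nn_integral_multc[OF m])
  qed
  also have "\<dots> = (\<integral>\<^sup>+x. (\<integral>\<^sup>+t. indicator (- G) (x + t *\<^sub>R e) * indicator {0..1::real} t \<partial>lborel) \<partial>lborel)"
  proof (rule lborel_pair.Fubini')
    have "(\<lambda>p. fst p + snd p *\<^sub>R e) \<in> borel_measurable (lborel \<Otimes>\<^sub>M lborel)" by measurable
    then have "(\<lambda>p. indicator (- G) (fst p + snd p *\<^sub>R e) :: ennreal) \<in> borel_measurable (lborel \<Otimes>\<^sub>M lborel)"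
      by (rule measurable_compose[OF _ Gi])
    then show "(\<lambda>(x, t). indicator (- G) (x + t *\<^sub>R e) * indicator {0..1::real} t :: ennreal)
        \<in> borel_measurable (lborel \<Otimes>\<^sub>M lborel)"
      by (simp add: case_prod_beta)
  qed
  also have "\<dots> = (\<integral>\<^sup>+x. 0 \<partial>(lborel :: 'a measure))"
  proof (rule nn_integral_cong)
    fix x :: 'a
    have "AE t in lborel. x + t *\<^sub>R e \<in> G"
      by (rule AE_I'[OF null[of x]]) auto
    then have "(\<integral>\<^sup>+t. indicator (- G) (x + t *\<^sub>R e) * indicator {0..1::real} t \<partial>lborel) = (\<integral>\<^sup>+t. 0 \<partial>(lborel :: real measure))"
      by (intro nn_integral_cong_AE, eventually_elim) auto
    then show "(\<integral>\<^sup>+t. indicator (- G) (x + t *\<^sub>R e) * indicator {0..1::real} t \<partial>lborel) = 0" by simp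
  qed
  finally have "emeasure lborel (- G) = 0" by simp
  then have "- G \<in> null_sets lborel" using Gb by (intro null_setsI) auto
  then show ?thesis
    by (rule AE_I') (use lim in \<open>auto simp: q_def[abs_def]\<close>)
qed

text \<open>By compactness of the unit sphere, finitely many directions of \<open>T\<close>
  approximate all unit vectors. Finitely many directional limits have a common radius, and the
  Lipschitz bound pays for the change of direction.\<close>

lemma lipschitz_has_derivative_of_dense_directions:
  fixes g :: "'a::euclidean_space \<Rightarrow> real"
  assumes g: "L-lipschitz_on UNIV g"
    and dense: "\<And>U. open U \<Longrightarrow> U \<noteq> {} \<Longrightarrow> \<exists>t\<in>T. t \<in> U"
    and dir: "\<And>e. e \<in> T \<Longrightarrow> ((\<lambda>h. (g (x + h *\<^sub>R e) - g x) / h) \<longlongrightarrow> e \<bullet> G) (at 0)"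
  shows "(g has_derivative (\<lambda>h. h \<bullet> G)) (at x)"
  unfolding has_derivative_at_alt
proof (intro conjI allI impI)
  show "bounded_linear (\<lambda>h. h \<bullet> G)" by (rule bounded_linear_inner_left)
  fix \<epsilon> :: real assume \<epsilon>: "\<epsilon> > 0"
  have L0: "L \<ge> 0" using g by (rule lipschitz_on_nonneg)
  define K where "K = L + norm G + 1"
  have K: "K > 0" using L0 by (simp add: K_def add_nonneg_pos)
  \<comment> \<open>Replacing a direction by one at distance \<eta> costs at most (L + |G|) \<eta>
    per unit length, which is below \<epsilon> / 2; the other half is spent on the directional
    limits.\<close>
  define \<eta> where "\<eta> = \<epsilon> / (2 * K)"
  have \<eta>: "\<eta> > 0" using \<epsilon> K by (simp add: \<eta>_def)
  have "sphere 0 1 \<subseteq> (\<Union>t\<in>T. ball t \<eta>)"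
  proof
    fix e :: 'a
    obtain t where "t \<in> T" "t \<in> ball e \<eta>" using dense[of "ball e \<eta>"] \<eta> by auto
    then show "e \<in> (\<Union>t\<in>T. ball t \<eta>)" by (auto simp: dist_commute)
  qed
  then obtain T0 where T0: "T0 \<subseteq> T" "finite T0" "sphere 0 1 \<subseteq> (\<Union>t\<in>T0. ball t \<eta>)"
    using compactE_image[OF compact_sphere, of T "\<lambda>t. ball t \<eta>" "0::'a" 1] by auto
  have "\<exists>d>0. \<forall>h. h \<noteq> 0 \<and> \<bar>h\<bar> < d \<longrightarrow> \<bar>(g (x + h *\<^sub>R t) - g x) / h - t \<bullet> G\<bar> < \<epsilon> / 2" if "t \<in> T0" for t
    using LIM_D[OF dir[of t], of "\<epsilon> / 2"] that T0(1) \<epsilon> by auto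
  then obtain d where d: "\<And>t. t \<in> T0 \<Longrightarrow> d t > 0"
    "\<And>t h. t \<in> T0 \<Longrightarrow> h \<noteq> 0 \<Longrightarrow> \<bar>h\<bar> < d t \<Longrightarrow> \<bar>(g (x + h *\<^sub>R t) - g x) / h - t \<bullet> G\<bar> < \<epsilon> / 2"
    by metis
  define \<delta> where "\<delta> = Min (insert 1 (d ` T0))"
  have \<delta>: "\<delta> > 0" "\<And>t. t \<in> T0 \<Longrightarrow> \<delta> \<le> d t" using T0(2) d(1) by (auto simp: \<delta>_def)
  have "norm (g y - g x - (y - x) \<bullet> G) \<le> \<epsilon> * norm (y - x)" if y: "norm (y - x) < \<delta>" for y
  proof (cases "y = x")
    case False
    define h where "h = norm (y - x)"
    define e where "e = (y - x) /\<^sub>R h"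
    have h: "h > 0" using False by (simp add: h_def)
    have ye: "y = x + h *\<^sub>R e" using h by (simp add: e_def)
    have "e \<in> sphere 0 1" using h by (simp add: e_def h_def)
    then obtain t where t: "t \<in> T0" "dist t e < \<eta>" using T0(3) by auto
    have "\<bar>(g (x + h *\<^sub>R t) - g x) / h - t \<bullet> G\<bar> < \<epsilon> / 2"
      using d(2)[OF t(1), of h] \<delta>(2)[OF t(1)] y h by (simp add: h_def)
    then have 1: "\<bar>g (x + h *\<^sub>R t) - g x - h * (t \<bullet> G)\<bar> \<le> \<epsilon> / 2 * h"
      using h by (simp add: field_simps abs_le_iff abs_less_iff)
    have "\<bar>g y - g (x + h *\<^sub>R t)\<bar> \<le> L * dist y (x + h *\<^sub>R t)"
      using lipschitz_onD[OF g, of y "x + h *\<^sub>R t"] by (simp add: dist_real_def)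
    also have "dist y (x + h *\<^sub>R t) = h * dist t e"
      using h by (simp add: ye dist_norm scaleR_diff_right[symmetric] norm_minus_commute)
    also have "L * (h * dist t e) \<le> L * (h * \<eta>)"
      using t(2) h L0 by (intro mult_left_mono) auto
    finally have 2: "\<bar>g y - g (x + h *\<^sub>R t)\<bar> \<le> L * (h * \<eta>)" .
    have "\<bar>h * (t \<bullet> G) - (y - x) \<bullet> G\<bar> = h * \<bar>(t - e) \<bullet> G\<bar>"
      using h by (simp add: ye inner_diff_left abs_mult right_diff_distrib[symmetric])
    also have "\<dots> \<le> h * (dist t e * norm G)"
      using h Cauchy_Schwarz_ineq2[of "t - e" G] by (simp add: dist_norm)
    also have "\<dots> \<le> h * (\<eta> * norm G)"
      using t(2) h by (intro mult_left_mono mult_right_mono) auto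
    finally have 3: "\<bar>h * (t \<bullet> G) - (y - x) \<bullet> G\<bar> \<le> h * (\<eta> * norm G)" .
    have "\<bar>g y - g x - (y - x) \<bullet> G\<bar> \<le> \<epsilon> / 2 * h + L * (h * \<eta>) + h * (\<eta> * norm G)"
      using 1 2 3 by linarith
    also have "\<dots> = \<epsilon> / 2 * h + h * \<eta> * (K - 1)" by (simp add: K_def algebra_simps)
    also have "\<dots> \<le> \<epsilon> / 2 * h + h * \<eta> * K" using h \<eta> by simp
    also have "\<dots> = \<epsilon> * h" using K by (simp add: \<eta>_def field_simps)
    finally show ?thesis by (simp add: h_def)
  qed simp
  with \<delta>(1) show "\<exists>d>0. \<forall>y. norm (y - x) < d \<longrightarrow> norm (g y - g x - (y - x) \<bullet> G) \<le> \<epsilon> * norm (y - x)"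
    by blast
qed

text \<open>The directional derivative along a fixed null sequence, which makes it Borel measurable
  everywhere.\<close>

definition seq_deriv :: "('a::euclidean_space \<Rightarrow> real) \<Rightarrow> 'a \<Rightarrow> 'a \<Rightarrow> real" where
  "seq_deriv g e x = lim (\<lambda>n. (g (x + (1 / Suc n) *\<^sub>R e) - g x) * real (Suc n))"

lemma seq_deriv_eq:
  assumes "((\<lambda>h. (g (x + h *\<^sub>R e) - g x) / h) \<longlongrightarrow> l) (at 0)"
  shows "(\<lambda>n. (g (x + (1 / Suc n) *\<^sub>R e) - g x) * real (Suc n)) \<longlonglongrightarrow> l"
    and "seq_deriv g e x = l"
proof -
  have "filterlim (\<lambda>n. 1 / real (Suc n)) (at 0) sequentially"
    by (rule filterlim_atI[OF LIMSEQ_Suc[OF lim_1_over_n]]) auto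
  from filterlim_compose[OF assms this]
  show *: "(\<lambda>n. (g (x + (1 / Suc n) *\<^sub>R e) - g x) * real (Suc n)) \<longlonglongrightarrow> l"
    by simp
  then show "seq_deriv g e x = l" unfolding seq_deriv_def by (rule limI)
qed

lemma lipschitz_quotient_bound:
  fixes g :: "'a::euclidean_space \<Rightarrow> real"
  assumes g: "L-lipschitz_on UNIV g"
  shows "\<bar>(g (x + (1 / Suc n) *\<^sub>R e) - g x) * real (Suc n)\<bar> \<le> L * norm e"
proof -
  have "\<bar>g (x + (1 / Suc n) *\<^sub>R e) - g x\<bar> \<le> L * (norm e / Suc n)"
    using lipschitz_onD[OF g, of "x + (1 / Suc n) *\<^sub>R e" x] by (simp add: dist_norm)
  then have "\<bar>g (x + (1 / Suc n) *\<^sub>R e) - g x\<bar> * real (Suc n) \<le> L * (norm e / Suc n) * real (Suc n)"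
    by (rule mult_right_mono) simp
  then show ?thesis by (simp add: abs_mult)
qed

lemma lipschitz_AE_seq_deriv:
  fixes g :: "'a::euclidean_space \<Rightarrow> real"
  assumes g: "L-lipschitz_on UNIV g"
  shows "AE x in lborel. ((\<lambda>h. (g (x + h *\<^sub>R e) - g x) / h) \<longlongrightarrow> seq_deriv g e x) (at 0)"
    using lipschitz_AE_directional_limit[OF g, of e]
    by eventually_elim (auto simp: seq_deriv_eq(2))

lemma borel_measurable_seq_deriv:
  fixes g :: "'a::euclidean_space \<Rightarrow> real"
  assumes g: "continuous_on UNIV g"
  shows "seq_deriv g e \<in> borel_measurable borel"
proof -
  have "(\<lambda>x. (g (x + (1 / Suc n) *\<^sub>R e) - g x) * real (Suc n)) \<in> borel_measurable borel" for n
    by (intro borel_measurable_continuous_onI continuous_intros continuous_on_compose2[OF g] g) auto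
  then show ?thesis unfolding seq_deriv_def by (rule borel_measurable_lim_metric)
qed

lemma integral_lborel_shift:
  fixes f :: "'a::euclidean_space \<Rightarrow> real"
  assumes "f \<in> borel_measurable borel"
  shows "(\<integral>x. f (x + c) \<partial>lborel) = (\<integral>x. f x \<partial>lborel)"
proof -
  have "(\<integral>x. f x \<partial>lborel) = (\<integral>x. f x \<partial>distr lborel borel ((+) c))"
    by (simp add: lborel_distr_plus)
  also have "\<dots> = (\<integral>x. f (c + x) \<partial>lborel)"
    using assms by (subst integral_distr) auto
  finally show ?thesis by (simp add: add.commute)
qed

text \<open>At almost every point the value is the limit of averages over cubes with a corner at
  that point, and all these averages vanish.\<close>

lemma AE_eq_0_if_box_integrals_0:
  fixes k :: "'a::euclidean_space \<Rightarrow> real"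
  assumes k: "k \<in> borel_measurable borel" and bd: "AE x in lborel. \<bar>k x\<bar> \<le> C"
    and zero: "\<And>a b. (\<integral>x. indicator (cbox a b) x * k x \<partial>lborel) = 0"
  shows "AE x in lborel. k x = 0"
proof -
  have si: "set_integrable lborel (cbox a b) k" for a b
    unfolding set_integrable_def
  proof (rule Bochner_Integration.integrable_bound)
    show "integrable lborel (\<lambda>x. C * indicator (cbox a b) x)"
      by (auto intro!: integrable_mult_right integrable_real_indicator emeasure_lborel_cbox_finite)
    show "AE x in lborel. norm (indicat_real (cbox a b) x *\<^sub>R k x) \<le> norm (C * indicat_real (cbox a b) x)"
      using bd by eventually_elim (auto simp: indicator_def)
  qed (use k in measurable)
  have 1: "k integrable_on cbox a b" "integral (cbox a b) k = 0" for a b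
    using set_borel_integral_eq_integral[OF si[of a b]] zero[of a b]
    by (auto simp: set_lebesgue_integral_def)
  obtain N where N: "negligible N" "\<And>x e. \<lbrakk>x \<notin> N; 0 < e\<rbrakk> \<Longrightarrow> \<exists>d>0. \<forall>h. 0 < h \<and> h < d \<longrightarrow>
      norm (integral (cbox x (x + h *\<^sub>R One)) k /\<^sub>R h ^ DIM('a) - k x) < e"
    using integrable_ccontinuous_explicit[OF 1(1)] by blast
  have "k x = 0" if "x \<notin> N" for x
  proof (rule ccontr)
    assume "k x \<noteq> 0"
    then have "\<bar>k x\<bar> > 0" by simp
    from N(2)[OF that this] obtain d :: real where "d > 0" "\<And>h. 0 < h \<and> h < d \<longrightarrow> \<bar>k x\<bar> < \<bar>k x\<bar>"
      by (auto simp: 1(2))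
    then show False using dense[of 0 d] by auto
  qed
  moreover have "AE x in lebesgue. x \<notin> N"
    using N(1) by (intro AE_not_in) (simp add: negligible_iff_null_sets)
  ultimately have "AE x in lebesgue. k x = 0" by (auto elim: eventually_mono)
  then show ?thesis by (simp add: AE_completion_iff)
qed

text \<open>The second limit, with the quotient taken at a moving base point, is what additivity in
  the direction requires. The quotients themselves need not converge at moving points; after a
  translation it is the box that moves.\<close>

lemma seq_deriv_box_limits:
  fixes g :: "'a::euclidean_space \<Rightarrow> real"
  assumes g: "L-lipschitz_on UNIV g"
  shows "(\<lambda>n. \<integral>x. indicator (cbox a b) x * ((g (x + (1 / Suc n) *\<^sub>R e) - g x) * real (Suc n)) \<partial>lborel)
      \<longlonglongrightarrow> (\<integral>x. indicator (cbox a b) x * seq_deriv g e x \<partial>lborel)" (is ?A)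
    and "(\<lambda>n. \<integral>x. indicator (cbox a b) x *
         ((g (x + (1 / Suc n) *\<^sub>R e' + (1 / Suc n) *\<^sub>R e) - g (x + (1 / Suc n) *\<^sub>R e')) * real (Suc n)) \<partial>lborel)
      \<longlonglongrightarrow> (\<integral>x. indicator (cbox a b) x * seq_deriv g e x \<partial>lborel)" (is ?B)
proof -
  have cg: "continuous_on UNIV g" using g by (rule lipschitz_on_continuous_on)
  define q where "q n x = (g (x + (1 / Suc n) *\<^sub>R e) - g x) * real (Suc n)" for n x
  have cq: "continuous_on UNIV (q n)" for n
    unfolding q_def by (intro continuous_intros continuous_on_compose2[OF cg] cg) auto
  have qm[measurable]: "q n \<in> borel_measurable borel" for n
    using cq by (rule borel_measurable_continuous_onI)
  have Dm[measurable]: "seq_deriv g e \<in> borel_measurable borel"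
    using cg by (rule borel_measurable_seq_deriv)
  have lim: "AE x in lborel. (\<lambda>n. q n x) \<longlonglongrightarrow> seq_deriv g e x"
    using lipschitz_AE_seq_deriv[OF g, of e] unfolding q_def
    by eventually_elim (rule seq_deriv_eq)
  have qb: "\<bar>q n x\<bar> \<le> L * norm e" for n x
    unfolding q_def by (rule lipschitz_quotient_bound[OF g])
  define c where "c n = (1 / real (Suc n)) *\<^sub>R e'" for n
  define a' where "a' = a - norm e' *\<^sub>R One"
  define b' where "b' = b + norm e' *\<^sub>R One"
  have c0: "c \<longlonglongrightarrow> 0"
  proof -
    have "(\<lambda>n. (1 / real (Suc n)) *\<^sub>R e') \<longlonglongrightarrow> 0 *\<^sub>R e'"
      by (intro tendsto_intros LIMSEQ_Suc lim_1_over_n)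
    then show ?thesis unfolding c_def by simp
  qed
  \<comment> \<open>The indicators of the moving boxes converge off the frontier of the box, which
    is negligible. The choices d = 0 and d = \<open>c\<close> give the two claims; the enlarged box
    from \<open>a'\<close> to \<open>b'\<close> serves as a common dominating support.\<close>
  have conv: "(\<lambda>n. \<integral>x. indicator (cbox a b) (x - d n) * q n x \<partial>lborel)
      \<longlonglongrightarrow> (\<integral>x. indicator (cbox a b) x * seq_deriv g e x \<partial>lborel)"
    if d: "d \<longlonglongrightarrow> 0" "\<And>n. norm (d n) \<le> norm e'" for d :: "nat \<Rightarrow> 'a"
  proof (rule integral_dominated_convergence)
    show "integrable lborel (\<lambda>x. L * norm e * indicator (cbox a' b') x)"
      by (auto intro!: integrable_mult_right integrable_real_indicator emeasure_lborel_cbox_finite)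
    have "AE x in lebesgue. x \<notin> frontier (cbox a b)"
      by (intro AE_not_in) (simp add: negligible_iff_null_sets[symmetric] negligible_convex_frontier)
    then have fr: "AE x in lborel. x \<notin> frontier (cbox a b)" by (simp add: AE_completion_iff)
    show "AE x in lborel. (\<lambda>n. indicator (cbox a b) (x - d n) * q n x) \<longlonglongrightarrow> indicator (cbox a b) x * seq_deriv g e x"
      using fr lim
    proof eventually_elim
      case (elim x)
      have xd: "(\<lambda>n. x - d n) \<longlonglongrightarrow> x" using tendsto_diff[OF tendsto_const d(1), of x] by simp
      have "\<forall>\<^sub>F n in sequentially. (indicator (cbox a b) (x - d n) :: real) = indicator (cbox a b) x"
      proof (cases "x \<in> cbox a b")
        case True
        then have "x \<in> interior (cbox a b)" using elim(1) by (simp add: frontier_def)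
        then have "\<forall>\<^sub>F n in sequentially. x - d n \<in> interior (cbox a b)"
          using topological_tendstoD[OF xd] by blast
        then show ?thesis
          by (rule eventually_mono) (use True box_subset_cbox in \<open>auto simp: indicator_def\<close>)
      next
        case False
        then have "\<forall>\<^sub>F n in sequentially. x - d n \<in> - cbox a b"
          using topological_tendstoD[OF xd, of "- cbox a b"] by (auto simp: open_Compl)
        then show ?thesis by (rule eventually_mono) (use False in \<open>auto simp: indicator_def\<close>)
      qed
      then have "(\<lambda>n. indicator (cbox a b) (x - d n) :: real) \<longlonglongrightarrow> indicator (cbox a b) x"
        by (rule tendsto_eventually)
      then show ?case using elim(2) by (rule tendsto_mult)
    qed
    show "AE x in lborel. norm (indicator (cbox a b) (x - d n) * q n x) \<le> L * norm e * indicator (cbox a' b') x" for n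
    proof (rule AE_I2)
      fix x :: 'a
      have "x \<in> cbox a' b'" if "x - d n \<in> cbox a b"
      proof -
        have "a' \<bullet> i \<le> x \<bullet> i \<and> x \<bullet> i \<le> b' \<bullet> i" if i: "i \<in> Basis" for i
          using \<open>x - d n \<in> cbox a b\<close> i Basis_le_norm[OF i, of "d n"] d(2)[of n]
          by (fastforce simp: mem_box a'_def b'_def inner_diff_left inner_add_left abs_le_iff)
        then show ?thesis by (simp add: mem_box)
      qed
      then show "norm (indicator (cbox a b) (x - d n) * q n x) \<le> L * norm e * indicator (cbox a' b') x"
        using qb[of n x] lipschitz_on_nonneg[OF g] by (auto simp: indicator_def)
    qed
  qed measurable
  show ?A using conv[of "\<lambda>_. 0"] by (simp add: q_def)
  have sh: "(\<integral>x. indicator (cbox a b) x * q n (x + c n) \<partial>lborel)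
      = (\<integral>x. indicator (cbox a b) (x - c n) * q n x \<partial>lborel)" for n
    using integral_lborel_shift[of "\<lambda>x. indicator (cbox a b) (x - c n) * q n x" "c n"] by simp
  have "norm (c n) \<le> norm e'" for n by (simp add: c_def divide_le_eq mult_le_cancel_left1)
  from conv[OF c0 this, folded sh] show ?B by (simp add: q_def c_def)
qed

lemma lipschitz_seq_deriv_AE_bound:
  fixes g :: "'a::euclidean_space \<Rightarrow> real"
  assumes g: "L-lipschitz_on UNIV g"
  shows "AE x in lborel. \<bar>seq_deriv g e x\<bar> \<le> L * norm e"
  using lipschitz_AE_seq_deriv[OF g, of e]
proof eventually_elim
  case (elim x)
  show ?case
    by (rule tendsto_upperbound[OF tendsto_rabs[OF seq_deriv_eq(1)[OF elim]]])
       (auto intro!: always_eventually lipschitz_quotient_bound[OF g] simp del: of_nat_Suc)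
qed

text \<open>The increment along h (e + e') telescopes into the increment along h e at the point x +
  h e' and the increment along h e' at x. Integrated over boxes, both pass to the limit, and box
  integrals determine a function almost everywhere.\<close>

lemma lipschitz_seq_deriv_add:
  fixes g :: "'a::euclidean_space \<Rightarrow> real"
  assumes g: "L-lipschitz_on UNIV g"
  shows "AE x in lborel. seq_deriv g (e + e') x = seq_deriv g e x + seq_deriv g e' x"
proof -
  have cg: "continuous_on UNIV g" using g by (rule lipschitz_on_continuous_on)
  have Dm[measurable]: "seq_deriv g d \<in> borel_measurable borel" for d
    using cg by (rule borel_measurable_seq_deriv)
  have bq: "integrable lborel (\<lambda>x. indicator (cbox a b) x * f x)"
    if "f \<in> borel_measurable borel" "AE x in lborel. \<bar>f x\<bar> \<le> C" for f :: "'a \<Rightarrow> real" and a b C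
  proof (rule Bochner_Integration.integrable_bound)
    show "integrable lborel (\<lambda>x. C * indicator (cbox a b) x)"
      by (auto intro!: integrable_mult_right integrable_real_indicator emeasure_lborel_cbox_finite)
    show "AE x in lborel. norm (indicator (cbox a b) x * f x) \<le> norm (C * indicat_real (cbox a b) x)"
      using that(2) by eventually_elim (auto simp: indicator_def)
  qed (use that in measurable)
  let ?k = "\<lambda>x. seq_deriv g (e + e') x - seq_deriv g e x - seq_deriv g e' x"
  have "AE x in lborel. ?k x = 0"
  proof (rule AE_eq_0_if_box_integrals_0)
    show "?k \<in> borel_measurable borel" by measurable
    show "AE x in lborel. \<bar>?k x\<bar> \<le> L * norm (e + e') + L * norm e + L * norm e'"
      using lipschitz_seq_deriv_AE_bound[OF g, of "e + e'"] lipschitz_seq_deriv_AE_bound[OF g, of e]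
        lipschitz_seq_deriv_AE_bound[OF g, of e']
      by eventually_elim linarith
    fix a b :: 'a
    let ?I = "\<lambda>f. \<integral>x. indicator (cbox a b) x * f x \<partial>lborel"
    let ?q = "\<lambda>n e x. (g (x + (1 / Suc n) *\<^sub>R e) - g x) * real (Suc n)"
    have qm: "?q n d \<in> borel_measurable borel" for n d
      by (intro borel_measurable_continuous_onI continuous_intros continuous_on_compose2[OF cg] cg) auto
    have qs: "(\<lambda>x. ?q n d (x + c)) \<in> borel_measurable borel" for n d c
      by (rule measurable_compose[OF _ qm]) auto
    have iq: "integrable lborel (\<lambda>x. indicator (cbox a b) x * ?q n d x)" for n d
      by (rule bq[OF qm]) (auto intro!: AE_I2 lipschitz_quotient_bound[OF g] simp del: of_nat_Suc)
    have iqs: "integrable lborel (\<lambda>x. indicator (cbox a b) x * ?q n d (x + c))" for n d c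
      by (rule bq[OF qs]) (auto intro!: AE_I2 lipschitz_quotient_bound[OF g] simp del: of_nat_Suc)
    have "?I (?q n (e + e')) = ?I (\<lambda>x. ?q n e (x + (1 / Suc n) *\<^sub>R e')) + ?I (?q n e')" for n
    proof -
      have "?I (?q n (e + e')) = (\<integral>x. indicator (cbox a b) x * ?q n e (x + (1 / Suc n) *\<^sub>R e')
          + indicator (cbox a b) x * ?q n e' x \<partial>lborel)"
        by (rule Bochner_Integration.integral_cong)
           (simp_all add: indicator_def scaleR_add_right add_ac left_diff_distrib)
      also have "\<dots> = ?I (\<lambda>x. ?q n e (x + (1 / Suc n) *\<^sub>R e')) + ?I (?q n e')"
        by (rule Bochner_Integration.integral_add[OF iqs iq])
      finally show ?thesis .
    qed
    then have "(\<lambda>n. ?I (?q n (e + e'))) \<longlonglongrightarrow> ?I (seq_deriv g e) + ?I (seq_deriv g e')"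
      using tendsto_add[OF seq_deriv_box_limits(2)[OF g, of a b e' e] seq_deriv_box_limits(1)[OF g, of a b e']]
      by (simp add: add_ac)
    with seq_deriv_box_limits(1)[OF g, of a b "e + e'"]
    have eq: "?I (seq_deriv g (e + e')) = ?I (seq_deriv g e) + ?I (seq_deriv g e')"
      by (rule LIMSEQ_unique)
    have id: "integrable lborel (\<lambda>x. indicator (cbox a b) x * seq_deriv g d x)" for d
      by (rule bq[OF Dm lipschitz_seq_deriv_AE_bound[OF g]])
    have "?I ?k = ?I (seq_deriv g (e + e')) - ?I (seq_deriv g e) - ?I (seq_deriv g e')"
      using id by (simp add: right_diff_distrib)
    then show "?I ?k = 0" using eq by simp
  qed
  then show ?thesis by eventually_elim simp
qed

lemma lipschitz_seq_deriv_linear: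
  fixes g :: "'a::euclidean_space \<Rightarrow> real"
  assumes g: "L-lipschitz_on UNIV g"
  shows "AE x in lborel. seq_deriv g e x = e \<bullet> (\<Sum>b\<in>Basis. seq_deriv g b x *\<^sub>R b)"
proof -
  have sc: "AE x in lborel. seq_deriv g (c *\<^sub>R e) x = c * seq_deriv g e x" for c e
    using lipschitz_AE_seq_deriv[OF g, of e]
  proof eventually_elim
    case (elim x)
    show ?case
    proof (cases "c = 0")
      case True then show ?thesis by (simp add: seq_deriv_def)
    next
      case False
      have "filterlim (\<lambda>h. h * c) (at 0) (at (0::real))"
      proof (rule filterlim_atI)
        have "((\<lambda>h. h * c) \<longlongrightarrow> 0 * c) (at 0)" by (intro tendsto_intros)
        then show "((\<lambda>h. h * c) \<longlongrightarrow> 0) (at (0::real))" by simp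
        show "\<forall>\<^sub>F h in at (0::real). h * c \<noteq> 0" using False by (auto simp: eventually_at_filter)
      qed
      from tendsto_mult_left[OF filterlim_compose[OF elim this], of c]
      have "((\<lambda>h. (g (x + h *\<^sub>R c *\<^sub>R e) - g x) / h) \<longlongrightarrow> c * seq_deriv g e x) (at 0)"
        using False by (simp add: mult.commute)
      then show ?thesis by (rule seq_deriv_eq)
    qed
  qed
  have "AE x in lborel. seq_deriv g (\<Sum>b\<in>F. (e \<bullet> b) *\<^sub>R b) x = (\<Sum>b\<in>F. (e \<bullet> b) * seq_deriv g b x)"
    if "finite F" for F
    using that
  proof induction
    case empty then show ?case by (simp add: seq_deriv_def)
  next
    case (insert b F)
    show ?case
      using insert.IH sc[of "e \<bullet> b" b] lipschitz_seq_deriv_add[OF g, of "(e \<bullet> b) *\<^sub>R b" "\<Sum>b\<in>F. (e \<bullet> b) *\<^sub>R b"]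
      by eventually_elim (use insert.hyps in simp)
  qed
  from this[OF finite_Basis] show ?thesis
    by eventually_elim (simp add: euclidean_representation inner_sum_right mult.commute)
qed

text \<open>The exceptional null sets for the limit and for linearity depend on the direction, so
  they are united only over a countable dense set of directions.\<close>

theorem rademacher:
  fixes g :: "'a::euclidean_space \<Rightarrow> real"
  assumes g: "L-lipschitz_on UNIV g"
  shows "AE x in lebesgue. (g has_derivative (\<lambda>h. h \<bullet> (\<Sum>b\<in>Basis. seq_deriv g b x *\<^sub>R b))) (at x)"
proof -
  obtain T :: "'a set" where T: "countable T" "\<And>U. open U \<Longrightarrow> U \<noteq> {} \<Longrightarrow> \<exists>t\<in>T. t \<in> U"
    using countable_dense_exists by blast
  have "AE x in lborel. \<forall>e\<in>T. ((\<lambda>h. (g (x + h *\<^sub>R e) - g x) / h) \<longlongrightarrow>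
      e \<bullet> (\<Sum>b\<in>Basis. seq_deriv g b x *\<^sub>R b)) (at 0)"
  proof (subst AE_ball_countable[OF T(1)], intro ballI)
    fix e
    show "AE x in lborel. ((\<lambda>h. (g (x + h *\<^sub>R e) - g x) / h) \<longlongrightarrow>
      e \<bullet> (\<Sum>b\<in>Basis. seq_deriv g b x *\<^sub>R b)) (at 0)"
      using lipschitz_AE_seq_deriv[OF g, of e] lipschitz_seq_deriv_linear[OF g, of e]
      by eventually_elim simp
  qed
  then have "AE x in lborel. (g has_derivative (\<lambda>h. h \<bullet> (\<Sum>b\<in>Basis. seq_deriv g b x *\<^sub>R b))) (at x)"
    by eventually_elim (auto intro!: lipschitz_has_derivative_of_dense_directions[OF g T(2)])
  then show ?thesis by (rule AE_completion)
qed

section \<open>Lipschitz functions with compact support\<close>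

lemma AE_lebesgue_shift:
  fixes c :: "'a::euclidean_space"
  assumes "AE x in lebesgue. P x"
  shows "AE x in lebesgue. P (x + c)"
proof -
  have "AE x in lborel. P x" using assms by (simp add: AE_completion_iff)
  then obtain N where N: "{x. \<not> P x} \<subseteq> N" "N \<in> null_sets lborel"
    by (auto simp: eventually_ae_filter)
  have "{x. x - (- c) \<in> N} \<in> null_sets lborel" by (rule null_sets_translation[OF N(2)])
  then have "AE x in lborel. P (x + c)"
    by (rule AE_I') (use N(1) in auto)
  then show ?thesis by (rule AE_completion)
qed

text \<open>Passes through a Borel function equal to \<open>f\<close> almost everywhere, for which
  composition with a translation is measurable and the integral is translation invariant.\<close>

lemma integral_lebesgue_shift:
  fixes f :: "'a::euclidean_space \<Rightarrow> real"
  assumes f: "f \<in> borel_measurable lebesgue"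
  shows "(\<lambda>x. f (x + c)) \<in> borel_measurable lebesgue"
    and "(\<integral>x. f (x + c) \<partial>lebesgue) = (\<integral>x. f x \<partial>lebesgue)"
proof -
  obtain g where g: "g \<in> borel_measurable lborel" "AE x in lborel. f x = g x"
    using completion_ex_borel_measurable_real[OF f] by blast
  then have fg: "AE x in lebesgue. f x = g x" by (intro AE_completion)
  have gc: "(\<lambda>x. g (x + c)) \<in> borel_measurable lborel" using g(1) by measurable
  have gl: "g \<in> borel_measurable lebesgue" "(\<lambda>x. g (x + c)) \<in> borel_measurable lebesgue"
    using g(1) gc by (auto intro: measurable_completion)
  have fc: "AE x in lebesgue. f (x + c) = g (x + c)" by (rule AE_lebesgue_shift[OF fg])
  show m: "(\<lambda>x. f (x + c)) \<in> borel_measurable lebesgue"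
    by (rule borel_measurable_AE[OF gl(2)]) (use fc in eventually_elim, simp)
  have "(\<integral>x. f (x + c) \<partial>lebesgue) = (\<integral>x. g (x + c) \<partial>lebesgue)"
    by (rule integral_cong_AE[OF m gl(2) fc])
  also have "\<dots> = (\<integral>x. g (x + c) \<partial>lborel)" by (rule integral_completion[OF gc])
  also have "\<dots> = (\<integral>x. g x \<partial>lborel)" using g(1) by (intro integral_lborel_shift) simp
  also have "\<dots> = (\<integral>x. g x \<partial>lebesgue)" by (rule integral_completion[OF g(1), symmetric])
  also have "\<dots> = (\<integral>x. f x \<partial>lebesgue)" by (rule integral_cong_AE[OF f gl(1) fg, symmetric])
  finally show "(\<integral>x. f (x + c) \<partial>lebesgue) = (\<integral>x. f x \<partial>lebesgue)" .
qed

lemma integrable_compact_supportI: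
  fixes f :: "'a::euclidean_space \<Rightarrow> real"
  assumes "f \<in> borel_measurable lebesgue" "compact K"
    and "AE x in lebesgue. \<bar>f x\<bar> \<le> C" "\<And>x. x \<notin> K \<Longrightarrow> f x = 0"
  shows "integrable lebesgue f"
proof (rule Bochner_Integration.integrable_bound)
  show "integrable lebesgue (\<lambda>x. C * indicator K x)"
    using lmeasurable_compact[OF assms(2)]
    by (intro integrable_mult_right integrable_real_indicator) (auto simp: fmeasurable_def)
  show "AE x in lebesgue. norm (f x) \<le> norm (C * indicat_real K x)"
    using assms(3) by eventually_elim (use assms(4) in \<open>auto simp: indicator_def\<close>)
qed fact

text \<open>If constant n failed for every n, the bound on \<open>g\<close> would force the two
  points of the violating pairs together; a limit of the first points in \<open>K\<close> would then
  contradict the local Lipschitz bound there.\<close>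

lemma lipschitz_near_compactI:
  fixes g :: "'a::metric_space \<Rightarrow> 'b::real_normed_vector"
  assumes K: "compact K" and KT: "K \<subseteq> T"
    and bd: "\<And>x. x \<in> T \<Longrightarrow> norm (g x) \<le> M"
    and loc: "\<And>x. x \<in> K \<Longrightarrow> \<exists>e>0. \<exists>L. L-lipschitz_on (ball x e \<inter> T) g"
  obtains L where "L \<ge> 0" "\<And>x y. x \<in> K \<Longrightarrow> y \<in> T \<Longrightarrow> dist (g x) (g y) \<le> L * dist x y"
proof -
  have "\<exists>n::nat. \<forall>x\<in>K. \<forall>y\<in>T. dist (g x) (g y) \<le> real n * dist x y"
  proof (rule ccontr)
    assume "\<not> ?thesis"
    then have "\<forall>n::nat. \<exists>x\<in>K. \<exists>y\<in>T. dist (g x) (g y) > real n * dist x y" by (auto simp: not_le)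
    then obtain x y where xy: "\<And>n. x n \<in> K" "\<And>n. y n \<in> T"
      "\<And>n::nat. dist (g (x n)) (g (y n)) > real n * dist (x n) (y n)" by metis
    obtain l r where l: "l \<in> K" "strict_mono (r :: nat \<Rightarrow> nat)" "(x \<circ> r) \<longlonglongrightarrow> l"
      using K xy(1) unfolding compact_def by blast
    obtain e L where e: "e > 0" "L-lipschitz_on (ball l e \<inter> T) g" using loc[OF l(1)] by blast
    have db: "dist (x n) (y n) * real n \<le> 2 * M" for n
    proof -
      have "dist (g (x n)) (g (y n)) \<le> norm (g (x n)) + norm (g (y n))"
        by (simp add: dist_norm norm_triangle_ineq4)
      also have "\<dots> \<le> 2 * M" using bd[of "x n"] bd[of "y n"] xy(1,2) KT by fastforce
      finally show ?thesis using xy(3)[of n] by (simp add: mult.commute)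
    qed
    have "(\<lambda>n. dist (x n) (y n)) \<longlonglongrightarrow> 0"
    proof (rule tendsto_sandwich[OF _ _ tendsto_const])
      show "(\<lambda>n. 2 * M * (1 / real n)) \<longlonglongrightarrow> 0"
        using tendsto_mult_right_zero[OF lim_1_over_n] by blast
      show "\<forall>\<^sub>F n in sequentially. dist (x n) (y n) \<le> 2 * M * (1 / real n)"
        using eventually_gt_at_top[of 0] by eventually_elim (use db in \<open>simp add: field_simps\<close>)
    qed simp
    then have d0: "(\<lambda>n. dist (x (r n)) (y (r n))) \<longlonglongrightarrow> 0"
      using LIMSEQ_subseq_LIMSEQ[OF _ l(2)] by (fastforce simp: o_def)
    have "(\<lambda>n. dist (x (r n)) l) \<longlonglongrightarrow> 0" using l(3) by (simp add: o_def flip: tendsto_dist_iff)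
    then have "(\<lambda>n. dist (x (r n)) l + dist (x (r n)) (y (r n))) \<longlonglongrightarrow> 0 + 0"
      using d0 by (rule tendsto_add)
    then have "\<forall>\<^sub>F n in sequentially. dist (x (r n)) l + dist (x (r n)) (y (r n)) < e"
      using e(1) by (intro order_tendstoD) auto
    moreover have "\<forall>\<^sub>F n in sequentially. real n > L"
      using filterlim_real_sequentially by (auto simp: filterlim_at_top_dense)
    ultimately have "\<forall>\<^sub>F n in sequentially. False"
    proof eventually_elim
      case (elim n)
      let ?x = "x (r n)" and ?y = "y (r n)"
      have "dist l ?x < e" "dist l ?y < e"
        using elim(1) dist_triangle[of l ?y ?x] zero_le_dist[of ?x ?y] dist_commute[of ?x l] by linarith+
      then have "dist (g ?x) (g ?y) \<le> L * dist ?x ?y"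
        using xy(1,2)[of "r n"] KT by (intro lipschitz_onD[OF e(2)]) auto
      moreover have "L * dist ?x ?y \<le> real (r n) * dist ?x ?y"
        using elim(2) seq_suble[OF l(2), of n] by (intro mult_right_mono) auto
      ultimately show False using xy(3)[of "r n"] by simp
    qed
    then show False by simp
  qed
  then show ?thesis using that by (metis of_nat_0_le_iff)
qed

text \<open>McShane's infimum of cones with slope L. It brings the functions of the energy
  condition, Lipschitz only on a closure, within reach of Rademacher's theorem.\<close>

lemma lipschitz_extension:
  fixes g :: "'a::metric_space \<Rightarrow> real"
  assumes g: "L-lipschitz_on S g" and S: "S \<noteq> {}"
  obtains h where "L-lipschitz_on UNIV h" "\<And>x. x \<in> S \<Longrightarrow> h x = g x"
proof -
  have L: "L \<ge> 0" using g by (rule lipschitz_on_nonneg)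
  define h where "h x = (INF y\<in>S. g y + L * dist x y)" for x
  obtain s where s: "s \<in> S" using S by blast
  have lb: "g s - L * dist s x \<le> g y + L * dist x y" if "y \<in> S" for x y
  proof -
    have "g s - g y \<le> L * dist s y" using lipschitz_onD[OF g s that] by (simp add: dist_real_def)
    also have "\<dots> \<le> L * (dist s x + dist x y)" using L dist_triangle[of s y x] by (intro mult_left_mono) auto
    finally show ?thesis by (simp add: algebra_simps)
  qed
  then have bd: "bdd_below ((\<lambda>y. g y + L * dist x y) ` S)" for x by (intro bdd_belowI2)
  have le: "h x \<le> h x' + L * dist x x'" for x x'
  proof -
    have "h x - L * dist x x' \<le> g y + L * dist x' y" if "y \<in> S" for y
    proof -
      have "h x \<le> g y + L * dist x y" unfolding h_def by (rule cINF_lower[OF bd that])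
      also have "L * dist x y \<le> L * (dist x x' + dist x' y)"
        using L dist_triangle[of x y x'] by (intro mult_left_mono) auto
      finally show ?thesis by (simp add: algebra_simps)
    qed
    then have "h x - L * dist x x' \<le> h x'" unfolding h_def[of x'] by (intro cINF_greatest[OF S])
    then show ?thesis by simp
  qed
  have "L-lipschitz_on UNIV h"
  proof (rule lipschitz_onI)
    show "dist (h x) (h y) \<le> L * dist x y" for x y
      using le[of x y] le[of y x] by (simp add: dist_real_def dist_commute abs_le_iff)
  qed (rule L)
  moreover have "h x = g x" if x: "x \<in> S" for x
  proof (rule antisym)
    have "h x \<le> g x + L * dist x x" unfolding h_def by (rule cINF_lower[OF bd x])
    then show "h x \<le> g x" by simp
    show "g x \<le> h x" unfolding h_def
    proof (rule cINF_greatest[OF S])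
      show "g x \<le> g y + L * dist x y" if "y \<in> S" for y
        using lipschitz_onD[OF g x that] by (simp add: dist_real_def)
    qed
  qed
  ultimately show ?thesis by (rule that)
qed

text \<open>The balls are not intersected with \<open>S\<close>, so the bound holds on a full
  neighbourhood of every point of \<open>S\<close>; in particular it gives continuity at these
  points in the whole space.\<close>

definition loclip :: "'a::metric_space set \<Rightarrow> ('a \<Rightarrow> 'b::metric_space) \<Rightarrow> bool" where
  "loclip S g \<longleftrightarrow> (\<forall>x\<in>S. \<exists>e>0. \<exists>L. L-lipschitz_on (ball x e) g)"

lemma loclipD:
  assumes "loclip S g" "x \<in> S"
  obtains e L where "e > 0" "L-lipschitz_on (ball x e) g"
  using assms unfolding loclip_def by blast

lemma loclip_continuous:
  assumes "loclip S g" "x \<in> S"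
  shows "continuous (at x) g"
proof -
  obtain e L where "e > 0" "L-lipschitz_on (ball x e) g" using loclipD[OF assms] .
  then have "continuous_on (ball x e) g" by (intro lipschitz_on_continuous_on)
  then show ?thesis using \<open>e > 0\<close> by (simp add: continuous_on_eq_continuous_at)
qed

lemma loclip_subset: "loclip S g \<Longrightarrow> T \<subseteq> S \<Longrightarrow> loclip T g"
  unfolding loclip_def by blast

lemma lipschitz_imp_loclip: "L-lipschitz_on UNIV g \<Longrightarrow> loclip S g"
  unfolding loclip_def by (meson lipschitz_on_subset subset_UNIV zero_less_one)

lemma loclip_cong:
  assumes "loclip S g" "open S" "\<And>x. x \<in> S \<Longrightarrow> g x = h x"
  shows "loclip S h"
  unfolding loclip_def
proof
  fix x assume x: "x \<in> S"
  obtain e L where e: "e > 0" "L-lipschitz_on (ball x e) g" using loclipD[OF assms(1) x] .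
  obtain d where d: "d > 0" "ball x d \<subseteq> S" using assms(2) x by (auto simp: open_contains_ball)
  have "L-lipschitz_on (ball x (min e d)) g" by (rule lipschitz_on_subset[OF e(2)]) auto
  then have "L-lipschitz_on (ball x (min e d)) h"
    by (rule lipschitz_on_transform) (use assms(3) d in auto)
  then show "\<exists>e>0. \<exists>L. L-lipschitz_on (ball x e) h"
    using e(1) d(1) by (intro exI[of _ "min e d"]) auto
qed

lemma loclip_const: "loclip S (\<lambda>x. c)"
  by (rule lipschitz_imp_loclip[of 0]) (rule lipschitz_intros)

lemma loclip_add:
  fixes g h :: "'a::metric_space \<Rightarrow> 'b::real_normed_vector"
  assumes "loclip S g" "loclip S h"
  shows "loclip S (\<lambda>x. g x + h x)"
  unfolding loclip_def
proof
  fix x assume x: "x \<in> S"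
  obtain e L where e: "e > 0" "L-lipschitz_on (ball x e) g" using loclipD[OF assms(1) x] .
  obtain d M where d: "d > 0" "M-lipschitz_on (ball x d) h" using loclipD[OF assms(2) x] .
  have "L-lipschitz_on (ball x (min e d)) g" "M-lipschitz_on (ball x (min e d)) h"
    by (auto intro: lipschitz_on_subset[OF e(2)] lipschitz_on_subset[OF d(2)])
  then have "(L + M)-lipschitz_on (ball x (min e d)) (\<lambda>x. g x + h x)" by (rule lipschitz_on_add)
  then show "\<exists>e>0. \<exists>L. L-lipschitz_on (ball x e) (\<lambda>x. g x + h x)"
    using e(1) d(1) by (intro exI[of _ "min e d"]) auto
qed

lemma loclip_scaleR:
  fixes g :: "'a::metric_space \<Rightarrow> real" and h :: "'a \<Rightarrow> 'b::real_normed_vector"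
  assumes "loclip S g" "loclip S h"
  shows "loclip S (\<lambda>x. g x *\<^sub>R h x)"
  unfolding loclip_def
proof
  fix x assume x: "x \<in> S"
  obtain e L where e: "e > 0" "L-lipschitz_on (ball x e) g" using loclipD[OF assms(1) x] .
  obtain d M where d: "d > 0" "M-lipschitz_on (ball x d) h" using loclipD[OF assms(2) x] .
  define r where "r = min e d"
  have r: "r > 0" "r \<le> e" "r \<le> d" using e(1) d(1) by (auto simp: r_def)
  have L0: "L \<ge> 0" "M \<ge> 0" using e d lipschitz_on_nonneg by auto
  have gL: "\<bar>g y - g z\<bar> \<le> L * dist y z" "norm (h y - h z) \<le> M * dist y z"
    if "y \<in> ball x r" "z \<in> ball x r" for y z
    using lipschitz_onD[OF e(2), of y z] lipschitz_onD[OF d(2), of y z] that r(2,3) by (auto simp: dist_norm)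
  have gb: "\<bar>g y\<bar> \<le> \<bar>g x\<bar> + L * r" "norm (h y) \<le> norm (h x) + M * r" if y: "y \<in> ball x r" for y
  proof -
    have dy: "dist y x \<le> r" using y by (simp add: dist_commute)
    have xb: "x \<in> ball x r" using r(1) by simp
    have "\<bar>g y - g x\<bar> \<le> L * r"
      by (rule order_trans[OF gL(1)[OF y xb] mult_left_mono[OF dy L0(1)]])
    then show "\<bar>g y\<bar> \<le> \<bar>g x\<bar> + L * r" by (simp add: abs_le_iff) arith
    have "norm (h y - h x) \<le> M * r"
      by (rule order_trans[OF gL(2)[OF y xb] mult_left_mono[OF dy L0(2)]])
    then show "norm (h y) \<le> norm (h x) + M * r"
      using norm_triangle_ineq2[of "h y" "h x"] by arith
  qed
  let ?A = "\<bar>g x\<bar> + L * r" and ?B = "norm (h x) + M * r"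
  have "(?A * M + L * ?B)-lipschitz_on (ball x r) (\<lambda>x. g x *\<^sub>R h x)"
  proof (rule lipschitz_onI)
    fix y z assume yz: "y \<in> ball x r" "z \<in> ball x r"
    have "norm (g y *\<^sub>R h y - g z *\<^sub>R h z) = norm (g y *\<^sub>R (h y - h z) + (g y - g z) *\<^sub>R h z)"
      by (simp add: algebra_simps)
    also have "\<dots> \<le> \<bar>g y\<bar> * norm (h y - h z) + \<bar>g y - g z\<bar> * norm (h z)"
      by (metis norm_triangle_ineq norm_scaleR)
    also have "\<dots> \<le> ?A * (M * dist y z) + (L * dist y z) * ?B"
      using gL[OF yz] gb(1)[OF yz(1)] gb(2)[OF yz(2)] L0 r(1)
      by (intro add_mono mult_mono) auto
    finally show "dist (g y *\<^sub>R h y) (g z *\<^sub>R h z) \<le> (?A * M + L * ?B) * dist y z"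
      by (simp add: dist_norm algebra_simps)
  qed (use L0 r(1) in auto)
  then show "\<exists>e>0. \<exists>L. L-lipschitz_on (ball x e) (\<lambda>x. g x *\<^sub>R h x)"
    using r(1) by blast
qed

lemma loclip_mult:
  fixes g h :: "'a::metric_space \<Rightarrow> real"
  assumes "loclip S g" "loclip S h"
  shows "loclip S (\<lambda>x. g x * h x)"
  using loclip_scaleR[OF assms] by simp

lemma loclip_compose:
  assumes g: "loclip S g" and f: "loclip (g ` S) f"
  shows "loclip S (\<lambda>x. f (g x))"
  unfolding loclip_def
proof
  fix x assume x: "x \<in> S"
  obtain e L where e: "e > 0" "L-lipschitz_on (ball x e) g" using loclipD[OF g x] .
  obtain d M where d: "d > 0" "M-lipschitz_on (ball (g x) d) f" using loclipD[OF f, of "g x"] x by blast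
  have "continuous (at x) g" using g x by (rule loclip_continuous)
  then obtain r where r: "r > 0" "\<And>y. dist y x < r \<Longrightarrow> dist (g y) (g x) < d"
    using d(1) unfolding continuous_at_eps_delta by blast
  have "L-lipschitz_on (ball x (min e r)) g" by (rule lipschitz_on_subset[OF e(2)]) auto
  moreover have "g ` ball x (min e r) \<subseteq> ball (g x) d" using r(2) by (auto simp: dist_commute)
  then have "M-lipschitz_on (g ` ball x (min e r)) f" by (rule lipschitz_on_subset[OF d(2)])
  ultimately have "(M * L)-lipschitz_on (ball x (min e r)) (\<lambda>x. f (g x))"
    using lipschitz_on_compose2[of L "ball x (min e r)" g M f] by blast
  then show "\<exists>e>0. \<exists>L. L-lipschitz_on (ball x e) (\<lambda>x. f (g x))"
    using e(1) r(1) by (intro exI[of _ "min e r"]) auto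
qed

lemma loclip_diff:
  fixes g h :: "'a::metric_space \<Rightarrow> real"
  assumes "loclip S g" "loclip S h"
  shows "loclip S (\<lambda>x. g x - h x)"
  using loclip_add[OF assms(1) loclip_mult[OF loclip_const[of S "-1"] assms(2)]] by simp

lemma loclip_max0:
  fixes g :: "'a::metric_space \<Rightarrow> real"
  assumes "loclip S g"
  shows "loclip S (\<lambda>x. max 0 (g x))"
  by (rule loclip_compose[OF assms], rule lipschitz_imp_loclip[of 1], rule lipschitz_onI)
     (auto simp: dist_real_def)

lemma loclip_sum:
  fixes g :: "'i \<Rightarrow> 'a::metric_space \<Rightarrow> 'b::real_normed_vector"
  assumes "\<And>i. i \<in> I \<Longrightarrow> loclip S (g i)"
  shows "loclip S (\<lambda>x. \<Sum>i\<in>I. g i x)"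
  using assms by (induction I rule: infinite_finite_induct) (auto intro: loclip_const loclip_add)

lemma loclip_bounded_linear:
  assumes "bounded_linear f" "loclip S g"
  shows "loclip S (\<lambda>x. f (g x))"
proof -
  obtain B where "B-lipschitz_on UNIV f"
    using bounded_linear.lipschitz_boundE[OF assms(1)] by blast
  then show ?thesis by (intro loclip_compose[OF assms(2)] lipschitz_imp_loclip)
qed

lemma loclip_of_continuous_derivative:
  fixes g :: "'a::euclidean_space \<Rightarrow> real"
  assumes S: "open S" and d: "\<And>x. x \<in> S \<Longrightarrow> (g has_derivative (\<lambda>h. h \<bullet> G x)) (at x)"
    and G: "continuous_on S G"
  shows "loclip S g"
  unfolding loclip_def
proof
  fix x assume "x \<in> S"
  then obtain e where e: "e > 0" "cball x e \<subseteq> S" using S open_contains_cball by blast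
  have "compact (G ` cball x e)"
    by (intro compact_continuous_image continuous_on_subset[OF G] e) auto
  then obtain B where B: "\<And>y. y \<in> cball x e \<Longrightarrow> norm (G y) \<le> B"
    using compact_imp_bounded by (fastforce simp: bounded_iff)
  have "norm (G x) \<le> B" using B[of x] e(1) by simp
  then have B0: "B \<ge> 0" by (rule order_trans[OF norm_ge_zero])
  have "B-lipschitz_on (ball x e) g"
  proof (rule bounded_derivative_imp_lipschitz[where f' = "\<lambda>y h. h \<bullet> G y"])
    fix y assume y: "y \<in> ball x e"
    then show "(g has_derivative (\<lambda>h. h \<bullet> G y)) (at y within ball x e)"
      using e(2) by (auto intro!: has_derivative_at_withinI[OF d])
    have "norm (h \<bullet> G y) \<le> B * norm h" for h
    proof -
      have "norm (h \<bullet> G y) \<le> norm h * norm (G y)" by (simp add: Cauchy_Schwarz_ineq2)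
      also have "\<dots> \<le> norm h * B" using B[of y] y by (intro mult_left_mono) auto
      finally show ?thesis by (simp add: mult.commute)
    qed
    then show "onorm (\<lambda>h. h \<bullet> G y) \<le> B" using B0 by (intro onorm_bound) auto
  qed (use B0 in auto)
  then show "\<exists>e>0. \<exists>L. L-lipschitz_on (ball x e) g" using e(1) by blast
qed

text \<open>The working version of \<open>lipschitz_compact_support\<close>: Lipschitz on the whole
  space and zero off a compact subset of \<open>S\<close>. Translates, products and integrals over
  the whole space then need no reference to \<open>S\<close>.\<close>

definition lipc :: "'a::euclidean_space set \<Rightarrow> ('a \<Rightarrow> real) \<Rightarrow> bool" where
  "lipc S g \<longleftrightarrow> (\<exists>L. L-lipschitz_on UNIV g) \<and> (\<exists>K. compact K \<and> K \<subseteq> S \<and> (\<forall>x. x \<notin> K \<longrightarrow> g x = 0))"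

lemma lipcE:
  assumes "lipc S g"
  obtains L K where "L-lipschitz_on UNIV g" "L \<ge> 0" "compact K" "K \<subseteq> S" "\<And>x. x \<notin> K \<Longrightarrow> g x = 0"
  using assms lipschitz_on_nonneg unfolding lipc_def by metis

text \<open>Two points outside \<open>K\<close> have equal values; otherwise one point lies in
  \<open>K\<close>, where the local bounds are uniform by compactness even if the other point is
  arbitrary.\<close>

lemma lipcI_loclip:
  fixes g :: "'a::euclidean_space \<Rightarrow> real"
  assumes K: "compact K" "K \<subseteq> S" and 0: "\<And>x. x \<notin> K \<Longrightarrow> g x = 0" and g: "loclip K g"
  shows "lipc S g"
proof -
  have "continuous_on K g" by (intro continuous_at_imp_continuous_on ballI loclip_continuous[OF g])
  then have "compact (g ` K)" using K(1) by (rule compact_continuous_image)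
  then obtain M where M: "\<And>x. x \<in> K \<Longrightarrow> norm (g x) \<le> M"
    using compact_imp_bounded by (fastforce simp: bounded_iff)
  have bd: "norm (g x) \<le> max 0 M" for x using M[of x] 0[of x] by (cases "x \<in> K") auto
  have loc: "\<exists>e>0. \<exists>L. L-lipschitz_on (ball x e \<inter> UNIV) g" if "x \<in> K" for x
    using g that unfolding loclip_def by simp
  obtain L where L: "L \<ge> 0" "\<And>x y. x \<in> K \<Longrightarrow> y \<in> UNIV \<Longrightarrow> dist (g x) (g y) \<le> L * dist x y"
    using lipschitz_near_compactI[OF K(1) subset_UNIV bd loc] by blast
  have "L-lipschitz_on UNIV g"
  proof (rule lipschitz_onI)
    fix x y
    show "dist (g x) (g y) \<le> L * dist x y"
    proof (cases "x \<in> K")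
      case False
      show ?thesis
      proof (cases "y \<in> K")
        case True then show ?thesis using L(2)[of y x] by (simp add: dist_commute)
      next
        case nf: False then show ?thesis using 0 False L(1) by simp
      qed
    qed (use L(2) in simp)
  qed fact
  then show ?thesis unfolding lipc_def using K 0 by blast
qed

lemma lipc_loclip: "lipc S g \<Longrightarrow> loclip T g"
  unfolding lipc_def using lipschitz_imp_loclip by blast

lemma lipc_mono: "lipc S g \<Longrightarrow> S \<subseteq> T \<Longrightarrow> lipc T g"
  unfolding lipc_def by blast

lemma lipc_continuous: "lipc S g \<Longrightarrow> continuous_on T g"
  unfolding lipc_def using lipschitz_on_continuous_on continuous_on_subset by blast

text \<open>The device by which functions known only on an open set, such as coefficients or
  components of the flux, become globally Lipschitz: they are multiplied by a cutoff.\<close>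

lemma lipc_mult_loclip:
  assumes g: "lipc S g" and h: "loclip S h"
  shows "lipc S (\<lambda>x. g x * h x)"
proof -
  obtain L K where K: "L-lipschitz_on UNIV g" "L \<ge> 0" "compact K" "K \<subseteq> S" "\<And>x. x \<notin> K \<Longrightarrow> g x = 0"
    by (rule lipcE[OF g]) blast
  show ?thesis
    by (rule lipcI_loclip[OF K(3,4)]) (use K(5) lipc_loclip[OF g] h K(4) in \<open>auto intro: loclip_mult loclip_subset\<close>)
qed

lemma lipc_add:
  assumes g: "lipc S g" and h: "lipc S h"
  shows "lipc S (\<lambda>x. g x + h x)"
proof -
  obtain L K where K: "L-lipschitz_on UNIV g" "L \<ge> 0" "compact K" "K \<subseteq> S" "\<And>x. x \<notin> K \<Longrightarrow> g x = 0"
    by (rule lipcE[OF g]) blast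
  obtain L' K' where K': "L'-lipschitz_on UNIV h" "L' \<ge> 0" "compact K'" "K' \<subseteq> S" "\<And>x. x \<notin> K' \<Longrightarrow> h x = 0"
    by (rule lipcE[OF h]) blast
  show ?thesis
    by (rule lipcI_loclip[of "K \<union> K'"])
       (use K K' lipc_loclip[OF g] lipc_loclip[OF h] in \<open>auto intro: loclip_add\<close>)
qed

lemma lipc_cmult:
  assumes g: "lipc S g"
  shows "lipc S (\<lambda>x. c * g x)"
  using lipc_mult_loclip[OF g loclip_const[of S c]] by (simp add: mult.commute)

section \<open>Pointwise gradients of Lipschitz functions\<close>

lemma grad_works:
  assumes "u differentiable (at x)"
  shows "GDERIV u x :> grad u x"
proof -
  obtain D where "(u has_derivative D) (at x)" using assms unfolding differentiable_def by blast
  moreover have "D = (\<lambda>h. h \<bullet> (\<Sum>b\<in>Basis. D b *\<^sub>R b))"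
  proof
    fix h
    have lin: "linear D" using calculation has_derivative_linear by blast
    have "D h = D (\<Sum>b\<in>Basis. (h \<bullet> b) *\<^sub>R b)" by (simp add: euclidean_representation)
    also have "\<dots> = (\<Sum>b\<in>Basis. (h \<bullet> b) * D b)" by (simp add: linear_sum[OF lin] linear_scale[OF lin])
    finally show "D h = h \<bullet> (\<Sum>b\<in>Basis. D b *\<^sub>R b)" by (simp add: inner_sum_right mult.commute)
  qed
  ultimately have "GDERIV u x :> (\<Sum>b\<in>Basis. D b *\<^sub>R b)" unfolding gderiv_def by metis
  then show ?thesis using grad_eqI by metis
qed

lemma GDERIV_differentiable: "GDERIV u x :> D \<Longrightarrow> u differentiable (at x)"
  unfolding gderiv_def by (rule differentiableI)

lemma GDERIV_cong_near:
  assumes "GDERIV f x :> D" "open S" "x \<in> S" "\<And>y. y \<in> S \<Longrightarrow> f y = g y"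
  shows "GDERIV g x :> D"
  using assms unfolding gderiv_def by (metis has_derivative_transform_within_open)

lemma grad_cong_near:
  assumes "open S" "x \<in> S" "\<And>y. y \<in> S \<Longrightarrow> f y = g y"
  shows "grad f x = grad g x"
proof (cases "f differentiable (at x)")
  case True
  then have "GDERIV g x :> grad f x" using assms grad_works GDERIV_cong_near by blast
  then show ?thesis using grad_eqI by metis
next
  case False
  have "\<not> g differentiable (at x)"
    using False assms grad_works[of g x] GDERIV_cong_near[of g x _ S f] GDERIV_differentiable[of f x] by metis
  with False show ?thesis by (simp add: grad_def)
qed

lemma grad_eq_0_outside:
  assumes "compact K" "\<And>x. x \<notin> K \<Longrightarrow> g x = 0" "x \<notin> K"
  shows "GDERIV g x :> 0" "grad g x = 0"
proof -
  have "open (- K)" using assms(1) by (simp add: compact_imp_closed open_Compl)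
  then show "GDERIV g x :> 0"
    by (rule GDERIV_cong_near[OF GDERIV_const]) (use assms in auto)
  then show "grad g x = 0" by (rule grad_eqI)
qed

text \<open>Handles the zero sets of positive parts: such functions are nonnegative, so every zero
  is a minimum and the gradient is 0 there, by Fermat's rule or by the convention at points of
  non-differentiability.\<close>

lemma grad_eq_0_at_min:
  assumes "\<And>y. g y \<ge> g x"
  shows "grad g x = 0"
proof (cases "g differentiable (at x)")
  case True
  have "(g has_derivative (\<lambda>h. h \<bullet> grad g x)) (at x)" using grad_works[OF True] by (simp add: gderiv_def)
  then have "(\<lambda>h. h \<bullet> grad g x) = (\<lambda>h. 0)"
    by (intro differential_zero_maxmin[of x UNIV g]) (use assms in auto)
  from fun_cong[OF this, of "grad g x"] show ?thesis by simp
qed (simp add: grad_def)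

lemma has_derivative_along_line:
  fixes g :: "'a::euclidean_space \<Rightarrow> real"
  assumes "(g has_derivative (\<lambda>h. h \<bullet> G)) (at x)"
  shows "((\<lambda>t. g (x + t *\<^sub>R e)) has_real_derivative e \<bullet> G) (at 0)"
proof -
  have 1: "((\<lambda>t. x + t *\<^sub>R e) has_derivative (\<lambda>t. t *\<^sub>R e)) (at 0)"
    by (auto intro!: derivative_eq_intros)
  have 2: "(g has_derivative (\<lambda>h. h \<bullet> G)) (at (x + 0 *\<^sub>R e))" using assms by simp
  have "(\<lambda>t. (t *\<^sub>R e) \<bullet> G) = (*) (e \<bullet> G)" by auto
  with has_derivative_compose[OF 1 2] show ?thesis by (simp only: has_field_derivative_def)
qed

text \<open>Difference quotients in the direction of the gradient itself bound its squared length by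
  L times its length.\<close>

lemma grad_lipschitz_bound:
  assumes g: "L-lipschitz_on S g" and S: "open S" "x \<in> S"
  shows "norm (grad g x) \<le> L"
proof (cases "g differentiable (at x)")
  case True
  let ?G = "grad g x"
  have "(g has_derivative (\<lambda>h. h \<bullet> ?G)) (at x)" using grad_works[OF True] by (simp add: gderiv_def)
  then have "((\<lambda>t. g (x + t *\<^sub>R ?G)) has_real_derivative ?G \<bullet> ?G) (at 0)"
    by (rule has_derivative_along_line)
  then have lim: "((\<lambda>t. \<bar>(g (x + t *\<^sub>R ?G) - g x) / t\<bar>) \<longlongrightarrow> \<bar>?G \<bullet> ?G\<bar>) (at 0)"
    by (intro tendsto_rabs) (simp add: DERIV_def)
  have "((\<lambda>t. x + t *\<^sub>R ?G) \<longlongrightarrow> x + 0 *\<^sub>R ?G) (at 0)" by (intro tendsto_intros)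
  then have "\<forall>\<^sub>F t in at 0. x + t *\<^sub>R ?G \<in> S" using S topological_tendstoD by fastforce
  moreover have "\<forall>\<^sub>F t in at (0::real). t \<noteq> 0" by (simp add: eventually_at_filter)
  ultimately have "\<forall>\<^sub>F t in at 0. \<bar>(g (x + t *\<^sub>R ?G) - g x) / t\<bar> \<le> L * norm ?G"
  proof eventually_elim
    case (elim t)
    have "\<bar>g (x + t *\<^sub>R ?G) - g x\<bar> \<le> L * (\<bar>t\<bar> * norm ?G)"
      using lipschitz_onD[OF g elim(1) S(2)] by (simp add: dist_norm)
    then show ?case using elim(2) by (simp add: field_simps)
  qed
  then have "\<bar>?G \<bullet> ?G\<bar> \<le> L * norm ?G" by (intro tendsto_upperbound[OF lim]) auto
  then have "norm ?G * norm ?G \<le> L * norm ?G" by (simp add: power2_norm_eq_inner flip: power2_eq_square)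
  then show ?thesis using lipschitz_on_nonneg[OF g] by (cases "norm ?G = 0") (auto simp: mult_le_cancel_right)
qed (simp add: grad_def lipschitz_on_nonneg[OF g])

lemma lipschitz_AE_GDERIV:
  assumes g: "L-lipschitz_on UNIV g"
  shows "AE x in lebesgue. GDERIV g x :> grad g x"
  using rademacher[OF g]
  by eventually_elim (auto intro!: grad_works simp: differentiable_def)

text \<open>Almost everywhere the gradient is the vector of sequential derivatives, which is Borel;
  completeness of Lebesgue measure does the rest.\<close>

lemma lipschitz_grad_measurable:
  assumes g: "L-lipschitz_on UNIV g"
  shows "grad g \<in> borel_measurable lebesgue"
proof (rule borel_measurable_AE)
  have "seq_deriv g b \<in> borel_measurable lebesgue" for b
    using borel_measurable_seq_deriv[OF lipschitz_on_continuous_on[OF g]]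
    by (intro measurable_completion) simp
  then show "(\<lambda>x. \<Sum>b\<in>Basis. seq_deriv g b x *\<^sub>R b) \<in> borel_measurable lebesgue" by simp
  show "AE x in lebesgue. (\<Sum>b\<in>Basis. seq_deriv g b x *\<^sub>R b) = grad g x"
    using rademacher[OF g]
    by eventually_elim (auto intro!: grad_eqI[symmetric] simp: gderiv_def)
qed

lemma lipc_AE: "lipc S g \<Longrightarrow> AE x in lebesgue. GDERIV g x :> grad g x"
  unfolding lipc_def using lipschitz_AE_GDERIV by blast

lemma lipc_grad_measurable: "lipc S g \<Longrightarrow> grad g \<in> borel_measurable lebesgue"
  unfolding lipc_def using lipschitz_grad_measurable by blast

lemma lipc_grad_bound:
  assumes "lipc S g"
  obtains B where "\<And>x. norm (grad g x) \<le> B"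
  using assms grad_lipschitz_bound[OF _ open_UNIV] unfolding lipc_def by blast

lemma lipc_measurable: "lipc S g \<Longrightarrow> g \<in> borel_measurable lebesgue"
  using lipc_continuous[of S g UNIV] by (intro measurable_completion) (auto intro: borel_measurable_continuous_onI)

lemma lipc_bound:
  assumes "lipc S g"
  obtains B where "\<And>x. \<bar>g x\<bar> \<le> B"
proof -
  obtain L K where K: "L-lipschitz_on UNIV g" "L \<ge> 0" "compact K" "K \<subseteq> S" "\<And>x. x \<notin> K \<Longrightarrow> g x = 0"
    by (rule lipcE[OF assms]) blast
  have "compact (g ` K)" using K(3) lipc_continuous[OF assms] by (intro compact_continuous_image)
  then obtain M where M: "\<And>x. x \<in> K \<Longrightarrow> \<bar>g x\<bar> \<le> M"
    using compact_imp_bounded by (fastforce simp: bounded_iff)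
  have "\<bar>g x\<bar> \<le> max 0 M" for x using M[of x] K(5)[of x] by (cases "x \<in> K") auto
  then show ?thesis by (rule that)
qed

lemma lipc_integrable_mult:
  assumes g: "lipc S g" and k: "k \<in> borel_measurable lebesgue" and kb: "\<And>x. \<bar>k x\<bar> \<le> C"
  shows "integrable lebesgue (\<lambda>x. g x * k x)"
proof -
  obtain L K where K: "L-lipschitz_on UNIV g" "L \<ge> 0" "compact K" "K \<subseteq> S" "\<And>x. x \<notin> K \<Longrightarrow> g x = 0"
    by (rule lipcE[OF g]) blast
  obtain B where B: "\<And>x. \<bar>g x\<bar> \<le> B" by (rule lipc_bound[OF g]) blast
  show ?thesis
  proof (rule integrable_compact_supportI[OF _ K(3)])
    show "(\<lambda>x. g x * k x) \<in> borel_measurable lebesgue" using lipc_measurable[OF g] k by measurable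
    have "\<bar>g x * k x\<bar> \<le> \<bar>B\<bar> * \<bar>C\<bar>" for x
      unfolding abs_mult using B[of x] kb[of x] by (intro mult_mono) auto
    then show "AE x in lebesgue. \<bar>g x * k x\<bar> \<le> \<bar>B\<bar> * \<bar>C\<bar>" by simp
  qed (use K(5) in auto)
qed

lemma lipc_integrable: "lipc S g \<Longrightarrow> integrable lebesgue g"
  using lipc_integrable_mult[of S g "\<lambda>_. 1" 1] by simp

section \<open>Difference quotients and integration by parts\<close>

lemma lipc_shift:
  assumes g: "lipc UNIV g"
  shows "lipc UNIV (\<lambda>x. g (x + c))"
proof -
  obtain L K where K: "L-lipschitz_on UNIV g" "L \<ge> 0" "compact K" "K \<subseteq> UNIV" "\<And>x. x \<notin> K \<Longrightarrow> g x = 0"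
    by (rule lipcE[OF g]) blast
  have "L-lipschitz_on UNIV (\<lambda>x. g (x + c))"
    by (rule lipschitz_onI) (use lipschitz_onD[OF K(1)] K(2) in \<open>auto simp: dist_norm algebra_simps\<close>,
       metis add_diff_cancel_right lipschitz_onD[OF K(1)] dist_norm UNIV_I)
  moreover have "compact ((\<lambda>x. x - c) ` K)" using K(3) by (intro compact_continuous_image continuous_intros)
  moreover have "g (x + c) = 0" if "x \<notin> (\<lambda>x. x - c) ` K" for x
    using that by (intro K(5)) (auto simp: image_iff)
  ultimately show ?thesis unfolding lipc_def by blast
qed

text \<open>Dominated convergence with the Lipschitz constant as bound. Together with translation
  invariance it is the source of all integrations by parts: with k = 1 the integrals of the
  quotients are zero.\<close>

lemma lipc_quotient_limit:
  fixes g :: "real^'n \<Rightarrow> real"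
  assumes g: "lipc S g" and k: "k \<in> borel_measurable lebesgue" and kb: "\<And>x. \<bar>k x\<bar> \<le> C"
  shows "(\<lambda>n. \<integral>x. (g (x + (1 / Suc n) *\<^sub>R e) - g x) * real (Suc n) * k x \<partial>lebesgue)
      \<longlonglongrightarrow> (\<integral>x. (grad g x \<bullet> e) * k x \<partial>lebesgue)"
proof -
  obtain L K where K: "L-lipschitz_on UNIV g" "L \<ge> 0" "compact K" "K \<subseteq> S" "\<And>x. x \<notin> K \<Longrightarrow> g x = 0"
    by (rule lipcE[OF g]) blast
  obtain R where "\<forall>x\<in>K. norm x \<le> R" using compact_imp_bounded[OF K(3)] unfolding bounded_iff by blast
  then have R: "K \<subseteq> cball 0 R" by auto
  \<comment> \<open>Contains the supports of all the quotients, since every step has length at most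
    |e|.\<close>
  let ?B = "cball 0 (R + norm e)"
  let ?q = "\<lambda>n x. (g (x + (1 / Suc n) *\<^sub>R e) - g x) * real (Suc n)"
  have C0: "C \<ge> 0" using kb[of 0] by linarith
  have z: "?q n x = 0" if "x \<notin> ?B" for n x
  proof -
    have n1: "norm ((1 / Suc n) *\<^sub>R e) \<le> norm e" by (simp add: divide_le_eq mult_le_cancel_left1)
    have "x \<notin> K"
    proof
      assume "x \<in> K"
      then have "norm x \<le> R" using R by auto
      with that show False using norm_ge_zero[of e] by simp
    qed
    moreover have "x + (1 / Suc n) *\<^sub>R e \<notin> K"
    proof
      assume "x + (1 / Suc n) *\<^sub>R e \<in> K"
      then have "norm (x + (1 / Suc n) *\<^sub>R e) \<le> R" using R by auto
      then have "norm x \<le> R + norm e"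
        using n1 norm_triangle_ineq4[of "x + (1 / Suc n) *\<^sub>R e" "(1 / Suc n) *\<^sub>R e"] by simp
      with that show False by simp
    qed
    ultimately show ?thesis using K(5) by simp
  qed
  have m: "?q n \<in> borel_measurable lebesgue" for n
    using lipc_measurable[OF g] integral_lebesgue_shift(1)[OF lipc_measurable[OF g], of "(1 / Suc n) *\<^sub>R e"]
    by measurable
  show ?thesis
  proof (rule integral_dominated_convergence)
    show "integrable lebesgue (\<lambda>x. L * norm e * C * indicator ?B x)"
      using lmeasurable_compact[of ?B]
      by (intro integrable_mult_right integrable_real_indicator) (auto simp: fmeasurable_def)
    show "AE x in lebesgue. norm (?q n x * k x) \<le> L * norm e * C * indicat_real ?B x" for n
    proof (rule AE_I2)
      fix x
      show "norm (?q n x * k x) \<le> L * norm e * C * indicat_real ?B x"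
      proof (cases "x \<in> ?B")
        case True
        have "\<bar>?q n x\<bar> * \<bar>k x\<bar> \<le> L * norm e * C"
          using lipschitz_quotient_bound[OF K(1), of x n e] kb[of x] K(2) by (intro mult_mono) auto
        then show ?thesis using True by (simp add: abs_mult del: of_nat_Suc)
      qed (use z in simp)
    qed
    show "AE x in lebesgue. (\<lambda>n. ?q n x * k x) \<longlonglongrightarrow> (grad g x \<bullet> e) * k x"
      using lipc_AE[OF g]
    proof eventually_elim
      case (elim x)
      then have d: "(g has_derivative (\<lambda>h. h \<bullet> grad g x)) (at x)" by (simp add: gderiv_def)
      have "((\<lambda>t. g (x + t *\<^sub>R e)) has_real_derivative e \<bullet> grad g x) (at 0)"
        by (rule has_derivative_along_line[OF d])
      then have "((\<lambda>h. (g (x + h *\<^sub>R e) - g x) / h) \<longlongrightarrow> grad g x \<bullet> e) (at 0)"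
        by (simp add: DERIV_def inner_commute)
      from seq_deriv_eq(1)[OF this] show ?case by (rule tendsto_mult_right)
    qed
    show "(\<lambda>x. (grad g x \<bullet> e) * k x) \<in> borel_measurable lebesgue"
      using lipc_grad_measurable[OF g] k by measurable
    show "(\<lambda>x. ?q n x * k x) \<in> borel_measurable lebesgue" for n
      using m k by measurable
  qed
qed

lemma lipc_integral_grad:
  fixes g :: "real^'n \<Rightarrow> real"
  assumes g: "lipc S g"
  shows "(\<integral>x. grad g x \<bullet> e \<partial>lebesgue) = 0"
proof -
  have gu: "lipc UNIV g" using g lipc_mono by blast
  have z: "(\<integral>x. (g (x + c) - g x) * r * 1 \<partial>lebesgue) = 0" for c r
  proof -
    have "(\<integral>x. (g (x + c) - g x) * r \<partial>lebesgue) = ((\<integral>x. g (x + c) \<partial>lebesgue) - (\<integral>x. g x \<partial>lebesgue)) * r"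
      using lipc_integrable[OF gu] lipc_integrable[OF lipc_shift[OF gu]] by simp
    then show ?thesis using integral_lebesgue_shift(2)[OF lipc_measurable[OF g]] by simp
  qed
  have "(\<lambda>n::nat. 0) \<longlonglongrightarrow> (\<integral>x. (grad g x \<bullet> e) * 1 \<partial>lebesgue)"
    using lipc_quotient_limit[OF g, of "\<lambda>_. 1" 1 e] unfolding z by simp
  then show ?thesis using LIMSEQ_unique[OF tendsto_const] by fastforce
qed

lemma lipc_ibp:
  fixes g h :: "real^'n \<Rightarrow> real"
  assumes g: "lipc S g" and h: "lipc S h"
  shows "(\<integral>x. g x * (grad h x \<bullet> e) \<partial>lebesgue) = - (\<integral>x. (grad g x \<bullet> e) * h x \<partial>lebesgue)"
proof -
  have gm: "lipc S (\<lambda>x. g x * h x)" using lipc_mult_loclip[OF g lipc_loclip[OF h]] .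
  obtain Bg where Bg: "\<And>x. norm (grad g x) \<le> Bg" by (rule lipc_grad_bound[OF g]) blast
  obtain Bh where Bh: "\<And>x. norm (grad h x) \<le> Bh" by (rule lipc_grad_bound[OF h]) blast
  have bd: "\<bar>G \<bullet> e\<bar> \<le> B * norm e" if "norm G \<le> B" for G B
    using Cauchy_Schwarz_ineq2[of G e] mult_right_mono[OF that, of "norm e"] by simp
  have i1: "integrable lebesgue (\<lambda>x. g x * (grad h x \<bullet> e))"
    using lipc_grad_measurable[OF h] by (intro lipc_integrable_mult[OF g]) (auto intro: bd[OF Bh])
  have i2: "integrable lebesgue (\<lambda>x. h x * (grad g x \<bullet> e))"
    using lipc_grad_measurable[OF g] by (intro lipc_integrable_mult[OF h]) (auto intro: bd[OF Bg])
  have "0 = (\<integral>x. grad (\<lambda>x. g x * h x) x \<bullet> e \<partial>lebesgue)" using lipc_integral_grad[OF gm] by simp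
  also have "\<dots> = (\<integral>x. g x * (grad h x \<bullet> e) + h x * (grad g x \<bullet> e) \<partial>lebesgue)"
  proof (rule integral_cong_AE)
    show "AE x in lebesgue. grad (\<lambda>x. g x * h x) x \<bullet> e = g x * (grad h x \<bullet> e) + h x * (grad g x \<bullet> e)"
      using lipc_AE[OF g] lipc_AE[OF h]
      by eventually_elim (simp add: grad_eqI[OF GDERIV_mult] inner_add_left)
  qed (use i1 i2 lipc_grad_measurable[OF gm] in auto)
  also have "\<dots> = (\<integral>x. g x * (grad h x \<bullet> e) \<partial>lebesgue) + (\<integral>x. h x * (grad g x \<bullet> e) \<partial>lebesgue)"
    using i1 i2 by simp
  finally show ?thesis by (simp add: mult.commute)
qed

lemma inner_Basis_bound: "norm G \<le> B \<Longrightarrow> \<bar>G \<bullet> e\<bar> \<le> B * norm e"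
  using Cauchy_Schwarz_ineq2[of G e] mult_right_mono[of "norm G" B "norm e"] by simp

lemma GDERIV_shift:
  assumes "GDERIV g (x + c) :> D"
  shows "GDERIV (\<lambda>x. g (x + c)) x :> D"
proof -
  have "((\<lambda>x. x + c) has_derivative (\<lambda>h. h)) (at x)" by (auto intro!: derivative_eq_intros)
  from has_derivative_compose[OF this assms[unfolded gderiv_def]] show ?thesis by (simp add: gderiv_def)
qed

text \<open>Both sides equal the limit of \<open>\<integral> D\<^sub>h \<xi> \<cdot> \<partial>\<^sub>e P\<close>, \<open>D\<^sub>h\<close> being the difference quotient in direction \<open>X\<close>:
  no second derivatives are needed.\<close>

lemma lipc_ibp_swap:
  fixes P \<xi> :: "real^'n \<Rightarrow> real"
  assumes P: "lipc S P" and \<xi>: "lipc S \<xi>"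
  shows "(\<integral>x. (grad P x \<bullet> X) * (grad \<xi> x \<bullet> e) \<partial>lebesgue)
       = (\<integral>x. (grad P x \<bullet> e) * (grad \<xi> x \<bullet> X) \<partial>lebesgue)"
proof -
  have PU: "lipc UNIV P" and \<xi>U: "lipc UNIV \<xi>" using P \<xi> lipc_mono by blast+
  obtain BP where BP: "\<And>x. norm (grad P x) \<le> BP" by (rule lipc_grad_bound[OF P]) blast
  obtain B\<xi> where B\<xi>: "\<And>x. norm (grad \<xi> x) \<le> B\<xi>" by (rule lipc_grad_bound[OF \<xi>]) blast
  note m[measurable] = lipc_grad_measurable[OF P] lipc_grad_measurable[OF \<xi>] lipc_measurable[OF P]
  \<comment> \<open>Discrete summation by parts: integrate by parts in direction \<open>e\<close>,
    then translate so that the difference falls on \<open>P\<close>. The step changes sign, whence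
    the direction -X in the limit.\<close>
  have eq: "(\<integral>x. (\<xi> (x + (1 / Suc n) *\<^sub>R X) - \<xi> x) * real (Suc n) * (grad P x \<bullet> e) \<partial>lebesgue)
    = - (\<integral>x. (P (x + (1 / Suc n) *\<^sub>R (- X)) - P x) * real (Suc n) * (grad \<xi> x \<bullet> e) \<partial>lebesgue)" for n
  proof -
    define c where "c = (1 / real (Suc n)) *\<^sub>R X"
    define r where "r = real (Suc n)"
    have \<xi>c: "lipc UNIV (\<lambda>x. \<xi> (x + c))" by (rule lipc_shift[OF \<xi>U])
    have q: "lipc UNIV (\<lambda>x. r * (\<xi> (x + c) + (-1) * \<xi> x))"
      by (intro lipc_cmult lipc_add \<xi>c \<xi>U)
    have gq: "AE x in lebesgue. grad (\<lambda>x. r * (\<xi> (x + c) + (-1) * \<xi> x)) x = r *\<^sub>R (grad \<xi> (x + c) - grad \<xi> x)"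
      using lipc_AE[OF \<xi>] AE_lebesgue_shift[OF lipc_AE[OF \<xi>], of c]
    proof eventually_elim
      case (elim x)
      have "GDERIV (\<lambda>x. r * (\<xi> (x + c) + (-1) * \<xi> x)) x :>
          r *\<^sub>R (grad \<xi> (x + c) + ((-1) *\<^sub>R grad \<xi> x + \<xi> x *\<^sub>R 0)) + (\<xi> (x + c) + (-1) * \<xi> x) *\<^sub>R 0"
        by (intro GDERIV_mult GDERIV_const GDERIV_add GDERIV_shift elim)
      then show ?case by (intro grad_eqI) simp
    qed
    have mc: "(\<lambda>x. grad \<xi> (x + c) \<bullet> e) \<in> borel_measurable lebesgue"
      by (rule integral_lebesgue_shift(1)[of "\<lambda>x. grad \<xi> x \<bullet> e"]) measurable
    have i1: "integrable lebesgue (\<lambda>x. P x * (grad \<xi> (x + c) \<bullet> e))"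
      by (rule lipc_integrable_mult[OF P mc inner_Basis_bound[OF B\<xi>]])
    have i2: "integrable lebesgue (\<lambda>x. P x * (grad \<xi> x \<bullet> e))"
      by (rule lipc_integrable_mult[OF P _ inner_Basis_bound[OF B\<xi>]]) measurable
    have i3: "integrable lebesgue (\<lambda>x. P (x + (- c)) * (grad \<xi> x \<bullet> e))"
      by (rule lipc_integrable_mult[OF lipc_shift[OF PU] _ inner_Basis_bound[OF B\<xi>]]) measurable
    have "(\<integral>x. r * (\<xi> (x + c) + (-1) * \<xi> x) * (grad P x \<bullet> e) \<partial>lebesgue)
        = - (\<integral>x. (grad (\<lambda>x. r * (\<xi> (x + c) + (-1) * \<xi> x)) x \<bullet> e) * P x \<partial>lebesgue)"
      by (rule lipc_ibp[OF q PU])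
    also have "(\<integral>x. (grad (\<lambda>x. r * (\<xi> (x + c) + (-1) * \<xi> x)) x \<bullet> e) * P x \<partial>lebesgue)
        = (\<integral>x. r * (P x * (grad \<xi> (x + c) \<bullet> e) - P x * (grad \<xi> x \<bullet> e)) \<partial>lebesgue)"
    proof (rule integral_cong_AE)
      show "AE x in lebesgue. (grad (\<lambda>x. r * (\<xi> (x + c) + (-1) * \<xi> x)) x \<bullet> e) * P x
          = r * (P x * (grad \<xi> (x + c) \<bullet> e) - P x * (grad \<xi> x \<bullet> e))"
        using gq
      proof eventually_elim
        case (elim x)
        show ?case unfolding elim by (simp add: inner_diff_left algebra_simps)
      qed
    qed (use lipc_grad_measurable[OF q] mc in measurable)
    also have "\<dots> = r * ((\<integral>x. P x * (grad \<xi> (x + c) \<bullet> e) \<partial>lebesgue) - (\<integral>x. P x * (grad \<xi> x \<bullet> e) \<partial>lebesgue))"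
      using i1 i2 by simp
    also have "(\<integral>x. P x * (grad \<xi> (x + c) \<bullet> e) \<partial>lebesgue) = (\<integral>x. P (x + (- c)) * (grad \<xi> x \<bullet> e) \<partial>lebesgue)"
      using integral_lebesgue_shift(2)[of "\<lambda>x. P (x + (- c)) * (grad \<xi> x \<bullet> e)" c] borel_measurable_integrable[OF i3]
      by simp
    also have "r * ((\<integral>x. P (x + (- c)) * (grad \<xi> x \<bullet> e) \<partial>lebesgue) - (\<integral>x. P x * (grad \<xi> x \<bullet> e) \<partial>lebesgue))
        = (\<integral>x. r * (P (x + (- c)) * (grad \<xi> x \<bullet> e) - P x * (grad \<xi> x \<bullet> e)) \<partial>lebesgue)"
      using i2 i3 by simp
    finally show ?thesis by (simp add: c_def r_def algebra_simps del: of_nat_Suc)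
  qed
  have 1: "(\<lambda>n. \<integral>x. (\<xi> (x + (1 / Suc n) *\<^sub>R X) - \<xi> x) * real (Suc n) * (grad P x \<bullet> e) \<partial>lebesgue)
      \<longlonglongrightarrow> (\<integral>x. (grad \<xi> x \<bullet> X) * (grad P x \<bullet> e) \<partial>lebesgue)"
    by (rule lipc_quotient_limit[OF \<xi> _ inner_Basis_bound[OF BP]]) measurable
  have 2: "(\<lambda>n. \<integral>x. (P (x + (1 / Suc n) *\<^sub>R (- X)) - P x) * real (Suc n) * (grad \<xi> x \<bullet> e) \<partial>lebesgue)
      \<longlonglongrightarrow> (\<integral>x. (grad P x \<bullet> (- X)) * (grad \<xi> x \<bullet> e) \<partial>lebesgue)"
    by (rule lipc_quotient_limit[OF P _ inner_Basis_bound[OF B\<xi>]]) measurable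
  have "(\<integral>x. (grad \<xi> x \<bullet> X) * (grad P x \<bullet> e) \<partial>lebesgue) = - (\<integral>x. (grad P x \<bullet> (- X)) * (grad \<xi> x \<bullet> e) \<partial>lebesgue)"
    by (rule LIMSEQ_unique[OF 1]) (unfold eq, rule tendsto_minus[OF 2])
  then show ?thesis by (simp add: mult.commute)
qed

text \<open>Moves the gradient onto \<open>V\<close>: the weak derivative of a Lipschitz component
  is paired with the L1 norm of \<eta> alone, with no gradient of \<eta> left.\<close>

lemma lipc_integral_grad_bound:
  fixes V \<eta> :: "real^'n \<Rightarrow> real"
  assumes V: "lipc S V" "K-lipschitz_on UNIV V" and \<eta>: "lipc T \<eta>"
  shows "(\<integral>x. V x * (grad \<eta> x \<bullet> e) \<partial>lebesgue) \<le> K * norm e * (\<integral>x. \<bar>\<eta> x\<bar> \<partial>lebesgue)"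
proof -
  obtain B where B: "\<And>x. norm (grad V x) \<le> B" by (rule lipc_grad_bound[OF V(1)]) blast
  have K: "norm (grad V x) \<le> K" for x by (rule grad_lipschitz_bound[OF V(2)]) auto
  note m[measurable] = lipc_grad_measurable[OF V(1)]
  have VU: "lipc UNIV V" and \<eta>U: "lipc UNIV \<eta>" using V(1) \<eta> lipc_mono by blast+
  have i: "integrable lebesgue (\<lambda>x. \<eta> x * (grad V x \<bullet> e))"
    by (rule lipc_integrable_mult[OF \<eta> _ inner_Basis_bound[OF B]]) measurable
  have "(\<integral>x. V x * (grad \<eta> x \<bullet> e) \<partial>lebesgue) = (\<integral>x. - (\<eta> x * (grad V x \<bullet> e)) \<partial>lebesgue)"
    using lipc_ibp[OF VU \<eta>U, of e] by (simp add: mult.commute)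
  also have "\<dots> \<le> (\<integral>x. K * norm e * \<bar>\<eta> x\<bar> \<partial>lebesgue)"
  proof (rule integral_mono)
    show "integrable lebesgue (\<lambda>x. K * norm e * \<bar>\<eta> x\<bar>)" using lipc_integrable[OF \<eta>] by simp
    fix x
    have "- (\<eta> x * (grad V x \<bullet> e)) \<le> \<bar>grad V x \<bullet> e\<bar> * \<bar>\<eta> x\<bar>" by (metis abs_ge_minus_self abs_mult mult.commute)
    also have "\<dots> \<le> K * norm e * \<bar>\<eta> x\<bar>" by (intro mult_right_mono inner_Basis_bound[OF K]) simp
    finally show "- (\<eta> x * (grad V x \<bullet> e)) \<le> K * norm e * \<bar>\<eta> x\<bar>" .
  qed (use i in simp)
  finally show ?thesis by simp
qed

text \<open>The function is 1 on an open neighbourhood of \<open>K\<close> rather than just on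
  \<open>K\<close>, so multiplication by it changes neither values nor gradients on
  \<open>K\<close>.\<close>

lemma lipc_cutoff:
  fixes K :: "'a::euclidean_space set"
  assumes K: "compact K" and S: "open S" "K \<subseteq> S"
  obtains \<theta> U where "lipc S \<theta>" "open U" "K \<subseteq> U" "U \<subseteq> S" "\<And>x. x \<in> U \<Longrightarrow> \<theta> x = 1"
    "\<And>x. 0 \<le> \<theta> x" "\<And>x. \<theta> x \<le> 1"
proof (cases "K = {}")
  case True
  have "lipc S (\<lambda>x. 0)" unfolding lipc_def by (auto intro!: exI[of _ 0] exI[of _ "{}"] simp: lipschitz_on_def)
  from that[OF this, of "{}"] True show ?thesis by simp
next
  case False
  obtain d where d: "d > 0" "\<And>x y. x \<in> K \<Longrightarrow> y \<in> - S \<Longrightarrow> d \<le> dist x y"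
    using separate_compact_closed[OF K, of "- S"] S by blast
  \<comment> \<open>The cutoff is 1 within \<delta> of \<open>K\<close> and 0 beyond 2 \<delta>,
    still less than the distance d to the complement of \<open>S\<close>.\<close>
  define \<delta> where "\<delta> = d / 3"
  have \<delta>: "\<delta> > 0" using d(1) by (simp add: \<delta>_def)
  define \<theta> where "\<theta> x = max 0 (min 1 (2 - infdist x K / \<delta>))" for x
  let ?C = "{x. infdist x K \<le> 2 * \<delta>}"
  have C: "compact ?C" using compact_infdist_le[OF False K, of "2 * \<delta>"] \<delta> by simp
  have CS: "?C \<subseteq> S"
  proof
    fix x assume x: "x \<in> ?C"
    obtain y where y: "y \<in> K" "infdist x K = dist x y"
      using infdist_attains_inf[OF compact_imp_closed[OF K] False] by metis
    show "x \<in> S"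
    proof (rule ccontr)
      assume "x \<notin> S"
      then have "d \<le> dist y x" using d(2)[OF y(1), of x] by simp
      then show False using x y(2) d(1) by (simp add: dist_commute \<delta>_def)
    qed
  qed
  have z: "\<theta> x = 0" if "x \<notin> ?C" for x
  proof -
    have "2 \<le> infdist x K / \<delta>" using that \<delta> by (simp add: field_simps)
    then show ?thesis by (simp add: \<theta>_def)
  qed
  have "(1 / \<delta>)-lipschitz_on UNIV \<theta>"
  proof (rule lipschitz_onI)
    fix x y :: 'a
    have "\<bar>\<theta> x - \<theta> y\<bar> \<le> \<bar>infdist x K / \<delta> - infdist y K / \<delta>\<bar>" unfolding \<theta>_def by linarith
    also have "\<dots> = \<bar>infdist x K - infdist y K\<bar> / \<delta>" using \<delta> by (simp add: diff_divide_distrib[symmetric])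
    also have "\<dots> \<le> dist x y / \<delta>" using infdist_triangle_abs[of x K y] \<delta> by (intro divide_right_mono) auto
    finally show "dist (\<theta> x) (\<theta> y) \<le> 1 / \<delta> * dist x y" by (simp add: dist_real_def)
  qed (use \<delta> in simp)
  then have 1: "lipc S \<theta>" unfolding lipc_def using C CS z by blast
  let ?U = "{x. infdist x K < \<delta>}"
  have 2: "open ?U" by (intro open_Collect_less continuous_intros)
  have 3: "K \<subseteq> ?U" using \<delta> by auto
  have 4: "?U \<subseteq> S" using CS \<delta> by auto
  have 5: "\<theta> x = 1" if "x \<in> ?U" for x
  proof -
    have "infdist x K / \<delta> \<le> 1" using that \<delta> by (simp add: field_simps)
    then show ?thesis by (simp add: \<theta>_def)
  qed
  show ?thesis by (rule that[OF 1 2 3 4 5]) (auto simp: \<theta>_def)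
qed

section \<open>The strong maximum principle for stable forms\<close>

text \<open>Abstracts the linearised operator: later \<open>M x\<close> is
  \<open>A_op a (grad u x)\<close> and \<open>c\<close> is f'(u). Regularity and ellipticity are
  local in the domain, which may be unbounded.\<close>

locale elliptic_form =
  fixes \<Omega> :: "(real^'n) set" and M :: "real^'n \<Rightarrow> real^'n \<Rightarrow> real^'n" and c :: "real^'n \<Rightarrow> real"
  assumes open_\<Omega>: "open \<Omega>"
    and linear_M: "\<And>x. linear (M x)"
    and sym_M: "\<And>x Y Z. M x Y \<bullet> Z = M x Z \<bullet> Y"
    and loclip_M: "\<And>Y Z. loclip \<Omega> (\<lambda>x. M x Y \<bullet> Z)"
    and elliptic: "\<And>K. compact K \<Longrightarrow> K \<subseteq> \<Omega> \<Longrightarrow> \<exists>l>0. \<forall>x\<in>K. \<forall>Z. l * (norm Z)\<^sup>2 \<le> M x Z \<bullet> Z"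
    and continuous_c: "continuous_on \<Omega> c"
begin

lemma M_expand: "M x Y \<bullet> Z = (\<Sum>a\<in>Basis. \<Sum>b\<in>Basis. (Y \<bullet> a) * (Z \<bullet> b) * (M x a \<bullet> b))"
proof -
  have "M x Y \<bullet> Z = M x (\<Sum>a\<in>Basis. (Y \<bullet> a) *\<^sub>R a) \<bullet> (\<Sum>b\<in>Basis. (Z \<bullet> b) *\<^sub>R b)"
    by (simp add: euclidean_representation)
  also have "\<dots> = (\<Sum>a\<in>Basis. \<Sum>b\<in>Basis. (Y \<bullet> a) * (Z \<bullet> b) * (M x a \<bullet> b))"
    unfolding linear_sum[OF linear_M] linear_scale[OF linear_M] inner_sum_left inner_sum_right
    by (subst sum.swap) (simp add: algebra_simps)
  finally show ?thesis .
qed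

lemma M_nonneg: "x \<in> \<Omega> \<Longrightarrow> 0 \<le> M x Z \<bullet> Z"
  using elliptic[of "{x}"] by (auto intro: order_trans[rotated])

lemmas M_simps = linear_add[OF linear_M] linear_diff[OF linear_M] linear_scale[OF linear_M] linear_0[OF linear_M]
  inner_add_left inner_add_right inner_diff_left inner_diff_right

lemma integrable_form:
  assumes \<phi>: "lipc \<Omega> \<phi>" and \<psi>: "lipc S \<psi>"
  shows "integrable lebesgue (\<lambda>x. M x (grad \<phi> x) \<bullet> grad \<psi> x)"
proof -
  obtain L K where K: "L-lipschitz_on UNIV \<phi>" "L \<ge> 0" "compact K" "K \<subseteq> \<Omega>" "\<And>x. x \<notin> K \<Longrightarrow> \<phi> x = 0"
    by (rule lipcE[OF \<phi>]) blast
  obtain \<theta> U where \<theta>: "lipc \<Omega> \<theta>" "open U" "K \<subseteq> U" "U \<subseteq> \<Omega>" "\<And>x. x \<in> U \<Longrightarrow> \<theta> x = 1"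
    by (rule lipc_cutoff[OF K(3) open_\<Omega> K(4)]) blast
  obtain B where B: "\<And>x. norm (grad \<phi> x) \<le> B" by (rule lipc_grad_bound[OF \<phi>]) blast
  obtain B' where B': "\<And>x. norm (grad \<psi> x) \<le> B'" by (rule lipc_grad_bound[OF \<psi>]) blast
  note m[measurable] = lipc_grad_measurable[OF \<phi>] lipc_grad_measurable[OF \<psi>]
  \<comment> \<open>On the support of \<phi> the cutoff is 1, and off it the gradient of \<phi>
    vanishes; so the coefficients may be replaced by globally bounded ones.\<close>
  have eq: "(\<theta> x * (M x a \<bullet> b)) * ((grad \<phi> x \<bullet> a) * (grad \<psi> x \<bullet> b)) = (grad \<phi> x \<bullet> a) * (grad \<psi> x \<bullet> b) * (M x a \<bullet> b)"
    for x a b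
  proof (cases "x \<in> K")
    case True then show ?thesis using \<theta>(3,5) by auto
  next
    case False then show ?thesis using grad_eq_0_outside[OF K(3,5) False] by simp
  qed
  have "integrable lebesgue (\<lambda>x. (\<theta> x * (M x a \<bullet> b)) * ((grad \<phi> x \<bullet> a) * (grad \<psi> x \<bullet> b)))" for a b
  proof (rule lipc_integrable_mult)
    show "lipc \<Omega> (\<lambda>x. \<theta> x * (M x a \<bullet> b))" by (rule lipc_mult_loclip[OF \<theta>(1) loclip_M])
    show "(\<lambda>x. (grad \<phi> x \<bullet> a) * (grad \<psi> x \<bullet> b)) \<in> borel_measurable lebesgue" by measurable
    show "\<bar>(grad \<phi> x \<bullet> a) * (grad \<psi> x \<bullet> b)\<bar> \<le> (B * norm a) * (B' * norm b)" for x
    proof -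
      have "0 \<le> B" using B[of x] norm_ge_zero order_trans by blast
      then show ?thesis unfolding abs_mult by (intro mult_mono inner_Basis_bound B B') auto
    qed
  qed
  then show ?thesis unfolding eq by (subst M_expand) (intro Bochner_Integration.integrable_sum)
qed

lemma integrable_c:
  assumes \<phi>: "lipc \<Omega> \<phi>"
  shows "integrable lebesgue (\<lambda>x. c x * \<phi> x)"
proof -
  obtain L K where K: "L-lipschitz_on UNIV \<phi>" "L \<ge> 0" "compact K" "K \<subseteq> \<Omega>" "\<And>x. x \<notin> K \<Longrightarrow> \<phi> x = 0"
    by (rule lipcE[OF \<phi>]) blast
  have "continuous_on \<Omega> (\<lambda>x. c x * \<phi> x)" using continuous_c lipc_continuous[OF \<phi>] by (intro continuous_intros)
  moreover have "continuous_on (- K) (\<lambda>x. c x * \<phi> x)"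
    by (rule continuous_on_eq[of _ "\<lambda>_. 0"]) (use K(5) in auto)
  ultimately have "continuous_on (\<Omega> \<union> - K) (\<lambda>x. c x * \<phi> x)"
    using open_\<Omega> K(3) by (intro continuous_on_open_Un) (auto simp: compact_imp_closed open_Compl)
  moreover have "\<Omega> \<union> - K = UNIV" using K(4) by auto
  ultimately have cont: "continuous_on UNIV (\<lambda>x. c x * \<phi> x)" by simp
  have "compact ((\<lambda>x. c x * \<phi> x) ` K)" by (intro compact_continuous_image continuous_on_subset[OF cont] K) auto
  then obtain B where B: "\<And>x. x \<in> K \<Longrightarrow> \<bar>c x * \<phi> x\<bar> \<le> B"
    using compact_imp_bounded by (fastforce simp: bounded_iff)
  show ?thesis
  proof (rule integrable_compact_supportI[OF _ K(3)])
    show "(\<lambda>x. c x * \<phi> x) \<in> borel_measurable lebesgue"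
      using borel_measurable_continuous_onI[OF cont] by (intro measurable_completion) simp
    have "\<bar>c x * \<phi> x\<bar> \<le> max 0 B" for x using B[of x] K(5)[of x] by (cases "x \<in> K") auto
    then show "AE x in lebesgue. \<bar>c x * \<phi> x\<bar> \<le> max 0 B" by simp
  qed (use K(5) in simp)
qed

lemma lipc_product: "lipc \<Omega> \<phi> \<Longrightarrow> lipc \<Omega> \<psi> \<Longrightarrow> lipc \<Omega> (\<lambda>x. \<phi> x * \<psi> x)"
  by (rule lipc_mult_loclip[OF _ lipc_loclip])

definition E where "E \<phi> \<psi> = (\<integral>x. M x (grad \<phi> x) \<bullet> grad \<psi> x \<partial>lebesgue)"

text \<open>The second variation, polarised. For functions that vanish off a compact subset of
  \<Omega> the integral over the whole space is the one in the stability condition.\<close>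

definition Q where "Q \<phi> \<psi> = E \<phi> \<psi> - (\<integral>x. c x * (\<phi> x * \<psi> x) \<partial>lebesgue)"

lemma E_nonneg:
  assumes \<phi>: "lipc \<Omega> \<phi>"
  shows "E \<phi> \<phi> \<ge> 0"
proof -
  obtain L K where K: "L-lipschitz_on UNIV \<phi>" "L \<ge> 0" "compact K" "K \<subseteq> \<Omega>" "\<And>x. x \<notin> K \<Longrightarrow> \<phi> x = 0"
    by (rule lipcE[OF \<phi>]) blast
  have "0 \<le> M x (grad \<phi> x) \<bullet> grad \<phi> x" for x
    using M_nonneg[of x] grad_eq_0_outside(2)[OF K(3,5)] K(4) by (cases "x \<in> K") auto
  then show ?thesis unfolding E_def by simp
qed

lemma Q_quadratic:
  assumes \<phi>: "lipc \<Omega> \<phi>" and \<psi>: "lipc \<Omega> \<psi>"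
  shows "Q (\<lambda>x. t * \<phi> x + \<psi> x) (\<lambda>x. t * \<phi> x + \<psi> x) = t\<^sup>2 * Q \<phi> \<phi> + 2 * t * Q \<phi> \<psi> + Q \<psi> \<psi>"
proof -
  let ?s = "\<lambda>x. t * \<phi> x + \<psi> x"
  have s: "lipc \<Omega> ?s" by (intro lipc_add lipc_cmult \<phi> \<psi>)
  note i = integrable_form[OF \<phi> \<phi>] integrable_form[OF \<phi> \<psi>] integrable_form[OF \<psi> \<psi>]
  note j = integrable_c[OF lipc_product[OF \<phi> \<phi>]] integrable_c[OF lipc_product[OF \<phi> \<psi>]]
    integrable_c[OF lipc_product[OF \<psi> \<psi>]]
  have "E ?s ?s = (\<integral>x. t\<^sup>2 * (M x (grad \<phi> x) \<bullet> grad \<phi> x) + 2 * t * (M x (grad \<phi> x) \<bullet> grad \<psi> x)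
      + M x (grad \<psi> x) \<bullet> grad \<psi> x \<partial>lebesgue)"
    unfolding E_def
  proof (rule integral_cong_AE)
    show "AE x in lebesgue. M x (grad ?s x) \<bullet> grad ?s x = t\<^sup>2 * (M x (grad \<phi> x) \<bullet> grad \<phi> x)
        + 2 * t * (M x (grad \<phi> x) \<bullet> grad \<psi> x) + M x (grad \<psi> x) \<bullet> grad \<psi> x"
      using lipc_AE[OF \<phi>] lipc_AE[OF \<psi>]
    proof eventually_elim
      case (elim x)
      have "GDERIV ?s x :> (t *\<^sub>R grad \<phi> x + \<phi> x *\<^sub>R 0) + grad \<psi> x"
        by (intro GDERIV_mult GDERIV_const GDERIV_add elim)
      then have g: "grad ?s x = t *\<^sub>R grad \<phi> x + grad \<psi> x" by (intro grad_eqI) simp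
      show ?case unfolding g using sym_M[of x "grad \<psi> x" "grad \<phi> x"]
        by (simp add: M_simps power2_eq_square algebra_simps)
    qed
  qed (use i borel_measurable_integrable[OF integrable_form[OF s s]] in simp_all)
  also have "\<dots> = t\<^sup>2 * E \<phi> \<phi> + 2 * t * E \<phi> \<psi> + E \<psi> \<psi>"
    using i by (simp add: E_def)
  finally have 1: "E ?s ?s = t\<^sup>2 * E \<phi> \<phi> + 2 * t * E \<phi> \<psi> + E \<psi> \<psi>" .
  have "(\<integral>x. c x * (?s x * ?s x) \<partial>lebesgue) = (\<integral>x. t\<^sup>2 * (c x * (\<phi> x * \<phi> x)) + 2 * t * (c x * (\<phi> x * \<psi> x))
      + c x * (\<psi> x * \<psi> x) \<partial>lebesgue)"
    by (rule Bochner_Integration.integral_cong) (simp_all add: power2_eq_square algebra_simps)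
  also have "\<dots> = t\<^sup>2 * (\<integral>x. c x * (\<phi> x * \<phi> x) \<partial>lebesgue) + 2 * t * (\<integral>x. c x * (\<phi> x * \<psi> x) \<partial>lebesgue)
      + (\<integral>x. c x * (\<psi> x * \<psi> x) \<partial>lebesgue)"
    using j by simp
  finally show ?thesis using 1 unfolding Q_def by (simp add: algebra_simps)
qed

end

locale stable_form = elliptic_form \<Omega> M c
  for \<Omega> :: "(real^'n) set" and M c +
  assumes stable: "\<And>\<phi>. lipc \<Omega> \<phi> \<Longrightarrow> 0 \<le> Q \<phi> \<phi>"
begin

text \<open>Cauchy-Schwarz in weighted form, from nonnegativity at t \<phi> + \<psi>. A large
  \<open>t\<close> makes the uncontrolled term with \<psi> cheap and charges the small form of
  \<phi> instead.\<close>

lemma Q_Cauchy_Schwarz: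
  assumes "lipc \<Omega> \<phi>" "lipc \<Omega> \<psi>" and t: "t > 0"
  shows "- Q \<phi> \<psi> \<le> t / 2 * Q \<phi> \<phi> + Q \<psi> \<psi> / (2 * t)"
proof -
  have "0 \<le> t\<^sup>2 * Q \<phi> \<phi> + 2 * t * Q \<phi> \<psi> + Q \<psi> \<psi>"
    unfolding Q_quadratic[OF assms(1,2), symmetric] using assms by (intro stable lipc_add lipc_cmult)
  then have "0 \<le> (t\<^sup>2 * Q \<phi> \<phi> + 2 * t * Q \<phi> \<psi> + Q \<psi> \<psi>) / (2 * t)" using t by simp
  also have "\<dots> = t / 2 * Q \<phi> \<phi> + Q \<phi> \<psi> + Q \<psi> \<psi> / (2 * t)"
    using t by (simp add: field_simps power2_eq_square)
  finally show ?thesis by simp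
qed

end

context elliptic_form begin

text \<open>The vector field is \<open>M \<nabla>q\<close> with \<open>q = - |x - y|\<^sup>2\<close>; \<open>M\<close> need not be differentiable.\<close>

lemma quadratic_divergence_bound:
  assumes N: "compact N" "N \<subseteq> \<Omega>"
  obtains K where "\<And>\<eta>. lipc N \<eta> \<Longrightarrow> (\<And>x. 0 \<le> \<eta> x) \<Longrightarrow>
    integrable lebesgue (\<lambda>x. M x (- 2 *\<^sub>R (x - y)) \<bullet> grad \<eta> x) \<and>
    (\<integral>x. M x (- 2 *\<^sub>R (x - y)) \<bullet> grad \<eta> x \<partial>lebesgue) \<le> K * (\<integral>x. \<eta> x \<partial>lebesgue)"
proof -
  obtain \<theta> U where \<theta>: "lipc \<Omega> \<theta>" "open U" "N \<subseteq> U" "U \<subseteq> \<Omega>" "\<And>x. x \<in> U \<Longrightarrow> \<theta> x = 1"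
    by (rule lipc_cutoff[OF N(1) open_\<Omega> N(2)]) blast
  \<comment> \<open>The components of M grad q, cut off so as to be Lipschitz on the whole space;
    their Lipschitz constants add up to the bound on the weak divergence.\<close>
  define V where "V b x = \<theta> x * (M x (- 2 *\<^sub>R (x - y)) \<bullet> b)" for b x
  have V: "lipc \<Omega> (V b)" for b
  proof -
    have "M x (- 2 *\<^sub>R (x - y)) \<bullet> b = (\<Sum>a\<in>Basis. (- 2 * ((x - y) \<bullet> a)) * (M x a \<bullet> b))" for x
    proof -
      have "M x (- 2 *\<^sub>R (x - y)) \<bullet> b = M x (- 2 *\<^sub>R (\<Sum>a\<in>Basis. ((x - y) \<bullet> a) *\<^sub>R a)) \<bullet> b"
        by (simp only: euclidean_representation)
      also have "\<dots> = (\<Sum>a\<in>Basis. (- 2 * ((x - y) \<bullet> a)) * (M x a \<bullet> b))"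
        unfolding linear_scale[OF linear_M] linear_sum[OF linear_M] inner_sum_left inner_scaleR_left sum_distrib_left
        by (simp add: mult.assoc)
      finally show ?thesis .
    qed
    moreover have "loclip \<Omega> (\<lambda>x. \<Sum>a\<in>Basis. (- 2 * ((x - y) \<bullet> a)) * (M x a \<bullet> b))"
    proof (intro loclip_sum loclip_mult loclip_M loclip_const)
      fix a :: "real^'n"
      show "loclip \<Omega> (\<lambda>x. (x - y) \<bullet> a)"
        by (rule loclip_bounded_linear[OF bounded_linear_inner_left, of _ "\<lambda>x. x - y"],
            rule lipschitz_imp_loclip[of 1], rule lipschitz_onI) (auto simp: dist_norm)
    qed
    ultimately have "loclip \<Omega> (\<lambda>x. M x (- 2 *\<^sub>R (x - y)) \<bullet> b)" by (simp only:)
    then show ?thesis unfolding V_def by (rule lipc_mult_loclip[OF \<theta>(1)])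
  qed
  then have "\<forall>b. \<exists>L. L-lipschitz_on UNIV (V b)" unfolding lipc_def by blast
  then obtain L where L: "\<And>b. (L b)-lipschitz_on UNIV (V b)" by metis
  show ?thesis
  proof (rule that[of "\<Sum>b\<in>Basis. L b * norm (b :: real^'n)"])
    fix \<eta> assume \<eta>: "lipc N \<eta>" and pos: "\<And>x. 0 \<le> \<eta> x"
    obtain L' K where K: "L'-lipschitz_on UNIV \<eta>" "L' \<ge> 0" "compact K" "K \<subseteq> N" "\<And>x. x \<notin> K \<Longrightarrow> \<eta> x = 0"
      by (rule lipcE[OF \<eta>]) blast
    obtain B where B: "\<And>x. norm (grad \<eta> x) \<le> B" by (rule lipc_grad_bound[OF \<eta>]) blast
    note m[measurable] = lipc_grad_measurable[OF \<eta>]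
    have i: "integrable lebesgue (\<lambda>x. V b x * (grad \<eta> x \<bullet> b))" for b
      by (rule lipc_integrable_mult[OF V _ inner_Basis_bound[OF B]]) measurable
    have eq: "M x (- 2 *\<^sub>R (x - y)) \<bullet> grad \<eta> x = (\<Sum>b\<in>Basis. V b x * (grad \<eta> x \<bullet> b))" for x
    proof (cases "x \<in> K")
      case True
      then have "\<theta> x = 1" using K(4) \<theta> by auto
      then show ?thesis unfolding V_def by (subst euclidean_inner) simp
    next
      case False
      then show ?thesis using grad_eq_0_outside[OF K(3,5) False] by simp
    qed
    have int: "integrable lebesgue (\<lambda>x. M x (- 2 *\<^sub>R (x - y)) \<bullet> grad \<eta> x)"
      unfolding eq using i by (intro Bochner_Integration.integrable_sum)
    have "(\<integral>x. M x (- 2 *\<^sub>R (x - y)) \<bullet> grad \<eta> x \<partial>lebesgue) = (\<Sum>b\<in>Basis. \<integral>x. V b x * (grad \<eta> x \<bullet> b) \<partial>lebesgue)"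
      unfolding eq using i by (simp add: Bochner_Integration.integral_sum)
    also have "\<dots> \<le> (\<Sum>b\<in>Basis. L b * norm (b :: real^'n) * (\<integral>x. \<bar>\<eta> x\<bar> \<partial>lebesgue))"
      by (intro sum_mono lipc_integral_grad_bound[OF V L \<eta>])
    finally have "(\<integral>x. M x (- 2 *\<^sub>R (x - y)) \<bullet> grad \<eta> x \<partial>lebesgue)
        \<le> (\<Sum>b\<in>Basis. L b * norm (b :: real^'n)) * (\<integral>x. \<eta> x \<partial>lebesgue)"
      using pos by (simp add: sum_distrib_right)
    with int show "integrable lebesgue (\<lambda>x. M x (- 2 *\<^sub>R (x - y)) \<bullet> grad \<eta> x) \<and>
      (\<integral>x. M x (- 2 *\<^sub>R (x - y)) \<bullet> grad \<eta> x \<partial>lebesgue)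
        \<le> (\<Sum>b\<in>Basis. L b * norm (b :: real^'n)) * (\<integral>x. \<eta> x \<partial>lebesgue)" by blast
  qed
qed

end

section \<open>The Hopf barrier and the strong maximum principle\<close>

lemma GDERIV_exp_quadratic:
  fixes y :: "'a::real_inner"
  shows "GDERIV (\<lambda>x. exp (- \<alpha> * ((x - y) \<bullet> (x - y)))) x :>
    (\<alpha> * exp (- \<alpha> * ((x - y) \<bullet> (x - y)))) *\<^sub>R (- 2 *\<^sub>R (x - y))"
proof -
  have "GDERIV (\<lambda>x. (x - y) \<bullet> (x - y)) x :> 2 *\<^sub>R (x - y)"
    unfolding gderiv_def
    by (rule has_derivative_eq_rhs, (rule derivative_intros)+) (simp add: fun_eq_iff inner_commute inner_diff_right)
  moreover have "((\<lambda>t. exp (- \<alpha> * t)) has_real_derivative - \<alpha> * exp (- \<alpha> * ((x - y) \<bullet> (x - y)))) (at ((x - y) \<bullet> (x - y)))"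
    by (auto intro!: derivative_eq_intros)
  ultimately have "GDERIV (\<lambda>x. exp (- \<alpha> * ((x - y) \<bullet> (x - y)))) x :>
      (- \<alpha> * exp (- \<alpha> * ((x - y) \<bullet> (x - y)))) *\<^sub>R (2 *\<^sub>R (x - y))"
    by (rule GDERIV_DERIV_compose)
  then show ?thesis by (rule GDERIV_subst) simp
qed

context elliptic_form begin

text \<open>The barrier \<open>H\<close> is a strict subsolution for large \<alpha>, stated weakly
  by testing with the part of \<open>H\<close> above \<open>g\<close>. If \<open>g\<close> solved
  the linearised equation, the term \<open>Q g \<psi>\<close> would vanish; here it stays as an
  error. The strictness, \<epsilon> times the integral of e \<psi>, is the gain, and the lift by
  \<open>s\<close> costs C s times the integral of \<psi>.\<close>

lemma barrier_energy:
  assumes N: "cball p \<rho> \<subseteq> \<Omega>"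
    and far: "\<And>x. x \<in> cball p \<rho> \<Longrightarrow> R / 2 \<le> norm (x - y)" "R > 0"
    and l: "l > 0" "\<And>x Z. x \<in> cball p \<rho> \<Longrightarrow> l * (norm Z)\<^sup>2 \<le> M x Z \<bullet> Z"
    and C: "\<And>x. x \<in> cball p \<rho> \<Longrightarrow> \<bar>c x\<bar> \<le> C"
    and K: "\<And>\<eta>. lipc (cball p \<rho>) \<eta> \<Longrightarrow> (\<And>x. 0 \<le> \<eta> x) \<Longrightarrow>
      integrable lebesgue (\<lambda>x. M x (- 2 *\<^sub>R (x - y)) \<bullet> grad \<eta> x) \<and>
      (\<integral>x. M x (- 2 *\<^sub>R (x - y)) \<bullet> grad \<eta> x \<partial>lebesgue) \<le> K * (\<integral>x. \<eta> x \<partial>lebesgue)"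
    and \<alpha>: "\<alpha> > 0" "C + 1 \<le> \<alpha> * (\<alpha> * l * R\<^sup>2 - K)"
    and pos: "\<epsilon> > 0" "s > 0"
    and e: "\<And>x. e x = exp (- \<alpha> * ((x - y) \<bullet> (x - y)))"
    and H: "\<And>x. H x = \<epsilon> * (e x - exp (- \<alpha> * R\<^sup>2)) + s"
    and g: "lipc \<Omega> g" "\<And>x. 0 \<le> g x" "\<And>x. x \<in> sphere p \<rho> \<Longrightarrow> H x < g x"
    and \<psi>: "\<And>x. \<psi> x = (if x \<in> cball p \<rho> then max 0 (H x - g x) else 0)"
  shows "lipc (ball p \<rho>) \<psi>"
    and "E \<psi> \<psi> \<le> - \<epsilon> * (\<integral>x. e x * \<psi> x \<partial>lebesgue) + C * s * (\<integral>x. \<psi> x \<partial>lebesgue) - Q g \<psi>"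
proof -
  have ge: "GDERIV e x :> (\<alpha> * e x) *\<^sub>R (- 2 *\<^sub>R (x - y))" for x
    using GDERIV_exp_quadratic[of \<alpha> y x] by (simp add: e[abs_def])
  have ce: "continuous_on UNIV e" unfolding e[abs_def] by (intro continuous_intros)
  have gH: "GDERIV H x :> (\<epsilon> * \<alpha> * e x) *\<^sub>R (- 2 *\<^sub>R (x - y))" for x
  proof -
    have "GDERIV (\<lambda>x. \<epsilon> * (e x - exp (- \<alpha> * R\<^sup>2)) + s) x :>
      (\<epsilon> *\<^sub>R ((\<alpha> * e x) *\<^sub>R (- 2 *\<^sub>R (x - y)) - 0) + (e x - exp (- \<alpha> * R\<^sup>2)) *\<^sub>R 0) + 0"
      by (intro GDERIV_add GDERIV_mult GDERIV_const GDERIV_diff ge)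
    then show ?thesis unfolding H[abs_def] by (rule GDERIV_subst) simp
  qed
  have lipe: "loclip S e" for S
    by (rule loclip_subset[OF _ subset_UNIV],
        rule loclip_of_continuous_derivative[OF open_UNIV ge[unfolded gderiv_def]])
       (intro continuous_intros ce)
  have lipH: "loclip S H" for S
    unfolding H[abs_def] by (intro loclip_add loclip_mult loclip_const loclip_diff lipe)
  have cH: "continuous_on S H" for S
    unfolding H[abs_def] using continuous_on_subset[OF ce] by (intro continuous_intros) auto
  have cg: "continuous_on S g" for S using g(1) by (rule lipc_continuous)
  \<comment> \<open>Since \<open>H\<close> < \<open>g\<close> on the sphere, the contact set is
    compact in the open ball, so the truncation extended by zero remains Lipschitz.\<close>
  define S0 where "S0 = {x \<in> cball p \<rho>. 0 \<le> H x - g x}"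
  have S0: "compact S0" "S0 \<subseteq> ball p \<rho>"
  proof -
    have "S0 = cball p \<rho> \<inter> {x. 0 \<le> H x - g x}" by (auto simp: S0_def)
    moreover have "closed {x. 0 \<le> H x - g x}" using cH cg by (intro closed_Collect_le continuous_intros)
    ultimately show "compact S0" by (auto intro: compact_Int_closed)
    show "S0 \<subseteq> ball p \<rho>"
    proof
      fix x assume x: "x \<in> S0"
      then have "x \<notin> sphere p \<rho>" using g(3)[of x] by (auto simp: S0_def)
      with x show "x \<in> ball p \<rho>" by (auto simp: S0_def)
    qed
  qed
  have \<psi>0: "\<psi> x = 0" if "x \<notin> S0" for x using that by (auto simp: \<psi> S0_def)
  have "loclip (ball p \<rho>) \<psi>"
    by (rule loclip_cong[OF loclip_max0[OF loclip_diff[OF lipH lipc_loclip[OF g(1)]]] open_ball])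
       (auto simp: \<psi>)
  then show \<psi>l: "lipc (ball p \<rho>) \<psi>"
    by (intro lipcI_loclip[OF S0 \<psi>0] loclip_subset[OF _ S0(2)]) auto
  have \<psi>\<Omega>: "lipc \<Omega> \<psi>" and \<psi>N: "lipc (cball p \<rho>) \<psi>" using lipc_mono[OF \<psi>l] subset_trans[OF ball_subset_cball N] by auto
  have \<psi>pos: "0 \<le> \<psi> x" for x by (simp add: \<psi>)
  \<comment> \<open>The gradient of \<open>H\<close> carries the factor \<open>e\<close>. Absorbing
    it into the test function leaves the fixed field M grad q, to which \<open>K\<close> applies,
    and the derivative falling on \<open>e\<close> yields the quadratic gain in \<alpha>.\<close>
  define \<eta> where "\<eta> x = \<psi> x * e x" for x
  have epos: "e x > 0" for x by (simp add: e)
  have \<eta>N: "lipc (cball p \<rho>) \<eta>" unfolding \<eta>_def by (rule lipc_mult_loclip[OF \<psi>N lipe])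
  have \<eta>pos: "0 \<le> \<eta> x" for x using \<psi>pos epos by (simp add: \<eta>_def less_imp_le)
  note K\<eta> = K[OF \<eta>N \<eta>pos]
  let ?D = "\<lambda>x. - 2 *\<^sub>R (x - y)"
  have "AE x in lebesgue. M x (grad \<psi> x) \<bullet> grad \<psi> x \<le>
      \<epsilon> * \<alpha> * (M x (?D x) \<bullet> grad \<eta> x - \<alpha> * l * R\<^sup>2 * \<eta> x) - M x (grad g x) \<bullet> grad \<psi> x"
    using lipc_AE[OF g(1)] lipc_AE[OF \<psi>N]
  proof eventually_elim
    case (elim x)
    show ?case
    proof (cases "\<psi> x = 0")
      case True
      then have "grad \<psi> x = 0" using \<psi>pos by (intro grad_eq_0_at_min) simp
      moreover have "grad \<eta> x = 0" using True \<eta>pos by (intro grad_eq_0_at_min) (simp add: \<eta>_def)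
      ultimately show ?thesis using True by (simp add: \<eta>_def M_simps)
    next
      case False
      then have \<psi>x: "\<psi> x > 0" using \<psi>pos[of x] by simp
      have xS: "x \<in> S0" using \<psi>0 False by blast
      then have xb: "x \<in> ball p \<rho>" "x \<in> cball p \<rho>" using S0(2) by auto
      have Hg: "H x - g x > 0" using \<psi>x xb(2) by (auto simp: \<psi> max_def split: if_splits)
      let ?U = "ball p \<rho> \<inter> {z. 0 < H z - g z}"
      have "open ?U" using cH cg by (intro open_Int open_Collect_less continuous_intros) auto
      moreover have "x \<in> ?U" using xb Hg by simp
      moreover have "H z - g z = \<psi> z" if "z \<in> ?U" for z using that by (simp add: \<psi>)
      ultimately have "GDERIV \<psi> x :> (\<epsilon> * \<alpha> * e x) *\<^sub>R ?D x - grad g x"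
        by (intro GDERIV_cong_near[OF GDERIV_diff[OF gH elim(1)]])
      then have g\<psi>: "grad \<psi> x = (\<epsilon> * \<alpha> * e x) *\<^sub>R ?D x - grad g x" by (rule grad_eqI)
      have g\<eta>: "grad \<eta> x = \<psi> x *\<^sub>R ((\<alpha> * e x) *\<^sub>R ?D x) + e x *\<^sub>R grad \<psi> x"
        unfolding \<eta>_def by (rule grad_eqI[OF GDERIV_mult[OF elim(2) ge]])
      define d where "d = ?D x"
      \<comment> \<open>The vector is twice x - y, whose length is at least R / 2.\<close>
      have dd: "R\<^sup>2 \<le> (norm d)\<^sup>2"
        using far(1)[OF xb(2)] far(2) by (intro power_mono) (auto simp: d_def)
      have "l * R\<^sup>2 \<le> l * (norm d)\<^sup>2" using dd l(1) by simp
      also have "\<dots> \<le> M x d \<bullet> d" by (rule l(2)[OF xb(2)])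
      finally have "\<psi> x * \<alpha> * e x * (l * R\<^sup>2) \<le> \<psi> x * \<alpha> * e x * (M x d \<bullet> d)"
        using \<psi>x \<alpha>(1) epos[of x] by (intro mult_left_mono) auto
      then have le: "e x * (M x d \<bullet> grad \<psi> x) \<le> M x d \<bullet> grad \<eta> x - \<alpha> * l * R\<^sup>2 * \<eta> x"
        unfolding g\<eta> d_def[symmetric] by (simp add: M_simps \<eta>_def algebra_simps)
      have "M x (grad \<psi> x) \<bullet> grad \<psi> x = M x ((\<epsilon> * \<alpha> * e x) *\<^sub>R d - grad g x) \<bullet> grad \<psi> x"
        by (subst (1) g\<psi>) (simp add: d_def)
      also have "\<dots> = \<epsilon> * \<alpha> * (e x * (M x d \<bullet> grad \<psi> x)) - M x (grad g x) \<bullet> grad \<psi> x"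
        by (simp add: M_simps)
      also have "\<dots> \<le> \<epsilon> * \<alpha> * (M x d \<bullet> grad \<eta> x - \<alpha> * l * R\<^sup>2 * \<eta> x) - M x (grad g x) \<bullet> grad \<psi> x"
        using le pos(1) \<alpha>(1) by simp
      finally show ?thesis unfolding d_def .
    qed
  qed
  then have "E \<psi> \<psi> \<le> (\<integral>x. \<epsilon> * \<alpha> * (M x (?D x) \<bullet> grad \<eta> x - \<alpha> * l * R\<^sup>2 * \<eta> x) - M x (grad g x) \<bullet> grad \<psi> x \<partial>lebesgue)"
    unfolding E_def using K\<eta> integrable_form[OF \<psi>\<Omega> \<psi>\<Omega>] integrable_form[OF g(1) \<psi>\<Omega>] lipc_integrable[OF \<eta>N]
    by (intro integral_mono_AE) auto
  also have "\<dots> = \<epsilon> * \<alpha> * ((\<integral>x. M x (?D x) \<bullet> grad \<eta> x \<partial>lebesgue) - \<alpha> * l * R\<^sup>2 * (\<integral>x. \<eta> x \<partial>lebesgue)) - E g \<psi>"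
    unfolding E_def using K\<eta> integrable_form[OF g(1) \<psi>\<Omega>] lipc_integrable[OF \<eta>N] by simp
  finally have 1: "E \<psi> \<psi> \<le> \<epsilon> * \<alpha> * ((\<integral>x. M x (?D x) \<bullet> grad \<eta> x \<partial>lebesgue) - \<alpha> * l * R\<^sup>2 * (\<integral>x. \<eta> x \<partial>lebesgue)) - E g \<psi>" .
  define I where "I = (\<integral>x. \<eta> x \<partial>lebesgue)"
  have I: "I \<ge> 0" unfolding I_def using \<eta>pos by simp
  have "\<epsilon> * \<alpha> * ((\<integral>x. M x (?D x) \<bullet> grad \<eta> x \<partial>lebesgue) - \<alpha> * l * R\<^sup>2 * I) \<le> \<epsilon> * \<alpha> * (K * I - \<alpha> * l * R\<^sup>2 * I)"
    using K\<eta> pos(1) \<alpha>(1) by (intro mult_left_mono) (auto simp: I_def)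
  also have "\<dots> = - (\<epsilon> * I) * (\<alpha> * (\<alpha> * l * R\<^sup>2 - K))" by (simp add: algebra_simps)
  \<comment> \<open>\<open>C\<close> will pay for the zero-order term with coefficient
    \<open>c\<close>; the 1 survives as the gain of the lemma.\<close>
  also have "\<dots> \<le> - (\<epsilon> * I) * (C + 1)"
    using mult_left_mono[OF \<alpha>(2), of "\<epsilon> * I"] pos(1) I by simp
  finally have 2: "E \<psi> \<psi> \<le> - (\<epsilon> * I) * (C + 1) - E g \<psi>" using 1 unfolding I_def by linarith
  have "- (\<integral>x. c x * (g x * \<psi> x) \<partial>lebesgue) = (\<integral>x. - (c x * (g x * \<psi> x)) \<partial>lebesgue)" by simp
  also have "\<dots> \<le> (\<integral>x. C * \<epsilon> * \<eta> x + C * s * \<psi> x \<partial>lebesgue)"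
  proof (rule integral_mono)
    show "integrable lebesgue (\<lambda>x. - (c x * (g x * \<psi> x)))"
      using integrable_c[OF lipc_product[OF g(1) \<psi>\<Omega>]] by simp
    show "integrable lebesgue (\<lambda>x. C * \<epsilon> * \<eta> x + C * s * \<psi> x)"
      using lipc_integrable[OF \<eta>N] lipc_integrable[OF \<psi>N] by simp
    fix x
    show "- (c x * (g x * \<psi> x)) \<le> C * \<epsilon> * \<eta> x + C * s * \<psi> x"
    proof (cases "\<psi> x = 0")
      case False
      then have x: "x \<in> cball p \<rho>" and Hg: "g x \<le> H x"
        by (auto simp: \<psi> max_def split: if_splits)
      have "\<epsilon> * exp (- \<alpha> * R\<^sup>2) \<ge> 0" using pos by simp
      \<comment> \<open>Where \<psi> is positive \<open>g\<close> lies below \<open>H\<close>, so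
        the zero-order term of \<open>g\<close> is bounded through the barrier alone.\<close>
      then have "H x \<le> \<epsilon> * e x + s" unfolding H right_diff_distrib by linarith
      then have "g x * \<psi> x \<le> (\<epsilon> * e x + s) * \<psi> x" using Hg \<psi>pos by (intro mult_right_mono) auto
      then have "\<bar>c x\<bar> * (g x * \<psi> x) \<le> C * ((\<epsilon> * e x + s) * \<psi> x)"
        using C[OF x] g(2)[of x] \<psi>pos[of x] order_trans[OF abs_ge_zero C[OF x]] by (intro mult_mono[of "\<bar>c x\<bar>" C]) auto
      moreover have "- (c x * (g x * \<psi> x)) \<le> \<bar>c x\<bar> * (g x * \<psi> x)"
        using mult_right_mono[of "- c x" "\<bar>c x\<bar>" "g x * \<psi> x"] g(2)[of x] \<psi>pos[of x] by simp
      ultimately show ?thesis by (simp add: \<eta>_def algebra_simps)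
    qed (simp add: \<eta>_def)
  qed
  also have "\<dots> = C * \<epsilon> * I + C * s * (\<integral>x. \<psi> x \<partial>lebesgue)"
    using lipc_integrable[OF \<eta>N] lipc_integrable[OF \<psi>N] by (simp add: I_def)
  finally have "- E g \<psi> \<le> C * \<epsilon> * I + C * s * (\<integral>x. \<psi> x \<partial>lebesgue) - Q g \<psi>" unfolding Q_def by simp
  with 2 have "E \<psi> \<psi> \<le> - \<epsilon> * I + C * s * (\<integral>x. \<psi> x \<partial>lebesgue) - Q g \<psi>" by (simp add: algebra_simps)
  then show "E \<psi> \<psi> \<le> - \<epsilon> * (\<integral>x. e x * \<psi> x \<partial>lebesgue) + C * s * (\<integral>x. \<psi> x \<partial>lebesgue) - Q g \<psi>"
    by (simp add: I_def \<eta>_def mult.commute)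
qed

end

context stable_form begin

text \<open>The lifted barrier lies below w on a small sphere about p but above it at p. So the part
  of the barrier above W_j has an integral bounded below uniformly in j, while the energy inequality
  and the smallness of Q(W_j, W_j) make that integral small.\<close>

lemma no_interior_touching:
  fixes W :: "nat \<Rightarrow> real^'n \<Rightarrow> real"
  assumes w: "continuous_on \<Omega> w" "\<And>x. x \<in> \<Omega> \<Longrightarrow> 0 \<le> w x"
    and W: "\<And>j. lipc \<Omega> (W j)" "\<And>j x. 0 \<le> W j x" "(\<lambda>j. Q (W j) (W j)) \<longlonglongrightarrow> 0"
      "\<And>K. compact K \<Longrightarrow> K \<subseteq> \<Omega> \<Longrightarrow> uniform_limit K W w sequentially"
    and p: "p \<in> \<Omega>" "w p = 0"
    and ball: "R > 0" "dist p y = R" "\<And>x. x \<in> cball y R \<Longrightarrow> x \<noteq> p \<Longrightarrow> x \<in> \<Omega> \<and> 0 < w x"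
  shows False
proof -
  obtain \<rho>0 where \<rho>0: "\<rho>0 > 0" "cball p \<rho>0 \<subseteq> \<Omega>" using open_\<Omega> p(1) open_contains_cball by blast
  \<comment> \<open>A radius of at most R / 2 keeps the ball away from \<open>y\<close>, where the
    gradient of the barrier vanishes.\<close>
  define \<rho> where "\<rho> = min \<rho>0 (R / 2)"
  have \<rho>: "\<rho> > 0" "\<rho> \<le> R / 2" "cball p \<rho> \<subseteq> \<Omega>" using \<rho>0 ball(1) by (auto simp: \<rho>_def)
  let ?N = "cball p \<rho>"
  have far: "R / 2 \<le> norm (x - y)" "norm (x - y) \<le> 2 * R" if "x \<in> ?N" for x
  proof -
    have "dist p x \<le> R / 2" using that \<rho>(2) by simp
    then show "R / 2 \<le> norm (x - y)" "norm (x - y) \<le> 2 * R"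
      using ball(1,2) dist_triangle[of p y x] dist_triangle[of x y p] by (auto simp: dist_norm norm_minus_commute)
  qed
  obtain l where l: "l > 0" "\<And>x Z. x \<in> ?N \<Longrightarrow> l * (norm Z)\<^sup>2 \<le> M x Z \<bullet> Z"
    using elliptic[OF compact_cball \<rho>(3)] by blast
  have "compact (c ` ?N)" by (intro compact_continuous_image continuous_on_subset[OF continuous_c \<rho>(3)]) simp
  then obtain C where C: "\<And>x. x \<in> ?N \<Longrightarrow> \<bar>c x\<bar> \<le> C" using compact_imp_bounded by (fastforce simp: bounded_iff)
  have C0: "C \<ge> 0" using C[of p] \<rho>(1) order_trans[OF abs_ge_zero] by simp
  obtain K where K: "\<And>\<eta>. lipc ?N \<eta> \<Longrightarrow> (\<And>x. 0 \<le> \<eta> x) \<Longrightarrow>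
      integrable lebesgue (\<lambda>x. M x (- 2 *\<^sub>R (x - y)) \<bullet> grad \<eta> x) \<and>
      (\<integral>x. M x (- 2 *\<^sub>R (x - y)) \<bullet> grad \<eta> x \<partial>lebesgue) \<le> K * (\<integral>x. \<eta> x \<partial>lebesgue)"
    by (rule quadratic_divergence_bound[OF compact_cball \<rho>(3), of y]) blast
  \<comment> \<open>Makes \<alpha> l R^2 - K at least C + 1; since \<alpha> >= 1, a further factor
    \<alpha> preserves this.\<close>
  define \<alpha> where "\<alpha> = 1 + (\<bar>K\<bar> + C + 1) / (l * R\<^sup>2)"
  have lR: "l * R\<^sup>2 > 0" using l(1) ball(1) by simp
  have \<alpha>1: "\<alpha> \<ge> 1" unfolding \<alpha>_def using lR C0 by simp
  have "\<alpha> * (l * R\<^sup>2) = l * R\<^sup>2 + (\<bar>K\<bar> + C + 1)" unfolding \<alpha>_def using lR l(1) ball(1) by (simp add: field_simps)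
  then have "C + 1 \<le> \<alpha> * l * R\<^sup>2 - K" using lR by (simp add: mult.assoc)
  also have "\<dots> \<le> \<alpha> * (\<alpha> * l * R\<^sup>2 - K)"
    using mult_right_mono[OF \<alpha>1, of "\<alpha> * l * R\<^sup>2 - K"] calculation C0 by simp
  finally have \<alpha>: "C + 1 \<le> \<alpha> * (\<alpha> * l * R\<^sup>2 - K)" .
  define e where "e x = exp (- \<alpha> * ((x - y) \<bullet> (x - y)))" for x
  define k where "k = exp (- \<alpha> * R\<^sup>2)"
  have ce: "continuous_on S e" for S unfolding e_def by (intro continuous_intros)
  have en: "e x = exp (- \<alpha> * (norm (x - y))\<^sup>2)" for x by (simp add: e_def power2_norm_eq_inner)
  have cw: "continuous_on ?N w" by (rule continuous_on_subset[OF w(1) \<rho>(3)])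
  have csph: "sphere p \<rho> \<subseteq> ?N" by auto
  obtain m where m: "m > 0" "\<And>x. x \<in> sphere p \<rho> \<inter> cball y R \<Longrightarrow> m \<le> w x"
  proof (cases "sphere p \<rho> \<inter> cball y R = {}")
    case True with that[of 1] show ?thesis by auto
  next
    case False
    have "compact (sphere p \<rho> \<inter> cball y R)" by (simp add: compact_Int_closed)
    moreover have "continuous_on (sphere p \<rho> \<inter> cball y R) w" by (rule continuous_on_subset[OF cw]) auto
    ultimately obtain z where z: "z \<in> sphere p \<rho> \<inter> cball y R" "\<And>x. x \<in> sphere p \<rho> \<inter> cball y R \<Longrightarrow> w z \<le> w x"
      using continuous_attains_inf[OF _ False] by metis
    have "z \<noteq> p" using z(1) \<rho>(1) by auto
    then show ?thesis using that[of "w z"] z ball(3)[of z] by auto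
  qed
  \<comment> \<open>The sphere has two parts. Inside the touching ball w is at least
    \<open>m\<close> by compactness, as p is not on the sphere, and the barrier is at most
    \<epsilon>; outside that ball the barrier is negative.\<close>
  define \<epsilon> where "\<epsilon> = m / 2"
  have \<epsilon>: "\<epsilon> > 0" using m(1) by (simp add: \<epsilon>_def)
  have e1: "e x \<le> 1" for x using \<alpha>1 by (simp add: en)
  have k0: "k > 0" by (simp add: k_def)
  have bar: "\<epsilon> * (e x - k) < w x" if x: "x \<in> sphere p \<rho>" for x
  proof (cases "x \<in> cball y R")
    case True
    have "\<epsilon> * (e x - k) \<le> \<epsilon> * 1" using e1[of x] k0 \<epsilon> by (intro mult_left_mono) auto
    also have "\<dots> < m" using m(1) by (simp add: \<epsilon>_def)
    finally show ?thesis using m(2)[of x] x True by simp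
  next
    case False
    then have "R\<^sup>2 < (norm (x - y))\<^sup>2" using ball(1) by (intro power_strict_mono) (auto simp: dist_norm norm_minus_commute)
    then have "e x < k" unfolding en k_def using \<alpha>1 by simp
    then have "\<epsilon> * (e x - k) < 0" using \<epsilon> by (simp add: mult_less_0_iff)
    then show ?thesis using w(2)[of x] x csph \<rho>(3) by fastforce
  qed
  obtain m' where m': "m' > 0" "\<And>x. x \<in> sphere p \<rho> \<Longrightarrow> \<epsilon> * (e x - k) + m' \<le> w x"
  proof (cases "sphere p \<rho> = {}")
    case True with that[of 1] show ?thesis by auto
  next
    case False
    have "continuous_on (sphere p \<rho>) (\<lambda>x. w x - \<epsilon> * (e x - k))"
      by (intro continuous_intros ce continuous_on_subset[OF cw csph])
    from continuous_attains_inf[OF compact_sphere False this]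
    obtain z where z: "z \<in> sphere p \<rho>" "\<And>x. x \<in> sphere p \<rho> \<Longrightarrow> w z - \<epsilon> * (e z - k) \<le> w x - \<epsilon> * (e x - k)" by blast
    show ?thesis using that[of "w z - \<epsilon> * (e z - k)"] bar[OF z(1)] z(2) by (simp add: algebra_simps)
  qed
  define e0 where "e0 = exp (- \<alpha> * (2 * R)\<^sup>2)"
  have e0: "e0 > 0" "\<And>x. x \<in> ?N \<Longrightarrow> e0 \<le> e x"
  proof -
    show "e0 \<le> e x" if "x \<in> ?N" for x
    proof -
      have "(norm (x - y))\<^sup>2 \<le> (2 * R)\<^sup>2" using far(2)[OF that] by (intro power_mono) auto
      then show ?thesis unfolding e0_def en using \<alpha>1 by (simp del: power_mult_distrib)
    qed
  qed (simp add: e0_def)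
  \<comment> \<open>The lift is positive at p, leaves half of the gap m' on the sphere, and costs at
    most half of the gain \<epsilon> e0.\<close>
  define s where "s = min (m' / 2) (\<epsilon> * e0 / (2 * (C + 1)))"
  have s: "s > 0" "s \<le> m' / 2" "C * s \<le> \<epsilon> * e0 / 2"
  proof -
    show "s > 0" using m'(1) \<epsilon> e0(1) C0 by (simp add: s_def)
    show "s \<le> m' / 2" unfolding s_def by (rule min.cobounded1)
    have "(C + 1) * s \<le> (C + 1) * (\<epsilon> * e0 / (2 * (C + 1)))" using C0 by (intro mult_left_mono) (auto simp: s_def)
    also have "\<dots> = \<epsilon> * e0 / 2" using C0 by (simp add: field_simps)
    finally show "C * s \<le> \<epsilon> * e0 / 2" using \<open>s > 0\<close> by (simp add: algebra_simps)
  qed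
  define H where "H x = \<epsilon> * (e x - k) + s" for x
  have cH: "continuous_on S H" for S unfolding H_def by (intro continuous_intros ce)
  have Hb: "H x \<le> \<epsilon> + s" for x
  proof -
    have "\<epsilon> * (e x - k) \<le> \<epsilon> * 1" using e1[of x] k0 \<epsilon> by (intro mult_left_mono) auto
    then show ?thesis by (simp add: H_def)
  qed
  have "norm (p - y) = R" using ball(2) by (simp add: dist_norm)
  then have Hp: "H p = s" by (simp add: H_def en k_def)
  have "continuous_on (ball p \<rho>) (\<lambda>x. H x - w x)"
    by (intro continuous_intros cH continuous_on_subset[OF cw]) auto
  then have "isCont (\<lambda>x. H x - w x) p" using \<rho>(1) by (simp add: continuous_on_eq_continuous_at)
  then have "\<forall>\<^sub>F x in at p. s / 2 < H x - w x"
    unfolding isCont_def using s(1) Hp p(2) by (intro order_tendstoD(1)) auto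
  then obtain r0 where r0: "r0 > 0" "\<And>x. x \<noteq> p \<Longrightarrow> dist x p < r0 \<Longrightarrow> s / 2 < H x - w x"
    unfolding eventually_at by auto
  define r where "r = min \<rho> (r0 / 2)"
  have r: "r > 0" "cball p r \<subseteq> ?N" using r0 \<rho>(1) by (auto simp: r_def)
  have near: "s / 2 < H x - w x" if "x \<in> cball p r" for x
    using r0(2)[of x] that r0(1) Hp p(2) s(1) by (cases "x = p") (auto simp: r_def dist_commute)
  \<comment> \<open>Lower bound for the integral of \<psi>: near p the barrier exceeds w by s / 2,
    and W_j will be within s / 4 of w.\<close>
  define b where "b = s / 4 * measure lebesgue (cball p r)"
  have b: "b > 0" using s(1) r(1) content_cball_pos[of r p] by (simp add: b_def)
  define c0 where "c0 = \<epsilon> * e0 / 2"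
  have c0: "c0 > 0" using \<epsilon> e0 by (simp add: c0_def)
  \<comment> \<open>Crude bound for the zero-order part of \<open>Q \<psi> \<psi>\<close>, valid for
    all j because \<psi> is at most \<epsilon> + s.\<close>
  define C2 where "C2 = C * (\<epsilon> + s)\<^sup>2 * measure lebesgue ?N"
  have C2: "C2 \<ge> 0" using C0 by (simp add: C2_def)
  \<comment> \<open>First \<open>t\<close> is chosen so large that C2 / t is below c0 b, and only
    then j, so that t Q(W_j, W_j) is below c0 b as well.\<close>
  define t where "t = 1 + C2 / (c0 * b)"
  have t: "t \<ge> 1" using C2 c0 b by (simp add: t_def)
  have "C2 / (c0 * b) < t" by (simp add: t_def)
  then have tC: "C2 / t < c0 * b" using t c0 b by (simp add: field_simps)
  have "\<forall>\<^sub>F j in sequentially. \<forall>x\<in>?N. dist (W j x) (w x) < min (m' / 4) (s / 4)"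
    using W(4)[OF compact_cball \<rho>(3)] m'(1) s(1) by (intro uniform_limitD) auto
  moreover have "\<forall>\<^sub>F j in sequentially. Q (W j) (W j) < (c0 * b) / t"
    using W(3) c0 b t by (intro order_tendstoD(2)[where y = 0]) auto
  ultimately have "\<forall>\<^sub>F j in sequentially. (\<forall>x\<in>?N. dist (W j x) (w x) < min (m' / 4) (s / 4))
      \<and> Q (W j) (W j) < (c0 * b) / t" by eventually_elim simp
  then obtain j where j: "\<And>x. x \<in> ?N \<Longrightarrow> \<bar>W j x - w x\<bar> < min (m' / 4) (s / 4)" "Q (W j) (W j) < (c0 * b) / t"
    using eventually_happens'[OF sequentially_bot] unfolding dist_real_def by blast
  have gs: "H x < W j x" if "x \<in> sphere p \<rho>" for x
  proof -
    have "\<bar>W j x - w x\<bar> < m' / 4" using j(1)[of x] that csph by auto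
    moreover have "H x + m' \<le> w x + s" using m'(2)[OF that] by (simp add: H_def)
    ultimately show ?thesis using s(2) m'(1) by linarith
  qed
  define \<psi> where "\<psi> x = (if x \<in> ?N then max 0 (H x - W j x) else 0)" for x
  have \<alpha>0: "\<alpha> > 0" using \<alpha>1 by simp
  have Heq: "H x = \<epsilon> * (e x - exp (- \<alpha> * R\<^sup>2)) + s" for x by (simp add: H_def k_def)
  note be = barrier_energy[where p = p and \<rho> = \<rho> and R = R and y = y and l = l and C = C and K = K
      and \<alpha> = \<alpha> and \<epsilon> = \<epsilon> and s = s and e = e and H = H and g = "W j" and \<psi> = \<psi>,
      OF \<rho>(3) far(1) ball(1) l C K \<alpha>0 \<alpha> \<epsilon> s(1) e_def Heq W(1,2) gs \<psi>_def]
  have \<psi>l: "lipc (ball p \<rho>) \<psi>" by (rule be(1))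
  then have \<psi>\<Omega>: "lipc \<Omega> \<psi>" using lipc_mono subset_trans[OF ball_subset_cball \<rho>(3)] by blast
  have \<psi>pos: "0 \<le> \<psi> x" for x by (simp add: \<psi>_def)
  have \<psi>b: "\<psi> x \<le> \<epsilon> + s" for x using Hb[of x] W(2)[of j x] \<epsilon> s(1) by (auto simp: \<psi>_def)
  define I where "I = (\<integral>x. \<psi> x \<partial>lebesgue)"
  have "e0 * I = (\<integral>x. e0 * \<psi> x \<partial>lebesgue)" by (simp add: I_def)
  also have "\<dots> \<le> (\<integral>x. e x * \<psi> x \<partial>lebesgue)"
  proof (rule integral_mono)
    show "integrable lebesgue (\<lambda>x. e0 * \<psi> x)" using lipc_integrable[OF \<psi>l] by simp
    have "\<bar>e x\<bar> \<le> 1" for x using e1[of x] by (simp add: e_def)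
    moreover have "e \<in> borel_measurable lebesgue"
      using borel_measurable_continuous_onI[OF ce] by (intro measurable_completion) simp
    ultimately have "integrable lebesgue (\<lambda>x. \<psi> x * e x)" by (intro lipc_integrable_mult[OF \<psi>l])
    then show "integrable lebesgue (\<lambda>x. e x * \<psi> x)" by (simp add: mult.commute)
    show "e0 * \<psi> x \<le> e x * \<psi> x" for x
      using e0(2)[of x] \<psi>pos[of x] by (cases "x \<in> ?N") (auto intro: mult_right_mono simp: \<psi>_def)
  qed
  finally have eI: "\<epsilon> * (e0 * I) \<le> \<epsilon> * (\<integral>x. e x * \<psi> x \<partial>lebesgue)" using \<epsilon> by simp
  have I0: "I \<ge> 0" unfolding I_def using \<psi>pos by simp
  have CsI: "C * s * I \<le> c0 * I" using mult_right_mono[OF s(3) I0] by (simp add: c0_def)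
  have "E \<psi> \<psi> \<le> - \<epsilon> * (\<integral>x. e x * \<psi> x \<partial>lebesgue) + C * s * I - Q (W j) \<psi>"
    unfolding I_def by (rule be(2))
  then have E1: "E \<psi> \<psi> \<le> - c0 * I - Q (W j) \<psi>"
    using eI CsI by (simp add: c0_def)
  have "- (\<integral>x. c x * (\<psi> x * \<psi> x) \<partial>lebesgue) = (\<integral>x. - (c x * (\<psi> x * \<psi> x)) \<partial>lebesgue)" by simp
  also have "\<dots> \<le> (\<integral>x. C * (\<epsilon> + s)\<^sup>2 * indicator ?N x \<partial>lebesgue)"
  proof (rule integral_mono)
    show "integrable lebesgue (\<lambda>x. - (c x * (\<psi> x * \<psi> x)))"
      using integrable_c[OF lipc_product[OF \<psi>\<Omega> \<psi>\<Omega>]] by simp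
    show "integrable lebesgue (\<lambda>x. C * (\<epsilon> + s)\<^sup>2 * indicat_real ?N x)"
      using lmeasurable_compact[of ?N] by (intro integrable_mult_right integrable_real_indicator) (auto simp: fmeasurable_def)
    fix x
    show "- (c x * (\<psi> x * \<psi> x)) \<le> C * (\<epsilon> + s)\<^sup>2 * indicat_real ?N x"
    proof (cases "x \<in> ?N")
      case True
      have "- (c x * (\<psi> x * \<psi> x)) \<le> \<bar>c x\<bar> * (\<psi> x * \<psi> x)"
        using mult_right_mono[of "- c x" "\<bar>c x\<bar>" "\<psi> x * \<psi> x"] by simp
      also have "\<dots> \<le> C * ((\<epsilon> + s) * (\<epsilon> + s))"
        using C[OF True] C0 \<psi>pos[of x] \<psi>b[of x] \<epsilon> s(1) by (intro mult_mono) auto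
      finally show ?thesis using True by (simp add: power2_eq_square)
    qed (simp add: \<psi>_def)
  qed
  also have "\<dots> = C2" by (simp add: C2_def)
  finally have Q\<psi>: "Q \<psi> \<psi> \<le> E \<psi> \<psi> + C2" unfolding Q_def by simp
  have "- Q (W j) \<psi> \<le> t / 2 * Q (W j) (W j) + Q \<psi> \<psi> / (2 * t)"
    by (rule Q_Cauchy_Schwarz[OF W(1) \<psi>\<Omega>]) (use t in simp)
  also have "\<dots> \<le> t / 2 * Q (W j) (W j) + (E \<psi> \<psi> + C2) / (2 * t)"
    using Q\<psi> t by (intro add_left_mono divide_right_mono) auto
  also have "\<dots> = t / 2 * Q (W j) (W j) + E \<psi> \<psi> / (2 * t) + C2 / t / 2"
    using t by (simp add: field_simps)
  \<comment> \<open>The energy of the j-dependent test function cancels against the left side of the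
    barrier inequality, so no bound for it uniform in j enters.\<close>
  also have "E \<psi> \<psi> / (2 * t) \<le> E \<psi> \<psi>"
    using E_nonneg[OF \<psi>\<Omega>] t by (simp add: divide_le_eq mult_le_cancel_left1)
  finally have "c0 * I \<le> t / 2 * Q (W j) (W j) + C2 / t / 2" using E1 by simp
  also have "t / 2 * Q (W j) (W j) < t / 2 * ((c0 * b) / t)"
    using j(2) t by (intro mult_strict_left_mono) auto
  also have "t / 2 * ((c0 * b) / t) = c0 * b / 2" using t by simp
  finally have "c0 * I < c0 * b" using tC by simp
  then have "I < b" using c0 by simp
  moreover have "b \<le> I"
  proof -
    have "b = (\<integral>x. s / 4 * indicator (cball p r) x \<partial>lebesgue)" by (simp add: b_def)
    also have "\<dots> \<le> I" unfolding I_def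
    proof (rule integral_mono)
      show "integrable lebesgue (\<lambda>x. s / 4 * indicat_real (cball p r) x)"
        using lmeasurable_compact[of "cball p r"]
        by (intro integrable_mult_right integrable_real_indicator) (auto simp: fmeasurable_def)
      show "integrable lebesgue \<psi>" by (rule lipc_integrable[OF \<psi>l])
      fix x
      show "s / 4 * indicat_real (cball p r) x \<le> \<psi> x"
      proof (cases "x \<in> cball p r")
        case True
        have "\<bar>W j x - w x\<bar> < s / 4" using j(1)[of x] True r(2) by auto
        then have "s / 4 \<le> H x - W j x" using near[OF True] by linarith
        moreover have "\<psi> x = max 0 (H x - W j x)" using True r(2) by (auto simp: \<psi>_def)
        moreover have "H x - W j x \<le> max 0 (H x - W j x)" by (rule max.cobounded2)
        ultimately have "s / 4 \<le> \<psi> x" by linarith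
        then show ?thesis using True by simp
      qed (use \<psi>pos in simp)
    qed
    finally show ?thesis .
  qed
  ultimately show False by simp
qed

text \<open>Hopf's reduction: if w had both positive values and zeros, some ball inside the
  positivity set would touch its complement at exactly one point, and that point would lie in
  \<Omega>.\<close>

theorem strong_maximum_principle:
  fixes W :: "nat \<Rightarrow> real^'n \<Rightarrow> real"
  assumes w: "continuous_on \<Omega> w" "\<And>x. x \<in> \<Omega> \<Longrightarrow> 0 \<le> w x"
    and W: "\<And>j. lipc \<Omega> (W j)" "\<And>j x. 0 \<le> W j x" "(\<lambda>j. Q (W j) (W j)) \<longlonglongrightarrow> 0"
      "\<And>K. compact K \<Longrightarrow> K \<subseteq> \<Omega> \<Longrightarrow> uniform_limit K W w sequentially"
    and conn: "connected \<Omega>" and x0: "x0 \<in> \<Omega>" "w x0 > 0" and x: "x \<in> \<Omega>"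
  shows "w x > 0"
proof (rule ccontr)
  assume nx: "\<not> w x > 0"
  define P where "P = {x \<in> \<Omega>. 0 < w x}"
  have oP: "open P"
  proof -
    have "open (\<Omega> \<inter> w -` {0<..})" by (rule continuous_open_preimage[OF w(1) open_\<Omega>]) simp
    moreover have "\<Omega> \<inter> w -` {0<..} = P" by (auto simp: P_def)
    ultimately show ?thesis by simp
  qed
  have "frontier P \<inter> \<Omega> \<noteq> {}"
    using connected_Int_frontier[OF conn, of P] x0 x nx by (auto simp: P_def)
  then obtain q where q: "q \<in> frontier P" "q \<in> \<Omega>" by blast
  have qP: "q \<notin> P" using q(1) oP by (simp add: frontier_def interior_open)
  obtain d where d: "d > 0" "cball q d \<subseteq> \<Omega>" using open_\<Omega> q(2) open_contains_cball by blast
  have "q \<in> closure P" using q(1) by (simp add: frontier_def)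
  then obtain z where z: "z \<in> P" "dist z q < d / 2" using d(1) closure_approachable by (metis half_gt_zero)
  have nP: "closed (- P)" "- P \<noteq> {}" using oP qP by auto
  \<comment> \<open>Nearest point in the complement taken in the whole space. As \<open>z\<close> is
    within d / 2 of \<open>q\<close>, the point \<open>p\<close> is within d of \<open>q\<close> and
    therefore in \<Omega>.\<close>
  obtain p where p: "p \<in> - P" "\<And>y. y \<in> - P \<Longrightarrow> dist z p \<le> dist z y"
    using distance_attains_inf[OF nP] by metis
  define \<rho> where "\<rho> = dist z p"
  have \<rho>0: "\<rho> > 0" using z(1) p(1) by (auto simp: \<rho>_def)
  have \<rho>q: "\<rho> \<le> dist z q" using p(2)[of q] qP by (simp add: \<rho>_def)
  have pO: "p \<in> \<Omega>"
  proof -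
    have "dist q p \<le> dist z q + dist z p" using dist_triangle2[of q p z] by (simp add: dist_commute)
    then have "dist q p \<le> d" using z(2) \<rho>q by (simp add: \<rho>_def)
    then show ?thesis using d(2) by auto
  qed
  have wp: "w p = 0" using p(1) pO w(2)[OF pO] by (simp add: P_def)
  \<comment> \<open>Halving the ball about \<open>z\<close> isolates the contact: the smaller ball,
    internally tangent at \<open>p\<close>, meets the boundary of the larger one only there.\<close>
  define y where "y = (1/2) *\<^sub>R (z + p)"
  have yd: "dist p y = \<rho> / 2"
  proof -
    have "p - y = (1/2) *\<^sub>R (p - z)" by (simp add: y_def vec_eq_iff field_simps)
    then show ?thesis by (simp add: dist_norm \<rho>_def norm_minus_commute)
  qed
  have "x \<in> \<Omega> \<and> 0 < w x" if xy: "x \<in> cball y (\<rho> / 2)" "x \<noteq> p" for x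
  proof -
    have "dist z x < \<rho>"
    proof (rule ccontr)
      assume n: "\<not> dist z x < \<rho>"
      define a where "a = (1/2) *\<^sub>R (z - p)"
      define b where "b = x - y"
      have na: "norm a = \<rho> / 2" by (simp add: a_def \<rho>_def dist_norm)
      have nb: "norm b \<le> \<rho> / 2" using xy(1) by (simp add: b_def dist_norm norm_minus_commute)
      have zx: "z - x = a - b" by (simp add: a_def b_def y_def vec_eq_iff field_simps)
      have xp: "x - p = a + b" by (simp add: a_def b_def y_def vec_eq_iff field_simps)
      \<comment> \<open>Parallelogram law: |a| and |b| are at most \<rho> / 2 while |a - b| is at
        least \<rho>, which forces a + b = 0, that is x = p.\<close>
      have "(norm (a - b))\<^sup>2 + (norm (a + b))\<^sup>2 = 2 * (norm a)\<^sup>2 + 2 * (norm b)\<^sup>2"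
        by (simp add: power2_norm_eq_inner inner_simps inner_commute)
      moreover have "\<rho>\<^sup>2 \<le> (norm (a - b))\<^sup>2"
        using n \<rho>0 unfolding zx[symmetric] by (intro power_mono) (auto simp: dist_norm)
      moreover have "(norm b)\<^sup>2 \<le> (\<rho> / 2)\<^sup>2" using nb by (intro power_mono) auto
      ultimately have "(norm (a + b))\<^sup>2 \<le> 0" unfolding na by (simp add: power2_eq_square)
      then have "a + b = 0" by simp
      then show False using xy(2) xp by simp
    qed
    then have "x \<in> P" using p(2)[of x] by (force simp: \<rho>_def)
    then show ?thesis by (simp add: P_def)
  qed
  from no_interior_touching[OF w W pO wp _ yd this] \<rho>0 show False by simp
qed

end

section \<open>Carleman estimate and unique continuation\<close>

lemma integrable_continuous_compact_support:
  fixes f :: "'a::euclidean_space \<Rightarrow> real"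
  assumes S: "open S" "continuous_on S f" and K: "compact K" "K \<subseteq> S" "\<And>x. x \<notin> K \<Longrightarrow> f x = 0"
  shows "integrable lebesgue f"
proof -
  have "continuous_on (- K) f" by (rule continuous_on_eq[of _ "\<lambda>_. 0"]) (use K(3) in auto)
  then have "continuous_on (S \<union> - K) f"
    using S K(1) by (intro continuous_on_open_Un) (auto simp: compact_imp_closed open_Compl)
  moreover have "S \<union> - K = UNIV" using K(2) by auto
  ultimately have cont: "continuous_on UNIV f" by simp
  have "compact (f ` K)" by (intro compact_continuous_image continuous_on_subset[OF cont] K) auto
  then obtain B where B: "\<And>x. x \<in> K \<Longrightarrow> \<bar>f x\<bar> \<le> B"
    using compact_imp_bounded by (fastforce simp: bounded_iff)
  show ?thesis
  proof (rule integrable_compact_supportI[OF _ K(1)])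
    show "f \<in> borel_measurable lebesgue"
      using borel_measurable_continuous_onI[OF cont] by (intro measurable_completion) simp
    have "\<bar>f x\<bar> \<le> max 0 B" for x using B[of x] K(3)[of x] by (cases "x \<in> K") auto
    then show "AE x in lebesgue. \<bar>f x\<bar> \<le> max 0 B" by simp
  qed (use K(3) in simp)
qed

text \<open>Componentwise, the integral of a derivative of a compactly supported Lipschitz function
  vanishes. The trace is cut off to \<open>K\<close> because nothing is known about
  \<open>W'\<close> outside \<open>S\<close>.\<close>

lemma divergence_integral:
  fixes W :: "real^'n \<Rightarrow> real^'n"
  assumes S: "open S" and K: "compact K" "K \<subseteq> S" "\<And>x. x \<notin> K \<Longrightarrow> W x = 0"
    and d: "\<And>x. x \<in> S \<Longrightarrow> (W has_derivative W' x) (at x)"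
    and c: "\<And>h. continuous_on S (\<lambda>x. W' x h)"
  shows "integrable lebesgue (\<lambda>x. if x \<in> K then \<Sum>b\<in>Basis. W' x b \<bullet> b else 0)"
    and "(\<integral>x. (if x \<in> K then \<Sum>b\<in>Basis. W' x b \<bullet> b else 0) \<partial>lebesgue) = 0"
proof -
  define G where "G b x = (\<Sum>a\<in>Basis. (W' x a \<bullet> b) *\<^sub>R a)" for b x
  have gd: "GDERIV (\<lambda>x. W x \<bullet> b) x :> G b x" if "x \<in> S" for x b
    unfolding gderiv_def
  proof (rule has_derivative_eq_rhs)
    show "((\<lambda>x. W x \<bullet> b) has_derivative (\<lambda>h. W' x h \<bullet> b)) (at x)"
      using d[OF that] by (rule has_derivative_inner_left)
    have lin: "linear (W' x)" using d[OF that] by (rule has_derivative_linear)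
    show "(\<lambda>h. W' x h \<bullet> b) = (\<lambda>h. h \<bullet> G b x)"
    proof
      fix h
      have "W' x h \<bullet> b = W' x (\<Sum>a\<in>Basis. (h \<bullet> a) *\<^sub>R a) \<bullet> b" by (simp add: euclidean_representation)
      also have "\<dots> = h \<bullet> G b x"
        by (simp add: G_def linear_sum[OF lin] linear_scale[OF lin] inner_sum_left inner_sum_right mult.commute)
      finally show "W' x h \<bullet> b = h \<bullet> G b x" .
    qed
  qed
  have cG: "continuous_on S (G b)" for b unfolding G_def by (intro continuous_intros c)
  have lip: "lipc S (\<lambda>x. W x \<bullet> b)" for b
  proof (rule lipcI_loclip[OF K(1,2)])
    show "loclip K (\<lambda>x. W x \<bullet> b)"
      by (rule loclip_subset[OF loclip_of_continuous_derivative[OF S gd[unfolded gderiv_def] cG] K(2)])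
  qed (use K(3) in simp)
  have eq: "grad (\<lambda>x. W x \<bullet> b) x \<bullet> b = (if x \<in> K then W' x b \<bullet> b else 0)" if "b \<in> Basis" for x b
  proof (cases "x \<in> K")
    case True
    then have "grad (\<lambda>x. W x \<bullet> b) x = G b x" using gd K(2) by (intro grad_eqI) auto
    then show ?thesis using True that by (simp add: G_def inner_sum_left_Basis)
  next
    case False
    then show ?thesis using grad_eq_0_outside(2)[OF K(1), of "\<lambda>x. W x \<bullet> b"] K(3) by simp
  qed
  have i: "integrable lebesgue (\<lambda>x. grad (\<lambda>x. W x \<bullet> b) x \<bullet> b)" if b: "b \<in> Basis" for b
  proof -
    obtain B where B: "\<And>x. norm (grad (\<lambda>x. W x \<bullet> b) x) \<le> B" by (rule lipc_grad_bound[OF lip]) blast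
    note [measurable] = lipc_grad_measurable[OF lip[of b]]
    show ?thesis
    proof (rule integrable_compact_supportI[OF _ K(1)])
      show "AE x in lebesgue. \<bar>grad (\<lambda>x. W x \<bullet> b) x \<bullet> b\<bar> \<le> B * norm b"
        using inner_Basis_bound[OF B] by blast
      show "(\<lambda>x. grad (\<lambda>x. W x \<bullet> b) x \<bullet> b) \<in> borel_measurable lebesgue" by measurable
    qed (simp add: eq[OF b])
  qed
  have sum: "(\<lambda>x. if x \<in> K then \<Sum>b\<in>Basis. W' x b \<bullet> b else 0) = (\<lambda>x. \<Sum>b\<in>Basis. grad (\<lambda>x. W x \<bullet> b) x \<bullet> b)"
    by (rule ext) (simp add: eq)
  show "integrable lebesgue (\<lambda>x. if x \<in> K then \<Sum>b\<in>Basis. W' x b \<bullet> b else 0)"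
    unfolding sum using i by (intro Bochner_Integration.integrable_sum)
  show "(\<integral>x. (if x \<in> K then \<Sum>b\<in>Basis. W' x b \<bullet> b else 0) \<partial>lebesgue) = 0"
    unfolding sum using i lipc_integral_grad[OF lip] by (simp add: Bochner_Integration.integral_sum)
qed

lemma has_derivative_inverse_square:
  fixes y :: "'a::real_inner"
  assumes "x \<noteq> y"
  shows "((\<lambda>x. inverse ((x - y) \<bullet> (x - y))) has_derivative
    (\<lambda>h. - 2 * (inverse ((x - y) \<bullet> (x - y)))\<^sup>2 * (h \<bullet> (x - y)))) (at x)"
proof -
  have d: "((\<lambda>x. (x - y) \<bullet> (x - y)) has_derivative (\<lambda>h. 2 * (h \<bullet> (x - y)))) (at x)"
    by (rule has_derivative_eq_rhs, (rule derivative_intros)+) (simp add: fun_eq_iff inner_commute)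
  have ne: "(x - y) \<bullet> (x - y) \<noteq> 0" using assms by simp
  show ?thesis
    by (rule has_derivative_eq_rhs[OF Deriv.has_derivative_inverse[OF ne d]])
       (simp add: fun_eq_iff power2_eq_square mult_ac)
qed

text \<open>Carleman's estimate with the weight \<open>exp (\<tau> \<sigma>)\<close>, \<open>\<sigma> = 1 / |x - y|\<^sup>2\<close>, in conjugated form. The conjugated
  Laplacian is split as \<open>S + T\<close> with \<open>S\<close> essentially symmetric and \<open>T\<close> essentially skew; the zero-order
  term moved from \<open>T\<close> to \<open>S\<close> is chosen so that \<open>2 S T\<close> is a divergence plus a positive quadratic form.\<close>

lemma carleman_conjugated:
  fixes g :: "real^'n \<Rightarrow> real" and D :: "real^'n \<Rightarrow> real^'n"
  defines "n \<equiv> real (DIM(real^'n))"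
  assumes K: "compact K" "y \<notin> K" "\<And>x. x \<notin> K \<Longrightarrow> g x = 0" "\<And>x. x \<notin> K \<Longrightarrow> D x = 0"
    and g: "\<And>x. x \<noteq> y \<Longrightarrow> (g has_derivative (\<lambda>h. h \<bullet> D x)) (at x)"
    and D: "\<And>x. x \<noteq> y \<Longrightarrow> (D has_derivative HH x) (at x)"
    and sym: "\<And>x h k. x \<noteq> y \<Longrightarrow> HH x h \<bullet> k = HH x k \<bullet> h"
    and cont: "\<And>h. continuous_on (- {y}) (\<lambda>x. HH x h)"
    and \<sigma>: "\<And>x. \<sigma> x = inverse ((x - y) \<bullet> (x - y))"
    and P: "integrable lebesgue (\<lambda>x. (P x)\<^sup>2)"
      "\<And>x. x \<in> K \<Longrightarrow> P x = (\<Sum>b\<in>Basis. HH x b \<bullet> b) + 4 * \<tau> * (\<sigma> x)\<^sup>2 * ((x - y) \<bullet> D x)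
        + 4 * \<tau>\<^sup>2 * (\<sigma> x)^3 * g x - (8 - 2 * n) * \<tau> * (\<sigma> x)\<^sup>2 * g x"
  shows "integrable lebesgue (\<lambda>x. 8 * \<tau> * (\<sigma> x)\<^sup>2 * (D x \<bullet> D x) + 32 * \<tau> * (\<sigma> x)^3 * ((x - y) \<bullet> D x)\<^sup>2
      + (32 * \<tau>^3 * (\<sigma> x)^5 - 8 * \<tau> * (8 - n) * (6 - n) * (\<sigma> x)^3) * (g x)\<^sup>2)"
    and "(\<integral>x. 8 * \<tau> * (\<sigma> x)\<^sup>2 * (D x \<bullet> D x) + 32 * \<tau> * (\<sigma> x)^3 * ((x - y) \<bullet> D x)\<^sup>2
      + (32 * \<tau>^3 * (\<sigma> x)^5 - 8 * \<tau> * (8 - n) * (6 - n) * (\<sigma> x)^3) * (g x)\<^sup>2 \<partial>lebesgue)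
      \<le> (\<integral>x. (P x)\<^sup>2 \<partial>lebesgue)"
proof -
  let ?S = "- {y}"
  have oS: "open ?S" by auto
  have KS: "K \<subseteq> ?S" using K(2) by auto
  have cg: "continuous_on ?S g"
    using g by (intro continuous_at_imp_continuous_on ballI has_derivative_continuous) auto
  have cD: "continuous_on ?S D"
    using D by (intro continuous_at_imp_continuous_on ballI has_derivative_continuous) auto
  have c\<sigma>: "continuous_on ?S \<sigma>" unfolding \<sigma>[abs_def] by (intro continuous_intros) auto
  define R1 where "R1 x = 8 * \<tau> * (\<sigma> x)\<^sup>2 * (D x \<bullet> D x) + 32 * \<tau> * (\<sigma> x)^3 * ((x - y) \<bullet> D x)\<^sup>2
      + (32 * \<tau>^3 * (\<sigma> x)^5 - 8 * \<tau> * (8 - n) * (6 - n) * (\<sigma> x)^3) * (g x)\<^sup>2" for x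
  have R1: "integrable lebesgue R1"
  proof (rule integrable_continuous_compact_support[OF oS _ K(1) KS])
    show "continuous_on ?S R1" unfolding R1_def by (intro continuous_intros cg cD c\<sigma>)
  qed (use K(3,4) in \<open>simp add: R1_def\<close>)
  \<comment> \<open>Twice the skew part T below, so that the divergence of \<open>a\<close> D
    contains the product of 2 T with the Laplacian.\<close>
  define a where "a x = 8 * \<tau> * (\<sigma> x)\<^sup>2 * ((x - y) \<bullet> D x) - 2 * \<tau> * (16 - 2 * n) * (\<sigma> x)\<^sup>2 * g x" for x
  \<comment> \<open>The first term is the Pohozaev term, which removes the products of the Hessian
    with D and x - y; the others integrate the mixed products of g and (x - y) . D, so that only
    squares remain.\<close>
  define \<beta> where "\<beta> x = - 4 * \<tau> * (\<sigma> x)\<^sup>2 * (D x \<bullet> D x) - 4 * \<tau> * (16 - 2 * n) * (\<sigma> x)^3 * (g x)\<^sup>2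
      + (16 * \<tau>^3 * (\<sigma> x)^5 + 32 * \<tau>\<^sup>2 * (\<sigma> x)^4) * (g x)\<^sup>2" for x
  define a' where "a' x h = 8 * \<tau> * (- 4 * (\<sigma> x)^3 * (h \<bullet> (x - y)) * ((x - y) \<bullet> D x) + (\<sigma> x)\<^sup>2 * (h \<bullet> D x + HH x h \<bullet> (x - y)))
      - 2 * \<tau> * (16 - 2 * n) * (- 4 * (\<sigma> x)^3 * (h \<bullet> (x - y)) * g x + (\<sigma> x)\<^sup>2 * (h \<bullet> D x))" for x h
  define \<beta>' where "\<beta>' x h = - 4 * \<tau> * (- 4 * (\<sigma> x)^3 * (h \<bullet> (x - y)) * (D x \<bullet> D x) + (\<sigma> x)\<^sup>2 * (2 * (HH x h \<bullet> D x)))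
      - 4 * \<tau> * (16 - 2 * n) * (- 6 * (\<sigma> x)^4 * (h \<bullet> (x - y)) * (g x)\<^sup>2 + (\<sigma> x)^3 * (2 * g x * (h \<bullet> D x)))
      + 16 * \<tau>^3 * (- 10 * (\<sigma> x)^6 * (h \<bullet> (x - y)) * (g x)\<^sup>2 + (\<sigma> x)^5 * (2 * g x * (h \<bullet> D x)))
      + 32 * \<tau>\<^sup>2 * (- 8 * (\<sigma> x)^5 * (h \<bullet> (x - y)) * (g x)\<^sup>2 + (\<sigma> x)^4 * (2 * g x * (h \<bullet> D x)))" for x h
  define W where "W x = a x *\<^sub>R D x + \<beta> x *\<^sub>R (x - y)" for x
  define W' where "W' x h = a x *\<^sub>R HH x h + a' x h *\<^sub>R D x + (\<beta> x *\<^sub>R h + \<beta>' x h *\<^sub>R (x - y))" for x h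
  have d\<sigma>: "(\<sigma> has_derivative (\<lambda>h. - 2 * (\<sigma> x)\<^sup>2 * (h \<bullet> (x - y)))) (at x)" if "x \<noteq> y" for x
    using has_derivative_inverse_square[OF that] by (simp add: \<sigma>[abs_def])
  have da: "(a has_derivative a' x) (at x)" if x: "x \<noteq> y" for x
    unfolding a_def[abs_def] a'_def
    by (rule has_derivative_eq_rhs, (rule derivative_intros d\<sigma>[OF x] D[OF x] g[OF x])+)
       (simp add: fun_eq_iff inner_commute power2_eq_square power3_eq_cube algebra_simps)
  have d\<beta>: "(\<beta> has_derivative \<beta>' x) (at x)" if x: "x \<noteq> y" for x
    unfolding \<beta>_def[abs_def] \<beta>'_def
    by (rule has_derivative_eq_rhs, (rule derivative_intros d\<sigma>[OF x] D[OF x] g[OF x])+)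
       (simp add: fun_eq_iff inner_commute power_numeral_reduce algebra_simps)
  have dW: "(W has_derivative W' x) (at x)" if "x \<in> ?S" for x
  proof -
    have x: "x \<noteq> y" using that by simp
    show ?thesis
      unfolding W_def[abs_def] W'_def
      by (rule has_derivative_eq_rhs, (rule derivative_intros da[OF x] d\<beta>[OF x] D[OF x])+) simp
  qed
  have cW': "continuous_on ?S (\<lambda>x. W' x h)" for h
    unfolding W'_def a'_def \<beta>'_def a_def \<beta>_def by (intro continuous_intros cont cg cD c\<sigma>)
  have W0: "W x = 0" if "x \<notin> K" for x using K(3,4)[OF that] by (simp add: W_def a_def \<beta>_def)
  define dv where "dv x = (if x \<in> K then \<Sum>b\<in>Basis. W' x b \<bullet> b else 0)" for x
  have dv: "integrable lebesgue dv" "(\<integral>x. dv x \<partial>lebesgue) = 0"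
    using divergence_integral[OF oS K(1) KS W0 dW cW'] unfolding dv_def by auto
  have key: "R1 x + dv x \<le> (P x)\<^sup>2" for x
  proof (cases "x \<in> K")
    case False
    then show ?thesis using K(3,4)[OF False] by (simp add: R1_def dv_def)
  next
    case True
    then have x: "x \<noteq> y" using K(2) by auto
    define L where "L = (\<Sum>b\<in>Basis. HH x b \<bullet> b)"
    define p where "p = (x - y) \<bullet> D x"
    define q where "q = D x \<bullet> D x"
    define t where "t = HH x (D x) \<bullet> (x - y)"
    define s where "s = (x - y) \<bullet> (x - y)"
    define r where "r = \<sigma> x"
    define k where "k = g x"
    have rs: "r * s = 1" using x by (simp add: r_def s_def \<sigma>)
    have la: "linear (a' x)" and lb: "linear (\<beta>' x)" using da[OF x] d\<beta>[OF x] by (auto intro: has_derivative_linear)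
    have tr: "(\<Sum>b\<in>Basis. f b * (v \<bullet> b)) = f v" if "linear f" for f :: "real^'n \<Rightarrow> real" and v
    proof -
      have "f v = f (\<Sum>b\<in>Basis. (v \<bullet> b) *\<^sub>R b)" by (simp add: euclidean_representation)
      also have "\<dots> = (\<Sum>b\<in>Basis. f b * (v \<bullet> b))"
        by (simp add: linear_sum[OF that] linear_scale[OF that] mult.commute)
      finally show ?thesis by simp
    qed
    have one: "(\<Sum>b\<in>(Basis :: (real^'n) set). \<beta> x * (b \<bullet> b)) = n * \<beta> x"
      by (simp add: n_def inner_Basis)
    have "dv x = (\<Sum>b\<in>Basis. a x * (HH x b \<bullet> b) + a' x b * (D x \<bullet> b) + (\<beta> x * (b \<bullet> b) + \<beta>' x b * ((x - y) \<bullet> b)))"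
      using True by (simp only: dv_def W'_def inner_add_left inner_scaleR_left if_True)
    also have "\<dots> = a x * L + a' x (D x) + (n * \<beta> x + \<beta>' x (x - y))"
      unfolding sum.distrib tr[OF la] tr[OF lb] one L_def by (simp add: sum_distrib_left)
    finally have 1: "dv x = a x * L + a' x (D x) + (n * \<beta> x + \<beta>' x (x - y))" .
    have ax: "a x = 8 * \<tau> * r\<^sup>2 * p - 2 * \<tau> * (16 - 2 * n) * r\<^sup>2 * k" by (simp add: a_def p_def r_def k_def)
    have bx: "\<beta> x = - 4 * \<tau> * r\<^sup>2 * q - 4 * \<tau> * (16 - 2 * n) * r^3 * k\<^sup>2 + (16 * \<tau>^3 * r^5 + 32 * \<tau>\<^sup>2 * r^4) * k\<^sup>2"
      by (simp add: \<beta>_def q_def r_def k_def)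
    have a'x: "a' x (D x) = 8 * \<tau> * (- 4 * r^3 * p * p + r\<^sup>2 * (q + t))
      - 2 * \<tau> * (16 - 2 * n) * (- 4 * r^3 * p * k + r\<^sup>2 * q)"
      by (simp add: a'_def p_def q_def r_def k_def t_def inner_commute)
    have b'x: "\<beta>' x (x - y) = - 4 * \<tau> * (- 4 * r^3 * s * q + r\<^sup>2 * (2 * t))
      - 4 * \<tau> * (16 - 2 * n) * (- 6 * r^4 * s * k\<^sup>2 + r^3 * (2 * k * p))
      + 16 * \<tau>^3 * (- 10 * r^6 * s * k\<^sup>2 + r^5 * (2 * k * p))
      + 32 * \<tau>\<^sup>2 * (- 8 * r^5 * s * k\<^sup>2 + r^4 * (2 * k * p))"
      using sym[OF x, of "x - y" "D x"] by (simp add: \<beta>'_def p_def q_def r_def k_def t_def s_def)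
    have pw: "r^3 * s = r^2" "r^4 * s = r^3" "r^5 * s = r^4" "r^6 * s = r^5"
      using rs by (simp_all add: power_numeral_reduce mult.assoc)
    have b'x: "\<beta>' x (x - y) = - 4 * \<tau> * (- 4 * r\<^sup>2 * q + r\<^sup>2 * (2 * t))
      - 4 * \<tau> * (16 - 2 * n) * (- 6 * r^3 * k\<^sup>2 + r^3 * (2 * k * p))
      + 16 * \<tau>^3 * (- 10 * r^5 * k\<^sup>2 + r^5 * (2 * k * p))
      + 32 * \<tau>\<^sup>2 * (- 8 * r^4 * k\<^sup>2 + r^4 * (2 * k * p))"
      unfolding b'x using pw by (simp add: mult.assoc)
    \<comment> \<open>Exact skewness of the first-order part would require the coefficient 8 - 2n
      instead of 16 - 2n in \<open>Tx\<close>, and then \<sigma>^2 |D|^2 would appear with factor -8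
      \<tau>. Moving 8 \<tau> \<sigma>^2 g from T to S turns this factor into +8 \<tau>.\<close>
    define Sx where "Sx = L + 4 * \<tau>\<^sup>2 * r^3 * k + 8 * \<tau> * r\<^sup>2 * k"
    define Tx where "Tx = 4 * \<tau> * r\<^sup>2 * p - \<tau> * (16 - 2 * n) * r\<^sup>2 * k"
    have R1x: "R1 x = 8 * \<tau> * r\<^sup>2 * q + 32 * \<tau> * r^3 * p\<^sup>2
      + (32 * \<tau>^3 * r^5 - 8 * \<tau> * (8 - n) * (6 - n) * r^3) * k\<^sup>2"
      by (simp add: R1_def r_def p_def q_def k_def)
    have "R1 x + dv x = 2 * Sx * Tx"
      unfolding 1 ax bx a'x b'x R1x Sx_def Tx_def by algebra
    also have "\<dots> \<le> (Sx + Tx)\<^sup>2" by (simp add: power2_sum)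
    also have "Sx + Tx = P x" unfolding P(2)[OF True] Sx_def Tx_def
      by (simp add: L_def r_def p_def k_def algebra_simps)
    finally show ?thesis .
  qed
  show "integrable lebesgue (\<lambda>x. 8 * \<tau> * (\<sigma> x)\<^sup>2 * (D x \<bullet> D x) + 32 * \<tau> * (\<sigma> x)^3 * ((x - y) \<bullet> D x)\<^sup>2
      + (32 * \<tau>^3 * (\<sigma> x)^5 - 8 * \<tau> * (8 - n) * (6 - n) * (\<sigma> x)^3) * (g x)\<^sup>2)"
    using R1 unfolding R1_def .
  have "(\<integral>x. R1 x \<partial>lebesgue) = (\<integral>x. R1 x + dv x \<partial>lebesgue)" using R1 dv by simp
  also have "\<dots> \<le> (\<integral>x. (P x)\<^sup>2 \<partial>lebesgue)" using R1 dv P(1) key by (intro integral_mono) auto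
  finally show "(\<integral>x. 8 * \<tau> * (\<sigma> x)\<^sup>2 * (D x \<bullet> D x) + 32 * \<tau> * (\<sigma> x)^3 * ((x - y) \<bullet> D x)\<^sup>2
      + (32 * \<tau>^3 * (\<sigma> x)^5 - 8 * \<tau> * (8 - n) * (6 - n) * (\<sigma> x)^3) * (g x)\<^sup>2 \<partial>lebesgue)
      \<le> (\<integral>x. (P x)\<^sup>2 \<partial>lebesgue)"
    unfolding R1_def .
qed

text \<open>Undoes the conjugation with g = \<open>e\<close> \<zeta>. The point is that \<kappa>
  does not depend on \<tau>, so the factor \<kappa> \<tau> grows without bound and absorbs any fixed
  multiple of the left-hand integral.\<close>

lemma carleman_weighted:
  fixes \<zeta> :: "real^'n \<Rightarrow> real" and Z :: "real^'n \<Rightarrow> real^'n"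
  defines "n \<equiv> real (DIM(real^'n))"
  assumes K: "compact K" "y \<notin> K" "\<And>x. x \<notin> K \<Longrightarrow> \<zeta> x = 0" "\<And>x. x \<notin> K \<Longrightarrow> Z x = 0" "\<And>x h. x \<notin> K \<Longrightarrow> ZZ x h = 0"
    and \<zeta>: "\<And>x. (\<zeta> has_derivative (\<lambda>h. h \<bullet> Z x)) (at x)"
    and Z: "\<And>x. (Z has_derivative ZZ x) (at x)"
    and sym: "\<And>x h k. ZZ x h \<bullet> k = ZZ x k \<bullet> h"
    and cont: "\<And>h. continuous_on UNIV (\<lambda>x. ZZ x h)"
    and \<sigma>: "\<And>x. \<sigma> x = inverse ((x - y) \<bullet> (x - y))"
    and \<sigma>0: "0 < \<sigma>0" "\<And>x. x \<in> K \<Longrightarrow> \<sigma>0 \<le> \<sigma> x"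
    and \<tau>: "1 \<le> \<tau>" "8 * \<bar>(8 - n) * (6 - n)\<bar> + 1 \<le> \<tau> * \<sigma>0"
    and e: "\<And>x. e x = exp (\<tau> * \<sigma> x)"
    and \<kappa>: "\<kappa> = min (\<sigma>0\<^sup>2) (8 * \<sigma>0^5)"
  shows "integrable lebesgue (\<lambda>x. (e x)\<^sup>2 * ((\<zeta> x)\<^sup>2 + Z x \<bullet> Z x))"
    and "integrable lebesgue (\<lambda>x. (e x * (\<Sum>b\<in>Basis. ZZ x b \<bullet> b))\<^sup>2)"
    and "\<kappa> * \<tau> * (\<integral>x. (e x)\<^sup>2 * ((\<zeta> x)\<^sup>2 + Z x \<bullet> Z x) \<partial>lebesgue)
      \<le> (\<integral>x. (e x * (\<Sum>b\<in>Basis. ZZ x b \<bullet> b))\<^sup>2 \<partial>lebesgue)"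
proof -
  let ?S = "- {y}"
  have oS: "open ?S" by auto
  have KS: "K \<subseteq> ?S" using K(2) by auto
  have c\<zeta>: "continuous_on S \<zeta>" for S
    using \<zeta> by (intro continuous_at_imp_continuous_on ballI has_derivative_continuous) auto
  have cZ: "continuous_on S Z" for S
    using Z by (intro continuous_at_imp_continuous_on ballI has_derivative_continuous) auto
  have cZZ: "continuous_on S (\<lambda>x. ZZ x h)" for S h by (rule continuous_on_subset[OF cont]) simp
  have c\<sigma>: "continuous_on ?S \<sigma>" unfolding \<sigma>[abs_def] by (intro continuous_intros) auto
  have ce: "continuous_on ?S e" unfolding e[abs_def] by (intro continuous_intros c\<sigma>)
  define A where "A x = (e x)\<^sup>2 * ((\<zeta> x)\<^sup>2 + Z x \<bullet> Z x)" for x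
  define P where "P x = e x * (\<Sum>b\<in>Basis. ZZ x b \<bullet> b)" for x
  have A: "integrable lebesgue A"
  proof (rule integrable_continuous_compact_support[OF oS _ K(1) KS])
    show "continuous_on ?S A" unfolding A_def by (intro continuous_intros ce c\<zeta> cZ)
  qed (use K(3,4) in \<open>simp add: A_def\<close>)
  have P: "integrable lebesgue (\<lambda>x. (P x)\<^sup>2)"
  proof (rule integrable_continuous_compact_support[OF oS _ K(1) KS])
    show "continuous_on ?S (\<lambda>x. (P x)\<^sup>2)" unfolding P_def by (intro continuous_intros ce cZZ)
  qed (use K(5) in \<open>simp add: P_def\<close>)
  define g where "g x = e x * \<zeta> x" for x
  define D where "D x = e x *\<^sub>R Z x - (2 * \<tau> * (\<sigma> x)\<^sup>2 * g x) *\<^sub>R (x - y)" for x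
  define HH where "HH x h = e x *\<^sub>R ZZ x h + (e x * (\<tau> * (- 2 * (\<sigma> x)\<^sup>2 * (h \<bullet> (x - y))))) *\<^sub>R Z x
     - ((2 * \<tau> * (\<sigma> x)\<^sup>2 * g x) *\<^sub>R h + (2 * \<tau> * (- 4 * (\<sigma> x)^3 * (h \<bullet> (x - y)) * g x + (\<sigma> x)\<^sup>2 * (h \<bullet> D x))) *\<^sub>R (x - y))"
    for x h
  have d\<sigma>: "(\<sigma> has_derivative (\<lambda>h. - 2 * (\<sigma> x)\<^sup>2 * (h \<bullet> (x - y)))) (at x)" if "x \<noteq> y" for x
    using has_derivative_inverse_square[OF that] by (simp add: \<sigma>[abs_def])
  have de: "(e has_derivative (\<lambda>h. e x * (\<tau> * (- 2 * (\<sigma> x)\<^sup>2 * (h \<bullet> (x - y)))))) (at x)" if x: "x \<noteq> y" for x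
    unfolding e[abs_def]
    by (rule has_derivative_eq_rhs, (rule derivative_intros d\<sigma>[OF x])+) (simp add: fun_eq_iff)
  have dg: "(g has_derivative (\<lambda>h. h \<bullet> D x)) (at x)" if x: "x \<noteq> y" for x
    unfolding g_def[abs_def]
    by (rule has_derivative_eq_rhs, (rule derivative_intros de[OF x] \<zeta>)+)
       (simp add: fun_eq_iff D_def g_def inner_diff_right algebra_simps)
  have dD: "(D has_derivative HH x) (at x)" if x: "x \<noteq> y" for x
    unfolding D_def[abs_def]
    by (rule has_derivative_eq_rhs, (rule derivative_intros de[OF x] d\<sigma>[OF x] dg[OF x] Z)+)
       (simp add: fun_eq_iff HH_def power2_eq_square power3_eq_cube algebra_simps)
  have symH: "HH x h \<bullet> k = HH x k \<bullet> h" for x h k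
    using sym[of x h k] by (simp add: HH_def D_def inner_simps inner_commute algebra_simps)
  have cg: "continuous_on ?S g" unfolding g_def by (intro continuous_intros ce c\<zeta>)
  have cD: "continuous_on ?S D" unfolding D_def by (intro continuous_intros ce cg c\<sigma> cZ)
  have cHH: "continuous_on ?S (\<lambda>x. HH x h)" for h
    unfolding HH_def by (intro continuous_intros ce cg c\<sigma> cZ cZZ cD)
  have g0: "g x = 0" and D0: "D x = 0" if "x \<notin> K" for x using K(3,4)[OF that] by (simp_all add: g_def D_def)
  have Pf: "P x = (\<Sum>b\<in>Basis. HH x b \<bullet> b) + 4 * \<tau> * (\<sigma> x)\<^sup>2 * ((x - y) \<bullet> D x)
        + 4 * \<tau>\<^sup>2 * (\<sigma> x)^3 * g x - (8 - 2 * n) * \<tau> * (\<sigma> x)\<^sup>2 * g x" if "x \<in> K" for x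
  proof -
    have xy: "x \<noteq> y" using that K(2) by auto
    have tr: "(\<Sum>b\<in>Basis. (b \<bullet> u) * (v \<bullet> b)) = u \<bullet> v" for u v :: "real^'n"
      by (subst euclidean_inner) (simp add: inner_commute)
    have one: "(\<Sum>b\<in>(Basis :: (real^'n) set). b \<bullet> b) = n" by (simp add: n_def inner_Basis)
    define L where "L = (\<Sum>b\<in>Basis. ZZ x b \<bullet> b)"
    define s where "s = (x - y) \<bullet> (x - y)"
    define m where "m = (x - y) \<bullet> Z x"
    have rs: "\<sigma> x * s = 1" using xy by (simp add: s_def \<sigma>)
    have "(\<Sum>b\<in>Basis. HH x b \<bullet> b) = (\<Sum>b\<in>Basis. e x * (ZZ x b \<bullet> b)
        + (- 2 * \<tau> * (\<sigma> x)\<^sup>2 * e x) * ((b \<bullet> (x - y)) * (Z x \<bullet> b))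
        - (2 * \<tau> * (\<sigma> x)\<^sup>2 * g x) * (b \<bullet> b) + (8 * \<tau> * (\<sigma> x)^3 * g x) * ((b \<bullet> (x - y)) * ((x - y) \<bullet> b))
        - (2 * \<tau> * (\<sigma> x)\<^sup>2) * ((b \<bullet> D x) * ((x - y) \<bullet> b)))"
      by (rule sum.cong) (simp_all add: HH_def inner_simps algebra_simps)
    also have "\<dots> = e x * L + (- 2 * \<tau> * (\<sigma> x)\<^sup>2 * e x) * ((x - y) \<bullet> Z x)
        - (2 * \<tau> * (\<sigma> x)\<^sup>2 * g x) * n + (8 * \<tau> * (\<sigma> x)^3 * g x) * ((x - y) \<bullet> (x - y))
        - (2 * \<tau> * (\<sigma> x)\<^sup>2) * (D x \<bullet> (x - y))"
      unfolding sum.distrib sum_subtractf sum_distrib_left[symmetric] tr one L_def ..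
    finally have 1: "(\<Sum>b\<in>Basis. HH x b \<bullet> b) = e x * L + (- 2 * \<tau> * (\<sigma> x)\<^sup>2 * e x) * m
        - (2 * \<tau> * (\<sigma> x)\<^sup>2 * g x) * n + (8 * \<tau> * (\<sigma> x)^3 * g x) * s
        - (2 * \<tau> * (\<sigma> x)\<^sup>2) * ((x - y) \<bullet> D x)"
      by (simp add: s_def m_def inner_commute)
    have 2: "(x - y) \<bullet> D x = e x * m - 2 * \<tau> * (\<sigma> x)\<^sup>2 * g x * s"
      by (simp add: D_def inner_diff_right m_def s_def)
    have 3: "P x = e x * L" by (simp add: P_def L_def)
    show ?thesis unfolding 1 2 3 using rs by algebra
  qed
  note car = carleman_conjugated[OF K(1,2) g0 D0 dg dD symH cHH \<sigma> P Pf[unfolded n_def], folded n_def]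
  define R1 where "R1 x = 8 * \<tau> * (\<sigma> x)\<^sup>2 * (D x \<bullet> D x) + 32 * \<tau> * (\<sigma> x)^3 * ((x - y) \<bullet> D x)\<^sup>2
      + (32 * \<tau>^3 * (\<sigma> x)^5 - 8 * \<tau> * (8 - n) * (6 - n) * (\<sigma> x)^3) * (g x)\<^sup>2" for x
  have low: "\<kappa> * \<tau> * A x \<le> R1 x" for x
  proof (cases "x \<in> K")
    case False
    then show ?thesis using g0[OF False] D0[OF False] K(3,4)[OF False] by (simp add: A_def R1_def)
  next
    case True
    then have xy: "x \<noteq> y" using K(2) by auto
    define r where "r = \<sigma> x"
    \<comment> \<open>The cubic term of \<open>R1\<close> may have the wrong sign. The second
      condition on \<tau> makes it at most half of the term 32 \<tau>^3 \<sigma>^5.\<close>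
    define Cn where "Cn = 8 * ((8 - n) * (6 - n))"
    have r: "r > 0" "\<sigma>0 \<le> r" using \<sigma>0(1) \<sigma>0(2)[OF True] by (auto simp: r_def)
    define s where "s = (x - y) \<bullet> (x - y)"
    have rs: "r * s = 1" using xy by (simp add: s_def \<sigma> r_def)
    have "\<tau> * \<sigma>0 \<le> \<tau> * r" using r(2) \<tau>(1) by (intro mult_left_mono) auto
    then have t1: "\<tau> * r \<ge> \<bar>Cn\<bar> + 1"
      using \<tau>(2) by (simp add: Cn_def abs_mult del: mult_le_cancel_left_pos)
    then have "(\<tau> * r) * (\<tau> * r) \<ge> 1 * (\<bar>Cn\<bar> + 1)" by (intro mult_mono) auto
    then have "Cn \<le> 16 * (\<tau> * r)\<^sup>2" by (simp add: power2_eq_square)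
    then have "\<tau> * r^3 * Cn \<le> \<tau> * r^3 * (16 * (\<tau> * r)\<^sup>2)" using \<tau>(1) r(1) by (intro mult_left_mono) auto
    also have "\<dots> = 16 * \<tau>^3 * r^5" by (simp add: power_mult_distrib power_numeral_reduce)
    finally have c1: "16 * \<tau>^3 * r^5 \<le> 32 * \<tau>^3 * r^5 - 8 * \<tau> * (8 - n) * (6 - n) * r^3"
      by (simp add: Cn_def algebra_simps)
    have "0 \<le> 32 * \<tau> * r^3 * ((x - y) \<bullet> D x)\<^sup>2" using \<tau>(1) r(1) by simp
    then have "8 * \<tau> * r\<^sup>2 * (D x \<bullet> D x) + 16 * \<tau>^3 * r^5 * (g x)\<^sup>2 \<le> R1 x"
      using mult_right_mono[OF c1, of "(g x)\<^sup>2"] unfolding R1_def r_def[symmetric] by simp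
    \<comment> \<open>Recovers the gradient of \<zeta> from that of g: they differ by 2 \<tau>
      \<sigma>^2 g (x - y), whose square is 4 \<tau>^2 \<sigma>^3 g^2 because \<sigma> |x - y|^2 =
      1.\<close>
    moreover have "e x * (e x * (Z x \<bullet> Z x)) \<le> 2 * (D x \<bullet> D x) + 8 * \<tau>\<^sup>2 * r^3 * (g x)\<^sup>2"
    proof -
      define v where "v = (2 * \<tau> * r\<^sup>2 * g x) *\<^sub>R (x - y)"
      have "e x *\<^sub>R Z x = D x + v" by (simp add: D_def v_def r_def)
      then have "(e x *\<^sub>R Z x) \<bullet> (e x *\<^sub>R Z x) = (D x + v) \<bullet> (D x + v)" by simp
      also have "\<dots> \<le> 2 * (D x \<bullet> D x) + 2 * (v \<bullet> v)"
        using inner_ge_zero[of "D x - v"] by (simp add: inner_simps inner_commute)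
      also have "v \<bullet> v = 4 * \<tau>\<^sup>2 * r^3 * (g x)\<^sup>2 * (r * s)"
        by (simp add: v_def s_def power2_eq_square power3_eq_cube)
      finally show ?thesis using rs by simp
    qed
    then have "\<tau> * r\<^sup>2 * (e x * (e x * (Z x \<bullet> Z x))) \<le> \<tau> * r\<^sup>2 * (2 * (D x \<bullet> D x) + 8 * \<tau>\<^sup>2 * r^3 * (g x)\<^sup>2)"
      using \<tau>(1) by (intro mult_left_mono) auto
    then have "\<tau> * r\<^sup>2 * (e x * (e x * (Z x \<bullet> Z x))) \<le> 2 * \<tau> * r\<^sup>2 * (D x \<bullet> D x) + 8 * \<tau>^3 * r^5 * (g x)\<^sup>2"
      by (simp add: algebra_simps power_numeral_reduce)
    moreover have "0 \<le> \<tau> * r\<^sup>2 * (D x \<bullet> D x)" using \<tau>(1) by simp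
    ultimately have "\<tau> * r\<^sup>2 * (e x * (e x * (Z x \<bullet> Z x))) + 8 * \<tau>^3 * r^5 * (g x)\<^sup>2 \<le> R1 x" by linarith
    moreover have "\<kappa> * (\<tau> * ((e x)\<^sup>2 * (Z x \<bullet> Z x))) \<le> r\<^sup>2 * (\<tau> * ((e x)\<^sup>2 * (Z x \<bullet> Z x)))"
    proof -
      have "\<kappa> \<le> \<sigma>0\<^sup>2" by (simp add: \<kappa>)
      also have "\<dots> \<le> r\<^sup>2" using \<sigma>0(1) r(2) by (intro power_mono) auto
      finally show ?thesis using \<tau>(1) by (intro mult_right_mono) auto
    qed
    moreover have "\<kappa> * (\<tau> * ((e x)\<^sup>2 * (\<zeta> x)\<^sup>2)) \<le> 8 * \<tau>^3 * r^5 * (g x)\<^sup>2"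
    proof -
      have "\<kappa> \<le> 8 * \<sigma>0^5" by (simp add: \<kappa>)
      also have "\<dots> \<le> 8 * r^5" using \<sigma>0(1) r(2) power_mono[of \<sigma>0 r 5] by simp
      finally have "\<kappa> * (\<tau> * ((e x)\<^sup>2 * (\<zeta> x)\<^sup>2)) \<le> 8 * r^5 * (\<tau> * ((e x)\<^sup>2 * (\<zeta> x)\<^sup>2))"
        using \<tau>(1) by (intro mult_right_mono) auto
      also have "\<dots> \<le> 8 * r^5 * (\<tau>^3 * ((e x)\<^sup>2 * (\<zeta> x)\<^sup>2))"
        using \<tau>(1) r(1) self_le_power[of \<tau> 3] by (intro mult_left_mono mult_right_mono) auto
      finally show ?thesis by (simp add: g_def power_mult_distrib algebra_simps)
    qed
    ultimately show ?thesis by (simp add: A_def algebra_simps power2_eq_square)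
  qed
  have R1: "integrable lebesgue R1" "(\<integral>x. R1 x \<partial>lebesgue) \<le> (\<integral>x. (P x)\<^sup>2 \<partial>lebesgue)"
    using car unfolding R1_def by blast+
  have "(\<integral>x. \<kappa> * \<tau> * A x \<partial>lebesgue) \<le> (\<integral>x. R1 x \<partial>lebesgue)"
    using A R1(1) low by (intro integral_mono) auto
  then show "\<kappa> * \<tau> * (\<integral>x. (e x)\<^sup>2 * ((\<zeta> x)\<^sup>2 + Z x \<bullet> Z x) \<partial>lebesgue)
      \<le> (\<integral>x. (e x * (\<Sum>b\<in>Basis. ZZ x b \<bullet> b))\<^sup>2 \<partial>lebesgue)"
    using R1(2) unfolding A_def P_def by simp
  show "integrable lebesgue (\<lambda>x. (e x)\<^sup>2 * ((\<zeta> x)\<^sup>2 + Z x \<bullet> Z x))" using A unfolding A_def .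
  show "integrable lebesgue (\<lambda>x. (e x * (\<Sum>b\<in>Basis. ZZ x b \<bullet> b))\<^sup>2)" using P unfolding P_def .
qed

text \<open>Where the differential inequality holds, the right side of Carleman's estimate is
  absorbed for large \<tau>. The rest lies where |x - y|^2 >= S1, with a weight no larger than the
  one near \<open>x1\<close>, and lacks the growing factor \<tau>.\<close>

lemma carleman_vanishing:
  fixes \<zeta> :: "real^'n \<Rightarrow> real" and Z :: "real^'n \<Rightarrow> real^'n"
  assumes K0: "compact K0" "\<And>x. x \<notin> K0 \<Longrightarrow> \<zeta> x = 0"
    and R: "R > 0" "\<And>x. dist x y < R \<Longrightarrow> \<zeta> x = 0"
    and \<zeta>: "\<And>x. (\<zeta> has_derivative (\<lambda>h. h \<bullet> Z x)) (at x)"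
    and Z: "\<And>x. (Z has_derivative ZZ x) (at x)"
    and sym: "\<And>x h k. ZZ x h \<bullet> k = ZZ x k \<bullet> h"
    and cont: "\<And>h. continuous_on UNIV (\<lambda>x. ZZ x h)"
    and ineq: "\<And>x. (x - y) \<bullet> (x - y) < S1 \<Longrightarrow> \<bar>\<Sum>b\<in>Basis. ZZ x b \<bullet> b\<bar> \<le> M * (\<bar>\<zeta> x\<bar> + norm (Z x))"
    and x1: "(x1 - y) \<bullet> (x1 - y) < S1"
  shows "\<zeta> x1 = 0"
proof (rule ccontr)
  assume nz: "\<zeta> x1 \<noteq> 0"
  \<comment> \<open>Removing the ball on which \<zeta> vanishes keeps the singularity of the weight
    off the support.\<close>
  define K where "K = K0 - ball y R"
  have K: "compact K" using K0(1) by (auto simp: K_def intro: compact_diff)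
  have yK: "y \<notin> K" using R(1) by (simp add: K_def)
  have \<zeta>0: "\<zeta> x = 0" if "x \<notin> K" for x
    using that K0(2)[of x] R(2)[of x] by (auto simp: K_def dist_commute)
  have Z0: "Z x = 0" if "x \<notin> K" for x
    using grad_eq_0_outside(2)[OF K \<zeta>0 that] grad_eqI[of \<zeta> x "Z x"] \<zeta>[of x] by (simp add: gderiv_def)
  have ZZ0: "ZZ x h = 0" if "x \<notin> K" for x h
  proof -
    have "open (- K)" using K by (simp add: compact_imp_closed open_Compl)
    then have "(Z has_derivative (\<lambda>h. 0)) (at x)"
      by (rule has_derivative_transform_within_open[OF has_derivative_const]) (use that Z0 in auto)
    then show ?thesis using has_derivative_unique[OF Z] by metis
  qed
  have x1K: "x1 \<in> K" using \<zeta>0 nz by blast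
  have c\<zeta>: "continuous_on UNIV \<zeta>"
    using \<zeta> by (intro continuous_at_imp_continuous_on ballI has_derivative_continuous) auto
  define \<sigma> where "\<sigma> x = inverse ((x - y) \<bullet> (x - y))" for x
  have spos: "0 < (x - y) \<bullet> (x - y)" if "x \<in> K" for x using that yK by auto
  have S1: "S1 > 0" by (rule less_trans[OF spos[OF x1K] x1])
  obtain B where B: "\<And>x. x \<in> K \<Longrightarrow> (x - y) \<bullet> (x - y) \<le> B"
  proof -
    have "compact ((\<lambda>x. (x - y) \<bullet> (x - y)) ` K)" by (intro compact_continuous_image continuous_intros K)
    then obtain B where "\<And>x. x \<in> K \<Longrightarrow> \<bar>(x - y) \<bullet> (x - y)\<bar> \<le> B"
      using compact_imp_bounded by (fastforce simp: bounded_iff)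
    then show ?thesis using that by fastforce
  qed
  have Bpos: "B > 0" by (rule less_le_trans[OF spos[OF x1K] B[OF x1K]])
  define \<sigma>0 where "\<sigma>0 = inverse B"
  have \<sigma>0: "\<sigma>0 > 0" "\<And>x. x \<in> K \<Longrightarrow> \<sigma>0 \<le> \<sigma> x"
    using Bpos B spos by (auto simp: \<sigma>0_def \<sigma>_def intro: le_imp_inverse_le)
  define \<kappa> where "\<kappa> = min (\<sigma>0\<^sup>2) (8 * \<sigma>0^5)"
  have \<kappa>: "\<kappa> > 0" using \<sigma>0(1) by (simp add: \<kappa>_def)
  define Lap where "Lap x = (\<Sum>b\<in>Basis. ZZ x b \<bullet> b)" for x
  have cL: "continuous_on UNIV Lap" unfolding Lap_def by (intro continuous_intros cont)
  obtain B' where B': "\<And>x. x \<in> K \<Longrightarrow> \<bar>Lap x\<bar> \<le> B'"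
  proof -
    have "compact (Lap ` K)" by (intro compact_continuous_image continuous_on_subset[OF cL] K) auto
    then show ?thesis using that compact_imp_bounded by (fastforce simp: bounded_iff)
  qed
  define m where "m = measure lebesgue K"
  define \<delta> where "\<delta> = \<bar>\<zeta> x1\<bar> / 2"
  have \<delta>: "\<delta> > 0" using nz by (simp add: \<delta>_def)
  let ?O = "{x. \<delta> < \<bar>\<zeta> x\<bar>} \<inter> {x. (x - y) \<bullet> (x - y) < S1}"
  have "open ?O" by (intro open_Int open_Collect_less continuous_intros c\<zeta>)
  moreover have "x1 \<in> ?O" using x1 nz by (simp add: \<delta>_def)
  ultimately obtain r where r: "r > 0" "cball x1 r \<subseteq> ?O" using open_contains_cball by blast
  define V where "V = measure lebesgue (cball x1 r)"
  have V: "V > 0" using content_cball_pos[OF r(1), of x1] by (simp add: V_def)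
  define n where "n = real (DIM(real^'n))"
  define \<tau>1 where "\<tau>1 = (8 * \<bar>(8 - n) * (6 - n)\<bar> + 1) / \<sigma>0"
  \<comment> \<open>\<tau>1 meets the condition of Carleman's estimate. \<tau>2 makes (\<tau>
    \<kappa> - 2 M^2) \<delta>^2 V at least B'^2 m + 1, which the final comparison
    contradicts.\<close>
  define \<tau>2 where "\<tau>2 = (2 * M\<^sup>2 + (B'\<^sup>2 * m + 1) / (\<delta>\<^sup>2 * V)) / \<kappa>"
  define \<tau> where "\<tau> = max 1 (max \<tau>1 \<tau>2)"
  have \<tau>: "1 \<le> \<tau>" "\<tau>1 \<le> \<tau>" "\<tau>2 \<le> \<tau>" by (auto simp: \<tau>_def)
  have \<tau>a: "8 * \<bar>(8 - n) * (6 - n)\<bar> + 1 \<le> \<tau> * \<sigma>0"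
    using \<tau>(2) \<sigma>0(1) unfolding \<tau>1_def by (simp only: pos_divide_le_eq)
  have \<tau>b: "2 * M\<^sup>2 + (B'\<^sup>2 * m + 1) / (\<delta>\<^sup>2 * V) \<le> \<tau> * \<kappa>"
    using \<tau>(3) \<kappa> unfolding \<tau>2_def by (simp only: pos_divide_le_eq)
  define e where "e x = exp (\<tau> * \<sigma> x)" for x
  define A where "A x = (e x)\<^sup>2 * ((\<zeta> x)\<^sup>2 + Z x \<bullet> Z x)" for x
  note car = carleman_weighted[OF K yK \<zeta>0 Z0 ZZ0 \<zeta> Z sym cont \<sigma>_def \<sigma>0 \<tau>(1) \<tau>a[unfolded n_def] e_def \<kappa>_def,
      folded A_def Lap_def]
  \<comment> \<open>The squared weight on the sphere |x - y|^2 = S1: a lower bound inside, an upper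
    bound outside. It cancels from the final comparison.\<close>
  define q where "q = (exp (\<tau> / S1))\<^sup>2"
  have q: "q > 0" by (simp add: q_def)
  have "(\<integral>x. (e x * Lap x)\<^sup>2 \<partial>lebesgue) \<le> (\<integral>x. 2 * M\<^sup>2 * A x + B'\<^sup>2 * q * indicator K x \<partial>lebesgue)"
  proof (rule integral_mono)
    show "integrable lebesgue (\<lambda>x. (e x * Lap x)\<^sup>2)" by (rule car(2))
    show "integrable lebesgue (\<lambda>x. 2 * M\<^sup>2 * A x + B'\<^sup>2 * q * indicat_real K x)"
      using car(1) lmeasurable_compact[OF K]
      by (intro Bochner_Integration.integrable_add integrable_mult_right integrable_real_indicator) (auto simp: fmeasurable_def)
    fix x
    have A0: "0 \<le> A x" by (simp add: A_def)
    show "(e x * Lap x)\<^sup>2 \<le> 2 * M\<^sup>2 * A x + B'\<^sup>2 * q * indicat_real K x"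
    proof (cases "x \<in> K")
      case False
      then show ?thesis using ZZ0[OF False] A0 by (simp add: Lap_def)
    next
      case True
      show ?thesis
      proof (cases "(x - y) \<bullet> (x - y) < S1")
        case lt: True
        define a where "a = \<bar>\<zeta> x\<bar>"
        define b where "b = norm (Z x)"
        have "\<bar>Lap x\<bar> \<le> M * (a + b)" using ineq[OF lt] by (simp add: Lap_def a_def b_def)
        then have "\<bar>Lap x\<bar>\<^sup>2 \<le> (M * (a + b))\<^sup>2" by (intro power_mono) auto
        also have "\<dots> \<le> 2 * M\<^sup>2 * (a\<^sup>2 + b\<^sup>2)"
        proof -
          have "(a + b)\<^sup>2 \<le> 2 * (a\<^sup>2 + b\<^sup>2)" using sum_squares_bound[of a b] by (simp add: power2_sum)
          then have "M\<^sup>2 * (a + b)\<^sup>2 \<le> M\<^sup>2 * (2 * (a\<^sup>2 + b\<^sup>2))" by (intro mult_left_mono) auto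
          then show ?thesis by (simp only: power_mult_distrib mult_ac)
        qed
        finally have "(e x)\<^sup>2 * (Lap x)\<^sup>2 \<le> (e x)\<^sup>2 * (2 * M\<^sup>2 * (a\<^sup>2 + b\<^sup>2))" by (intro mult_left_mono) auto
        also have "\<dots> = 2 * M\<^sup>2 * A x" by (simp add: A_def a_def b_def power2_norm_eq_inner)
        also have "\<dots> \<le> 2 * M\<^sup>2 * A x + B'\<^sup>2 * q * indicat_real K x" using q by simp
        finally show ?thesis by (simp add: power_mult_distrib)
      next
        case False
        then have "\<sigma> x \<le> 1 / S1"
          unfolding \<sigma>_def inverse_eq_divide[symmetric] using S1 by (intro le_imp_inverse_le) auto
        then have "\<tau> * \<sigma> x \<le> \<tau> / S1" using \<tau>(1) mult_left_mono[of "\<sigma> x" "1 / S1" \<tau>] by simp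
        then have "(e x)\<^sup>2 \<le> q" unfolding e_def q_def by (intro power_mono) auto
        moreover have "(Lap x)\<^sup>2 \<le> B'\<^sup>2" using power_mono[OF B'[OF True], of 2] by simp
        ultimately have "(e x)\<^sup>2 * (Lap x)\<^sup>2 \<le> q * B'\<^sup>2" using q by (intro mult_mono) auto
        then have "(e x * Lap x)\<^sup>2 \<le> B'\<^sup>2 * q" by (simp add: power_mult_distrib mult.commute)
        also have "\<dots> \<le> 2 * M\<^sup>2 * A x + B'\<^sup>2 * q * indicat_real K x" using True A0 by simp
        finally show ?thesis .
      qed
    qed
  qed
  also have "\<dots> = 2 * M\<^sup>2 * (\<integral>x. A x \<partial>lebesgue) + B'\<^sup>2 * q * m"
  proof -
    have "integrable lebesgue (\<lambda>x. B'\<^sup>2 * q * indicat_real K x)"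
      using lmeasurable_compact[OF K]
      by (intro integrable_mult_right integrable_real_indicator) (auto simp: fmeasurable_def)
    then show ?thesis using car(1) by (simp add: m_def)
  qed
  finally have 1: "(\<tau> * \<kappa> - 2 * M\<^sup>2) * (\<integral>x. A x \<partial>lebesgue) \<le> B'\<^sup>2 * q * m"
    using car(3) by (simp add: algebra_simps)
  have "\<delta>\<^sup>2 * q * V = (\<integral>x. \<delta>\<^sup>2 * q * indicator (cball x1 r) x \<partial>lebesgue)" by (simp add: V_def)
  also have "\<dots> \<le> (\<integral>x. A x \<partial>lebesgue)"
  proof (rule integral_mono)
    show "integrable lebesgue (\<lambda>x. \<delta>\<^sup>2 * q * indicat_real (cball x1 r) x)"
      using lmeasurable_compact[of "cball x1 r"]
      by (intro integrable_mult_right integrable_real_indicator) (auto simp: fmeasurable_def)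
    fix x
    show "\<delta>\<^sup>2 * q * indicat_real (cball x1 r) x \<le> A x"
    proof (cases "x \<in> cball x1 r")
      case True
      then have xO: "\<delta> < \<bar>\<zeta> x\<bar>" "(x - y) \<bullet> (x - y) < S1" using r(2) by auto
      have xK: "x \<in> K"
      proof (rule ccontr)
        assume "x \<notin> K"
        then have "\<zeta> x = 0" by (rule \<zeta>0)
        with xO(1) \<delta> show False by simp
      qed
      have "1 / S1 \<le> \<sigma> x"
        unfolding \<sigma>_def inverse_eq_divide[symmetric] using less_imp_le[OF xO(2)] spos[OF xK] by (rule le_imp_inverse_le)
      then have "\<tau> / S1 \<le> \<tau> * \<sigma> x" using \<tau>(1) mult_left_mono[of "1 / S1" "\<sigma> x" \<tau>] by simp
      then have "q \<le> (e x)\<^sup>2" unfolding e_def q_def by (intro power_mono) auto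
      moreover have "\<delta>\<^sup>2 \<le> (\<zeta> x)\<^sup>2" using power_mono[of \<delta> "\<bar>\<zeta> x\<bar>" 2] xO(1) \<delta> by simp
      then have "\<delta>\<^sup>2 \<le> (\<zeta> x)\<^sup>2 + Z x \<bullet> Z x" using inner_ge_zero[of "Z x"] by linarith
      ultimately have "q * \<delta>\<^sup>2 \<le> A x" unfolding A_def using q by (intro mult_mono) auto
      then show ?thesis using True by (simp add: mult.commute)
    qed (simp add: A_def)
  qed (rule car(1))
  finally have 2: "\<delta>\<^sup>2 * q * V \<le> (\<integral>x. A x \<partial>lebesgue)" .
  have m0: "m \<ge> 0" by (simp add: m_def)
  have dV: "\<delta>\<^sup>2 * V > 0" using \<delta> V by simp
  have 3: "(B'\<^sup>2 * m + 1) / (\<delta>\<^sup>2 * V) \<le> \<tau> * \<kappa> - 2 * M\<^sup>2" using \<tau>b by simp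
  have "(B'\<^sup>2 * m + 1) * q = (B'\<^sup>2 * m + 1) / (\<delta>\<^sup>2 * V) * (\<delta>\<^sup>2 * q * V)" using \<delta> V by (simp add: field_simps)
  also have "\<dots> \<le> (\<tau> * \<kappa> - 2 * M\<^sup>2) * (\<integral>x. A x \<partial>lebesgue)"
  proof (rule mult_mono[OF 3 2])
    have "0 \<le> (B'\<^sup>2 * m + 1) / (\<delta>\<^sup>2 * V)" using m0 V by simp
    then show "0 \<le> \<tau> * \<kappa> - 2 * M\<^sup>2" using 3 by linarith
    show "0 \<le> \<delta>\<^sup>2 * q * V" using q V by simp
  qed
  also have "\<dots> \<le> B'\<^sup>2 * q * m" by (rule 1)
  finally show False using q by (simp add: algebra_simps)
qed

section \<open>From Carleman's estimate to unique continuation\<close>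

lemma has_real_derivative_max0_power:
  fixes t :: real
  shows "((\<lambda>t. (max 0 t) ^ Suc (Suc k)) has_real_derivative real (Suc (Suc k)) * (max 0 t) ^ Suc k) (at t)"
proof (cases "t = 0")
  case True
  \<comment> \<open>An exponent of at least two leaves a positive power of |h| in the difference
    quotient at 0.\<close>
  have "((\<lambda>h. (max 0 h) ^ Suc (Suc k) / h) \<longlongrightarrow> 0) (at (0::real))"
  proof (rule Lim_null_comparison)
    have "\<bar>(max 0 h) ^ Suc (Suc k) / h\<bar> \<le> \<bar>h\<bar> ^ Suc k" for h :: real
    proof (cases "h > 0")
      case False
      then have "max 0 h = 0" by simp
      then have "(max 0 h) ^ Suc (Suc k) = 0" by (simp only: power_0_Suc)
      then show ?thesis by (simp only: div_0 abs_zero zero_le_power abs_ge_zero)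
    qed simp
    then show "\<forall>\<^sub>F h in at (0::real). norm ((max 0 h) ^ Suc (Suc k) / h) \<le> \<bar>h\<bar> ^ Suc k" by simp
    have "((\<lambda>h::real. \<bar>h\<bar> ^ Suc k) \<longlongrightarrow> \<bar>0\<bar> ^ Suc k) (at 0)" by (intro tendsto_intros)
    then show "((\<lambda>h::real. \<bar>h\<bar> ^ Suc k) \<longlongrightarrow> 0) (at 0)" by simp
  qed
  then show ?thesis using True by (simp add: DERIV_def)
next
  case False
  show ?thesis
  proof (cases "t > 0")
    case True
    have "((\<lambda>t. t ^ Suc (Suc k)) has_real_derivative real (Suc (Suc k)) * t ^ Suc k) (at t)"
      by (rule derivative_eq_intros refl | simp)+
    then show ?thesis
      by (rule DERIV_cong_ev[THEN iffD1, rotated 3])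
         (use True in \<open>auto intro: eventually_mono[OF eventually_nhds_in_open[of "{0<..}"]]\<close>)
  next
    case neg: False
    have "((\<lambda>t::real. 0) has_real_derivative 0) (at t)" by simp
    then show ?thesis
      by (rule DERIV_cong_ev[THEN iffD1, rotated 3])
         (use neg False in \<open>auto intro: eventually_mono[OF eventually_nhds_in_open[of "{..<0}"]]\<close>)
  qed
qed

text \<open>The \<open>C\<^sup>2\<close> cutoff \<open>((S - |x - y|\<^sup>2)\<^sup>+)\<^sup>3\<close> suffices: where it is bounded below it preserves the
  differential inequality, so no plateau is needed.\<close>

lemma ball_continuation:
  fixes w :: "real^'n \<Rightarrow> real" and G :: "real^'n \<Rightarrow> real^'n"
  assumes S: "open S" "cball y \<rho> \<subseteq> S"
    and dw: "\<And>x. x \<in> S \<Longrightarrow> (w has_derivative (\<lambda>h. h \<bullet> G x)) (at x)"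
    and dG: "\<And>x. x \<in> S \<Longrightarrow> (G has_derivative HG x) (at x)"
    and sym: "\<And>x h k. x \<in> S \<Longrightarrow> HG x h \<bullet> k = HG x k \<bullet> h"
    and cont: "\<And>h. continuous_on S (\<lambda>x. HG x h)"
    and ineq: "\<And>K. compact K \<Longrightarrow> K \<subseteq> S \<Longrightarrow>
      \<exists>M. \<forall>x\<in>K. \<bar>\<Sum>b\<in>Basis. HG x b \<bullet> b\<bar> \<le> M * (\<bar>w x\<bar> + norm (G x))"
    and R: "R > 0" "\<And>x. dist x y < R \<Longrightarrow> w x = 0"
    and x1: "dist x1 y < \<rho>"
  shows "w x1 = 0"
proof -
  define s where "s x = (x - y) \<bullet> (x - y)" for x
  have sd: "s x = (dist x y)\<^sup>2" for x by (simp add: s_def dist_norm power2_norm_eq_inner)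
  have \<rho>: "\<rho> > 0" using x1 zero_le_dist[of x1 y] by linarith
  define m where "m x = max 0 (\<rho>\<^sup>2 - s x)" for x
  have m0: "m x \<ge> 0" for x by (simp add: m_def)
  have mout: "m x = 0" if "x \<notin> cball y \<rho>" for x
  proof -
    have "\<rho> < dist x y" using that by (simp add: dist_commute)
    then have "\<rho>\<^sup>2 < s x" unfolding sd using \<rho> by (intro power_strict_mono) auto
    then show ?thesis by (simp add: m_def)
  qed
  have ds: "(s has_derivative (\<lambda>h. 2 * (h \<bullet> (x - y)))) (at x)" for x
    unfolding s_def[abs_def]
    by (rule has_derivative_eq_rhs, (rule derivative_intros)+) (simp add: fun_eq_iff inner_commute)
  have dmk: "((\<lambda>x. m x ^ Suc (Suc k)) has_derivative (\<lambda>h. real (Suc (Suc k)) * m x ^ Suc k * (- 2 * (h \<bullet> (x - y))))) (at x)" for x k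
  proof -
    have "((\<lambda>x. \<rho>\<^sup>2 - s x) has_derivative (\<lambda>h. - 2 * (h \<bullet> (x - y)))) (at x)"
      by (rule has_derivative_eq_rhs, (rule derivative_intros ds)+) simp
    from has_derivative_compose[OF this has_real_derivative_max0_power[where t = "\<rho>\<^sup>2 - s x" and k = k, unfolded has_field_derivative_def]]
    show ?thesis by (simp only: m_def)
  qed
  have dm3: "((\<lambda>x. m x ^ 3) has_derivative (\<lambda>h. 3 * (m x)\<^sup>2 * (- 2 * (h \<bullet> (x - y))))) (at x)" for x
    using dmk[of 1 x] by (simp add: numeral_eq_Suc)
  have dm2: "((\<lambda>x. (m x)\<^sup>2) has_derivative (\<lambda>h. 2 * m x * (- 2 * (h \<bullet> (x - y))))) (at x)" for x
    using dmk[of 0 x] by (simp add: numeral_eq_Suc)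
  have cm: "continuous_on A m" for A
    unfolding m_def s_def by (intro continuous_intros)
  have cw: "continuous_on S w"
    using dw by (intro continuous_at_imp_continuous_on ballI has_derivative_continuous) auto
  have cG: "continuous_on S G"
    using dG by (intro continuous_at_imp_continuous_on ballI has_derivative_continuous) auto
  \<comment> \<open>The primed functions are the product w m^3, its gradient and its Hessian by the
    product rule, meaningful on \<open>S\<close>. The unprimed ones extend them by zero, which is
    smooth enough since \<open>m\<close> vanishes off the closed ball.\<close>
  define \<zeta>' where "\<zeta>' x = m x ^ 3 * w x" for x
  define Z' where "Z' x = m x ^ 3 *\<^sub>R G x - (6 * (m x)\<^sup>2 * w x) *\<^sub>R (x - y)" for x
  define ZZ' where "ZZ' x h = m x ^ 3 *\<^sub>R HG x h - (6 * (m x)\<^sup>2 * (h \<bullet> (x - y))) *\<^sub>R G x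
      - ((6 * (m x)\<^sup>2 * w x) *\<^sub>R h + (6 * (m x)\<^sup>2 * (h \<bullet> G x) - 24 * m x * (h \<bullet> (x - y)) * w x) *\<^sub>R (x - y))" for x h
  define \<zeta> where "\<zeta> x = (if x \<in> S then \<zeta>' x else 0)" for x
  define Z where "Z x = (if x \<in> S then Z' x else 0)" for x
  define ZZ where "ZZ x h = (if x \<in> S then ZZ' x h else 0)" for x h
  have out: "\<zeta> x = 0" "Z x = 0" "ZZ x h = 0" if "x \<notin> cball y \<rho>" for x h
    using mout[OF that] by (simp_all add: \<zeta>_def Z_def ZZ_def \<zeta>'_def Z'_def ZZ'_def)
  have oc: "open (- cball y \<rho>)" by (simp add: open_Compl)
  have d\<zeta>: "(\<zeta> has_derivative (\<lambda>h. h \<bullet> Z x)) (at x)" for x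
  proof (cases "x \<in> S")
    case True
    have "(\<zeta>' has_derivative (\<lambda>h. h \<bullet> Z' x)) (at x)"
      unfolding \<zeta>'_def[abs_def]
      by (rule has_derivative_eq_rhs, (rule dm3 dw[OF True] derivative_intros)+)
         (simp add: fun_eq_iff Z'_def inner_diff_right algebra_simps)
    from has_derivative_transform_within_open[OF this S(1) True, of \<zeta>]
    show ?thesis using True by (simp add: \<zeta>_def Z_def)
  next
    case False
    then have x: "x \<in> - cball y \<rho>" using S(2) by auto
    have "(\<zeta> has_derivative (\<lambda>h. 0)) (at x)"
      by (rule has_derivative_transform_within_open[OF has_derivative_const oc x]) (simp add: out del: mem_cball)
    then show ?thesis using False by (simp add: Z_def)
  qed
  have dZ: "(Z has_derivative ZZ x) (at x)" for x
  proof (cases "x \<in> S")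
    case True
    have "(Z' has_derivative ZZ' x) (at x)"
      unfolding Z'_def[abs_def]
      by (rule has_derivative_eq_rhs, (rule dm3 dm2 dw[OF True] dG[OF True] derivative_intros)+)
         (simp add: fun_eq_iff ZZ'_def algebra_simps)
    from has_derivative_transform_within_open[OF this S(1) True, of Z]
    have "(Z has_derivative ZZ' x) (at x)" by (simp add: Z_def)
    then show ?thesis using True by (simp add: ZZ_def[abs_def])
  next
    case False
    then have x: "x \<in> - cball y \<rho>" using S(2) by auto
    have "(Z has_derivative (\<lambda>h. 0)) (at x)"
      by (rule has_derivative_transform_within_open[OF has_derivative_const oc x]) (simp add: out del: mem_cball)
    then show ?thesis using False by (simp add: ZZ_def[abs_def])
  qed
  have symZ: "ZZ x h \<bullet> k = ZZ x k \<bullet> h" for x h k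
    using sym[of x h k] by (simp add: ZZ_def ZZ'_def inner_simps inner_commute algebra_simps)
  have cZZ: "continuous_on UNIV (\<lambda>x. ZZ x h)" for h
  proof -
    have "continuous_on S (\<lambda>x. ZZ' x h)" unfolding ZZ'_def by (intro continuous_intros cm cw cG cont)
    then have "continuous_on S (\<lambda>x. ZZ x h)" by (rule continuous_on_eq) (simp add: ZZ_def)
    moreover have "continuous_on (- cball y \<rho>) (\<lambda>x. ZZ x h)"
      by (rule continuous_on_eq[of _ "\<lambda>_. 0"]) (auto simp: out simp del: mem_cball)
    ultimately have "continuous_on (S \<union> - cball y \<rho>) (\<lambda>x. ZZ x h)"
      using S(1) oc by (intro continuous_on_open_Un)
    moreover have "S \<union> - cball y \<rho> = UNIV" using S(2) by auto
    ultimately show ?thesis by simp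
  qed
  have near: "\<zeta> x = 0" if "dist x y < R" for x using R(2)[OF that] by (simp add: \<zeta>_def \<zeta>'_def)
  \<comment> \<open>A level strictly between s x1 and \<rho>^2: below it the cutoff is at least
    \<open>c0\<close>, so division by it is harmless, and \<open>x1\<close> lies below it.\<close>
  define S1 where "S1 = (s x1 + \<rho>\<^sup>2) / 2"
  have sx1: "s x1 < \<rho>\<^sup>2" unfolding sd using x1 by (intro power_strict_mono) auto
  then have S1: "s x1 < S1" "S1 < \<rho>\<^sup>2" by (auto simp: S1_def)
  define c0 where "c0 = (\<rho>\<^sup>2 - S1) ^ 3"
  have c0: "c0 > 0" using S1(2) by (simp add: c0_def)
  obtain M where M: "\<And>x. x \<in> cball y \<rho> \<Longrightarrow> \<bar>\<Sum>b\<in>Basis. HG x b \<bullet> b\<bar> \<le> M * (\<bar>w x\<bar> + norm (G x))"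
    using ineq[OF compact_cball S(2)] by blast
  define n where "n = real (DIM(real^'n))"
  \<comment> \<open>\<open>C1\<close> bounds the Laplacian of m^3 w, term by term, by |w| + |G|;
    \<open>C2\<close> bounds |w| + |G| back by |\<zeta>| + |Z| where the cutoff is at least
    \<open>c0\<close>.\<close>
  define C1 where "C1 = \<rho>^6 * \<bar>M\<bar> + 12 * \<rho>^5 + 6 * n * \<rho>^4 + 24 * \<rho>^4"
  define C2 where "C2 = (1 + 6 * \<rho>^5 / c0) / c0"
  have C1: "C1 \<ge> 0" using \<rho> by (simp add: C1_def n_def)
  have ineq1: "\<bar>\<Sum>b\<in>Basis. ZZ x b \<bullet> b\<bar> \<le> (C1 * C2) * (\<bar>\<zeta> x\<bar> + norm (Z x))" if lt: "s x < S1" for x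
  proof -
    have "(dist x y)\<^sup>2 < \<rho>\<^sup>2" using lt S1(2) by (simp add: sd)
    then have "dist x y < \<rho>" using \<rho> by (simp add: power_less_imp_less_base)
    then have xb: "x \<in> cball y \<rho>" and nx: "norm (x - y) \<le> \<rho>" by (simp_all add: dist_commute dist_norm norm_minus_commute)
    then have xS: "x \<in> S" using S(2) by blast
    have mx: "\<rho>\<^sup>2 - S1 \<le> m x" "m x \<le> \<rho>\<^sup>2" using lt by (auto simp: m_def s_def)
    have mc: "c0 \<le> m x ^ 3" unfolding c0_def using mx(1) S1(2) by (intro power_mono) auto
    have m3: "m x ^ 3 \<le> \<rho>^6" using power_mono[OF mx(2) m0, of 3] by simp
    have m2: "(m x)\<^sup>2 \<le> \<rho>^4" using power_mono[OF mx(2) m0, of 2] by simp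
    define a where "a = \<bar>w x\<bar>"
    define b where "b = norm (G x)"
    define t where "t = (x - y) \<bullet> G x"
    define L where "L = (\<Sum>b\<in>Basis. HG x b \<bullet> b)"
    have ab: "a \<ge> 0" "b \<ge> 0" by (auto simp: a_def b_def)
    have t: "\<bar>t\<bar> \<le> \<rho> * b"
      unfolding t_def b_def using Cauchy_Schwarz_ineq2[of "x - y" "G x"] mult_right_mono[OF nx, of "norm (G x)"] by simp
    have L: "\<bar>L\<bar> \<le> \<bar>M\<bar> * (a + b)"
    proof -
      have "\<bar>L\<bar> \<le> M * (a + b)" using M[OF xb] by (simp add: L_def a_def b_def)
      also have "\<dots> \<le> \<bar>M\<bar> * (a + b)" using ab by (intro mult_right_mono) auto
      finally show ?thesis .
    qed
    have tr: "(\<Sum>b\<in>Basis. (b \<bullet> u) * (v \<bullet> b)) = u \<bullet> v" for u v :: "real^'n"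
      by (subst euclidean_inner) (simp add: inner_commute)
    have one: "(\<Sum>b\<in>(Basis :: (real^'n) set). b \<bullet> b) = n" by (simp add: n_def inner_Basis)
    have "(\<Sum>b\<in>Basis. ZZ x b \<bullet> b) = (\<Sum>b\<in>Basis. m x ^ 3 * (HG x b \<bullet> b)
        - (6 * (m x)\<^sup>2) * ((b \<bullet> (x - y)) * (G x \<bullet> b)) - (6 * (m x)\<^sup>2 * w x) * (b \<bullet> b)
        - (6 * (m x)\<^sup>2) * ((b \<bullet> G x) * ((x - y) \<bullet> b)) + (24 * m x * w x) * ((b \<bullet> (x - y)) * ((x - y) \<bullet> b)))"
      using xS by (intro sum.cong) (simp_all add: ZZ_def ZZ'_def inner_simps algebra_simps)
    also have "\<dots> = m x ^ 3 * L - (6 * (m x)\<^sup>2) * ((x - y) \<bullet> G x) - (6 * (m x)\<^sup>2 * w x) * n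
        - (6 * (m x)\<^sup>2) * (G x \<bullet> (x - y)) + (24 * m x * w x) * ((x - y) \<bullet> (x - y))"
      unfolding sum.distrib sum_subtractf sum_distrib_left[symmetric] tr one L_def ..
    also have "\<dots> = m x ^ 3 * L - 12 * ((m x)\<^sup>2 * t) - 6 * n * ((m x)\<^sup>2 * w x) + 24 * (m x * s x * w x)"
      by (simp add: t_def s_def inner_commute)
    finally have "\<bar>\<Sum>b\<in>Basis. ZZ x b \<bullet> b\<bar> = \<bar>m x ^ 3 * L - 12 * ((m x)\<^sup>2 * t) - 6 * n * ((m x)\<^sup>2 * w x) + 24 * (m x * s x * w x)\<bar>"
      by simp
    also have "\<dots> \<le> \<bar>m x ^ 3 * L\<bar> + \<bar>12 * ((m x)\<^sup>2 * t)\<bar> + \<bar>6 * n * ((m x)\<^sup>2 * w x)\<bar> + \<bar>24 * (m x * s x * w x)\<bar>"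
      by linarith
    also have "\<dots> = m x ^ 3 * \<bar>L\<bar> + 12 * ((m x)\<^sup>2 * \<bar>t\<bar>) + 6 * n * ((m x)\<^sup>2 * a) + 24 * (m x * s x * a)"
      using m0[of x] sd[of x] by (simp add: abs_mult a_def n_def)
    also have "\<dots> \<le> \<rho>^6 * (\<bar>M\<bar> * (a + b)) + 12 * (\<rho>^4 * (\<rho> * b)) + 6 * n * (\<rho>^4 * a) + 24 * (\<rho>\<^sup>2 * \<rho>\<^sup>2 * a)"
    proof -
      have sx: "s x \<le> \<rho>\<^sup>2" "0 \<le> s x" using lt S1(2) by (simp_all add: sd)
      have "m x ^ 3 * \<bar>L\<bar> \<le> \<rho>^6 * (\<bar>M\<bar> * (a + b))"
        by (rule mult_mono[OF m3 L]) (use \<rho> in auto)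
      moreover have "(m x)\<^sup>2 * \<bar>t\<bar> \<le> \<rho>^4 * (\<rho> * b)"
        by (rule mult_mono[OF m2 t]) (use \<rho> in auto)
      moreover have "6 * n * ((m x)\<^sup>2 * a) \<le> 6 * n * (\<rho>^4 * a)"
        by (rule mult_left_mono[OF mult_right_mono[OF m2 ab(1)]]) (simp add: n_def)
      moreover have "m x * s x * a \<le> \<rho>\<^sup>2 * \<rho>\<^sup>2 * a"
        by (rule mult_right_mono[OF mult_mono[OF mx(2) sx(1)] ab(1)]) (use \<rho> sx in auto)
      ultimately show ?thesis by linarith
    qed
    also have "\<dots> \<le> C1 * (a + b)"
    proof -
      have "0 \<le> 12 * \<rho>^5 * a" "0 \<le> 6 * n * \<rho>^4 * b" "0 \<le> 24 * \<rho>^4 * b" using ab \<rho> by (simp_all add: n_def)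
      then show ?thesis by (simp add: C1_def algebra_simps power_numeral_reduce)
    qed
    finally have 1: "\<bar>\<Sum>b\<in>Basis. ZZ x b \<bullet> b\<bar> \<le> C1 * (a + b)" .
    \<comment> \<open>The way back: first w is read off from \<zeta>, then its gradient from
      \<open>Z\<close> and the value of w already bounded.\<close>
    have "c0 * a \<le> m x ^ 3 * a" using mc ab by (intro mult_right_mono)
    also have "\<dots> = \<bar>\<zeta> x\<bar>" using xS m0[of x] by (simp add: \<zeta>_def \<zeta>'_def a_def abs_mult)
    finally have a: "a \<le> \<bar>\<zeta> x\<bar> / c0" using c0 by (simp add: field_simps)
    have "c0 * b \<le> m x ^ 3 * b" using mc ab by (intro mult_right_mono)
    also have "\<dots> = norm (m x ^ 3 *\<^sub>R G x)" using m0[of x] by (simp add: b_def)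
    also have "m x ^ 3 *\<^sub>R G x = Z x + (6 * (m x)\<^sup>2 * w x) *\<^sub>R (x - y)" using xS by (simp add: Z_def Z'_def)
    also have "norm \<dots> \<le> norm (Z x) + 6 * (m x)\<^sup>2 * a * norm (x - y)"
      by (rule order_trans[OF norm_triangle_ineq]) (simp add: a_def abs_mult)
    also have "6 * (m x)\<^sup>2 * a * norm (x - y) \<le> 6 * \<rho>^4 * (\<bar>\<zeta> x\<bar> / c0) * \<rho>"
      using m2 a nx ab \<rho> c0 by (intro mult_mono) auto
    finally have "c0 * b \<le> norm (Z x) + 6 * \<rho>^5 * (\<bar>\<zeta> x\<bar> / c0)" by (simp add: power_numeral_reduce mult_ac)
    then have b: "b \<le> (norm (Z x) + 6 * \<rho>^5 * (\<bar>\<zeta> x\<bar> / c0)) / c0" using c0 by (simp add: pos_le_divide_eq mult.commute)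
    have "a + b \<le> \<bar>\<zeta> x\<bar> / c0 + (norm (Z x) + 6 * \<rho>^5 * (\<bar>\<zeta> x\<bar> / c0)) / c0" using a b by (rule add_mono)
    also have "\<dots> \<le> C2 * (\<bar>\<zeta> x\<bar> + norm (Z x))"
    proof -
      have "0 \<le> 6 * \<rho>^5 / c0 / c0 * norm (Z x)" using \<rho> c0 by simp
      then show ?thesis unfolding C2_def by (simp add: add_divide_distrib algebra_simps)
    qed
    finally have "C1 * (a + b) \<le> C1 * (C2 * (\<bar>\<zeta> x\<bar> + norm (Z x)))" using C1 by (rule mult_left_mono)
    with 1 show ?thesis by (simp add: mult.assoc)
  qed
  have "\<zeta> x1 = 0"
    by (rule carleman_vanishing[OF compact_cball out(1) R(1) near d\<zeta> dZ symZ cZZ ineq1[unfolded s_def] S1(1)[unfolded s_def]])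
  moreover have "x1 \<in> S" using x1 S(2) by (auto simp: dist_commute)
  moreover have "m x1 > 0" using sx1 by (simp add: m_def)
  ultimately show ?thesis by (simp add: \<zeta>_def \<zeta>'_def)
qed

text \<open>Zeros spread from a small ball to a concentric ball whose radius is limited only by the
  distance to the complement of \<open>S\<close>. Hence the interior of the zero set has no boundary
  point in \<open>S\<close>.\<close>

theorem unique_continuation:
  fixes w :: "real^'n \<Rightarrow> real" and G :: "real^'n \<Rightarrow> real^'n"
  assumes S: "open S" "connected S"
    and dw: "\<And>x. x \<in> S \<Longrightarrow> (w has_derivative (\<lambda>h. h \<bullet> G x)) (at x)"
    and dG: "\<And>x. x \<in> S \<Longrightarrow> (G has_derivative HG x) (at x)"
    and sym: "\<And>x h k. x \<in> S \<Longrightarrow> HG x h \<bullet> k = HG x k \<bullet> h"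
    and cont: "\<And>h. continuous_on S (\<lambda>x. HG x h)"
    and ineq: "\<And>K. compact K \<Longrightarrow> K \<subseteq> S \<Longrightarrow>
      \<exists>M. \<forall>x\<in>K. \<bar>\<Sum>b\<in>Basis. HG x b \<bullet> b\<bar> \<le> M * (\<bar>w x\<bar> + norm (G x))"
    and U: "open U" "U \<noteq> {}" "U \<subseteq> S" "\<And>x. x \<in> U \<Longrightarrow> w x = 0"
    and x: "x \<in> S"
  shows "w x = 0"
proof (rule ccontr)
  assume nz: "w x \<noteq> 0"
  define P where "P = interior {x \<in> S. w x = 0}"
  have oP: "open P" by (simp add: P_def)
  have PS: "P \<subseteq> {x \<in> S. w x = 0}" unfolding P_def by (rule interior_subset)
  have UP: "U \<subseteq> P" unfolding P_def using U by (intro interior_maximal) auto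
  have "frontier P \<inter> S \<noteq> {}"
  proof -
    have "S \<inter> P \<noteq> {}" using UP U(2,3) by auto
    moreover have "S - P \<noteq> {}" using x nz PS by auto
    ultimately have "S \<inter> frontier P \<noteq> {}" by (rule connected_Int_frontier[OF S(2)])
    then show ?thesis by (simp only: Int_commute not_False_eq_True)
  qed
  then obtain q where q: "q \<in> frontier P" "q \<in> S" by blast
  obtain d where d: "d > 0" "cball q d \<subseteq> S" using S(1) q(2) open_contains_cball by blast
  have "q \<in> closure P" using q(1) by (simp add: frontier_def)
  \<comment> \<open>The distance d / 4 puts \<open>q\<close> inside the ball of radius d / 2 about
    \<open>z\<close>, while that ball stays within distance d of \<open>q\<close>.\<close>
  then obtain z where z: "z \<in> P" "dist z q < d / 4"
    using d(1) closure_approachable[of q P] by (meson divide_pos_pos zero_less_numeral)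
  obtain R where R: "R > 0" "ball z R \<subseteq> P" using oP z(1) by (auto simp: open_contains_ball)
  have sub: "cball z (d / 2) \<subseteq> S"
  proof
    fix t assume "t \<in> cball z (d / 2)"
    then have "dist q t \<le> d" using z(2) d(1) dist_triangle[of q t z] by (simp add: dist_commute)
    then show "t \<in> S" using d(2) by auto
  qed
  have "w t = 0" if "t \<in> ball z (d / 2)" for t
  proof (rule ball_continuation[where w = w and G = G and HG = HG, OF S(1) sub dw dG sym cont ineq R(1)])
    fix x assume "dist x z < R"
    then have "x \<in> P" using R(2) by (auto simp: dist_commute)
    then show "w x = 0" using PS by blast
  next
    show "dist t z < d / 2" using that by (simp add: dist_commute)
  qed
  then have "ball z (d / 2) \<subseteq> P" unfolding P_def using sub by (intro interior_maximal) auto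
  moreover have "q \<in> ball z (d / 2)" using z(2) d(1) by simp
  ultimately have "q \<in> P" by blast
  with q(1) oP show False by (simp add: frontier_def interior_open)
qed

section \<open>The linearised equation\<close>

lemma lipc_cone:
  fixes p :: "'a::euclidean_space"
  assumes "cball p r \<subseteq> S"
  shows "lipc S (\<lambda>x. max 0 (r - dist x p))"
proof -
  have "1-lipschitz_on UNIV (\<lambda>x. max 0 (r - dist x p))"
  proof (rule lipschitz_onI)
    fix x y :: 'a
    have "\<bar>max 0 (r - dist x p) - max 0 (r - dist y p)\<bar> \<le> \<bar>dist x p - dist y p\<bar>" by linarith
    also have "\<dots> \<le> dist x y" using dist_triangle[of x p y] dist_triangle[of y p x] by (simp add: dist_commute abs_le_iff)
    finally show "dist (max 0 (r - dist x p)) (max 0 (r - dist y p)) \<le> 1 * dist x y" by (simp add: dist_real_def)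
  qed simp
  moreover have "compact (cball p r)" "\<forall>x. x \<notin> cball p r \<longrightarrow> max 0 (r - dist x p) = 0"
    by (auto simp: dist_commute)
  ultimately show ?thesis unfolding lipc_def using assms by blast
qed

text \<open>Schwarz's theorem, obtained by testing: the difference of the mixed derivatives integrates to zero
  against every Lipschitz function.\<close>

lemma symmetric_second_derivative:
  fixes u :: "real^'n \<Rightarrow> real"
  assumes S: "open S"
    and du: "\<And>x. x \<in> S \<Longrightarrow> (u has_derivative (\<lambda>h. h \<bullet> G x)) (at x)"
    and dG: "\<And>x. x \<in> S \<Longrightarrow> (G has_derivative HG x) (at x)"
    and cont: "\<And>h. continuous_on S (\<lambda>x. HG x h)"
    and p: "p \<in> S"
  shows "HG p X \<bullet> e = HG p e \<bullet> X"
proof -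
  have cG: "continuous_on S G"
    using dG by (intro continuous_at_imp_continuous_on ballI has_derivative_continuous) auto
  have loc: "loclip S u" by (rule loclip_of_continuous_derivative[OF S du cG])
  have gGe: "GDERIV (\<lambda>x. G x \<bullet> e) x :> (\<Sum>b\<in>Basis. (HG x b \<bullet> e) *\<^sub>R b)" if x: "x \<in> S" for x e
    unfolding gderiv_def
  proof (rule has_derivative_eq_rhs[OF has_derivative_inner_left[OF dG[OF x]]])
    have lin: "linear (HG x)" using dG[OF x] by (rule has_derivative_linear)
    show "(\<lambda>h. HG x h \<bullet> e) = (\<lambda>h. h \<bullet> (\<Sum>b\<in>Basis. (HG x b \<bullet> e) *\<^sub>R b))"
    proof
      fix h
      have "HG x h \<bullet> e = HG x (\<Sum>a\<in>Basis. (h \<bullet> a) *\<^sub>R a) \<bullet> e" by (simp add: euclidean_representation)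
      then show "HG x h \<bullet> e = h \<bullet> (\<Sum>b\<in>Basis. (HG x b \<bullet> e) *\<^sub>R b)"
        by (simp add: linear_sum[OF lin] linear_scale[OF lin] inner_sum_left inner_sum_right mult.commute)
    qed
  qed
  have gG: "grad (\<lambda>x. G x \<bullet> e) x \<bullet> h = HG x h \<bullet> e" if x: "x \<in> S" for x e h
  proof -
    have d: "((\<lambda>x. G x \<bullet> e) has_derivative (\<lambda>h. h \<bullet> grad (\<lambda>x. G x \<bullet> e) x)) (at x)"
      using grad_works[OF GDERIV_differentiable[OF gGe[OF x]]] by (simp add: gderiv_def)
    have "(\<lambda>h. h \<bullet> grad (\<lambda>x. G x \<bullet> e) x) = (\<lambda>h. HG x h \<bullet> e)"
      by (rule has_derivative_unique[OF d has_derivative_inner_left[OF dG[OF x]]])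
    then show ?thesis by (metis inner_commute)
  qed
  have locG: "loclip S (\<lambda>x. G x \<bullet> e)" for e
  proof (rule loclip_of_continuous_derivative[OF S gGe[unfolded gderiv_def]])
    show "continuous_on S (\<lambda>x. \<Sum>b\<in>Basis. (HG x b \<bullet> e) *\<^sub>R b)" by (intro continuous_intros cont)
  qed
  \<comment> \<open>One derivative is moved from the Hessian to the test function, which leaves
    first derivatives only; \<open>lipc_ibp_swap\<close> then exchanges the two directions.\<close>
  have weak: "integrable lebesgue (\<lambda>x. \<xi> x * (HG x h \<bullet> e))"
    "(\<integral>x. \<xi> x * (HG x h \<bullet> e) \<partial>lebesgue) = - (\<integral>x. (grad u x \<bullet> e) * (grad \<xi> x \<bullet> h) \<partial>lebesgue)"
    if \<xi>: "lipc S \<xi>" for \<xi> e h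
  proof -
    obtain L K where K: "L-lipschitz_on UNIV \<xi>" "L \<ge> 0" "compact K" "K \<subseteq> S" "\<And>x. x \<notin> K \<Longrightarrow> \<xi> x = 0"
      by (rule lipcE[OF \<xi>]) blast
    obtain \<theta> U where \<theta>: "lipc S \<theta>" "open U" "K \<subseteq> U" "U \<subseteq> S" "\<And>x. x \<in> U \<Longrightarrow> \<theta> x = 1"
      by (rule lipc_cutoff[OF K(3) S K(4)]) blast
    define P where "P x = \<theta> x * (G x \<bullet> e)" for x
    have P: "lipc S P" unfolding P_def by (rule lipc_mult_loclip[OF \<theta>(1) locG])
    have gP: "grad P x \<bullet> h = HG x h \<bullet> e" if x: "x \<in> U" for x
    proof -
      have "grad P x = grad (\<lambda>x. G x \<bullet> e) x"
        using \<theta> x by (intro grad_cong_near[OF \<theta>(2)]) (auto simp: P_def)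
      then show ?thesis using gG x \<theta>(4) by auto
    qed
    have eq: "\<xi> x * (grad P x \<bullet> h) = \<xi> x * (HG x h \<bullet> e)" for x
      using gP[of x] K(5)[of x] \<theta>(3) by (cases "x \<in> K") auto
    obtain B where B: "\<And>x. norm (grad P x) \<le> B" by (rule lipc_grad_bound[OF P]) blast
    note [measurable] = lipc_grad_measurable[OF P]
    have "integrable lebesgue (\<lambda>x. \<xi> x * (grad P x \<bullet> h))"
      by (rule lipc_integrable_mult[OF \<xi> _ inner_Basis_bound[OF B]]) measurable
    then show "integrable lebesgue (\<lambda>x. \<xi> x * (HG x h \<bullet> e))" by (simp add: eq)
    have "(\<integral>x. \<xi> x * (HG x h \<bullet> e) \<partial>lebesgue) = (\<integral>x. \<xi> x * (grad P x \<bullet> h) \<partial>lebesgue)" by (simp add: eq)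
    also have "\<dots> = - (\<integral>x. (grad \<xi> x \<bullet> h) * P x \<partial>lebesgue)" by (rule lipc_ibp[OF \<xi> P])
    also have "(\<integral>x. (grad \<xi> x \<bullet> h) * P x \<partial>lebesgue) = (\<integral>x. (grad u x \<bullet> e) * (grad \<xi> x \<bullet> h) \<partial>lebesgue)"
    proof (rule Bochner_Integration.integral_cong)
      fix x
      show "(grad \<xi> x \<bullet> h) * P x = (grad u x \<bullet> e) * (grad \<xi> x \<bullet> h)"
      proof (cases "x \<in> K")
        case True
        then have "x \<in> U" "x \<in> S" using \<theta> by auto
        moreover have "grad u x = G x" using du[OF \<open>x \<in> S\<close>] by (intro grad_eqI) (simp add: gderiv_def)
        ultimately show ?thesis using \<theta>(5) by (simp add: P_def)
      next
        case False
        then show ?thesis using grad_eq_0_outside(2)[OF K(3,5) False] by simp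
      qed
    qed simp
    finally show "(\<integral>x. \<xi> x * (HG x h \<bullet> e) \<partial>lebesgue) = - (\<integral>x. (grad u x \<bullet> e) * (grad \<xi> x \<bullet> h) \<partial>lebesgue)" .
  qed
  have test: "(\<integral>x. \<xi> x * (HG x X \<bullet> e - HG x e \<bullet> X) \<partial>lebesgue) = 0"
    "integrable lebesgue (\<lambda>x. \<xi> x * (HG x X \<bullet> e - HG x e \<bullet> X))" if \<xi>: "lipc S \<xi>" for \<xi> X e
  proof -
    obtain L K where K: "L-lipschitz_on UNIV \<xi>" "L \<ge> 0" "compact K" "K \<subseteq> S" "\<And>x. x \<notin> K \<Longrightarrow> \<xi> x = 0"
      by (rule lipcE[OF \<xi>]) blast
    obtain \<theta> U where \<theta>: "lipc S \<theta>" "open U" "K \<subseteq> U" "U \<subseteq> S" "\<And>x. x \<in> U \<Longrightarrow> \<theta> x = 1"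
      by (rule lipc_cutoff[OF K(3) S K(4)]) blast
    have P: "lipc S (\<lambda>x. \<theta> x * u x)" by (rule lipc_mult_loclip[OF \<theta>(1) loc])
    have eq: "(grad (\<lambda>x. \<theta> x * u x) x \<bullet> a) * (grad \<xi> x \<bullet> b) = (grad u x \<bullet> a) * (grad \<xi> x \<bullet> b)" for x a b
    proof (cases "x \<in> K")
      case True
      then have "grad (\<lambda>x. \<theta> x * u x) x = grad u x" using \<theta> by (intro grad_cong_near[OF \<theta>(2)]) auto
      then show ?thesis by simp
    next
      case False
      then show ?thesis using grad_eq_0_outside(2)[OF K(3,5) False] by simp
    qed
    from lipc_ibp_swap[OF P \<xi>, of e X]
    have "(\<integral>x. (grad u x \<bullet> e) * (grad \<xi> x \<bullet> X) \<partial>lebesgue) = (\<integral>x. (grad u x \<bullet> X) * (grad \<xi> x \<bullet> e) \<partial>lebesgue)"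
      unfolding eq .
    then show "(\<integral>x. \<xi> x * (HG x X \<bullet> e - HG x e \<bullet> X) \<partial>lebesgue) = 0"
      using weak[OF \<xi>, of X e] weak[OF \<xi>, of e X] by (simp add: right_diff_distrib)
    show "integrable lebesgue (\<lambda>x. \<xi> x * (HG x X \<bullet> e - HG x e \<bullet> X))"
      using weak(1)[OF \<xi>, of X e] weak(1)[OF \<xi>, of e X] by (simp add: right_diff_distrib)
  qed
  \<comment> \<open>Only this inequality needs a contradiction; exchanging the two vectors gives the
    reverse one.\<close>
  have le: "HG p X \<bullet> e \<le> HG p e \<bullet> X" for X e
  proof (rule ccontr)
    assume n: "\<not> HG p X \<bullet> e \<le> HG p e \<bullet> X"
    let ?k = "\<lambda>x. HG x X \<bullet> e - HG x e \<bullet> X"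
    have "continuous_on S ?k" by (intro continuous_intros cont)
    then have "open (S \<inter> ?k -` {0<..})" by (rule continuous_open_preimage[OF _ S]) simp
    moreover have "p \<in> S \<inter> ?k -` {0<..}" using p n by simp
    ultimately obtain r where r: "r > 0" "cball p r \<subseteq> S \<inter> ?k -` {0<..}" using open_contains_cball by blast
    \<comment> \<open>A cone that is positive exactly on a ball on which the difference is positive,
      so the vanishing integral would make that ball negligible.\<close>
    define \<xi> where "\<xi> x = max 0 (r - dist x p)" for x
    have \<xi>: "lipc S \<xi>" unfolding \<xi>_def by (rule lipc_cone) (use r in auto)
    have "AE x in lebesgue. \<xi> x * ?k x = 0"
    proof (rule integral_nonneg_eq_0_iff_AE[THEN iffD1, OF test(2)[OF \<xi>] _ test(1)[OF \<xi>]])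
      have "0 \<le> \<xi> x * ?k x" for x
      proof (cases "x \<in> cball p r")
        case True
        then have "0 < ?k x" using r(2) by blast
        then show ?thesis by (simp add: \<xi>_def)
      qed (simp add: \<xi>_def dist_commute)
      then show "AE x in lebesgue. 0 \<le> \<xi> x * ?k x" by simp
    qed
    then obtain N where N: "N \<in> null_sets lebesgue" "{x. \<xi> x * ?k x \<noteq> 0} \<subseteq> N"
      by (auto simp: eventually_ae_filter)
    have "ball p r \<subseteq> {x. \<xi> x * ?k x \<noteq> 0}"
    proof
      fix x assume x: "x \<in> ball p r"
      then have "x \<in> cball p r" by simp
      then have "?k x > 0" using r(2) by blast
      moreover have "\<xi> x > 0" using x by (simp add: \<xi>_def dist_commute)
      ultimately show "x \<in> {x. \<xi> x * ?k x \<noteq> 0}" by simp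
    qed
    then have sub: "ball p r \<subseteq> N" using N(2) by (rule order_trans)
    have "negligible N" using N(1) by (simp add: negligible_iff_null_sets)
    then have "negligible (ball p r)" using sub by (rule negligible_subset)
    then show False using open_not_negligible[OF open_ball, of p r] r(1) by simp
  qed
  show ?thesis by (rule antisym[OF le le])
qed

section \<open>The matrix A(Y): derivative of the flux, eigenvalues, Lipschitz dependence\<close>

locale coefficient =
  fixes a a' :: "real \<Rightarrow> real"
  assumes da: "\<And>t. t \<ge> 0 \<Longrightarrow> (a has_real_derivative a' t) (at t within {0..})"
    and lip_a': "\<And>t. t \<ge> 0 \<Longrightarrow> \<exists>e>0. \<exists>L. L-lipschitz_on (cball t e \<inter> {0..}) a'"
    and pos: "\<And>t. t \<ge> 0 \<Longrightarrow> a t > 0" "\<And>t. t \<ge> 0 \<Longrightarrow> a t + t * a' t > 0"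
begin

lemma deriv_a: "t > 0 \<Longrightarrow> deriv a t = a' t" "t > 0 \<Longrightarrow> (a has_real_derivative a' t) (at t)"
proof -
  assume t: "t > 0"
  have "at t within {0..} = at t" using t by (intro at_within_interior) (simp add: interior_real_atLeast)
  with da[of t] t show "(a has_real_derivative a' t) (at t)" by simp
  then show "deriv a t = a' t" by (rule DERIV_imp_deriv)
qed

text \<open>Uniform in Y: \<open>sgn 0\<close> is 0, so the first term vanishes at Y = 0. Writing
  one factor Y / |Y| as \<open>sgn Y\<close> also isolates the part whose regularity at 0 is in
  doubt.\<close>

lemma A_op_eq: "A_op a Y Z = (a' (norm Y) * (Y \<bullet> Z)) *\<^sub>R sgn Y + a (norm Y) *\<^sub>R Z"
  by (cases "Y = 0") (simp_all add: A_op_def deriv_a sgn_div_norm divide_inverse mult_ac)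

lemma A_op_linear: "linear (A_op a Y)"
  unfolding A_op_eq by (rule linearI) (simp_all add: inner_simps algebra_simps)

lemma A_op_sym: "A_op a Y Z \<bullet> W = A_op a Y W \<bullet> Z"
  unfolding A_op_eq by (cases "Y = 0") (simp_all add: inner_simps inner_commute sgn_div_norm)

text \<open>Even reflection turns one-sided regularity at 0 into regularity on a full neighbourhood,
  so that composition with the norm is covered by \<open>loclip_compose\<close>.\<close>

lemma loclip_a'_abs: "loclip UNIV (\<lambda>t. a' \<bar>t\<bar>)"
  unfolding loclip_def
proof
  fix t :: real
  obtain e L where e: "e > 0" "L-lipschitz_on (cball \<bar>t\<bar> e \<inter> {0..}) a'" using lip_a'[of "\<bar>t\<bar>"] by auto
  have "L-lipschitz_on (ball t e) (\<lambda>t. a' \<bar>t\<bar>)"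
  proof (rule lipschitz_onI)
    fix x y assume xy: "x \<in> ball t e" "y \<in> ball t e"
    have "dist (a' \<bar>x\<bar>) (a' \<bar>y\<bar>) \<le> L * dist \<bar>x\<bar> \<bar>y\<bar>"
      using xy by (intro lipschitz_onD[OF e(2)]) (auto simp: dist_real_def)
    also have "\<dots> \<le> L * dist x y"
      using lipschitz_on_nonneg[OF e(2)] by (intro mult_left_mono) (auto simp: dist_real_def)
    finally show "dist (a' \<bar>x\<bar>) (a' \<bar>y\<bar>) \<le> L * dist x y" .
  qed (rule lipschitz_on_nonneg[OF e(2)])
  then show "\<exists>e>0. \<exists>L. L-lipschitz_on (ball t e) (\<lambda>t. a' \<bar>t\<bar>)" using e(1) by blast
qed

lemma continuous_a'_abs: "continuous_on S (\<lambda>t. a' \<bar>t\<bar>)"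
  by (intro continuous_at_imp_continuous_on ballI loclip_continuous[OF loclip_a'_abs]) auto

lemma loclip_a_abs: "loclip UNIV (\<lambda>t. a \<bar>t\<bar>)"
  unfolding loclip_def
proof
  fix t :: real
  have "compact ((\<lambda>t. a' \<bar>t\<bar>) ` {0..\<bar>t\<bar> + 1})" by (intro compact_continuous_image continuous_a'_abs) simp
  then obtain B where B0: "\<And>s. s \<in> {0..\<bar>t\<bar> + 1} \<Longrightarrow> \<bar>a' \<bar>s\<bar>\<bar> \<le> B"
    using compact_imp_bounded by (fastforce simp: bounded_iff)
  have B: "\<bar>a' s\<bar> \<le> \<bar>B\<bar>" if "s \<in> {0..\<bar>t\<bar> + 1}" for s using B0[OF that] that by simp
  have l: "\<bar>B\<bar>-lipschitz_on {0..\<bar>t\<bar> + 1} a"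
  proof (rule bounded_derivative_imp_lipschitz[where f' = "\<lambda>s h. a' s * h"])
    show "(a has_derivative (\<lambda>h. a' s * h)) (at s within {0..\<bar>t\<bar> + 1})" if "s \<in> {0..\<bar>t\<bar> + 1}" for s
      using has_field_derivative_subset[OF da, of s "{0..\<bar>t\<bar> + 1}"] that by (auto simp: has_field_derivative_def)
    show "onorm (\<lambda>h. a' s * h) \<le> \<bar>B\<bar>" if "s \<in> {0..\<bar>t\<bar> + 1}" for s
      using B[OF that] by (intro onorm_bound) (auto simp: abs_mult mult_right_mono)
  qed auto
  have "\<bar>B\<bar>-lipschitz_on (ball t 1) (\<lambda>t. a \<bar>t\<bar>)"
  proof (rule lipschitz_onI)
    fix x y assume xy: "x \<in> ball t 1" "y \<in> ball t 1"
    have "dist (a \<bar>x\<bar>) (a \<bar>y\<bar>) \<le> \<bar>B\<bar> * dist \<bar>x\<bar> \<bar>y\<bar>"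
      using xy by (intro lipschitz_onD[OF l]) (auto simp: dist_real_def)
    also have "\<dots> \<le> \<bar>B\<bar> * dist x y" by (intro mult_left_mono) (auto simp: dist_real_def)
    finally show "dist (a \<bar>x\<bar>) (a \<bar>y\<bar>) \<le> \<bar>B\<bar> * dist x y" .
  qed simp
  then show "\<exists>e>0. \<exists>L. L-lipschitz_on (ball t e) (\<lambda>t. a \<bar>t\<bar>)" using zero_less_one by blast
qed

lemma continuous_a_abs: "continuous_on S (\<lambda>t. a \<bar>t\<bar>)"
  by (intro continuous_at_imp_continuous_on ballI loclip_continuous[OF loclip_a_abs]) auto

text \<open>The two numbers are the eigenvalues of A(Y) across and along Y. The form is affine in (Y
  . Z)^2 / |Y|, which ranges between 0 and |Y| |Z|^2, so the sign of a' decides which end gives the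
  bound.\<close>

lemma A_op_lower: "min (a (norm Y)) (a (norm Y) + norm Y * a' (norm Y)) * (norm Z)\<^sup>2 \<le> A_op a Y Z \<bullet> Z"
proof (cases "Y = 0")
  case True
  then show ?thesis by (simp add: A_op_eq power2_norm_eq_inner)
next
  case False
  define t where "t = norm Y"
  have t: "t > 0" using False by (simp add: t_def)
  define q where "q = (Y \<bullet> Z)\<^sup>2 / t"
  have q: "0 \<le> q" "q \<le> t * (norm Z)\<^sup>2"
  proof -
    have "\<bar>Y \<bullet> Z\<bar>\<^sup>2 \<le> (t * norm Z)\<^sup>2" unfolding t_def by (intro power_mono Cauchy_Schwarz_ineq2) simp
    then show "q \<le> t * (norm Z)\<^sup>2" using t by (simp add: q_def pos_divide_le_eq power_mult_distrib power2_eq_square mult_ac)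
  qed (use t in \<open>simp add: q_def\<close>)
  have eq: "A_op a Y Z \<bullet> Z = a' t * q + a t * (norm Z)\<^sup>2"
    by (simp add: A_op_eq inner_simps sgn_div_norm t_def q_def power2_eq_square divide_inverse mult_ac flip: power2_norm_eq_inner)
  show ?thesis
  proof (cases "a' t \<ge> 0")
    case True
    have "min (a t) (a t + t * a' t) * (norm Z)\<^sup>2 \<le> a t * (norm Z)\<^sup>2" by (intro mult_right_mono) auto
    also have "\<dots> \<le> a' t * q + a t * (norm Z)\<^sup>2" using True q by simp
    finally show ?thesis unfolding eq t_def .
  next
    case False
    have "min (a t) (a t + t * a' t) * (norm Z)\<^sup>2 \<le> (a t + t * a' t) * (norm Z)\<^sup>2" by (intro mult_right_mono) auto
    also have "\<dots> = a' t * (t * (norm Z)\<^sup>2) + a t * (norm Z)\<^sup>2" by (simp add: algebra_simps)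
    also have "\<dots> \<le> a' t * q + a t * (norm Z)\<^sup>2" using False q by (simp add: mult_left_mono_neg)
    finally show ?thesis unfolding eq t_def .
  qed
qed

text \<open>The origin of A(Y). At 0, continuity of \<open>a\<close> suffices, since the remainder
  divided by |h| is |a(|h|) - a(0)|.\<close>

lemma A_op_field_derivative: "((\<lambda>Y. a (norm Y) *\<^sub>R Y) has_derivative A_op a Y) (at Y)" for Y :: "real^'n"
proof (cases "Y = 0")
  case False
  have "((\<lambda>Y. a (norm Y)) has_derivative (\<lambda>h. a' (norm Y) * (h \<bullet> sgn Y))) (at Y)"
    using has_derivative_compose[OF has_derivative_norm[OF False] deriv_a(2)[of "norm Y", unfolded has_field_derivative_def]] False
    by simp
  from has_derivative_scaleR[OF this has_derivative_ident]
  show ?thesis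
    by (rule has_derivative_eq_rhs)
       (use False in \<open>simp add: fun_eq_iff A_op_eq sgn_div_norm inner_commute mult_ac\<close>)
next
  case True
  have "((\<lambda>h::real^'n. a \<bar>norm h\<bar>) \<longlongrightarrow> a \<bar>norm (0::real^'n)\<bar>) (at 0)"
  proof -
    have "isCont (\<lambda>t. a \<bar>t\<bar>) (norm (0::real^'n))" using loclip_continuous[OF loclip_a_abs] by simp
    then show ?thesis by (rule isCont_tendsto_compose) (intro tendsto_intros)
  qed
  then have lim: "((\<lambda>h::real^'n. \<bar>a (norm h) - a 0\<bar>) \<longlongrightarrow> 0) (at 0)"
    by (intro tendsto_rabs_zero LIM_zero) simp
  have "((\<lambda>Y::real^'n. a (norm Y) *\<^sub>R Y) has_derivative (\<lambda>h. a 0 *\<^sub>R h)) (at 0)"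
    unfolding has_derivative_at
  proof
    show "bounded_linear (\<lambda>h::real^'n. a 0 *\<^sub>R h)" by (rule bounded_linear_scaleR_right)
    show "(\<lambda>h::real^'n. norm (a (norm (0 + h)) *\<^sub>R (0 + h) - a (norm (0::real^'n)) *\<^sub>R 0 - a 0 *\<^sub>R h) / norm h) \<midarrow>0\<rightarrow> 0"
    proof (rule Lim_transform_eventually[OF lim])
      show "\<forall>\<^sub>F h::real^'n in at 0. \<bar>a (norm h) - a 0\<bar>
          = norm (a (norm (0 + h)) *\<^sub>R (0 + h) - a (norm (0::real^'n)) *\<^sub>R 0 - a 0 *\<^sub>R h) / norm h"
        by (simp add: eventually_at_filter flip: scaleR_left_diff_distrib)
    qed
  qed
  then show ?thesis using True by (simp add: A_op_eq[abs_def])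
qed

text \<open>The jump of \<open>sgn\<close> at 0 is compensated by the factor W . Y, which vanishes
  there to first order.\<close>

lemma loclip_A_op: "loclip UNIV (\<lambda>W. A_op a W Y \<bullet> Z)" for Y Z :: "real^'n"
proof -
  have n: "loclip UNIV (norm :: real^'n \<Rightarrow> real)"
    by (rule lipschitz_imp_loclip[of 1], rule lipschitz_onI) (auto simp: dist_norm dist_real_def norm_triangle_ineq3)
  have 1: "loclip UNIV (\<lambda>W::real^'n. a' \<bar>norm W\<bar>)" "loclip UNIV (\<lambda>W::real^'n. a \<bar>norm W\<bar>)"
    by (rule loclip_compose[OF n loclip_subset[OF loclip_a'_abs]], simp,
        rule loclip_compose[OF n loclip_subset[OF loclip_a_abs]], simp)
  have s: "(3 * norm Y)-lipschitz_on UNIV (\<lambda>W. (W \<bullet> Y) *\<^sub>R sgn W)"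
  proof (rule lipschitz_onI)
    fix V W :: "real^'n"
    have zero: "norm ((W \<bullet> Y) *\<^sub>R sgn W) \<le> 3 * norm Y * norm W" for W
    proof -
      have "norm ((W \<bullet> Y) *\<^sub>R sgn W) \<le> \<bar>W \<bullet> Y\<bar> * 1" unfolding norm_scaleR by (intro mult_left_mono) (auto simp: norm_sgn)
      also have "\<dots> \<le> norm W * norm Y" using Cauchy_Schwarz_ineq2 by simp
      also have "\<dots> \<le> 3 * norm Y * norm W" by (simp add: mult_ac)
      finally show ?thesis .
    qed
    show "dist ((V \<bullet> Y) *\<^sub>R sgn V) ((W \<bullet> Y) *\<^sub>R sgn W) \<le> 3 * norm Y * dist V W"
    proof (cases "V = 0 \<or> W = 0")
      case True
      then show ?thesis using zero[of V] zero[of W] by (auto simp: dist_norm)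
    next
      case False
      have sV: "norm (sgn V) = 1" using False by (simp add: norm_sgn)
      \<comment> \<open>Accounts for two of the three units in the Lipschitz constant 3 |Y|; the
        third comes from the change of the factor W . Y.\<close>
      have "norm W * norm (sgn V - sgn W) \<le> 2 * dist V W"
      proof -
        have "norm W * norm (sgn V - sgn W) = norm (norm W *\<^sub>R sgn V - norm W *\<^sub>R sgn W)"
          by (simp flip: scaleR_diff_right)
        also have "norm W *\<^sub>R sgn V - norm W *\<^sub>R sgn W = (norm W - norm V) *\<^sub>R sgn V + (V - W)"
          using False by (simp add: sgn_div_norm algebra_simps)
        also have "norm \<dots> \<le> \<bar>norm W - norm V\<bar> + norm (V - W)"
          by (rule order_trans[OF norm_triangle_ineq]) (simp add: sV)
        also have "\<dots> \<le> 2 * dist V W" using norm_triangle_ineq3[of W V] by (simp add: dist_norm norm_minus_commute)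
        finally show ?thesis .
      qed
      then have b: "norm Y * (norm W * norm (sgn V - sgn W)) \<le> norm Y * (2 * dist V W)" by (rule mult_left_mono) simp
      have "(V \<bullet> Y) *\<^sub>R sgn V - (W \<bullet> Y) *\<^sub>R sgn W = ((V - W) \<bullet> Y) *\<^sub>R sgn V + (W \<bullet> Y) *\<^sub>R (sgn V - sgn W)"
        by (simp add: inner_diff_left algebra_simps)
      then have "dist ((V \<bullet> Y) *\<^sub>R sgn V) ((W \<bullet> Y) *\<^sub>R sgn W)
          \<le> \<bar>(V - W) \<bullet> Y\<bar> + \<bar>W \<bullet> Y\<bar> * norm (sgn V - sgn W)"
        using norm_triangle_ineq[of "((V - W) \<bullet> Y) *\<^sub>R sgn V" "(W \<bullet> Y) *\<^sub>R (sgn V - sgn W)"] by (simp add: dist_norm sV)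
      also have "\<dots> \<le> norm (V - W) * norm Y + (norm W * norm Y) * norm (sgn V - sgn W)"
        by (intro add_mono Cauchy_Schwarz_ineq2 mult_right_mono) simp
      also have "\<dots> \<le> 3 * norm Y * dist V W" using b by (simp add: dist_norm algebra_simps)
      finally show ?thesis .
    qed
  qed simp
  have 2: "loclip UNIV (\<lambda>W. (a' \<bar>norm W\<bar> *\<^sub>R ((W \<bullet> Y) *\<^sub>R sgn W) + a \<bar>norm W\<bar> *\<^sub>R Y) \<bullet> Z)"
    by (rule loclip_bounded_linear[OF bounded_linear_inner_left])
       (intro loclip_add loclip_scaleR 1 loclip_const lipschitz_imp_loclip[OF s])
  have "(a' \<bar>norm W\<bar> *\<^sub>R ((W \<bullet> Y) *\<^sub>R sgn W) + a \<bar>norm W\<bar> *\<^sub>R Y) \<bullet> Z = A_op a W Y \<bullet> Z" for W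
    by (simp add: A_op_eq)
  with 2 show ?thesis by simp
qed

end

section \<open>Weak linearisation of the equation\<close>

lemma integrable_grad_product:
  fixes P \<xi> :: "real^'n \<Rightarrow> real"
  assumes P: "lipc S P" and \<xi>: "lipc T \<xi>"
  shows "integrable lebesgue (\<lambda>x. (grad P x \<bullet> d) * (grad \<xi> x \<bullet> e))"
proof -
  obtain L K where K: "L-lipschitz_on UNIV \<xi>" "L \<ge> 0" "compact K" "K \<subseteq> T" "\<And>x. x \<notin> K \<Longrightarrow> \<xi> x = 0"
    by (rule lipcE[OF \<xi>]) blast
  obtain B where B: "\<And>x. norm (grad P x) \<le> B" by (rule lipc_grad_bound[OF P]) blast
  obtain B' where B': "\<And>x. norm (grad \<xi> x) \<le> B'" by (rule lipc_grad_bound[OF \<xi>]) blast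
  have B0: "0 \<le> B" using B[of 0] norm_ge_zero order_trans by blast
  note [measurable] = lipc_grad_measurable[OF P] lipc_grad_measurable[OF \<xi>]
  show ?thesis
  proof (rule integrable_compact_supportI[OF _ K(3)])
    show "(\<lambda>x. (grad P x \<bullet> d) * (grad \<xi> x \<bullet> e)) \<in> borel_measurable lebesgue" by measurable
    have "\<bar>(grad P x \<bullet> d) * (grad \<xi> x \<bullet> e)\<bar> \<le> (B * norm d) * (B' * norm e)" for x
      unfolding abs_mult using B0 by (intro mult_mono inner_Basis_bound B B') auto
    then show "AE x in lebesgue. \<bar>(grad P x \<bullet> d) * (grad \<xi> x \<bullet> e)\<bar> \<le> (B * norm d) * (B' * norm e)" by simp
  qed (use grad_eq_0_outside(2)[OF K(3,5)] in simp)
qed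

text \<open>\<open>HG\<close> is the Hessian of \<open>u\<close>, and \<open>eqn\<close> is the
  equation with the divergence carried out by the chain rule.\<close>

locale quasilinear = coefficient a a' for a a' +
  fixes \<Omega> :: "(real^'n) set" and u :: "real^'n \<Rightarrow> real" and HG :: "real^'n \<Rightarrow> real^'n \<Rightarrow> real^'n"
    and f f' :: "real \<Rightarrow> real"
  assumes open_\<Omega>: "open \<Omega>"
    and du: "\<And>x. x \<in> \<Omega> \<Longrightarrow> (u has_derivative (\<lambda>h. h \<bullet> grad u x)) (at x)"
    and dG: "\<And>x. x \<in> \<Omega> \<Longrightarrow> (grad u has_derivative HG x) (at x)"
    and cont_HG: "\<And>h. continuous_on \<Omega> (\<lambda>x. HG x h)"
    and df: "\<And>t. (f has_real_derivative f' t) (at t)"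
    and cont_f': "continuous_on UNIV f'"
    and eqn: "\<And>x. x \<in> \<Omega> \<Longrightarrow> (\<Sum>b\<in>Basis. A_op a (grad u x) (HG x b) \<bullet> b) + f (u x) = 0"
begin

lemma sym_HG: "x \<in> \<Omega> \<Longrightarrow> HG x h \<bullet> k = HG x k \<bullet> h"
  by (rule symmetric_second_derivative[OF open_\<Omega> du dG cont_HG])

lemma linear_HG: "x \<in> \<Omega> \<Longrightarrow> linear (HG x)"
  using dG has_derivative_linear by blast

lemma continuous_grad: "continuous_on \<Omega> (grad u)"
  using dG by (intro continuous_at_imp_continuous_on ballI has_derivative_continuous) auto

lemma continuous_u: "continuous_on \<Omega> u"
  using du by (intro continuous_at_imp_continuous_on ballI has_derivative_continuous) auto

lemma GDERIV_of_has_derivative: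
  assumes "(g has_derivative g') (at x)"
  shows "GDERIV g x :> grad g x" "grad g x \<bullet> h = g' h"
proof -
  show *: "GDERIV g x :> grad g x" using assms by (intro grad_works differentiableI)
  have "(\<lambda>h. h \<bullet> grad g x) = g'"
    using has_derivative_unique[OF *[unfolded gderiv_def] assms] .
  then show "grad g x \<bullet> h = g' h" by (metis inner_commute)
qed

lemma loclip_C1:
  fixes g :: "real^'n \<Rightarrow> real"
  assumes d: "\<And>x. x \<in> \<Omega> \<Longrightarrow> (g has_derivative g' x) (at x)" and c: "\<And>h. continuous_on \<Omega> (\<lambda>x. g' x h)"
  shows "loclip \<Omega> g"
proof (rule loclip_of_continuous_derivative[OF open_\<Omega>])
  show "(g has_derivative (\<lambda>h. h \<bullet> grad g x)) (at x)" if "x \<in> \<Omega>" for x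
    using GDERIV_of_has_derivative(1)[OF d[OF that]] by (simp add: gderiv_def)
  have "continuous_on \<Omega> (\<lambda>x. \<Sum>b\<in>Basis. g' x b *\<^sub>R b)" by (intro continuous_intros c)
  then show "continuous_on \<Omega> (grad g)"
  proof (rule continuous_on_eq)
    fix x assume x: "x \<in> \<Omega>"
    have "grad g x = (\<Sum>b\<in>Basis. (grad g x \<bullet> b) *\<^sub>R b)" by (simp only: euclidean_representation)
    then show "(\<Sum>b\<in>Basis. g' x b *\<^sub>R b) = grad g x" by (simp only: GDERIV_of_has_derivative(2)[OF d[OF x]])
  qed
qed

lemma dv: "x \<in> \<Omega> \<Longrightarrow> ((\<lambda>x. grad u x \<bullet> X) has_derivative (\<lambda>h. HG x h \<bullet> X)) (at x)"
  by (rule has_derivative_inner_left[OF dG])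

lemma loclip_v: "loclip \<Omega> (\<lambda>x. grad u x \<bullet> X)"
  by (rule loclip_C1[OF dv]) (auto intro: continuous_intros cont_HG)

text \<open>Symmetry of the Hessian turns the derivative of a directional derivative into the vector
  \<open>HG x X\<close>, the gradient to which A is applied in the linearised equation.\<close>

lemma GDERIV_v:
  assumes x: "x \<in> \<Omega>"
  shows "GDERIV (\<lambda>x. grad u x \<bullet> X) x :> HG x X"
proof -
  have "(\<lambda>h. HG x h \<bullet> X) = (\<lambda>h. h \<bullet> HG x X)"
  proof
    fix h
    show "HG x h \<bullet> X = h \<bullet> HG x X" using sym_HG[OF x, of h X] by (simp add: inner_commute)
  qed
  with dv[OF x, of X] show ?thesis by (simp only: gderiv_def)
qed

lemma loclip_grad: "loclip \<Omega> (grad u)"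
proof -
  have "loclip \<Omega> (\<lambda>x. \<Sum>b\<in>Basis. (grad u x \<bullet> b) *\<^sub>R b)"
    by (intro loclip_sum loclip_scaleR loclip_v loclip_const)
  then show ?thesis by (simp add: euclidean_representation)
qed

definition flux :: "real^'n \<Rightarrow> real^'n" where "flux x = a (norm (grad u x)) *\<^sub>R grad u x"

lemma dflux: "x \<in> \<Omega> \<Longrightarrow> (flux has_derivative (\<lambda>h. A_op a (grad u x) (HG x h))) (at x)"
  unfolding flux_def[abs_def] using has_derivative_compose[OF dG A_op_field_derivative] .

lemma continuous_A_grad: "continuous_on \<Omega> (\<lambda>x. A_op a (grad u x) Y \<bullet> Z)"
  using loclip_continuous[OF loclip_compose[OF loclip_grad loclip_subset[OF loclip_A_op[of Y Z]]]]
  by (intro continuous_at_imp_continuous_on) auto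

lemma A_expand: "A_op a W Y \<bullet> Z = (\<Sum>b\<in>Basis. (Y \<bullet> b) * (A_op a W b \<bullet> Z))" for W Y Z :: "real^'n"
proof -
  have "A_op a W Y \<bullet> Z = A_op a W (\<Sum>b\<in>Basis. (Y \<bullet> b) *\<^sub>R b) \<bullet> Z" by (simp only: euclidean_representation)
  then show ?thesis
    by (simp only: linear_sum[OF A_op_linear] linear_scale[OF A_op_linear] inner_sum_left inner_scaleR_left)
qed

lemma continuous_A_HG: "continuous_on \<Omega> (\<lambda>x. A_op a (grad u x) (HG x h) \<bullet> Z)"
  unfolding A_expand[of _ "HG _ _"] by (intro continuous_intros cont_HG continuous_A_grad)

lemma dfu: "x \<in> \<Omega> \<Longrightarrow> ((\<lambda>x. f (u x)) has_derivative (\<lambda>h. f' (u x) * (h \<bullet> grad u x))) (at x)"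
  using has_derivative_compose[OF du df[unfolded has_field_derivative_def]] .

lemma loclip_fu: "loclip \<Omega> (\<lambda>x. f (u x))"
  by (rule loclip_C1[OF dfu])
     (auto intro!: continuous_intros continuous_grad continuous_on_compose2[OF cont_f' continuous_u])

text \<open>Formally the equation is tested with the X-derivative of \<xi>. Exchanging X with the
  direction of the divergence puts the latter on the flux, where the equation replaces it by -f(u);
  a last integration by parts differentiates f(u) in direction X.\<close>

lemma linearised_equation:
  assumes \<xi>: "lipc \<Omega> \<xi>"
  shows "integrable lebesgue (\<lambda>x. A_op a (grad u x) (HG x X) \<bullet> grad \<xi> x)"
    and "(\<integral>x. A_op a (grad u x) (HG x X) \<bullet> grad \<xi> x \<partial>lebesgue)
      = (\<integral>x. f' (u x) * ((grad u x \<bullet> X) * \<xi> x) \<partial>lebesgue)"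
proof -
  obtain L K where K: "L-lipschitz_on UNIV \<xi>" "L \<ge> 0" "compact K" "K \<subseteq> \<Omega>" "\<And>x. x \<notin> K \<Longrightarrow> \<xi> x = 0"
    by (rule lipcE[OF \<xi>]) blast
  obtain \<theta> U where \<theta>: "lipc \<Omega> \<theta>" "open U" "K \<subseteq> U" "U \<subseteq> \<Omega>" "\<And>x. x \<in> U \<Longrightarrow> \<theta> x = 1"
    by (rule lipc_cutoff[OF K(3) open_\<Omega> K(4)]) blast
  \<comment> \<open>Flux components and f(u), cut off near the support of \<xi> to become Lipschitz
    on the whole space; on the support their gradients are the original ones.\<close>
  define P where "P b x = \<theta> x * (flux x \<bullet> b)" for b x
  define P0 where "P0 x = \<theta> x * f (u x)" for x
  have "loclip \<Omega> (\<lambda>x. flux x \<bullet> b)" for b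
    by (rule loclip_C1[OF has_derivative_inner_left[OF dflux]]) (assumption, rule continuous_A_HG)
  then have P: "lipc \<Omega> (P b)" for b unfolding P_def by (rule lipc_mult_loclip[OF \<theta>(1)])
  have P0: "lipc \<Omega> P0" unfolding P0_def by (rule lipc_mult_loclip[OF \<theta>(1) loclip_fu])
  have gP: "grad (P b) x \<bullet> h = A_op a (grad u x) (HG x h) \<bullet> b" if x: "x \<in> K" for x b h
  proof -
    have xU: "x \<in> U" "x \<in> \<Omega>" using x \<theta>(3) K(4) by auto
    have "grad (P b) x = grad (\<lambda>x. flux x \<bullet> b) x"
      using \<theta>(5) by (intro grad_cong_near[OF \<theta>(2) xU(1)]) (simp add: P_def)
    then show ?thesis using GDERIV_of_has_derivative(2)[OF has_derivative_inner_left[OF dflux[OF xU(2)]]] by simp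
  qed
  have gP0: "grad P0 x \<bullet> h = f' (u x) * (h \<bullet> grad u x)" if x: "x \<in> K" for x h
  proof -
    have xU: "x \<in> U" "x \<in> \<Omega>" using x \<theta>(3) K(4) by auto
    have "grad P0 x = grad (\<lambda>x. f (u x)) x"
      using \<theta>(5) by (intro grad_cong_near[OF \<theta>(2) xU(1)]) (simp add: P0_def)
    then show ?thesis using GDERIV_of_has_derivative(2)[OF dfu[OF xU(2)]] by simp
  qed
  have g0: "grad \<xi> x = 0" if "x \<notin> K" for x using grad_eq_0_outside(2)[OF K(3,5) that] .
  have i: "integrable lebesgue (\<lambda>x. (grad (P b) x \<bullet> d) * (grad \<xi> x \<bullet> e))" for b d e
    by (rule integrable_grad_product[OF P \<xi>])
  have eq1: "A_op a (grad u x) (HG x X) \<bullet> grad \<xi> x = (\<Sum>b\<in>Basis. (grad (P b) x \<bullet> X) * (grad \<xi> x \<bullet> b))" for x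
  proof (cases "x \<in> K")
    case True
    then show ?thesis by (subst euclidean_inner) (simp add: gP)
  qed (simp add: g0)
  show "integrable lebesgue (\<lambda>x. A_op a (grad u x) (HG x X) \<bullet> grad \<xi> x)"
    unfolding eq1 by (intro Bochner_Integration.integrable_sum i)
  have "(\<integral>x. A_op a (grad u x) (HG x X) \<bullet> grad \<xi> x \<partial>lebesgue)
      = (\<Sum>b\<in>Basis. \<integral>x. (grad (P b) x \<bullet> X) * (grad \<xi> x \<bullet> b) \<partial>lebesgue)"
    unfolding eq1 by (rule Bochner_Integration.integral_sum) (rule i)
  also have "\<dots> = (\<Sum>b\<in>Basis. \<integral>x. (grad (P b) x \<bullet> b) * (grad \<xi> x \<bullet> X) \<partial>lebesgue)"
    by (rule sum.cong[OF refl lipc_ibp_swap[OF P \<xi>]])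
  also have "\<dots> = (\<integral>x. (\<Sum>b\<in>Basis. (grad (P b) x \<bullet> b) * (grad \<xi> x \<bullet> X)) \<partial>lebesgue)"
    by (rule Bochner_Integration.integral_sum[symmetric]) (rule i)
  also have "\<dots> = (\<integral>x. - (P0 x * (grad \<xi> x \<bullet> X)) \<partial>lebesgue)"
  proof (rule Bochner_Integration.integral_cong)
    fix x
    show "(\<Sum>b\<in>Basis. (grad (P b) x \<bullet> b) * (grad \<xi> x \<bullet> X)) = - (P0 x * (grad \<xi> x \<bullet> X))"
    proof (cases "x \<in> K")
      case True
      then have xU: "x \<in> U" "x \<in> \<Omega>" using \<theta>(3) K(4) by auto
      have "(\<Sum>b\<in>Basis. grad (P b) x \<bullet> b) = - P0 x"
        using eqn[OF xU(2)] \<theta>(5)[OF xU(1)] by (simp add: gP[OF True] P0_def)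
      then show ?thesis by (simp flip: sum_distrib_right)
    qed (simp add: g0)
  qed simp
  also have "\<dots> = - (\<integral>x. P0 x * (grad \<xi> x \<bullet> X) \<partial>lebesgue)" by simp
  also have "\<dots> = (\<integral>x. (grad P0 x \<bullet> X) * \<xi> x \<partial>lebesgue)" using lipc_ibp[OF P0 \<xi>, of X] by simp
  also have "\<dots> = (\<integral>x. f' (u x) * ((grad u x \<bullet> X) * \<xi> x) \<partial>lebesgue)"
  proof (rule Bochner_Integration.integral_cong)
    show "(grad P0 x \<bullet> X) * \<xi> x = f' (u x) * ((grad u x \<bullet> X) * \<xi> x)" for x
      using gP0[of x X] K(5)[of x] by (cases "x \<in> K") (auto simp: inner_commute)
  qed simp
  finally show "(\<integral>x. A_op a (grad u x) (HG x X) \<bullet> grad \<xi> x \<partial>lebesgue)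
      = (\<integral>x. f' (u x) * ((grad u x \<bullet> X) * \<xi> x) \<partial>lebesgue)" .
qed

lemma elliptic_on_compact:
  assumes K: "compact K" "K \<subseteq> \<Omega>"
  shows "\<exists>l>0. \<forall>x\<in>K. \<forall>Z. l * (norm Z)\<^sup>2 \<le> A_op a (grad u x) Z \<bullet> Z"
proof (cases "K = {}")
  case False
  define \<mu> where "\<mu> x = min (a \<bar>norm (grad u x)\<bar>) (a \<bar>norm (grad u x)\<bar> + norm (grad u x) * a' \<bar>norm (grad u x)\<bar>)" for x
  have cn: "continuous_on K (\<lambda>x. norm (grad u x))"
    by (intro continuous_intros continuous_on_subset[OF continuous_grad K(2)])
  have ca: "continuous_on K (\<lambda>x. a \<bar>norm (grad u x)\<bar>)" "continuous_on K (\<lambda>x. a' \<bar>norm (grad u x)\<bar>)"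
    by (rule continuous_on_compose2[OF continuous_a_abs[of UNIV] cn], simp,
        rule continuous_on_compose2[OF continuous_a'_abs[of UNIV] cn], simp)
  have "continuous_on K \<mu>" unfolding \<mu>_def by (intro continuous_intros cn ca)
  then obtain z where z: "z \<in> K" "\<And>x. x \<in> K \<Longrightarrow> \<mu> z \<le> \<mu> x"
    using continuous_attains_inf[OF K(1) False] by blast
  have "\<mu> z > 0" using pos[of "norm (grad u z)"] by (simp add: \<mu>_def)
  moreover have "\<mu> z * (norm Z)\<^sup>2 \<le> A_op a (grad u x) Z \<bullet> Z" if "x \<in> K" for x Z
  proof -
    have "\<mu> z * (norm Z)\<^sup>2 \<le> \<mu> x * (norm Z)\<^sup>2" using z(2)[OF that] by (intro mult_right_mono) auto
    also have "\<dots> \<le> A_op a (grad u x) Z \<bullet> Z" using A_op_lower[of "grad u x" Z] by (simp add: \<mu>_def)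
    finally show ?thesis .
  qed
  ultimately show ?thesis by blast
qed (auto intro: exI[of _ 1])

lemma elliptic_form_linearised: "elliptic_form \<Omega> (\<lambda>x. A_op a (grad u x)) (\<lambda>x. f' (u x))"
proof (rule elliptic_form.intro)
  show "loclip \<Omega> (\<lambda>x. A_op a (grad u x) Y \<bullet> Z)" for Y Z
    by (rule loclip_compose[OF loclip_grad loclip_subset[OF loclip_A_op]]) simp
  show "continuous_on \<Omega> (\<lambda>x. f' (u x))" by (rule continuous_on_compose2[OF cont_f' continuous_u]) simp
  show "open \<Omega>" by (rule open_\<Omega>)
  show "linear (A_op a (grad u x))" for x by (rule A_op_linear)
  show "A_op a (grad u x) Y \<bullet> Z = A_op a (grad u x) Z \<bullet> Y" for x Y Z by (rule A_op_sym)
  show "\<exists>l>0. \<forall>x\<in>K. \<forall>Z. l * (norm Z)\<^sup>2 \<le> A_op a (grad u x) Z \<bullet> Z"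
    if "compact K" "K \<subseteq> \<Omega>" for K by (rule elliptic_on_compact[OF that])
qed

text \<open>Unique continuation for u - k with the Laplacian as principal part. The quasilinear
  second-order term contains the factor grad u, so on compact sets, where the Hessian is bounded, it
  counts as a first-order term.\<close>

lemma constant_if_locally_constant:
  assumes conn: "connected \<Omega>" and U: "open U" "U \<noteq> {}" "U \<subseteq> \<Omega>" "\<And>x. x \<in> U \<Longrightarrow> grad u x = 0"
  obtains k where "\<And>x. x \<in> \<Omega> \<Longrightarrow> u x = k"
proof -
  obtain x0 where x0: "x0 \<in> U" using U(2) by blast
  obtain r where r: "r > 0" "ball x0 r \<subseteq> U" using U(1) x0 open_contains_ball by blast
  define k where "k = u x0"
  have uk: "u x = k" if "x \<in> ball x0 r" for x
  proof -
    have "\<exists>c. \<forall>x\<in>ball x0 r. u x = c"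
    proof (rule has_derivative_zero_constant)
      fix y assume "y \<in> ball x0 r"
      then have "y \<in> U" using r(2) by blast
      then have "(u has_derivative (\<lambda>h. 0)) (at y)" using du[of y] U(3,4) by auto
      then show "(u has_derivative (\<lambda>h. 0)) (at y within ball x0 r)" by (rule has_derivative_at_withinI)
    qed simp
    then obtain c where c: "\<And>x. x \<in> ball x0 r \<Longrightarrow> u x = c" by blast
    have "x0 \<in> ball x0 r" using r(1) by simp
    then show ?thesis unfolding k_def using c[OF that] c[of x0] by simp
  qed
  \<comment> \<open>On the ball the constant k itself solves the equation; this makes f(u)
    comparable with u - k.\<close>
  have fk: "f k = 0"
  proof -
    have x: "x0 \<in> \<Omega>" using x0 U(3) by blast
    have "(grad u has_derivative (\<lambda>h. 0)) (at x0)"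
      by (rule has_derivative_transform_within_open[OF has_derivative_const U(1) x0]) (simp add: U(4))
    then have "HG x0 = (\<lambda>h. 0)" using has_derivative_unique[OF dG[OF x]] by blast
    then show ?thesis using eqn[OF x] by (simp add: linear_0[OF A_op_linear] k_def)
  qed
  have "u x - k = 0" if x: "x \<in> \<Omega>" for x
  proof (rule unique_continuation[where w = "\<lambda>x. u x - k" and G = "grad u" and HG = HG and U = "ball x0 r", OF open_\<Omega> conn _ dG sym_HG cont_HG])
    show "((\<lambda>x. u x - k) has_derivative (\<lambda>h. h \<bullet> grad u x)) (at x)" if "x \<in> \<Omega>" for x
      by (rule has_derivative_eq_rhs, (rule du[OF that] derivative_intros)+) simp
    show "open (ball x0 r)" "ball x0 r \<noteq> {}" "ball x0 r \<subseteq> \<Omega>" using r U(3) by auto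
    show "u x - k = 0" if "x \<in> ball x0 r" for x using uk[OF that] by simp
    show "x \<in> \<Omega>" by fact
    fix K :: "(real^'n) set" assume K: "compact K" "K \<subseteq> \<Omega>"
    have bdd: "\<exists>B\<ge>0. \<forall>x\<in>K. \<bar>g x\<bar> \<le> B" if g: "continuous_on K g" for g :: "real^'n \<Rightarrow> real"
    proof -
      have "compact (g ` K)" using K(1) g by (intro compact_continuous_image)
      then obtain B where "\<And>x. x \<in> K \<Longrightarrow> \<bar>g x\<bar> \<le> B" using compact_imp_bounded by (fastforce simp: bounded_iff)
      then have "\<forall>x\<in>K. \<bar>g x\<bar> \<le> \<bar>B\<bar>" by (meson abs_ge_self order_trans)
      then show ?thesis by (intro exI[of _ "\<bar>B\<bar>"]) simp
    qed
    have cG: "continuous_on K (grad u)" by (rule continuous_on_subset[OF continuous_grad K(2)])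
    have cn: "continuous_on K (\<lambda>x. norm (grad u x))" by (intro continuous_intros cG)
    have ca: "continuous_on K (\<lambda>x. a \<bar>norm (grad u x)\<bar>)" "continuous_on K (\<lambda>x. a' \<bar>norm (grad u x)\<bar>)"
      by (rule continuous_on_compose2[OF continuous_a_abs[of UNIV] cn], simp,
          rule continuous_on_compose2[OF continuous_a'_abs[of UNIV] cn], simp)
    have apos: "a \<bar>norm (grad u x)\<bar> > 0" for x by (rule pos) simp
    have "continuous_on K (\<lambda>x. inverse (a \<bar>norm (grad u x)\<bar>))"
      by (rule continuous_on_inverse[OF ca(1)]) (use less_imp_neq[OF apos] in fastforce)
    then obtain B1 where B1: "B1 \<ge> 0" "\<And>x. x \<in> K \<Longrightarrow> \<bar>inverse (a \<bar>norm (grad u x)\<bar>)\<bar> \<le> B1"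
      using bdd by blast
    obtain B2 where B2: "B2 \<ge> 0" "\<And>x. x \<in> K \<Longrightarrow> \<bar>a' \<bar>norm (grad u x)\<bar>\<bar> \<le> B2" using bdd[OF ca(2)] by blast
    have "continuous_on K (\<lambda>x. \<Sum>b\<in>Basis. norm (HG x b))"
      by (intro continuous_intros continuous_on_subset[OF cont_HG K(2)])
    then obtain B3 where B3: "B3 \<ge> 0" "\<And>x. x \<in> K \<Longrightarrow> \<bar>\<Sum>b\<in>Basis. norm (HG x b)\<bar> \<le> B3" using bdd by blast
    obtain B4 where B4: "B4 \<ge> 0" "\<And>x. x \<in> K \<Longrightarrow> \<bar>u x\<bar> \<le> B4"
      using bdd[OF continuous_on_subset[OF continuous_u K(2)]] by blast
    \<comment> \<open>An interval containing k and all values of \<open>u\<close> on the compact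
      set, on which f is Lipschitz.\<close>
    define J where "J = {- (B4 + \<bar>k\<bar>)..B4 + \<bar>k\<bar>}"
    have "compact (f' ` J)" unfolding J_def by (intro compact_continuous_image continuous_on_subset[OF cont_f']) auto
    then obtain B5 where "\<And>t. t \<in> J \<Longrightarrow> \<bar>f' t\<bar> \<le> B5" using compact_imp_bounded by (fastforce simp: bounded_iff)
    then have B5: "\<bar>f' t\<bar> \<le> \<bar>B5\<bar>" if "t \<in> J" for t using that abs_ge_self order_trans by blast
    have fl: "\<bar>f (u x)\<bar> \<le> \<bar>B5\<bar> * \<bar>u x - k\<bar>" if x: "x \<in> K" for x
    proof -
      have "\<bar>B5\<bar>-lipschitz_on J f"
      proof (rule bounded_derivative_imp_lipschitz[where f' = "\<lambda>s h. f' s * h"])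
        show "(f has_derivative (\<lambda>h. f' s * h)) (at s within J)" for s
          by (rule has_derivative_at_withinI[OF df[unfolded has_field_derivative_def]])
        show "onorm (\<lambda>h. f' s * h) \<le> \<bar>B5\<bar>" if "s \<in> J" for s
          using B5[OF that] by (intro onorm_bound) (auto simp: abs_mult mult_right_mono)
      qed (auto simp: J_def)
      moreover have "u x \<in> J" "k \<in> J"
        using abs_le_D1[OF B4(2)[OF x]] abs_le_D2[OF B4(2)[OF x]] B4(1) abs_ge_self[of k] abs_ge_minus_self[of k]
        unfolding J_def atLeastAtMost_iff by linarith+
      ultimately show ?thesis using lipschitz_onD[of "\<bar>B5\<bar>" J f "u x" k] fk by (simp add: dist_real_def)
    qed
    have "\<bar>\<Sum>b\<in>Basis. HG x b \<bullet> b\<bar> \<le> (B1 * (\<bar>B5\<bar> + B2 * B3)) * (\<bar>u x - k\<bar> + norm (grad u x))" if x: "x \<in> K" for x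
    proof -
      have xO: "x \<in> \<Omega>" using x K(2) by blast
      define L where "L = (\<Sum>b\<in>Basis. HG x b \<bullet> b)"
      define g where "g = grad u x"
      have lin: "linear (HG x)" by (rule linear_HG[OF xO])
      have HGb: "norm (HG x h) \<le> B3 * norm h" for h
      proof -
        have "norm (HG x h) = norm (\<Sum>b\<in>Basis. (h \<bullet> b) *\<^sub>R HG x b)"
          by (subst (1) euclidean_representation[of h, symmetric]) (simp only: linear_sum[OF lin] linear_scale[OF lin])
        also have "\<dots> \<le> (\<Sum>b\<in>Basis. norm h * norm (HG x b))"
          by (rule sum_norm_le) (auto intro!: mult_right_mono Basis_le_norm)
        also have "\<dots> \<le> B3 * norm h" using B3(2)[OF x] by (simp add: mult.commute[of B3] mult_left_mono abs_le_iff flip: sum_distrib_left)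
        finally show ?thesis .
      qed
      have "(\<Sum>b\<in>Basis. A_op a g (HG x b) \<bullet> b) = (\<Sum>b\<in>Basis. a' (norm g) * ((HG x b \<bullet> g) * (sgn g \<bullet> b)) + a (norm g) * (HG x b \<bullet> b))"
        by (simp add: A_op_eq inner_simps inner_commute mult_ac)
      also have "\<dots> = a' (norm g) * (\<Sum>b\<in>Basis. (HG x g \<bullet> b) * (sgn g \<bullet> b)) + a (norm g) * L"
        by (simp add: sum.distrib sum_distrib_left L_def sym_HG[OF xO, of _ g])
      also have "(\<Sum>b\<in>Basis. (HG x g \<bullet> b) * (sgn g \<bullet> b)) = HG x g \<bullet> sgn g" by (rule euclidean_inner[symmetric])
      \<comment> \<open>The Laplacian isolated: the symmetric Hessian lets the term with a' be
        rewritten with D^2 u applied to the gradient, hence of size |grad u|.\<close>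
      finally have e: "a (norm g) * L = - f (u x) - a' (norm g) * (HG x g \<bullet> sgn g)"
        using eqn[OF xO] by (simp add: g_def)
      have ap: "a (norm g) > 0" using pos(1)[of "norm g"] by simp
      have "\<bar>HG x g \<bullet> sgn g\<bar> \<le> B3 * norm g"
      proof -
        have "\<bar>HG x g \<bullet> sgn g\<bar> \<le> norm (HG x g) * norm (sgn g)" by (rule Cauchy_Schwarz_ineq2)
        also have "\<dots> \<le> norm (HG x g) * 1" by (intro mult_left_mono) (auto simp: norm_sgn)
        finally show ?thesis using HGb[of g] by simp
      qed
      then have i1: "\<bar>a' (norm g)\<bar> * \<bar>HG x g \<bullet> sgn g\<bar> \<le> B2 * (B3 * norm g)"
        using B2(2)[OF x] B2(1) by (intro mult_mono) (auto simp: g_def)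
      have "\<bar>a (norm g) * L\<bar> \<le> \<bar>f (u x)\<bar> + \<bar>a' (norm g)\<bar> * \<bar>HG x g \<bullet> sgn g\<bar>"
        unfolding e abs_mult[symmetric] by linarith
      also have "\<dots> \<le> \<bar>B5\<bar> * \<bar>u x - k\<bar> + B2 * (B3 * norm g)" using fl[OF x] i1 by (rule add_mono)
      also have "\<dots> \<le> (\<bar>B5\<bar> + B2 * B3) * (\<bar>u x - k\<bar> + norm g)"
      proof -
        have "0 \<le> \<bar>B5\<bar> * norm g" "0 \<le> B2 * B3 * \<bar>u x - k\<bar>" using B2(1) B3(1) by auto
        then show ?thesis by (simp add: algebra_simps)
      qed
      finally have aL: "a (norm g) * \<bar>L\<bar> \<le> (\<bar>B5\<bar> + B2 * B3) * (\<bar>u x - k\<bar> + norm g)" using ap by (simp add: abs_mult)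
      have "inverse (a (norm g)) \<le> B1" using B1(2)[OF x] ap by (simp add: g_def)
      then have "inverse (a (norm g)) * (a (norm g) * \<bar>L\<bar>) \<le> B1 * ((\<bar>B5\<bar> + B2 * B3) * (\<bar>u x - k\<bar> + norm g))"
        using aL by (rule mult_mono) (use B1(1) ap in auto)
      moreover have "inverse (a (norm g)) * (a (norm g) * \<bar>L\<bar>) = \<bar>L\<bar>" using ap by (simp flip: mult.assoc)
      ultimately have "\<bar>L\<bar> \<le> B1 * ((\<bar>B5\<bar> + B2 * B3) * (\<bar>u x - k\<bar> + norm g))" by (simp only:)
      then show ?thesis by (simp only: L_def g_def mult.assoc)
    qed
    then show "\<exists>M. \<forall>x\<in>K. \<bar>\<Sum>b\<in>Basis. HG x b \<bullet> b\<bar> \<le> M * (\<bar>u x - k\<bar> + norm (grad u x))" by blast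
  qed
  then show ?thesis using that[of k] by simp
qed

end

section \<open>Truncated directional derivatives\<close>

context quasilinear begin

lemma A_op_upper:
  assumes Y: "norm Y \<le> B" and B1: "\<bar>a' (norm Y)\<bar> \<le> B1" and B2: "\<bar>a (norm Y)\<bar> \<le> B2"
  shows "\<bar>A_op a Y Z \<bullet> Z\<bar> \<le> (B1 * B + B2) * (norm Z)\<^sup>2"
proof -
  have "\<bar>A_op a Y Z \<bullet> Z\<bar> \<le> \<bar>a' (norm Y)\<bar> * \<bar>Y \<bullet> Z\<bar> * \<bar>sgn Y \<bullet> Z\<bar> + \<bar>a (norm Y)\<bar> * (norm Z)\<^sup>2"
    unfolding A_op_eq inner_add_left inner_scaleR_left
    by (rule order_trans[OF abs_triangle_ineq]) (simp add: abs_mult power2_norm_eq_inner)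
  also have "\<dots> \<le> B1 * (B * norm Z) * (1 * norm Z) + B2 * (norm Z)\<^sup>2"
  proof (intro add_mono mult_mono B1 B2)
    show "\<bar>Y \<bullet> Z\<bar> \<le> B * norm Z" by (rule inner_Basis_bound[OF Y])
    show "\<bar>sgn Y \<bullet> Z\<bar> \<le> 1 * norm Z" by (rule inner_Basis_bound) (simp add: norm_sgn)
    show "0 \<le> B1" using B1 by linarith
    show "0 \<le> B2" using B2 by linarith
    have "0 \<le> B" using Y norm_ge_zero[of Y] by linarith
    then show "0 \<le> B1 * (B * norm Z)" using \<open>0 \<le> B1\<close> by simp
  qed auto
  also have "\<dots> = (B1 * B + B2) * (norm Z)\<^sup>2" by (simp add: power2_eq_square algebra_simps)
  finally show ?thesis .
qed

text \<open>The constant \<open>C\<close> depends on \<phi> but not on \<delta>; this order of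
  quantifiers lets \<delta> be adapted to \<phi> later. The truncation both gives compact support in
  \<Omega> and costs only the error \<delta> C.\<close>

lemma truncated_energy:
  fixes \<phi> :: "real^'n \<Rightarrow> real"
  assumes cu: "continuous_on (closure \<Omega>) u"
    and G: "continuous_on (closure \<Omega>) G" "\<And>x. x \<in> \<Omega> \<Longrightarrow> G x = grad u x"
    and \<Omega>0: "open \<Omega>0" "\<Omega>0 \<noteq> {}" "\<Omega>0 \<subseteq> \<Omega>" and fr: "\<And>x. x \<in> frontier \<Omega>0 \<Longrightarrow> G x = 0"
    and \<phi>: "lipschitz_compact_support (closure \<Omega>0) \<phi>" "\<And>x. x \<in> closure \<Omega>0 \<Longrightarrow> 0 \<le> \<phi> x"
    and X: "norm X = 1"
  defines "w \<equiv> (\<lambda>\<delta> x. if x \<in> \<Omega>0 then max 0 (grad u x \<bullet> X - \<delta>) * \<phi> x else 0)"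
  obtains C where "C \<ge> 0" "\<And>\<delta>. \<delta> > 0 \<Longrightarrow> lipc \<Omega> (w \<delta>)"
    "\<And>\<delta>. \<delta> > 0 \<Longrightarrow> elliptic_form.Q (\<lambda>x. A_op a (grad u x)) (\<lambda>x. f' (u x)) (w \<delta>) (w \<delta>) \<le>
      (LINT x:\<Omega>0|lebesgue. (norm (grad u x))\<^sup>2 * (A_op a (grad u x) (grad \<phi> x) \<bullet> grad \<phi> x)) + \<delta> * C"
proof -
  interpret EF: elliptic_form \<Omega> "\<lambda>x. A_op a (grad u x)" "\<lambda>x. f' (u x)" by (rule elliptic_form_linearised)
  define S where "S = closure {x \<in> closure \<Omega>0. \<phi> x \<noteq> 0}"
  obtain L where L: "L-lipschitz_on (closure \<Omega>0) \<phi>" and S: "compact S" "S \<subseteq> closure \<Omega>0"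
    using \<phi>(1) unfolding lipschitz_compact_support_def S_def by blast
  have S\<Omega>: "S \<subseteq> closure \<Omega>" using S(2) closure_mono[OF \<Omega>0(3)] by blast
  have \<phi>0: "\<phi> x = 0" if "x \<in> closure \<Omega>0" "x \<notin> S" for x
    using that closure_subset[of "{x \<in> closure \<Omega>0. \<phi> x \<noteq> 0}"] unfolding S_def by blast
  have ne: "closure \<Omega>0 \<noteq> {}" using \<Omega>0(2) by simp
  \<comment> \<open>The extension agrees with \<phi> on the open set \<open>\<Omega>0\<close>, so
    gradients there are the same, including the convention at non-differentiability.\<close>
  obtain \<phi>e where \<phi>e: "L-lipschitz_on UNIV \<phi>e" "\<And>x. x \<in> closure \<Omega>0 \<Longrightarrow> \<phi>e x = \<phi> x"
    using lipschitz_extension[OF L ne] by blast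
  have \<phi>e\<Omega>: "\<phi>e x = \<phi> x" if "x \<in> \<Omega>0" for x using \<phi>e(2) that closure_subset by blast
  have g\<phi>: "grad \<phi> x = grad \<phi>e x" if "x \<in> \<Omega>0" for x
    using \<phi>e\<Omega> by (intro grad_cong_near[OF \<Omega>0(1) that]) simp
  have g\<phi>0: "grad \<phi>e x = 0" if x: "x \<in> \<Omega>0" "x \<notin> S" for x
  proof -
    have oS: "open (\<Omega>0 - S)" using \<Omega>0(1) S(1) by (simp add: open_Diff compact_imp_closed)
    have eq: "(0::real) = \<phi>e y" if "y \<in> \<Omega>0 - S" for y
      using that \<phi>e\<Omega>[of y] \<phi>0[of y] closure_subset[of \<Omega>0] by auto
    have "grad (\<lambda>_. 0) x = grad \<phi>e x" by (rule grad_cong_near[OF oS _ eq]) (use x in auto)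
    moreover have "grad (\<lambda>_. 0) x = 0" by (rule grad_eqI[OF GDERIV_const])
    ultimately show ?thesis by simp
  qed
  \<comment> \<open>The support \<open>S\<close> may meet the boundary of \<Omega>, so all bounds
    are taken for \<open>G\<close> and for \<open>u\<close> on the closure rather than on
    \<Omega>.\<close>
  have bdd: "\<exists>B\<ge>0. \<forall>x\<in>S. \<bar>g x\<bar> \<le> B" if g: "continuous_on S g" for g :: "real^'n \<Rightarrow> real"
  proof -
    have "compact (g ` S)" using S(1) g by (intro compact_continuous_image)
    then obtain B where B: "\<And>x. x \<in> S \<Longrightarrow> \<bar>g x\<bar> \<le> B" using compact_imp_bounded by (fastforce simp: bounded_iff)
    have "\<bar>g x\<bar> \<le> \<bar>B\<bar>" if "x \<in> S" for x using B[OF that] by simp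
    then show ?thesis by (intro exI[of _ "\<bar>B\<bar>"]) simp
  qed
  have cGS: "continuous_on S G" by (rule continuous_on_subset[OF G(1) S\<Omega>])
  have cn: "continuous_on S (\<lambda>x. norm (G x))" by (intro continuous_intros cGS)
  obtain BG where BG: "BG \<ge> 0" "\<And>x. x \<in> S \<Longrightarrow> norm (G x) \<le> BG" using bdd[OF cn] by auto
  have "continuous_on S (\<lambda>x. f' (u x))"
    by (rule continuous_on_compose2[OF cont_f' continuous_on_subset[OF cu S\<Omega>]]) simp
  then obtain Bc where Bc: "Bc \<ge> 0" "\<And>x. x \<in> S \<Longrightarrow> \<bar>f' (u x)\<bar> \<le> Bc" using bdd by blast
  have "continuous_on S \<phi>e" using lipschitz_on_continuous_on[OF \<phi>e(1)] continuous_on_subset by blast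
  then obtain B\<phi> where B\<phi>: "B\<phi> \<ge> 0" "\<And>x. x \<in> S \<Longrightarrow> \<bar>\<phi>e x\<bar> \<le> B\<phi>" using bdd by blast
  have "continuous_on S (\<lambda>x. a' \<bar>norm (G x)\<bar>)" "continuous_on S (\<lambda>x. a \<bar>norm (G x)\<bar>)"
    by (rule continuous_on_compose2[OF continuous_a'_abs[of UNIV] cn], simp,
        rule continuous_on_compose2[OF continuous_a_abs[of UNIV] cn], simp)
  then obtain B1 B2 where B12: "B1 \<ge> 0" "B2 \<ge> 0"
    "\<And>x. x \<in> S \<Longrightarrow> \<bar>a' \<bar>norm (G x)\<bar>\<bar> \<le> B1" "\<And>x. x \<in> S \<Longrightarrow> \<bar>a \<bar>norm (G x)\<bar>\<bar> \<le> B2"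
    using bdd by metis
  have GO: "G x = grad u x" if "x \<in> \<Omega>0" for x using G(2) \<Omega>0(3) that by blast
  define R where "R x = indicator \<Omega>0 x *\<^sub>R ((norm (grad u x))\<^sup>2 * (A_op a (grad u x) (grad \<phi>e x) \<bullet> grad \<phi>e x))" for x
  have Rnn: "0 \<le> R x" for x
    using EF.M_nonneg[of x "grad \<phi>e x"] \<Omega>0(3) by (auto simp: R_def indicator_def)
  note m[measurable] = lipschitz_grad_measurable[OF \<phi>e(1)]
  have Rm: "R \<in> borel_measurable lebesgue"
  proof -
    have "(\<lambda>x. indicator \<Omega>0 x *\<^sub>R ((norm (grad u x))\<^sup>2 * (A_op a (grad u x) d \<bullet> e))) \<in> borel_measurable lebesgue" for d e
    proof -
      have "continuous_on \<Omega>0 (\<lambda>x. (norm (grad u x))\<^sup>2 * (A_op a (grad u x) d \<bullet> e))"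
        by (rule continuous_on_subset[OF _ \<Omega>0(3)]) (intro continuous_intros continuous_grad continuous_A_grad)
      then have "(\<lambda>x. indicator \<Omega>0 x *\<^sub>R ((norm (grad u x))\<^sup>2 * (A_op a (grad u x) d \<bullet> e))) \<in> borel_measurable borel"
        using \<Omega>0(1) by (intro borel_measurable_continuous_on_indicator) auto
      then show ?thesis by (intro measurable_completion) simp
    qed
    note [measurable] = this
    have "R = (\<lambda>x. \<Sum>d\<in>Basis. \<Sum>e\<in>Basis. ((grad \<phi>e x \<bullet> d) * (grad \<phi>e x \<bullet> e)) *
        (indicator \<Omega>0 x *\<^sub>R ((norm (grad u x))\<^sup>2 * (A_op a (grad u x) d \<bullet> e))))"
      unfolding R_def by (rule ext, subst EF.M_expand) (simp add: sum_distrib_left mult_ac)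
    also have "\<dots> \<in> borel_measurable lebesgue" by measurable
    finally show ?thesis .
  qed
  have gb: "norm (grad \<phi>e x) \<le> L" for x by (rule grad_lipschitz_bound[OF \<phi>e(1)]) auto
  have Ri: "integrable lebesgue R"
  proof (rule integrable_compact_supportI[OF Rm S(1)])
    have "\<bar>R x\<bar> \<le> BG\<^sup>2 * ((B1 * BG + B2) * L\<^sup>2)" for x
    proof (cases "x \<in> \<Omega>0 \<and> x \<in> S")
      case True
      then have x: "x \<in> \<Omega>0" "x \<in> S" by auto
      have nG: "norm (grad u x) \<le> BG" using BG(2)[OF x(2)] GO[OF x(1)] by simp
      have "\<bar>A_op a (grad u x) (grad \<phi>e x) \<bullet> grad \<phi>e x\<bar> \<le> (B1 * BG + B2) * (norm (grad \<phi>e x))\<^sup>2"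
        using B12(3,4)[OF x(2)] GO[OF x(1)] by (intro A_op_upper nG) auto
      also have "\<dots> \<le> (B1 * BG + B2) * L\<^sup>2"
        using B12(1,2) BG(1) gb[of x] by (intro mult_left_mono power_mono) auto
      finally have "\<bar>A_op a (grad u x) (grad \<phi>e x) \<bullet> grad \<phi>e x\<bar> \<le> (B1 * BG + B2) * L\<^sup>2" .
      then have "(norm (grad u x))\<^sup>2 * \<bar>A_op a (grad u x) (grad \<phi>e x) \<bullet> grad \<phi>e x\<bar> \<le> BG\<^sup>2 * ((B1 * BG + B2) * L\<^sup>2)"
        by (intro mult_mono[OF power_mono[OF nG norm_ge_zero]]) auto
      then show ?thesis using x(1) by (simp add: R_def abs_mult)
    next
      case False
      then have "R x = 0" using g\<phi>0[of x] by (auto simp: R_def indicator_def)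
      then show ?thesis using B12(1,2) BG(1) by simp
    qed
    then show "AE x in lebesgue. \<bar>R x\<bar> \<le> BG\<^sup>2 * ((B1 * BG + B2) * L\<^sup>2)" by simp
    show "R x = 0" if "x \<notin> S" for x using g\<phi>0[of x] that by (auto simp: R_def indicator_def)
  qed
  have Reg: "(\<integral>x. R x \<partial>lebesgue)
      = (LINT x:\<Omega>0|lebesgue. (norm (grad u x))\<^sup>2 * (A_op a (grad u x) (grad \<phi> x) \<bullet> grad \<phi> x))"
    unfolding set_lebesgue_integral_def
    by (rule Bochner_Integration.integral_cong) (auto simp: R_def indicator_def g\<phi>)
  define C where "C = Bc * (BG * B\<phi>\<^sup>2) * measure lebesgue S"
  have C0: "C \<ge> 0" using Bc(1) BG(1) by (simp add: C_def)
  have lw0: "lipc \<Omega>0 (w \<delta>)" if \<delta>: "\<delta> > 0" for \<delta>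
  proof -
    \<comment> \<open>Contains every point where the truncation is nonzero. It is closed up to the
      boundary through \<open>G\<close>, yet avoids the frontier of \<open>\<Omega>0\<close>, where
      \<open>G\<close> = 0 < \<delta>.\<close>
    define K where "K = S \<inter> (\<lambda>x. G x \<bullet> X) -` {\<delta>..}"
    have "continuous_on S (\<lambda>x. G x \<bullet> X)" by (intro continuous_intros cGS)
    then have "closed K" unfolding K_def using S(1) by (intro continuous_closed_preimage) (auto simp: compact_imp_closed)
    moreover have "K \<subseteq> S" by (auto simp: K_def)
    ultimately have K: "compact K" using S(1) by (metis compact_Int_closed inf.absorb_iff2)
    have K\<Omega>: "K \<subseteq> \<Omega>0"
    proof
      fix x assume x: "x \<in> K"
      show "x \<in> \<Omega>0"
      proof (rule ccontr)
        assume "x \<notin> \<Omega>0"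
        then have "x \<in> frontier \<Omega>0" using x S(2) \<Omega>0(1) by (auto simp: K_def frontier_def interior_open)
        then have "G x = 0" by (rule fr)
        then show False using x \<delta> by (simp add: K_def)
      qed
    qed
    have w0: "w \<delta> x = 0" if x: "x \<notin> K" for x
    proof (cases "x \<in> \<Omega>0")
      case True
      show ?thesis
      proof (cases "x \<in> S")
        case xS: True
        then have "grad u x \<bullet> X < \<delta>" using x GO[OF True] by (simp add: K_def)
        then show ?thesis by (simp add: w_def)
      next
        case False
        then have "\<phi> x = 0" using \<phi>0[of x] True closure_subset by blast
        then show ?thesis by (simp add: w_def)
      qed
    qed (simp add: w_def)
    have "loclip \<Omega>0 (\<lambda>x. max 0 (grad u x \<bullet> X - \<delta>) * \<phi>e x)"
      by (intro loclip_mult loclip_max0 loclip_diff loclip_const lipschitz_imp_loclip[OF \<phi>e(1)]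
          loclip_subset[OF loclip_v \<Omega>0(3)])
    then have "loclip \<Omega>0 (w \<delta>)" by (rule loclip_cong[OF _ \<Omega>0(1)]) (simp add: w_def \<phi>e\<Omega>)
    then show ?thesis by (intro lipcI_loclip[OF K K\<Omega> w0] loclip_subset[OF _ K\<Omega>]) auto
  qed
  then have lw: "lipc \<Omega> (w \<delta>)" if "\<delta> > 0" for \<delta> using that lipc_mono[OF _ \<Omega>0(3)] by blast
  have Qw: "EF.Q (w \<delta>) (w \<delta>) \<le> (\<integral>x. R x \<partial>lebesgue) + \<delta> * C" if \<delta>: "\<delta> > 0" for \<delta>
  proof -
    define W where "W = w \<delta>"
    \<comment> \<open>The test function (v - \<delta>)^+ \<phi>^2 of the linearised equation,
      written as a multiple of the truncation \<open>W\<close>.\<close>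
    define \<xi> where "\<xi> x = W x * \<phi>e x" for x
    have W: "lipc \<Omega> W" unfolding W_def by (rule lw[OF \<delta>])
    have \<xi>: "lipc \<Omega> \<xi>" unfolding \<xi>_def by (rule lipc_mult_loclip[OF W lipschitz_imp_loclip[OF \<phi>e(1)]])
    have Wpos: "0 \<le> W x" for x
      using \<phi>(2)[of x] closure_subset[of \<Omega>0] by (auto simp: W_def w_def)
    have \<xi>pos: "0 \<le> \<xi> x" for x
    proof (cases "x \<in> \<Omega>0")
      case True
      then have "0 \<le> \<phi>e x" using \<phi>(2)[of x] \<phi>e\<Omega> closure_subset[of \<Omega>0] by auto
      then show ?thesis using Wpos by (simp add: \<xi>_def)
    qed (simp add: \<xi>_def W_def w_def)
    note lin = linearised_equation[OF \<xi>, of X]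
    have "AE x in lebesgue. A_op a (grad u x) (grad W x) \<bullet> grad W x \<le> R x + A_op a (grad u x) (HG x X) \<bullet> grad \<xi> x"
      using lipschitz_AE_GDERIV[OF \<phi>e(1)]
    proof eventually_elim
      case (elim x)
      show ?case
      proof (cases "x \<in> \<Omega>0 \<and> \<delta> < grad u x \<bullet> X")
        case True
        then have x: "x \<in> \<Omega>0" "x \<in> \<Omega>" "\<delta> < grad u x \<bullet> X" using \<Omega>0(3) by auto
        let ?A = "A_op a (grad u x)"
        let ?U = "\<Omega> \<inter> (\<lambda>x. grad u x \<bullet> X) -` {\<delta><..}"
        have "open ?U" by (rule continuous_open_preimage[OF _ open_\<Omega>]) (auto intro: continuous_intros continuous_grad)
        with \<Omega>0(1) have oU: "open (\<Omega>0 \<inter> ?U)" by (rule open_Int)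
        have xU: "x \<in> \<Omega>0 \<inter> ?U" using x by simp
        define z where "z = grad u x \<bullet> X - \<delta>"
        have "GDERIV (\<lambda>x. (grad u x \<bullet> X - \<delta>) * \<phi>e x) x :> z *\<^sub>R grad \<phi>e x + \<phi>e x *\<^sub>R (HG x X - 0)"
          unfolding z_def by (intro GDERIV_mult GDERIV_diff GDERIV_v[OF x(2)] GDERIV_const elim)
        then have gW: "GDERIV W x :> z *\<^sub>R grad \<phi>e x + \<phi>e x *\<^sub>R HG x X"
          using GDERIV_cong_near[OF _ oU xU, of _ _ W] by (simp add: W_def w_def \<phi>e\<Omega>)
        then have gW': "grad W x = z *\<^sub>R grad \<phi>e x + \<phi>e x *\<^sub>R HG x X" by (rule grad_eqI)
        have Wx: "W x = z * \<phi>e x" using x by (simp add: W_def w_def z_def \<phi>e\<Omega>)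
        have g\<xi>: "grad \<xi> x = W x *\<^sub>R grad \<phi>e x + \<phi>e x *\<^sub>R grad W x"
          unfolding \<xi>_def using grad_eqI[OF GDERIV_mult[OF gW elim]] gW' by simp
        \<comment> \<open>The cancellation behind the estimate: in the form of a product z \<phi>,
          everything containing grad z is exactly what testing with z \<phi>^2 produces, by symmetry
          of A.\<close>
        have "?A (grad W x) \<bullet> grad W x = z\<^sup>2 * (?A (grad \<phi>e x) \<bullet> grad \<phi>e x) + ?A (HG x X) \<bullet> grad \<xi> x"
        proof -
          define P where "P = ?A (grad \<phi>e x) \<bullet> grad \<phi>e x"
          define q where "q = ?A (HG x X) \<bullet> grad \<phi>e x"
          define r where "r = ?A (HG x X) \<bullet> HG x X"
          have q': "?A (grad \<phi>e x) \<bullet> HG x X = q" unfolding q_def by (rule A_op_sym)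
          have "?A (grad W x) \<bullet> grad W x = z * (z * P + \<phi>e x * q) + \<phi>e x * (z * q + \<phi>e x * r)"
            by (simp only: gW' linear_add[OF A_op_linear] linear_scale[OF A_op_linear] inner_add_left inner_add_right
                inner_scaleR_left inner_scaleR_right q' flip: P_def q_def r_def)
          moreover have "?A (HG x X) \<bullet> grad \<xi> x = z * \<phi>e x * q + \<phi>e x * (z * q + \<phi>e x * r)"
            by (simp only: g\<xi> gW' Wx inner_add_right inner_scaleR_right flip: q_def r_def)
          ultimately show ?thesis unfolding P_def[symmetric] by (simp add: power2_eq_square algebra_simps)
        qed
        also have "z\<^sup>2 * (?A (grad \<phi>e x) \<bullet> grad \<phi>e x) \<le> R x"
        proof -
          have "z \<le> norm (grad u x)" using Cauchy_Schwarz_ineq2[of "grad u x" X] X \<delta> by (simp add: z_def abs_le_iff)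
          then have "z\<^sup>2 \<le> (norm (grad u x))\<^sup>2" using x(3) by (intro power_mono) (auto simp: z_def)
          then show ?thesis using EF.M_nonneg[OF x(2), of "grad \<phi>e x"] x(1) by (simp add: R_def mult_right_mono)
        qed
        finally show ?thesis by simp
      next
        case False
        then have W0: "W x = 0" by (auto simp: W_def w_def max_def)
        then have "grad W x = 0" using Wpos by (intro grad_eq_0_at_min) simp
        moreover have "grad \<xi> x = 0" using W0 \<xi>pos by (intro grad_eq_0_at_min) (simp add: \<xi>_def)
        ultimately show ?thesis using Rnn by simp
      qed
    qed
    then have "EF.E W W \<le> (\<integral>x. R x + A_op a (grad u x) (HG x X) \<bullet> grad \<xi> x \<partial>lebesgue)"
      unfolding EF.E_def using Ri lin(1) EF.integrable_form[OF W W] by (intro integral_mono_AE) auto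
    also have "\<dots> = (\<integral>x. R x \<partial>lebesgue) + (\<integral>x. f' (u x) * ((grad u x \<bullet> X) * \<xi> x) \<partial>lebesgue)"
      using Ri lin by simp
    finally have E: "EF.E W W \<le> (\<integral>x. R x \<partial>lebesgue) + (\<integral>x. f' (u x) * ((grad u x \<bullet> X) * \<xi> x) \<partial>lebesgue)" .
    have i1: "integrable lebesgue (\<lambda>x. f' (u x) * ((grad u x \<bullet> X) * \<xi> x))"
      using EF.integrable_c[OF lipc_mult_loclip[OF \<xi> loclip_v[of X]]] by (simp add: mult.commute)
    have i2: "integrable lebesgue (\<lambda>x. f' (u x) * (W x * W x))" by (rule EF.integrable_c[OF EF.lipc_product[OF W W]])
    have "(\<integral>x. f' (u x) * ((grad u x \<bullet> X) * \<xi> x) \<partial>lebesgue) - (\<integral>x. f' (u x) * (W x * W x) \<partial>lebesgue)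
        = (\<integral>x. f' (u x) * ((grad u x \<bullet> X) * \<xi> x) - f' (u x) * (W x * W x) \<partial>lebesgue)"
      using i1 i2 by simp
    also have "\<dots> \<le> (\<integral>x. \<delta> * (Bc * (BG * B\<phi>\<^sup>2)) * indicator S x \<partial>lebesgue)"
    proof (rule integral_mono)
      show "integrable lebesgue (\<lambda>x. \<delta> * (Bc * (BG * B\<phi>\<^sup>2)) * indicat_real S x)"
        using lmeasurable_compact[OF S(1)]
        by (intro integrable_mult_right integrable_real_indicator) (auto simp: fmeasurable_def)
      fix x
      show "f' (u x) * ((grad u x \<bullet> X) * \<xi> x) - f' (u x) * (W x * W x) \<le> \<delta> * (Bc * (BG * B\<phi>\<^sup>2)) * indicat_real S x"
      proof (cases "W x = 0")
        case True
        have "0 \<le> \<delta> * (Bc * (BG * B\<phi>\<^sup>2)) * indicat_real S x" using \<delta> Bc(1) BG(1) by (simp add: indicator_def)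
        then show ?thesis using True by (simp add: \<xi>_def)
      next
        case False
        then have x: "x \<in> \<Omega>0" "\<delta> < grad u x \<bullet> X" "\<phi> x \<noteq> 0" by (auto simp: W_def w_def max_def split: if_splits)
        then have xS: "x \<in> S" using \<phi>0[of x] closure_subset[of \<Omega>0] by blast
        define z where "z = grad u x \<bullet> X - \<delta>"
        have Wx: "W x = z * \<phi>e x" using x by (simp add: W_def w_def z_def \<phi>e\<Omega>)
        have z: "0 \<le> z" "z \<le> BG"
          using x(2) Cauchy_Schwarz_ineq2[of "grad u x" X] X \<delta> BG(2)[OF xS] GO[OF x(1)]
          by (auto simp: z_def abs_le_iff)
        \<comment> \<open>The only mismatch between the linearised equation and the form of
          \<open>W\<close>: the equation carries v, the truncation v - \<delta>.\<close>
        have "(grad u x \<bullet> X) * \<xi> x - W x * W x = \<delta> * (z * (\<phi>e x)\<^sup>2)"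
          by (simp add: \<xi>_def Wx z_def power2_eq_square algebra_simps)
        then have "f' (u x) * ((grad u x \<bullet> X) * \<xi> x) - f' (u x) * (W x * W x) = f' (u x) * (\<delta> * (z * (\<phi>e x)\<^sup>2))"
          by (simp flip: right_diff_distrib)
        also have "\<dots> \<le> \<bar>f' (u x)\<bar> * (\<delta> * (z * (\<phi>e x)\<^sup>2))"
          using z(1) \<delta> by (intro mult_right_mono) auto
        also have "\<dots> \<le> Bc * (\<delta> * (BG * B\<phi>\<^sup>2))"
        proof -
          have "(\<phi>e x)\<^sup>2 \<le> B\<phi>\<^sup>2" using power_mono[OF B\<phi>(2)[OF xS], of 2] by simp
          then have "z * (\<phi>e x)\<^sup>2 \<le> BG * B\<phi>\<^sup>2" using z BG(1) by (intro mult_mono) auto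
          then have "\<delta> * (z * (\<phi>e x)\<^sup>2) \<le> \<delta> * (BG * B\<phi>\<^sup>2)" using \<delta> by simp
          then show ?thesis by (rule mult_mono[OF Bc(2)[OF xS]]) (use Bc(1) z(1) \<delta> in auto)
        qed
        finally show ?thesis using xS by (simp add: mult_ac)
      qed
    qed (use i1 i2 in simp)
    also have "\<dots> = \<delta> * C" by (simp add: C_def mult_ac)
    finally show ?thesis using E unfolding EF.Q_def W_def by simp
  qed
  show ?thesis by (rule that[OF C0 lw]) (use Qw Reg in auto)
qed

end

context quasilinear begin

text \<open>The truncated derivatives are approximants with vanishing form for the maximum principle
  on the whole of \<Omega>, although they live on \<open>\<Omega>0\<close>; positivity of their
  limit therefore also identifies the two sets.\<close>

theorem positive_directional_derivative:
  fixes \<phi> :: "nat \<Rightarrow> real^'n \<Rightarrow> real"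
  assumes conn: "connected \<Omega>"
    and cu: "continuous_on (closure \<Omega>) u"
    and G: "continuous_on (closure \<Omega>) G" "\<And>x. x \<in> \<Omega> \<Longrightarrow> G x = grad u x"
    and \<Omega>0: "open \<Omega>0" "\<Omega>0 \<noteq> {}" "\<Omega>0 \<subseteq> \<Omega>" and fr: "\<And>x. x \<in> frontier \<Omega>0 \<Longrightarrow> G x = 0"
    and nonconst: "\<not> u constant_on \<Omega>"
    and stable: "\<And>\<phi>. lipc \<Omega> \<phi> \<Longrightarrow> 0 \<le> elliptic_form.Q (\<lambda>x. A_op a (grad u x)) (\<lambda>x. f' (u x)) \<phi> \<phi>"
    and \<phi>: "\<And>j. lipschitz_compact_support (closure \<Omega>0) (\<phi> j)" "\<And>j x. x \<in> closure \<Omega>0 \<Longrightarrow> 0 \<le> \<phi> j x"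
    and unif: "\<And>x. x \<in> closure \<Omega>0 \<Longrightarrow> \<exists>e>0. uniform_limit (ball x e \<inter> closure \<Omega>0) \<phi> (\<lambda>_. 1) sequentially"
    and energy: "(\<lambda>j. LINT x:\<Omega>0|lebesgue.
        (norm (grad u x))\<^sup>2 * (A_op a (grad u x) (grad (\<phi> j) x) \<bullet> grad (\<phi> j) x)) \<longlonglongrightarrow> 0"
  obtains X where "norm X = 1" "\<Omega>0 = \<Omega>" "\<And>x. x \<in> \<Omega> \<Longrightarrow> 0 < grad u x \<bullet> X"
proof -
  interpret SF: stable_form \<Omega> "\<lambda>x. A_op a (grad u x)" "\<lambda>x. f' (u x)"
    by (rule stable_form.intro[OF elliptic_form_linearised stable_form_axioms.intro[OF stable]])
  have "\<exists>x\<in>\<Omega>0. grad u x \<noteq> 0"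
  proof (rule ccontr)
    assume "\<not> ?thesis"
    then have "\<And>x. x \<in> \<Omega>0 \<Longrightarrow> grad u x = 0" by blast
    then obtain k where "\<And>x. x \<in> \<Omega> \<Longrightarrow> u x = k"
      using constant_if_locally_constant[OF conn \<Omega>0] by blast
    then show False using nonconst unfolding constant_on_def by blast
  qed
  then obtain x0 where x0: "x0 \<in> \<Omega>0" "grad u x0 \<noteq> 0" by blast
  \<comment> \<open>With this direction the derivative of \<open>u\<close> at \<open>x0\<close> is
    |grad u|, hence positive.\<close>
  define X where "X = sgn (grad u x0)"
  have X: "norm X = 1" using x0(2) by (simp add: X_def norm_sgn)
  have v0: "0 < grad u x0 \<bullet> X"
    using x0(2) by (simp add: X_def sgn_div_norm inner_scaleR_right)
  define en where "en j = (LINT x:\<Omega>0|lebesgue.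
        (norm (grad u x))\<^sup>2 * (A_op a (grad u x) (grad (\<phi> j) x) \<bullet> grad (\<phi> j) x))" for j
  define wt where "wt j \<delta> x = (if x \<in> \<Omega>0 then max 0 (grad u x \<bullet> X - \<delta>) * \<phi> j x else 0)" for j \<delta> x
  have "\<exists>C\<ge>0. \<forall>\<delta>>0. lipc \<Omega> (wt j \<delta>) \<and> SF.Q (wt j \<delta>) (wt j \<delta>) \<le> en j + \<delta> * C" for j
    unfolding wt_def[abs_def] en_def
    by (rule truncated_energy[OF cu G \<Omega>0 fr \<phi>(1)[of j] \<phi>(2)[of _ j] X]) blast+
  then obtain C where C: "\<And>j. C j \<ge> 0" "\<And>j \<delta>. \<delta> > 0 \<Longrightarrow> lipc \<Omega> (wt j \<delta>)"
    "\<And>j \<delta>. \<delta> > 0 \<Longrightarrow> SF.Q (wt j \<delta>) (wt j \<delta>) \<le> en j + \<delta> * C j" by metis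
  \<comment> \<open>Both \<delta>_j and \<delta>_j C_j are at most 1 / (j + 1): the first gives
    uniform convergence, the second makes the stability form vanish in the limit.\<close>
  define \<delta> where "\<delta> j = 1 / (real (Suc j) * (1 + C j))" for j
  have \<delta>: "\<delta> j > 0" "\<delta> j \<le> 1 / real (Suc j)" "\<delta> j * C j \<le> 1 / real (Suc j)" for j
  proof -
    have c: "1 \<le> 1 + C j" using C(1)[of j] by simp
    show "\<delta> j > 0" using c by (simp add: \<delta>_def)
    have \<delta>': "\<delta> j = (1 / real (Suc j)) * (1 / (1 + C j))" by (simp add: \<delta>_def)
    have "1 / (1 + C j) \<le> 1" using c by simp
    then show "\<delta> j \<le> 1 / real (Suc j)"
      unfolding \<delta>' using mult_left_mono[of "1 / (1 + C j)" 1 "1 / real (Suc j)"] by simp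
    have "C j / (1 + C j) \<le> 1" using C(1)[of j] by simp
    then show "\<delta> j * C j \<le> 1 / real (Suc j)"
      unfolding \<delta>' using mult_left_mono[of "C j / (1 + C j)" 1 "1 / real (Suc j)"] by simp
  qed
  define W where "W j = wt j (\<delta> j)" for j
  define w where "w x = (if x \<in> \<Omega>0 then max 0 (grad u x \<bullet> X) else 0)" for x
  have W: "lipc \<Omega> (W j)" for j unfolding W_def by (rule C(2)[OF \<delta>(1)])
  have Wpos: "0 \<le> W j x" for j x
    using \<phi>(2)[of x j] closure_subset[of \<Omega>0] by (auto simp: W_def wt_def)
  have QW: "(\<lambda>j. SF.Q (W j) (W j)) \<longlonglongrightarrow> 0"
  proof (rule tendsto_sandwich[OF _ _ tendsto_const])
    show "\<forall>\<^sub>F j in sequentially. 0 \<le> SF.Q (W j) (W j)" by (simp add: stable W)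
    show "\<forall>\<^sub>F j in sequentially. SF.Q (W j) (W j) \<le> en j + 1 / real (Suc j)"
    proof (rule always_eventually, rule allI)
      fix j
      show "SF.Q (W j) (W j) \<le> en j + 1 / real (Suc j)"
        using C(3)[OF \<delta>(1), of j j] \<delta>(3)[of j] unfolding W_def by linarith
    qed
    show "(\<lambda>j. en j + 1 / real (Suc j)) \<longlonglongrightarrow> 0"
      using tendsto_add[OF energy LIMSEQ_Suc[OF lim_1_over_n]] by (simp add: en_def)
  qed
  have unifW: "uniform_limit K W w sequentially" if K: "compact K" "K \<subseteq> \<Omega>" for K
  proof (rule uniform_limitI)
    fix \<epsilon> :: real assume \<epsilon>: "\<epsilon> > 0"
    have "compact ((\<lambda>x. norm (grad u x)) ` K)"
      by (intro compact_continuous_image continuous_intros continuous_on_subset[OF continuous_grad K(2)] K(1))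
    then obtain B where B: "\<And>x. x \<in> K \<Longrightarrow> norm (grad u x) \<le> B" using compact_imp_bounded by (fastforce simp: bounded_iff)
    \<comment> \<open>The cap 1 bounds \<phi>_j by 2, and the total error is at most (|B| + 2)
      \<eta>; the third unit makes the inequality strict.\<close>
    define \<eta> where "\<eta> = min 1 (\<epsilon> / (\<bar>B\<bar> + 3))"
    have \<eta>: "\<eta> > 0" "\<eta> \<le> 1" "(\<bar>B\<bar> + 3) * \<eta> \<le> \<epsilon>"
    proof -
      show "\<eta> > 0" using \<epsilon> by (simp add: \<eta>_def)
      show "\<eta> \<le> 1" unfolding \<eta>_def by (rule min.cobounded1)
      have "\<eta> \<le> \<epsilon> / (\<bar>B\<bar> + 3)" unfolding \<eta>_def by (rule min.cobounded2)
      then show "(\<bar>B\<bar> + 3) * \<eta> \<le> \<epsilon>" by (simp add: pos_le_divide_eq mult.commute)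
    qed
    \<comment> \<open>Locally uniform convergence is available on the closure of
      \<open>\<Omega>0\<close> only; on the rest of \<open>K\<close> both functions are 0.\<close>
    define K' where "K' = K \<inter> closure \<Omega>0"
    have K': "compact K'" unfolding K'_def using K(1) by (simp add: compact_Int_closed)
    obtain r where r: "\<And>x. x \<in> closure \<Omega>0 \<Longrightarrow> r x > 0"
      "\<And>x. x \<in> closure \<Omega>0 \<Longrightarrow> uniform_limit (ball x (r x) \<inter> closure \<Omega>0) \<phi> (\<lambda>_. 1) sequentially"
      using unif by metis
    have "K' \<subseteq> (\<Union>x\<in>K'. ball x (r x))" using r(1) by (auto simp: K'_def)
    then obtain T where T: "T \<subseteq> K'" "finite T" "K' \<subseteq> (\<Union>x\<in>T. ball x (r x))"
      using compactE_image[OF K', of K' "\<lambda>x. ball x (r x)"] by auto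
    have "uniform_limit (\<Union>x\<in>T. ball x (r x) \<inter> closure \<Omega>0) \<phi> (\<lambda>_. 1) sequentially"
      using T r(2) by (intro uniform_limit_on_UNION) (auto simp: K'_def)
    moreover have "K' \<subseteq> (\<Union>x\<in>T. ball x (r x) \<inter> closure \<Omega>0)" using T(3) by (auto simp: K'_def)
    ultimately have "uniform_limit K' \<phi> (\<lambda>_. 1) sequentially" by (rule uniform_limit_on_subset)
    then have "\<forall>\<^sub>F j in sequentially. \<forall>x\<in>K'. dist (\<phi> j x) 1 < \<eta>" using \<eta>(1) by (rule uniform_limitD)
    moreover have "\<forall>\<^sub>F j in sequentially. 1 / real (Suc j) < \<eta>"
      using \<eta>(1) by (rule order_tendstoD(2)[OF LIMSEQ_Suc[OF lim_1_over_n]])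
    ultimately show "\<forall>\<^sub>F j in sequentially. \<forall>x\<in>K. dist (W j x) (w x) < \<epsilon>"
    proof eventually_elim
      case (elim j)
      show ?case
      proof
        fix x assume x: "x \<in> K"
        show "dist (W j x) (w x) < \<epsilon>"
        proof (cases "x \<in> \<Omega>0")
          case False
          then show ?thesis using \<epsilon> by (simp add: W_def wt_def w_def)
        next
          case True
          then have xK': "x \<in> K'" using x closure_subset by (auto simp: K'_def)
          define v where "v = grad u x \<bullet> X"
          define p where "p = \<phi> j x"
          have p: "\<bar>p - 1\<bar> < \<eta>" using elim(1) xK' by (simp add: p_def dist_real_def)
          have p2: "\<bar>p\<bar> \<le> 2" using p \<eta>(2) by linarith
          have v: "\<bar>max 0 v\<bar> \<le> \<bar>B\<bar>"
          proof -
            have "\<bar>v\<bar> \<le> norm (grad u x)" using Cauchy_Schwarz_ineq2[of "grad u x" X] X by (simp add: v_def)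
            then show ?thesis using B[OF x] by linarith
          qed
          have d: "\<bar>max 0 (v - \<delta> j) - max 0 v\<bar> \<le> \<eta>" using \<delta>(1)[of j] \<delta>(2)[of j] elim(2) by linarith
          have "W j x - w x = (max 0 (v - \<delta> j) - max 0 v) * p + max 0 v * (p - 1)"
            using True by (simp add: W_def wt_def w_def v_def p_def algebra_simps)
          then have "\<bar>W j x - w x\<bar> \<le> \<bar>max 0 (v - \<delta> j) - max 0 v\<bar> * \<bar>p\<bar> + \<bar>max 0 v\<bar> * \<bar>p - 1\<bar>"
            by (metis abs_mult abs_triangle_ineq)
          also have "\<dots> \<le> \<eta> * 2 + \<bar>B\<bar> * \<eta>"
            using d p2 v p \<eta>(1) by (intro add_mono mult_mono) auto
          also have "\<dots> < (\<bar>B\<bar> + 3) * \<eta>" using \<eta>(1) by (simp add: algebra_simps)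
          also have "\<dots> \<le> \<epsilon>" by (rule \<eta>(3))
          finally show ?thesis by (simp add: dist_real_def)
        qed
      qed
    qed
  qed
  \<comment> \<open>Continuity across the boundary of \<open>\<Omega>0\<close> inside \<Omega> is
    inherited from the approximants through locally uniform convergence.\<close>
  have cw: "continuous_on \<Omega> w"
  proof (intro continuous_at_imp_continuous_on ballI)
    fix x assume "x \<in> \<Omega>"
    then obtain r where r: "r > 0" "cball x r \<subseteq> \<Omega>" using open_\<Omega> open_contains_cball by blast
    have "continuous_on (cball x r) w"
    proof (rule uniform_limit_theorem[OF _ unifW[OF compact_cball r(2)]])
      show "\<forall>\<^sub>F j in sequentially. continuous_on (cball x r) (W j)" by (simp add: lipc_continuous[OF W])
    qed simp
    then have "continuous_on (ball x r) w" by (rule continuous_on_subset) auto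
    then show "isCont w x" using r(1) by (simp add: continuous_on_eq_continuous_at)
  qed
  have w0: "0 \<le> w x" for x by (simp add: w_def)
  have wx0: "w x0 > 0" using x0(1) v0 by (simp add: w_def)
  have wpos: "w x > 0" if "x \<in> \<Omega>" for x
    by (rule SF.strong_maximum_principle[OF cw w0 W Wpos QW unifW conn _ wx0 that]) (use x0(1) \<Omega>0(3) in auto)
  \<comment> \<open>Outside \<open>\<Omega>0\<close> the limit is 0 by definition, so positivity
    throughout \<Omega> leaves no such point.\<close>
  have pos: "x \<in> \<Omega>0 \<and> 0 < grad u x \<bullet> X" if "x \<in> \<Omega>" for x
    using wpos[OF that] by (auto simp: w_def max_def split: if_splits)
  then have "\<Omega>0 = \<Omega>" using \<Omega>0(3) by blast
  with pos that X show ?thesis by blast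
qed

end

section \<open>From coordinate hypotheses to the invariant setting\<close>

lemma sum_Basis_vec: "(\<Sum>b\<in>(Basis :: (real^'n) set). g b) = (\<Sum>i\<in>UNIV. g (axis i 1))"
proof -
  have B: "(Basis :: (real^'n) set) = range (\<lambda>i. axis i 1)" by (auto simp: Basis_vec_def)
  have "inj (\<lambda>i. axis i (1::real) :: real^'n)" by (simp add: inj_on_def axis_eq_axis)
  then show ?thesis unfolding B by (subst sum.reindex) simp_all
qed

theorem lemma45:
  fixes \<Omega> \<Omega>\<^sub>0 :: "(real^'n) set" and a f :: "real \<Rightarrow> real" and u :: "real^'n \<Rightarrow> real"
  assumes "CARD('n) \<ge> 2"
    and "C1_domain \<Omega>"
    and "C11_loc a"
    and "\<forall>t\<ge>0. a t > 0"
    and "\<forall>t\<ge>0. vector_derivative (\<lambda>s. s * a s) (at t within {0..}) > 0"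
    and "f C1_differentiable_on UNIV"
    and "Ck_on 3 \<Omega> u" and "C1_closure \<Omega> u"
    and "\<not> u constant_on \<Omega>"
    and "solution a f \<Omega> u" and "stable_solution a f \<Omega> u"
    and "open \<Omega>\<^sub>0" and "connected \<Omega>\<^sub>0" and "\<Omega>\<^sub>0 \<noteq> {}" and "\<Omega>\<^sub>0 \<subseteq> \<Omega>"
    and "\<forall>x\<in>frontier \<Omega>\<^sub>0. grad_closure \<Omega> u x = 0"
    and "moderate_energy_growth a \<Omega>\<^sub>0 u"
  shows "\<Omega>\<^sub>0 = \<Omega> \<and> (\<exists>X\<in>sphere 0 1. \<forall>x\<in>\<Omega>. grad u x \<bullet> X > 0) \<and> crit \<Omega> u = {}"
proof -
  have \<Omega>: "open \<Omega>" "connected \<Omega>" using assms(2) by (auto simp: C1_domain_def)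
  obtain a' where a': "\<forall>t\<ge>0. (a has_real_derivative a' t) (at t within {0..})"
    "\<forall>t\<ge>0. \<exists>e>0. \<exists>L. L-lipschitz_on (cball t e \<inter> {0..}) a'"
    using assms(3) unfolding C11_loc_def by blast
  interpret co: coefficient a a'
  proof
    fix t :: real assume t: "t \<ge> 0"
    show "(a has_real_derivative a' t) (at t within {0..})" using a'(1) t by blast
    show "\<exists>e>0. \<exists>L. L-lipschitz_on (cball t e \<inter> {0..}) a'" using a'(2) t by blast
    show "a t > 0" using assms(4) t by blast
    have "((\<lambda>s. s * a s) has_vector_derivative a t + t * a' t) (at t within {0..})"
      unfolding has_real_derivative_iff_has_vector_derivative[symmetric]
      using DERIV_mult[OF DERIV_ident a'(1)[rule_format, OF t]] by (simp add: add.commute mult.commute)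
    \<comment> \<open>At t = 0 the derivative is one-sided; a nontrivial filter makes
      \<open>vector_derivative\<close> return the product-rule value.\<close>
    moreover have "at t within {0..} \<noteq> bot"
    proof
      assume bot: "at t within {0..} = bot"
      have "at_right t \<le> at t within {0..}" using t by (intro at_le) auto
      then have "at_right t = bot" unfolding bot by (simp only: bot_unique)
      then show False by simp
    qed
    ultimately have "vector_derivative (\<lambda>s. s * a s) (at t within {0..}) = a t + t * a' t"
      by (intro vector_derivative_within)
    then show "a t + t * a' t > 0" using assms(5) t by metis
  qed
  obtain f' where f': "\<And>t. (f has_real_derivative f' t) (at t)" "continuous_on UNIV f'"
    using assms(6) unfolding C1_differentiable_on_def has_real_derivative_iff_has_vector_derivative by blast
  have deriv_f: "deriv f t = f' t" for t by (rule DERIV_imp_deriv[OF f'(1)])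
  define p where "p i x = frechet_derivative u (at x) (axis i 1)" for i x
  have "Ck_on (Suc (Suc (Suc 0))) \<Omega> u" using assms(7) by (simp add: numeral_3_eq_3)
  then have du: "\<And>x. x \<in> \<Omega> \<Longrightarrow> u differentiable (at x)"
    and dp: "\<And>x i. x \<in> \<Omega> \<Longrightarrow> p i differentiable (at x)"
    and dpp: "\<And>x i j. x \<in> \<Omega> \<Longrightarrow> (\<lambda>x. frechet_derivative (p i) (at x) (axis j 1)) differentiable (at x)"
    unfolding Ck_on.simps p_def[abs_def, symmetric] by (simp_all add: p_def[abs_def])
  have du': "(u has_derivative (\<lambda>h. h \<bullet> grad u x)) (at x)" if "x \<in> \<Omega>" for x
    using grad_works[OF du[OF that]] by (simp add: gderiv_def)
  have gp: "grad u x \<bullet> axis i 1 = p i x" if "x \<in> \<Omega>" for x i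
    unfolding p_def frechet_derivative_at[OF du'[OF that], symmetric] by (rule inner_commute)
  \<comment> \<open>The Hessian assembled from the derivatives of the partial derivatives; its
    symmetry is proved later from the continuity shown below.\<close>
  define HG where "HG x h = (\<chi> i. frechet_derivative (p i) (at x) h)" for x h
  have lp: "linear (frechet_derivative (p i) (at x))" if "x \<in> \<Omega>" for x i
    using dp[OF that] by (rule linear_frechet_derivative)
  have dG: "(grad u has_derivative HG x) (at x)" if x: "x \<in> \<Omega>" for x
  proof (rule has_derivative_componentwise_within[THEN iffD2], rule ballI)
    fix b :: "real^'n" assume "b \<in> Basis"
    then obtain i where b: "b = axis i 1" by (auto simp: Basis_vec_def)
    have "(p i has_derivative frechet_derivative (p i) (at x)) (at x)"
      by (rule frechet_derivative_works[THEN iffD1, OF dp[OF x]])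
    from has_derivative_transform_within_open[OF this \<Omega>(1) x gp[symmetric]]
    show "((\<lambda>x. grad u x \<bullet> b) has_derivative (\<lambda>h. HG x h \<bullet> b)) (at x)"
      by (simp add: b HG_def inner_axis)
  qed
  have cHG: "continuous_on \<Omega> (\<lambda>x. HG x h)" for h
  proof -
    have "continuous_on \<Omega> (\<lambda>x. \<Sum>j\<in>UNIV. h $ j * frechet_derivative (p i) (at x) (axis j 1))" for i
      by (intro continuous_intros continuous_at_imp_continuous_on ballI differentiable_imp_continuous_within dpp)
    moreover have "(\<Sum>j\<in>UNIV. h $ j * frechet_derivative (p i) (at x) (axis j 1)) = HG x h $ i" if "x \<in> \<Omega>" for x i
    proof -
      have "h = (\<Sum>j\<in>UNIV. h $ j *\<^sub>R axis j 1)"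
        using basis_expansion[of h] by (simp add: scalar_mult_eq_scaleR)
      then have "HG x h $ i = frechet_derivative (p i) (at x) (\<Sum>j\<in>UNIV. h $ j *\<^sub>R axis j 1)" by (simp add: HG_def)
      then show ?thesis by (simp add: linear_sum[OF lp[OF that]] linear_scale[OF lp[OF that]])
    qed
    ultimately have "continuous_on \<Omega> (\<lambda>x. HG x h $ i)" for i by (rule continuous_on_eq)
    then have "continuous_on \<Omega> (\<lambda>x. \<chi> i. HG x h $ i)" by (rule continuous_on_vec_lambda)
    then show ?thesis by simp
  qed
  interpret quasilinear a a' \<Omega> u HG f f'
  proof
    fix x assume x: "x \<in> \<Omega>"
    show "(\<Sum>b\<in>Basis. A_op a (grad u x) (HG x b) \<bullet> b) + f (u x) = 0"
    proof -
      let ?F = "\<lambda>y. a (norm (grad u y)) *\<^sub>R grad u y"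
      have "(?F has_derivative (\<lambda>h. A_op a (grad u x) (HG x h))) (at x)"
        using has_derivative_compose[OF dG[OF x] co.A_op_field_derivative] .
      then have "frechet_derivative ?F (at x) = (\<lambda>h. A_op a (grad u x) (HG x h))"
        by (rule frechet_derivative_at[symmetric])
      then have "divergence ?F x = (\<Sum>i\<in>UNIV. A_op a (grad u x) (HG x (axis i 1)) $ i)"
        by (simp add: divergence_def trace_def jacobian_def matrix_def)
      also have "\<dots> = (\<Sum>b\<in>Basis. A_op a (grad u x) (HG x b) \<bullet> b)"
        by (simp add: sum_Basis_vec inner_axis)
      finally have "divergence ?F x = (\<Sum>b\<in>Basis. A_op a (grad u x) (HG x b) \<bullet> b)" .
      moreover have "divergence ?F x + f (u x) = 0" using assms(10) x unfolding solution_def by blast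
      ultimately show ?thesis by (simp only:)
    qed
  qed (use \<Omega> du' dG cHG f' in auto)
  obtain G where G: "continuous_on (closure \<Omega>) G" "\<And>x. x \<in> \<Omega> \<Longrightarrow> G x = grad u x"
    and cu: "continuous_on (closure \<Omega>) u"
    using assms(8) unfolding C1_closure_def by blast
  \<comment> \<open>A point of the closure of an open set is a limit point of it, so the limit in
    \<open>grad_closure\<close> is unique and every continuous extension \<open>G\<close> has this
    value.\<close>
  have fr: "G x = 0" if x: "x \<in> frontier \<Omega>\<^sub>0" for x
  proof -
    have xc: "x \<in> closure \<Omega>" using x closure_mono[OF assms(15)] by (auto simp: frontier_def)
    then have "x islimpt \<Omega>"
      using \<Omega>(1) interior_limit_point[of x \<Omega>] by (auto simp: closure_def interior_open)
    then have nt: "\<not> trivial_limit (at x within \<Omega>)" by (simp add: trivial_limit_within)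
    have "(G \<longlongrightarrow> G x) (at x within closure \<Omega>)" using G(1) xc by (simp add: continuous_on_def)
    then have "(G \<longlongrightarrow> G x) (at x within \<Omega>)" by (rule tendsto_within_subset) (rule closure_subset)
    moreover have "\<forall>\<^sub>F y in at x within \<Omega>. G y = grad u y"
      using G(2) by (simp add: eventually_at_filter)
    ultimately have "(grad u \<longlongrightarrow> G x) (at x within \<Omega>)" by (rule Lim_transform_eventually)
    then have "grad_closure \<Omega> u x = G x" unfolding grad_closure_def by (rule tendsto_Lim[OF nt])
    then show ?thesis using assms(16) x by simp
  qed
  obtain \<phi> where \<phi>: "\<And>j. lipschitz_compact_support (closure \<Omega>\<^sub>0) (\<phi> j)" "\<And>j x. x \<in> closure \<Omega>\<^sub>0 \<Longrightarrow> 0 \<le> \<phi> j x"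
    "\<And>x. x \<in> closure \<Omega>\<^sub>0 \<Longrightarrow> \<exists>e>0. uniform_limit (ball x e \<inter> closure \<Omega>\<^sub>0) \<phi> (\<lambda>_. 1) sequentially"
    "(\<lambda>j. LINT x:\<Omega>\<^sub>0|lebesgue. (norm (grad u x))\<^sup>2 *
        (A_op a (grad u x) (grad (\<phi> j) x) \<bullet> grad (\<phi> j) x)) \<longlonglongrightarrow> 0"
    using assms(17) unfolding moderate_energy_growth_def by blast
  interpret EF: elliptic_form \<Omega> "\<lambda>x. A_op a (grad u x)" "\<lambda>x. f' (u x)" by (rule elliptic_form_linearised)
  \<comment> \<open>Functions in \<open>lipc \<Omega>\<close> vanish with their gradients off
    \<Omega>, so integrals over \<Omega> and over the whole space coincide.\<close>
  have stable: "0 \<le> EF.Q \<xi> \<xi>" if \<xi>: "lipc \<Omega> \<xi>" for \<xi>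
  proof -
    obtain L K where K: "L-lipschitz_on UNIV \<xi>" "L \<ge> 0" "compact K" "K \<subseteq> \<Omega>" "\<And>x. x \<notin> K \<Longrightarrow> \<xi> x = 0"
      by (rule lipcE[OF \<xi>]) blast
    have "closure {x \<in> \<Omega>. \<xi> x \<noteq> 0} \<subseteq> K"
      using K(3,5) by (intro closure_minimal) (auto simp: compact_imp_closed)
    moreover have "bounded {x \<in> \<Omega>. \<xi> x \<noteq> 0}"
      by (rule bounded_subset[OF compact_imp_bounded[OF K(3)]]) (use K(5) in auto)
    then have "compact (closure {x \<in> \<Omega>. \<xi> x \<noteq> 0})" by (simp add: compact_closure)
    ultimately have "lipschitz_compact_support \<Omega> \<xi>"
      unfolding lipschitz_compact_support_def using lipschitz_on_subset[OF K(1), of \<Omega>] K(4) by blast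
    then have le: "(LINT x:\<Omega>|lebesgue. deriv f (u x) * (\<xi> x)\<^sup>2)
       \<le> (LINT x:\<Omega>|lebesgue. A_op a (grad u x) (grad \<xi> x) \<bullet> grad \<xi> x)"
      using assms(11) unfolding stable_solution_def by blast
    have z: "\<xi> x = 0" "grad \<xi> x = 0" if "x \<notin> \<Omega>" for x
    proof -
      have xK: "x \<notin> K" using K(4) that by blast
      show "\<xi> x = 0" by (rule K(5)[OF xK])
      show "grad \<xi> x = 0" by (rule grad_eq_0_outside(2)[OF K(3,5) xK])
    qed
    have "(LINT x:\<Omega>|lebesgue. deriv f (u x) * (\<xi> x)\<^sup>2) = (\<integral>x. f' (u x) * (\<xi> x * \<xi> x) \<partial>lebesgue)"
      unfolding set_lebesgue_integral_def
      by (rule Bochner_Integration.integral_cong) (auto simp: indicator_def z deriv_f power2_eq_square)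
    moreover have "(LINT x:\<Omega>|lebesgue. A_op a (grad u x) (grad \<xi> x) \<bullet> grad \<xi> x) = EF.E \<xi> \<xi>"
      unfolding set_lebesgue_integral_def EF.E_def
      by (rule Bochner_Integration.integral_cong) (auto simp: indicator_def z)
    ultimately show ?thesis using le unfolding EF.Q_def by simp
  qed
  have "\<exists>X. norm X = 1 \<and> \<Omega>\<^sub>0 = \<Omega> \<and> (\<forall>x\<in>\<Omega>. 0 < grad u x \<bullet> X)"
    by (rule positive_directional_derivative[OF \<Omega>(2) cu G assms(12,14,15) fr assms(9) stable \<phi>])
       (assumption | blast)+
  then obtain X where X: "norm X = 1" "\<Omega>\<^sub>0 = \<Omega>" "\<And>x. x \<in> \<Omega> \<Longrightarrow> 0 < grad u x \<bullet> X" by blast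
  have "crit \<Omega> u = {}" using X(3) by (force simp: crit_def)
  moreover have "X \<in> sphere 0 1" using X(1) by simp
  ultimately show ?thesis using X(2,3) by blast
qed

end
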